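(* The Ricci vector field $g\mapsto\operatorname{Ricci}_g$ on $\mathcal M(M)$ is a gradient field for the $G^P$-metric if and only if the equation $$2\big(Q(h)-Q^*(h)\big)+(P_g\operatorname{Ricci}_g)\,\operatorname{Tr}(g^{-1}h)-g\;g^0_2\big(P_g\operatorname{Ricci}_g,h\big)=0,\qquad\text{with } Q(h)=Q_g(h)=D_{(g,h)}(P_g\operatorname{Ricci}_g),$$ is satisfied for all $g\in\mathcal M(M)$ and all symmetric $\binom02$-tensor fields $h$.
   Context: $M$ is a compact smooth manifold. $\mathcal M(M)=\Gamma(S^2_+T^*M)$ is the space of all smooth Riemannian metrics on $M$, an open convex subset of the Fréchet space $\Gamma(S^2T^*M)$ of smooth symmetric $\binom02$-tensor fields, so $T_g\mathcal M(M)=\Gamma(S^2T^*M)$ and the Ricci tensor defines a vector field on $\mathcal M(M)$. For symmetric $h,k$: $g^0_2(h,k)=\operatorname{Tr}(g^{-1}hg^{-1}k)$ and $\tilde g^0_2(h,k)=\int_Mg^0_2(h,k)\operatorname{vol}(g)$, where $\operatorname{vol}(g)$ is the volume density. $D_{(g,h)}F$ denotes the directional derivative $\partial_t|_0F(g+th)$. $P_g:\Gamma(S^2T^*M)\to\Gamma(S^2T^*M)$ is a positive, symmetric, bijective pseudo-differential operator of order $2p\ge 0$, depending smoothly on $g$, and $G^P_g(h,k)=\int_M g^0_2(P_gh,k)\operatorname{vol}(g)$ is the induced Riemannian metric on $\mathcal M(M)$. $Q_g$ is viewed as a linear operator on symmetric $\binom02$-tensor fields and $Q^*$ is its adjoint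 with respect to $\tilde g^0_2$. $\operatorname{Ricci}(X,Y)$ is the trace of $Z\mapsto R(Z,X)Y$, with $R(X,Y)Z=\nabla_X\nabla_YZ-\nabla_Y\nabla_XZ-\nabla_{[X,Y]}Z$. A vector field $V$ on $\mathcal M(M)$ is a gradient field for $G^P$ if there is a smooth function $F$ on $\mathcal M(M)$ with $dF(g)(h)=G^P_g(V_g,h)$ for all $g,h$. *)

theory Defs
  imports "HOL-Analysis.Analysis" "HOL-Library.Function_Algebras"
begin

section \<open>Pointwise vector space structure on function types\<close>

instantiation "fun" :: (type, real_vector) real_vector
begin

definition scaleR_fun :: "real \<Rightarrow> ('a \<Rightarrow> 'b) \<Rightarrow> 'a \<Rightarrow> 'b"
  where "scaleR_fun r f = (\<lambda>x. r *\<^sub>R f x)"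

instance
  by standard (auto simp: scaleR_fun_def fun_eq_iff scaleR_add_right scaleR_add_left)

end


section \<open>Smooth functions on open subsets of Euclidean spaces\<close>

fun iter_deriv :: "'e::euclidean_space list \<Rightarrow> ('e \<Rightarrow> 'b::real_normed_vector) \<Rightarrow> 'e \<Rightarrow> 'b"
  where
    "iter_deriv [] f = f"
  | "iter_deriv (v # vs) f = (\<lambda>x. frechet_derivative (iter_deriv vs f) (at x) v)"

text \<open>Meaningful for open \<open>S\<close> only: every iterated partial derivative exists and is
  (Frechet) differentiable, hence continuous, on \<open>S\<close>.\<close>

definition smooth_on :: "'e::euclidean_space set \<Rightarrow> ('e \<Rightarrow> 'b::real_normed_vector) \<Rightarrow> bool"
  where "smooth_on S f \<longleftrightarrow> (\<forall>vs\<in>lists Basis. \<forall>x\<in>S. iter_deriv vs f differentiable (at x))"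

definition test_function :: "'e::euclidean_space set \<Rightarrow> ('e \<Rightarrow> 'b::real_normed_vector) \<Rightarrow> bool"
  where "test_function S f \<longleftrightarrow> smooth_on UNIV f \<and>
    compact (closure {x. f x \<noteq> 0}) \<and> closure {x. f x \<noteq> 0} \<subseteq> S"


section \<open>Smooth manifolds\<close>

text \<open>The manifold \<open>M\<close> is the whole type \<open>'a\<close>; its smooth structure is a maximal atlas.
  The values of a chart map outside the chart domain are irrelevant.\<close>

type_synonym ('a, 'n) chart = "'a set \<times> ('a \<Rightarrow> real ^ 'n)"

definition chart_image :: "('a, 'n) chart \<Rightarrow> (real ^ 'n) set"
  where "chart_image c = snd c ` fst c"

definition chart_inv :: "('a, 'n) chart \<Rightarrow> real ^ 'n \<Rightarrow> 'a"
  where "chart_inv c = inv_into (fst c) (snd c)"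

definition is_chart :: "('a::topological_space, 'n::finite) chart \<Rightarrow> bool"
  where "is_chart c \<longleftrightarrow> open (fst c) \<and> open (chart_image c) \<and>
    homeomorphism (fst c) (chart_image c) (snd c) (chart_inv c)"

definition transition :: "('a, 'n) chart \<Rightarrow> ('a, 'n) chart \<Rightarrow> real ^ 'n \<Rightarrow> real ^ 'n"
  where "transition c d = snd d \<circ> chart_inv c"

definition smoothly_compatible ::
    "('a, 'n::finite) chart \<Rightarrow> ('a, 'n) chart \<Rightarrow> bool"
  where "smoothly_compatible c d \<longleftrightarrow>
    smooth_on (snd c ` (fst c \<inter> fst d)) (transition c d) \<and>
    smooth_on (snd d ` (fst c \<inter> fst d)) (transition d c)"

definition smooth_structure :: "('a::topological_space, 'n::finite) chart set \<Rightarrow> bool"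
  where "smooth_structure A \<longleftrightarrow>
    (\<forall>c\<in>A. is_chart c) \<and> (\<Union>c\<in>A. fst c) = UNIV \<and>
    (\<forall>c\<in>A. \<forall>d\<in>A. smoothly_compatible c d) \<and>
    (\<forall>c. is_chart c \<and> (\<forall>d\<in>A. smoothly_compatible c d) \<longrightarrow> c \<in> A)"

definition smooth_fun_on_manifold :: "('a, 'n::finite) chart set \<Rightarrow> ('a \<Rightarrow> real) \<Rightarrow> bool"
  where "smooth_fun_on_manifold A f \<longleftrightarrow> (\<forall>c\<in>A. smooth_on (chart_image c) (f \<circ> chart_inv c))"

definition partition_of_unity ::
    "('a::topological_space, 'n::finite) chart set \<Rightarrow>
      ('a, 'n) chart set \<Rightarrow> (('a, 'n) chart \<Rightarrow> 'a \<Rightarrow> real) \<Rightarrow> bool"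
  where "partition_of_unity A C \<rho> \<longleftrightarrow> finite C \<and> C \<subseteq> A \<and>
    (\<forall>c\<in>C. smooth_fun_on_manifold A (\<rho> c) \<and> (\<forall>x. 0 \<le> \<rho> c x) \<and>
      closure {x. \<rho> c x \<noteq> 0} \<subseteq> fst c) \<and>
    (\<forall>x. (\<Sum>c\<in>C. \<rho> c x) = 1)"


section \<open>Symmetric tensor fields and Riemannian metrics\<close>

text \<open>A \<open>(0,2)\<close>-tensor field \<open>h\<close> is given by its component matrices in all charts:
  \<open>h c x\<close> is the matrix of \<open>h\<close> in the chart \<open>c\<close>, at the point with coordinates \<open>x\<close>.
  Scalar fields are treated alike.  To make equality of fields equality in HOL,
  components are \<open>0\<close> where they have no meaning.\<close>

type_synonym ('a, 'n) scalar_field = "('a, 'n) chart \<Rightarrow> real ^ 'n \<Rightarrow> real"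
type_synonym ('a, 'n) tensor2_field = "('a, 'n) chart \<Rightarrow> real ^ 'n \<Rightarrow> real ^ 'n ^ 'n"

definition sym_tensor_fields :: "('a, 'n::finite) chart set \<Rightarrow> ('a, 'n) tensor2_field set"
  where "sym_tensor_fields A = {h.
    (\<forall>c x. \<not> (c \<in> A \<and> x \<in> chart_image c) \<longrightarrow> h c x = 0) \<and>
    (\<forall>c\<in>A. smooth_on (chart_image c) (h c)) \<and>
    (\<forall>c\<in>A. \<forall>x\<in>chart_image c. transpose (h c x) = h c x) \<and>
    (\<forall>c\<in>A. \<forall>d\<in>A. \<forall>x\<in>snd c ` (fst c \<inter> fst d).
      let J = matrix (frechet_derivative (transition c d) (at x))
      in h c x = transpose J ** h d (transition c d x) ** J)}"

definition metrics :: "('a, 'n::finite) chart set \<Rightarrow> ('a, 'n) tensor2_field set"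
  where "metrics A = {g \<in> sym_tensor_fields A.
    \<forall>c\<in>A. \<forall>x\<in>chart_image c. \<forall>v. v \<noteq> 0 \<longrightarrow> 0 < v \<bullet> (g c x *v v)}"

definition field_mult ::
    "('a, 'n) scalar_field \<Rightarrow> ('a, 'n) tensor2_field \<Rightarrow> ('a, 'n::finite) tensor2_field"
  where "field_mult f h = (\<lambda>c x. f c x *\<^sub>R h c x)"

definition trace_field ::
    "('a, 'n) tensor2_field \<Rightarrow> ('a, 'n) tensor2_field \<Rightarrow> ('a, 'n::finite) scalar_field"
  where "trace_field g h = (\<lambda>c x. trace (matrix_inv (g c x) ** h c x))"

definition g02 ::
    "('a, 'n) tensor2_field \<Rightarrow> ('a, 'n) tensor2_field \<Rightarrow> ('a, 'n) tensor2_field \<Rightarrow>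
      ('a, 'n::finite) scalar_field"
  where "g02 g h k =
    (\<lambda>c x. trace (matrix_inv (g c x) ** h c x ** matrix_inv (g c x) ** k c x))"

text \<open>Integration against the volume density by means of a smooth partition of unity;
  the result does not depend on the choice of the latter.\<close>

definition integral_vol ::
    "('a::topological_space, 'n::finite) chart set \<Rightarrow> ('a, 'n) tensor2_field \<Rightarrow>
      ('a, 'n) scalar_field \<Rightarrow> real"
  where "integral_vol A g f =
    (let (C, \<rho>) = (SOME (C, \<rho>). partition_of_unity A C \<rho>)
     in \<Sum>c\<in>C. LINT x:chart_image c|lborel.
          \<rho> c (chart_inv c x) * f c x * sqrt (det (g c x)))"

definition g02_L2 ::
    "('a::topological_space, 'n::finite) chart set \<Rightarrow> ('a, 'n) tensor2_field \<Rightarrow>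
      ('a, 'n) tensor2_field \<Rightarrow> ('a, 'n) tensor2_field \<Rightarrow> real"
  where "g02_L2 A g h k = integral_vol A g (g02 g h k)"


section \<open>Ricci curvature\<close>

text \<open>The following operations live on a coordinate domain, where \<open>G\<close> is the matrix-valued
  function representing the metric and vector fields are vector-valued functions.
  The Levi-Civita connection is given by its Christoffel symbols
  \<open>\<Gamma>\<^sup>k\<^sub>i\<^sub>j\<close>, written \<open>christoffel G x k i j\<close>.\<close>

definition partial_deriv ::
    "'n \<Rightarrow> (real ^ 'n \<Rightarrow> real) \<Rightarrow> real ^ 'n \<Rightarrow> real"
  where "partial_deriv i f x = frechet_derivative f (at x) (axis i 1)"

definition christoffel ::
    "(real ^ 'n \<Rightarrow> real ^ 'n ^ 'n) \<Rightarrow> real ^ 'n \<Rightarrow> 'n \<Rightarrow> 'n \<Rightarrow> 'n::finite \<Rightarrow> real"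
  where "christoffel G x k i j =
    (1/2) * (\<Sum>l\<in>UNIV. matrix_inv (G x) $ k $ l *
      (partial_deriv i (\<lambda>y. G y $ j $ l) x + partial_deriv j (\<lambda>y. G y $ i $ l) x
        - partial_deriv l (\<lambda>y. G y $ i $ j) x))"

definition cov_deriv ::
    "(real ^ 'n \<Rightarrow> real ^ 'n ^ 'n) \<Rightarrow> (real ^ 'n \<Rightarrow> real ^ 'n) \<Rightarrow> (real ^ 'n \<Rightarrow> real ^ 'n) \<Rightarrow>
      real ^ 'n \<Rightarrow> real ^ 'n::finite"
  where "cov_deriv G X Y = (\<lambda>x. frechet_derivative Y (at x) (X x) +
    (\<chi> k. \<Sum>i\<in>UNIV. \<Sum>j\<in>UNIV. christoffel G x k i j * X x $ i * Y x $ j))"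

definition lie_bracket ::
    "(real ^ 'n \<Rightarrow> real ^ 'n) \<Rightarrow> (real ^ 'n \<Rightarrow> real ^ 'n) \<Rightarrow> real ^ 'n \<Rightarrow> real ^ 'n::finite"
  where "lie_bracket X Y =
    (\<lambda>x. frechet_derivative Y (at x) (X x) - frechet_derivative X (at x) (Y x))"

definition curvature ::
    "(real ^ 'n \<Rightarrow> real ^ 'n ^ 'n) \<Rightarrow> (real ^ 'n \<Rightarrow> real ^ 'n) \<Rightarrow> (real ^ 'n \<Rightarrow> real ^ 'n) \<Rightarrow>
      (real ^ 'n \<Rightarrow> real ^ 'n) \<Rightarrow> real ^ 'n \<Rightarrow> real ^ 'n::finite"
  where "curvature G X Y Z = (\<lambda>x. cov_deriv G X (cov_deriv G Y Z) x
    - cov_deriv G Y (cov_deriv G X Z) x - cov_deriv G (lie_bracket X Y) Z x)"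

text \<open>The \<open>(i,j)\<close> entry is the trace of \<open>Z \<mapsto> R(Z,e\<^sub>i)e\<^sub>j\<close>, where \<open>e\<^sub>i\<close> are the coordinate
  vector fields.\<close>

definition ricci_matrix ::
    "(real ^ 'n \<Rightarrow> real ^ 'n ^ 'n) \<Rightarrow> real ^ 'n \<Rightarrow> real ^ 'n ^ 'n::finite"
  where "ricci_matrix G x = (\<chi> i j. trace (\<chi> l k.
    curvature G (\<lambda>_. axis k 1) (\<lambda>_. axis i 1) (\<lambda>_. axis j 1) x $ l))"

definition ricci ::
    "('a, 'n) chart set \<Rightarrow> ('a, 'n) tensor2_field \<Rightarrow> ('a, 'n::finite) tensor2_field"
  where "ricci A g =
    (\<lambda>c x. if c \<in> A \<and> x \<in> chart_image c then ricci_matrix (g c) x else 0)"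


section \<open>Calculus in Frechet spaces\<close>

text \<open>A Frechet space is represented by a carrier \<open>E\<close> and a set \<open>\<P>\<close> of seminorms
  generating its topology.\<close>

definition lcs_tendsto ::
    "('v::real_vector \<Rightarrow> real) set \<Rightarrow> ('i \<Rightarrow> 'v) \<Rightarrow> 'v \<Rightarrow> 'i filter \<Rightarrow> bool"
  where "lcs_tendsto \<P> f l F \<longleftrightarrow> (\<forall>p\<in>\<P>. ((\<lambda>i. p (f i - l)) \<longlongrightarrow> 0) F)"

definition dir_deriv ::
    "'w set \<Rightarrow> ('w::real_vector \<Rightarrow> real) set \<Rightarrow> ('v::real_vector \<Rightarrow> 'w) \<Rightarrow> 'v \<Rightarrow> 'v \<Rightarrow> 'w"
  where "dir_deriv E' \<P>' F x v = (THE d. d \<in> E' \<and>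
    lcs_tendsto \<P>' (\<lambda>t. inverse t *\<^sub>R (F (x + t *\<^sub>R v) - F x)) d (at (0::real)))"

text \<open>\<open>F\<close> is smooth from the open subset \<open>U\<close> of \<open>E\<close> to \<open>E'\<close> if all its iterated directional
  derivatives \<open>D vs x\<close> exist and are jointly continuous on \<open>U \<times> E\<^sup>k\<close>.
  As Frechet spaces are metrizable, continuity is expressed by sequences.\<close>

definition lcs_smooth ::
    "'v::real_vector set \<Rightarrow> ('v \<Rightarrow> real) set \<Rightarrow> 'v set \<Rightarrow>
      'w::real_vector set \<Rightarrow> ('w \<Rightarrow> real) set \<Rightarrow> ('v \<Rightarrow> 'w) \<Rightarrow> bool"
  where "lcs_smooth E \<P> U E' \<P>' F \<longleftrightarrow> (\<exists>D :: 'v list \<Rightarrow> 'v \<Rightarrow> 'w.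
    (\<forall>x\<in>U. D [] x = F x) \<and>
    (\<forall>vs\<in>lists E. \<forall>x\<in>U. D vs x \<in> E') \<and>
    (\<forall>vs\<in>lists E. \<forall>v\<in>E. \<forall>x\<in>U.
      lcs_tendsto \<P>' (\<lambda>t. inverse t *\<^sub>R (D vs (x + t *\<^sub>R v) - D vs x)) (D (v # vs) x)
        (at (0::real))) \<and>
    (\<forall>X V x. \<forall>vs\<in>lists E. (\<forall>n::nat. X n \<in> U) \<and> x \<in> U \<and>
      (\<forall>n. V n \<in> lists E \<and> length (V n) = length vs) \<and>
      lcs_tendsto \<P> X x sequentially \<and>
      (\<forall>i<length vs. lcs_tendsto \<P> (\<lambda>n. V n ! i) (vs ! i) sequentially) \<longrightarrow>
      lcs_tendsto \<P>' (\<lambda>n. D (V n) (X n)) (D vs x) sequentially))"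

definition prod_seminorms ::
    "('v \<Rightarrow> real) set \<Rightarrow> ('w \<Rightarrow> real) set \<Rightarrow> ('v \<times> 'w \<Rightarrow> real) set"
  where "prod_seminorms \<P> \<Q> = (\<lambda>p. p \<circ> fst) ` \<P> \<union> (\<lambda>q. q \<circ> snd) ` \<Q>"

text \<open>Uniform convergence of all derivatives on compact subsets of all charts; the inserted
  \<open>0\<close> takes care of the empty compact set.\<close>

definition tensor_seminorms ::
    "('a, 'n::finite) chart set \<Rightarrow> (('a, 'n) tensor2_field \<Rightarrow> real) set"
  where "tensor_seminorms A =
    {\<lambda>h. Sup (insert 0 ((\<lambda>x. norm (iter_deriv vs (h c) x)) ` K)) | c K vs.
      c \<in> A \<and> compact K \<and> K \<subseteq> chart_image c \<and> vs \<in> lists Basis}"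

definition smooth_real_on_metrics ::
    "('a, 'n::finite) chart set \<Rightarrow> (('a, 'n) tensor2_field \<Rightarrow> real) \<Rightarrow> bool"
  where "smooth_real_on_metrics A F \<longleftrightarrow>
    lcs_smooth (sym_tensor_fields A) (tensor_seminorms A) (metrics A) UNIV {abs} F"

definition D_real ::
    "(('a, 'n) tensor2_field \<Rightarrow> real) \<Rightarrow>
      ('a, 'n) tensor2_field \<Rightarrow> ('a, 'n::finite) tensor2_field \<Rightarrow> real"
  where "D_real F g h = dir_deriv UNIV {abs} F g h"

definition D_tensor ::
    "('a, 'n::finite) chart set \<Rightarrow> (('a, 'n) tensor2_field \<Rightarrow> ('a, 'n) tensor2_field) \<Rightarrow>
      ('a, 'n) tensor2_field \<Rightarrow> ('a, 'n) tensor2_field \<Rightarrow> ('a, 'n) tensor2_field"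
  where "D_tensor A F g h = dir_deriv (sym_tensor_fields A) (tensor_seminorms A) F g h"


section \<open>Pseudo-differential operators\<close>

text \<open>Symbols in the class \<open>S\<^sup>m\<close> (type \<open>(1,0)\<close>), as functions of \<open>(x,\<xi>)\<close>.  Basis vectors of the
  product space with nonzero second component are derivatives with respect to \<open>\<xi>\<close>.\<close>

definition symbol_class :: "real \<Rightarrow> ((real ^ 'n) \<times> (real ^ 'n) \<Rightarrow> complex) \<Rightarrow> bool"
  where "symbol_class m a \<longleftrightarrow> smooth_on UNIV a \<and>
    (\<forall>vs\<in>lists Basis. \<exists>B. \<forall>x \<xi>. norm (iter_deriv vs a (x, \<xi>)) \<le>
      B * (1 + norm \<xi>) powr (m - real (length (filter (\<lambda>v. snd v \<noteq> 0) vs))))"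

definition fourier :: "(real ^ 'n \<Rightarrow> real) \<Rightarrow> real ^ 'n \<Rightarrow> complex"
  where "fourier u \<xi> = (LINT x|lborel. cis (- (x \<bullet> \<xi>)) * of_real (u x))"

text \<open>\<open>(i,j)\<close> component of the operator with matrix symbol \<open>a\<close>, applied to a matrix-valued
  function \<open>u\<close>.\<close>

definition Op ::
    "('n \<Rightarrow> 'n \<Rightarrow> 'n \<Rightarrow> 'n \<Rightarrow> (real ^ 'n) \<times> (real ^ 'n) \<Rightarrow> complex) \<Rightarrow>
      (real ^ 'n \<Rightarrow> real ^ 'n ^ 'n) \<Rightarrow> real ^ 'n \<Rightarrow> 'n \<Rightarrow> 'n::finite \<Rightarrow> complex"
  where "Op a u x i j = of_real (1 / (2 * pi) ^ CARD('n)) *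
    (LINT \<xi>|lborel. cis (x \<bullet> \<xi>) *
      (\<Sum>k\<in>UNIV. \<Sum>l\<in>UNIV. a i j k l (x, \<xi>) * fourier (\<lambda>y. u y $ k $ l) \<xi>))"

text \<open>Hoermander's definition: a linear operator \<open>T\<close> is pseudo-differential of order \<open>m\<close> if in
  every chart \<open>c\<close> and for all cutoff functions \<open>\<phi>\<close>, \<open>\<psi>\<close> the operator \<open>u \<mapsto> \<phi> T (\<psi> u)\<close> is given by
  a symbol in \<open>S\<^sup>m\<close>.  Here \<open>h\<close> is the extension by zero of \<open>\<psi> u\<close> to a tensor field on the manifold.
  As the atlas is maximal, it contains disconnected charts joining neighbourhoods of
  any two points, so the smoothness of the kernel off the diagonal is included.\<close>

definition linear_on_tensors ::
    "('a, 'n::finite) chart set \<Rightarrow> (('a, 'n) tensor2_field \<Rightarrow> ('a, 'n) tensor2_field) \<Rightarrow> bool"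
  where "linear_on_tensors A T \<longleftrightarrow>
    (\<forall>h\<in>sym_tensor_fields A. T h \<in> sym_tensor_fields A) \<and>
    (\<forall>h\<in>sym_tensor_fields A. \<forall>k\<in>sym_tensor_fields A. T (h + k) = T h + T k) \<and>
    (\<forall>r. \<forall>h\<in>sym_tensor_fields A. T (r *\<^sub>R h) = r *\<^sub>R T h)"

definition pseudo_differential ::
    "('a, 'n::finite) chart set \<Rightarrow> real \<Rightarrow>
      (('a, 'n) tensor2_field \<Rightarrow> ('a, 'n) tensor2_field) \<Rightarrow> bool"
  where "pseudo_differential A m T \<longleftrightarrow> linear_on_tensors A T \<and>
    (\<forall>c\<in>A. \<forall>(\<phi> :: real ^ 'n \<Rightarrow> real) (\<psi> :: real ^ 'n \<Rightarrow> real).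
      test_function (chart_image c) \<phi> \<and> test_function (chart_image c) \<psi> \<longrightarrow>
      (\<exists>a. (\<forall>i j k l. symbol_class m (a i j k l)) \<and>
        (\<forall>u. \<forall>h\<in>sym_tensor_fields A.
          test_function UNIV u \<and> (\<forall>x. transpose (u x) = u x) \<and>
          (\<forall>x\<in>chart_image c. h c x = \<psi> x *\<^sub>R u x) \<and>
          (\<forall>d\<in>A. \<forall>y\<in>chart_image d. chart_inv d y \<notin> fst c \<longrightarrow> h d y = 0) \<longrightarrow>
          (\<forall>x i j. of_real (\<phi> x * T h c x $ i $ j) = Op a u x i j))))"


section \<open>Metrics on the space of metrics\<close>

definition is_adjoint ::
    "('a::topological_space, 'n::finite) chart set \<Rightarrow> ('a, 'n) tensor2_field \<Rightarrow>
      (('a, 'n) tensor2_field \<Rightarrow> ('a, 'n) tensor2_field) \<Rightarrow>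
      (('a, 'n) tensor2_field \<Rightarrow> ('a, 'n) tensor2_field) \<Rightarrow> bool"
  where "is_adjoint A g T T' \<longleftrightarrow>
    (\<forall>k\<in>sym_tensor_fields A. T' k \<in> sym_tensor_fields A) \<and>
    (\<forall>h\<in>sym_tensor_fields A. \<forall>k\<in>sym_tensor_fields A. g02_L2 A g (T h) k = g02_L2 A g h (T' k))"

definition positive_symmetric ::
    "('a::topological_space, 'n::finite) chart set \<Rightarrow> ('a, 'n) tensor2_field \<Rightarrow>
      (('a, 'n) tensor2_field \<Rightarrow> ('a, 'n) tensor2_field) \<Rightarrow> bool"
  where "positive_symmetric A g T \<longleftrightarrow> is_adjoint A g T T \<and>
    (\<forall>h\<in>sym_tensor_fields A. h \<noteq> 0 \<longrightarrow> 0 < g02_L2 A g (T h) h)"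

definition depends_smoothly ::
    "('a, 'n::finite) chart set \<Rightarrow>
      (('a, 'n) tensor2_field \<Rightarrow> ('a, 'n) tensor2_field \<Rightarrow> ('a, 'n) tensor2_field) \<Rightarrow> bool"
  where "depends_smoothly A P \<longleftrightarrow>
    lcs_smooth (sym_tensor_fields A \<times> sym_tensor_fields A)
      (prod_seminorms (tensor_seminorms A) (tensor_seminorms A))
      (metrics A \<times> sym_tensor_fields A)
      (sym_tensor_fields A) (tensor_seminorms A) (\<lambda>(g, h). P g h)"

definition admissible_operator ::
    "('a::topological_space, 'n::finite) chart set \<Rightarrow> real \<Rightarrow>
      (('a, 'n) tensor2_field \<Rightarrow> ('a, 'n) tensor2_field \<Rightarrow> ('a, 'n) tensor2_field) \<Rightarrow> bool"
  where "admissible_operator A p P \<longleftrightarrow> depends_smoothly A P \<and>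
    (\<forall>g\<in>metrics A. pseudo_differential A (2 * p) (P g) \<and> positive_symmetric A g (P g) \<and>
      bij_betw (P g) (sym_tensor_fields A) (sym_tensor_fields A))"

definition GP ::
    "('a::topological_space, 'n::finite) chart set \<Rightarrow>
      (('a, 'n) tensor2_field \<Rightarrow> ('a, 'n) tensor2_field \<Rightarrow> ('a, 'n) tensor2_field) \<Rightarrow>
      ('a, 'n) tensor2_field \<Rightarrow> ('a, 'n) tensor2_field \<Rightarrow> ('a, 'n) tensor2_field \<Rightarrow> real"
  where "GP A P g h k = integral_vol A g (g02 g (P g h) k)"

definition gradient_field ::
    "('a::topological_space, 'n::finite) chart set \<Rightarrow>
      (('a, 'n) tensor2_field \<Rightarrow> ('a, 'n) tensor2_field \<Rightarrow> ('a, 'n) tensor2_field) \<Rightarrow>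
      (('a, 'n) tensor2_field \<Rightarrow> ('a, 'n) tensor2_field) \<Rightarrow> bool"
  where "gradient_field A P V \<longleftrightarrow> (\<exists>F. smooth_real_on_metrics A F \<and>
    (\<forall>g\<in>metrics A. \<forall>h\<in>sym_tensor_fields A. D_real F g h = GP A P g (V g) h))"

end

theory Submission
  imports Defs
begin

text \<open>Put \<open>w\<^sub>g = P\<^sub>g Ricci\<^sub>g\<close> and consider the one-form
  \<open>\<omega>\<^sub>g(h) = \<integral> g\<^sup>0\<^sub>2(w\<^sub>g, h) vol(g)\<close> on
  the space of metrics. The Ricci field is a gradient field exactly if \<open>\<omega>\<close>
  is exact. The space of metrics is an open convex set, so the Poincare lemma and the equality
  of mixed derivatives (\<open>exact_iff_closed\<close>) reduce the question to
  \<open>D\<omega>(h)(k) = D\<omega>(k)(h)\<close> for all \<open>h\<close> and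
  \<open>k\<close>, where \<open>D\<omega>(h)(k)\<close> is the derivative of
  \<open>\<omega>\<^sub>g(k)\<close> in direction \<open>h\<close>.

  In the derivative of \<open>\<omega>\<^sub>g(h)\<close> in direction \<open>k\<close> the
  metric is varied in three places. The variation of \<open>w\<^sub>g\<close> contributes the
  \<open>L\<^sup>2\<close>-product of \<open>Q(k)\<close> and \<open>h\<close>. The variation
  of the two factors \<open>g\<inverse>\<close> in \<open>Tr(g\<inverse> w g\<inverse>
  h)\<close> contributes terms symmetric in \<open>h\<close> and \<open>k\<close>, which
  cancel upon antisymmetrization. The variation of the volume density contributes \<open>1/2
  Tr(g\<inverse> k) g\<^sup>0\<^sub>2(w, h)\<close> (\<open>eval_dg_formE_antisym\<close>).
  Altogether \<open>2 (D\<omega>(h)(k) - D\<omega>(k)(h))\<close> is the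
  \<open>L\<^sup>2\<close>-product of \<open>k\<close> with the left-hand side of the asserted
  equation. It vanishes for all \<open>k\<close> precisely if that left-hand side is zero, the
  \<open>L\<^sup>2\<close>-metric being nondegenerate (\<open>L2_nondegenerate\<close>).

  The analytic content is that \<open>\<omega>\<close> is a smooth one-form, with the
  derivatives computed above. All local quantities, the components of the Ricci tensor and the
  integrand of \<open>\<omega>\<close> among them, are given by expressions in the derivatives
  of the metric, the entries of its inverse and the root of its determinant. The derivatives
  of an expression with respect to a coordinate and to the metric are again expressions
  (\<open>eval_dx\<close>, \<open>eval_dg\<close>), the value of an expression depends
  continuously on the metric, uniformly on compact sets (\<open>uniform_limit_eval\<close>),
  and both kinds of derivative commute (\<open>eval_foldr_dx_dg\<close>); hence such
  expressions define smooth maps on the space of metrics (\<open>operator_derivative\<close>,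
  \<open>pairing_deriv\<close>). The product rule (\<open>leibniz_family\<close>) then
  combines the Ricci tensor, \<open>P\<close> and the integral.

  That the Ricci tensor is a symmetric tensor field at all rests on two facts of Riemannian
  geometry: \<open>\<Gamma>\<^sup>k\<^sub>k\<^sub>j\<close> is the logarithmic derivative of
  the volume density, so that the Ricci matrix is symmetric (\<open>ricci_matrix_sym\<close>),
  and the Levi-Civita connection is unique, so that it has the expected behaviour under a
  change of coordinates (\<open>ricci_matrix_transform\<close>).\<close>

section \<open>Smooth functions\<close>

lemma iter_deriv_snoc:
  "iter_deriv (vs @ [b]) f = iter_deriv vs (\<lambda>x. frechet_derivative f (at x) b)"
  by (induction vs) auto

lemma iter_deriv_cong:
  assumes "open S" "\<And>x. x \<in> S \<Longrightarrow> f x = g x" "x \<in> S"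
  shows "iter_deriv vs f x = iter_deriv vs g x"
  using assms(3)
proof (induction vs arbitrary: x)
  case (Cons v vs)
  have "frechet_derivative (iter_deriv vs f) (at x) = frechet_derivative (iter_deriv vs g) (at x)"
  proof -
    have "(iter_deriv vs f has_derivative D) (at x) \<longleftrightarrow> (iter_deriv vs g has_derivative D) (at x)" for D
      using has_derivative_transform_within_open[OF _ assms(1) Cons.prems, of "iter_deriv vs f" D UNIV "iter_deriv vs g"]
        has_derivative_transform_within_open[OF _ assms(1) Cons.prems, of "iter_deriv vs g" D UNIV "iter_deriv vs f"]
        Cons.IH by auto
    then show ?thesis unfolding frechet_derivative_def by simp
  qed
  then show ?case by simp
qed (use assms in auto)

lemma differentiable_cong_open:
  assumes "f differentiable (at x)" "open S" "x \<in> S" "\<And>y. y \<in> S \<Longrightarrow> f y = g y"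
  shows "g differentiable (at x)"
  using assms unfolding differentiable_def by (meson has_derivative_transform_within_open)

lemma smooth_onD: "smooth_on S f \<Longrightarrow> vs \<in> lists Basis \<Longrightarrow> x \<in> S \<Longrightarrow> iter_deriv vs f differentiable (at x)"
  by (auto simp: smooth_on_def)

lemma smooth_on_subset: "smooth_on S f \<Longrightarrow> T \<subseteq> S \<Longrightarrow> smooth_on T f"
  by (auto simp: smooth_on_def)

lemma smooth_on_differentiable: "smooth_on S f \<Longrightarrow> x \<in> S \<Longrightarrow> f differentiable (at x)"
  using smooth_onD[of S f "[]"] by auto

lemma smooth_on_iter_deriv: "smooth_on S f \<Longrightarrow> vs \<in> lists Basis \<Longrightarrow> smooth_on S (iter_deriv vs f)"
proof -
  have app: "iter_deriv ws (iter_deriv vs f) = iter_deriv (ws @ vs) f" for ws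
    by (induction ws) auto
  show "smooth_on S f \<Longrightarrow> vs \<in> lists Basis \<Longrightarrow> smooth_on S (iter_deriv vs f)"
    by (auto simp: smooth_on_def app)
qed

lemma smooth_on_iter_deriv_continuous:
  "smooth_on S f \<Longrightarrow> vs \<in> lists Basis \<Longrightarrow> continuous_on S (iter_deriv vs f)"
  by (meson smooth_onD continuous_at_imp_continuous_on differentiable_imp_continuous_within)

lemma smooth_on_continuous: "smooth_on S f \<Longrightarrow> continuous_on S f"
  using smooth_on_iter_deriv_continuous[of S f "[]"] by auto

lemma smooth_on_local:
  assumes "\<And>x. x \<in> S \<Longrightarrow> \<exists>T. x \<in> T \<and> smooth_on T f"
  shows "smooth_on S f"
  using assms unfolding smooth_on_def by metis

lemma smooth_on_cong:
  assumes "open S" "\<And>x. x \<in> S \<Longrightarrow> f x = g x" "smooth_on S f"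
  shows "smooth_on S g"
  unfolding smooth_on_def
proof (intro ballI)
  fix vs :: "'a list" and x assume "vs \<in> lists Basis" "x \<in> S"
  then show "iter_deriv vs g differentiable (at x)"
    using differentiable_cong_open[OF smooth_onD[OF assms(3)] assms(1), of vs x "iter_deriv vs g"]
      iter_deriv_cong[of S f g, OF assms(1,2)] by simp
qed

text \<open>Smoothness is a greatest fixed point: a class of differentiable functions that is closed
  under partial derivatives consists of smooth functions, as an iterated derivative can be
  computed from the inside out. Closure properties of smoothness are obtained by guessing such
  a class.\<close>

lemma smooth_on_coinduct:
  assumes "open S" "C f"
    and diff: "\<And>f x. C f \<Longrightarrow> x \<in> S \<Longrightarrow> f differentiable (at x)"
    and closed: "\<And>f b. C f \<Longrightarrow> b \<in> Basis \<Longrightarrow>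
      \<exists>g. C g \<and> (\<forall>x\<in>S. frechet_derivative f (at x) b = g x)"
  shows "smooth_on S f"
proof -
  have "\<forall>x\<in>S. iter_deriv vs f differentiable (at x)" if "vs \<in> lists Basis" "C f" for vs f
    using that
  proof (induction vs arbitrary: f rule: rev_induct)
    case Nil then show ?case using diff by auto
  next
    case (snoc b vs)
    then obtain g where g: "C g" "\<And>x. x \<in> S \<Longrightarrow> frechet_derivative f (at x) b = g x"
      using closed[of f b] by auto
    have "\<forall>x\<in>S. iter_deriv vs g differentiable (at x)"
      using snoc g by auto
    moreover have "iter_deriv (vs @ [b]) f x = iter_deriv vs g x" if "x \<in> S" for x
      unfolding iter_deriv_snoc by (rule iter_deriv_cong[OF \<open>open S\<close> g(2) that])
    ultimately show ?case
      using differentiable_cong_open[OF _ \<open>open S\<close>, of "iter_deriv vs g" _ "iter_deriv (vs @ [b]) f"] by simp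
  qed
  with assms(2) show ?thesis by (auto simp: smooth_on_def)
qed

lemma smooth_on_const [simp]: "smooth_on S (\<lambda>x. c)"
proof -
  have "smooth_on UNIV (\<lambda>x::'a. c)"
    by (rule smooth_on_coinduct[where C = "\<lambda>f. \<exists>c. f = (\<lambda>x. c)"]) auto
  then show ?thesis by (rule smooth_on_subset) auto
qed

lemma smooth_on_bounded_linear: "bounded_linear f \<Longrightarrow> smooth_on S f"
proof -
  assume f: "bounded_linear f"
  have "smooth_on UNIV f"
  proof (rule smooth_on_coinduct[where C = "\<lambda>g. g = f \<or> smooth_on UNIV g \<and> (\<exists>c. g = (\<lambda>x. c))"])
    fix g x assume "g = f \<or> smooth_on UNIV g \<and> (\<exists>c. g = (\<lambda>x. c))"
    then show "g differentiable (at x)"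
      using f bounded_linear_imp_differentiable smooth_on_differentiable by blast
  next
    fix g and b :: 'a assume g: "g = f \<or> smooth_on UNIV g \<and> (\<exists>c. g = (\<lambda>x. c))"
    have *: "frechet_derivative f (at x) b = f b" for x
      using fun_cong[OF frechet_derivative_at[OF bounded_linear.has_derivative[OF f has_derivative_ident]], of b x]
      by simp
    obtain c where "\<And>x. frechet_derivative g (at x) b = c"
      using g
    proof
      assume "g = f" then show ?thesis using * that by blast
    next
      assume "smooth_on UNIV g \<and> (\<exists>c. g = (\<lambda>x. c))"
      then obtain c where "g = (\<lambda>x. c)" by blast
      then show ?thesis using that[of 0] by simp
    qed
    then show "\<exists>h. (h = f \<or> smooth_on UNIV h \<and> (\<exists>c. h = (\<lambda>x. c))) \<and> (\<forall>x\<in>UNIV. frechet_derivative g (at x) b = h x)"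
      by (intro exI[of _ "\<lambda>x. c"] conjI disjI2 exI[of _ c] refl smooth_on_const ballI)
  qed simp_all
  then show ?thesis by (rule smooth_on_subset) auto
qed

lemma iter_deriv_bounded_linear:
  fixes f :: "'e::euclidean_space \<Rightarrow> 'b::real_normed_vector"
  assumes L: "bounded_linear L" and S: "open S" and f: "smooth_on S f"
    and vs: "vs \<in> lists Basis" "x \<in> S"
  shows "iter_deriv vs (\<lambda>x. L (f x)) x = L (iter_deriv vs f x)"
  using vs
proof (induction vs arbitrary: x)
  case (Cons v vs)
  then have "vs \<in> lists Basis" by simp
  have "((\<lambda>y. L (iter_deriv vs f y)) has_derivative (\<lambda>h. L (frechet_derivative (iter_deriv vs f) (at x) h))) (at x)"
    using smooth_onD[OF f \<open>vs \<in> lists Basis\<close> \<open>x \<in> S\<close>]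
    by (intro bounded_linear.has_derivative[OF L]) (auto simp: frechet_derivative_works)
  then have "(iter_deriv vs (\<lambda>x. L (f x)) has_derivative (\<lambda>h. L (frechet_derivative (iter_deriv vs f) (at x) h))) (at x)"
    by (rule has_derivative_transform_within_open[OF _ S]) (use Cons in auto)
  from fun_cong[OF frechet_derivative_at[OF this], of v] show ?case by simp
qed simp

lemma smooth_on_compose_bounded_linear:
  fixes f :: "'e::euclidean_space \<Rightarrow> 'b::real_normed_vector"
  assumes L: "bounded_linear L" and S: "open S" and f: "smooth_on S f"
  shows "smooth_on S (\<lambda>x. L (f x))"
  unfolding smooth_on_def
proof (intro ballI)
  fix vs :: "'e list" and x assume vs: "vs \<in> lists Basis" "x \<in> S"
  have "(\<lambda>y. L (iter_deriv vs f y)) differentiable (at x)"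
    using smooth_onD[OF f vs] bounded_linear.has_derivative[OF L] by (auto simp: differentiable_def)
  then show "iter_deriv vs (\<lambda>x. L (f x)) differentiable (at x)"
    by (rule differentiable_cong_open[OF _ S vs(2)])
       (use vs in \<open>simp add: iter_deriv_bounded_linear[OF L S f]\<close>)
qed

lemma iter_deriv_add:
  assumes S: "open S" and f: "smooth_on S f" and g: "smooth_on S g"
    and vs: "vs \<in> lists Basis" "x \<in> S"
  shows "iter_deriv vs (\<lambda>x. f x + g x) x = iter_deriv vs f x + iter_deriv vs g x"
  using vs
proof (induction vs arbitrary: x)
  case (Cons v vs)
  then have "vs \<in> lists Basis" by simp
  have "((\<lambda>y. iter_deriv vs f y + iter_deriv vs g y) has_derivative
      (\<lambda>h. frechet_derivative (iter_deriv vs f) (at x) h + frechet_derivative (iter_deriv vs g) (at x) h)) (at x)"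
    using smooth_onD[OF f \<open>vs \<in> lists Basis\<close> \<open>x \<in> S\<close>] smooth_onD[OF g \<open>vs \<in> lists Basis\<close> \<open>x \<in> S\<close>]
    by (intro has_derivative_add) (auto simp: frechet_derivative_works)
  then have "(iter_deriv vs (\<lambda>x. f x + g x) has_derivative
    (\<lambda>h. frechet_derivative (iter_deriv vs f) (at x) h + frechet_derivative (iter_deriv vs g) (at x) h)) (at x)"
    by (rule has_derivative_transform_within_open[OF _ S]) (use Cons in auto)
  from fun_cong[OF frechet_derivative_at[OF this], of v] show ?case by simp
qed simp

lemma smooth_on_add:
  assumes S: "open S" and f: "smooth_on S f" and g: "smooth_on S g"
  shows "smooth_on S (\<lambda>x. f x + g x)"
  unfolding smooth_on_def
proof (intro ballI)
  fix vs :: "'a list" and x assume vs: "vs \<in> lists Basis" "x \<in> S"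
  have "(\<lambda>y. iter_deriv vs f y + iter_deriv vs g y) differentiable (at x)"
    using smooth_onD[OF f vs] smooth_onD[OF g vs] by (rule differentiable_add)
  then show "iter_deriv vs (\<lambda>x. f x + g x) differentiable (at x)"
    by (rule differentiable_cong_open[OF _ S vs(2)])
       (use vs in \<open>simp add: iter_deriv_add[OF S f g]\<close>)
qed

lemma smooth_on_componentwise:
  fixes f :: "'e::euclidean_space \<Rightarrow> 'm::euclidean_space"
  assumes S: "open S"
  shows "smooth_on S f \<longleftrightarrow> (\<forall>b\<in>Basis. smooth_on S (\<lambda>x. f x \<bullet> b))"
proof
  assume "smooth_on S f"
  then show "\<forall>b\<in>Basis. smooth_on S (\<lambda>x. f x \<bullet> b)"
    by (intro ballI smooth_on_compose_bounded_linear[OF bounded_linear_inner_left S])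
next
  assume *: "\<forall>b\<in>Basis. smooth_on S (\<lambda>x. f x \<bullet> b)"
  show "smooth_on S f"
  proof (rule smooth_on_coinduct[where C = "\<lambda>f. \<forall>b\<in>Basis. smooth_on S (\<lambda>x. f x \<bullet> b)", OF S *])
    fix f :: "'e \<Rightarrow> 'm" and x assume f: "\<forall>b\<in>Basis. smooth_on S (\<lambda>x. f x \<bullet> b)" and x: "x \<in> S"
    show d: "f differentiable (at x)"
      unfolding differentiable_componentwise_within[of f x UNIV]
      using smooth_on_differentiable[OF bspec[OF f] x] by auto
  next
    fix f :: "'e \<Rightarrow> 'm" and e :: 'e assume f: "\<forall>b\<in>Basis. smooth_on S (\<lambda>x. f x \<bullet> b)" and e: "e \<in> Basis"
    let ?g = "\<lambda>x. frechet_derivative f (at x) e"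
    have "smooth_on S (\<lambda>x. ?g x \<bullet> b)" if b: "b \<in> Basis" for b
    proof (rule smooth_on_cong[OF S])
      show "smooth_on S (\<lambda>x. frechet_derivative (\<lambda>x. f x \<bullet> b) (at x) e)"
        using smooth_on_iter_deriv[of S "\<lambda>x. f x \<bullet> b" "[e]"] f b e by auto
      fix x assume "x \<in> S"
      then have "f differentiable (at x)"
        unfolding differentiable_componentwise_within[of f x UNIV]
        using smooth_on_differentiable[OF bspec[OF f]] by auto
      then have "((\<lambda>x. f x \<bullet> b) has_derivative (\<lambda>h. frechet_derivative f (at x) h \<bullet> b)) (at x)"
        by (intro bounded_linear.has_derivative[OF bounded_linear_inner_left]) (simp add: frechet_derivative_works)
      from fun_cong[OF frechet_derivative_at[OF this], of e]
      show "frechet_derivative (\<lambda>x. f x \<bullet> b) (at x) e = ?g x \<bullet> b" by simp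
    qed
    then show "\<exists>g. (\<forall>b\<in>Basis. smooth_on S (\<lambda>x. g x \<bullet> b)) \<and> (\<forall>x\<in>S. frechet_derivative f (at x) e = g x)"
      by (intro exI[of _ ?g]) simp
  qed
qed

text \<open>A derivative of a composition is a sum of products of compositions and smooth functions.
  Therefore the class to which coinduction is applied has to be the algebra generated by both.\<close>

inductive smooth_algebra :: "'e::euclidean_space set \<Rightarrow> 'm::euclidean_space set \<Rightarrow> ('e \<Rightarrow> real) \<Rightarrow> bool"
  for S T where
  smooth: "smooth_on S f \<Longrightarrow> smooth_algebra S T f"
| comp: "smooth_on T f \<Longrightarrow> \<tau> ` S \<subseteq> T \<Longrightarrow> smooth_on S \<tau> \<Longrightarrow> smooth_algebra S T (\<lambda>x. f (\<tau> x))"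
| add: "smooth_algebra S T f \<Longrightarrow> smooth_algebra S T g \<Longrightarrow> smooth_algebra S T (\<lambda>x. f x + g x)"
| mult: "smooth_algebra S T f \<Longrightarrow> smooth_algebra S T g \<Longrightarrow> smooth_algebra S T (\<lambda>x. f x * g x)"

lemma smooth_algebra_sum:
  "(\<And>i. i \<in> I \<Longrightarrow> smooth_algebra S T (f i)) \<Longrightarrow> smooth_algebra S T (\<lambda>x. \<Sum>i\<in>I. f i x)"
  by (induction I rule: infinite_finite_induct) (auto intro: smooth_algebra.intros)

lemma smooth_algebra_smooth:
  fixes S :: "'e::euclidean_space set" and T :: "'m::euclidean_space set"
  assumes S: "open S" and T: "open T" and f: "smooth_algebra S T f"
  shows "smooth_on S f"
proof -
  have step: "(\<forall>x\<in>S. f differentiable (at x)) \<and>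
      (\<exists>g. smooth_algebra S T g \<and> (\<forall>x\<in>S. frechet_derivative f (at x) e = g x))"
    if f: "smooth_algebra S T f" and e: "e \<in> Basis" for f e
    using f
  proof induction
    case (smooth f)
    then show ?case
      using smooth_on_differentiable smooth_on_iter_deriv[of S f "[e]"] e
      by (auto intro!: smooth_algebra.smooth)
  next
    case (comp f \<tau>)
    have d: "((\<lambda>x. f (\<tau> x)) has_derivative
        (\<lambda>h. frechet_derivative f (at (\<tau> x)) (frechet_derivative \<tau> (at x) h))) (at x)" if "x \<in> S" for x
      using comp that smooth_on_differentiable[of S \<tau> x] smooth_on_differentiable[of T f "\<tau> x"]
      by (intro has_derivative_compose[of \<tau> _ _ _ f]) (auto simp: frechet_derivative_works[symmetric])
    let ?g = "\<lambda>x. \<Sum>b\<in>Basis. frechet_derivative f (at (\<tau> x)) b * (frechet_derivative \<tau> (at x) e \<bullet> b)"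
    have "smooth_algebra S T ?g"
    proof (intro smooth_algebra_sum smooth_algebra.mult)
      fix b :: 'm assume b: "b \<in> Basis"
      show "smooth_algebra S T (\<lambda>x. frechet_derivative f (at (\<tau> x)) b)"
        using smooth_algebra.comp[OF _ comp(2,3), of "\<lambda>y. frechet_derivative f (at y) b"]
          smooth_on_iter_deriv[OF comp(1), of "[b]"] b by auto
      have "smooth_on S (\<lambda>x. frechet_derivative \<tau> (at x) e)"
        using smooth_on_iter_deriv[OF comp(3), of "[e]"] e by auto
      then show "smooth_algebra S T (\<lambda>x. frechet_derivative \<tau> (at x) e \<bullet> b)"
        by (intro smooth_algebra.smooth smooth_on_compose_bounded_linear[OF bounded_linear_inner_left S])
    qed
    moreover have "frechet_derivative (\<lambda>x. f (\<tau> x)) (at x) e = ?g x" if x: "x \<in> S" for x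
    proof -
      have lin: "linear (frechet_derivative f (at (\<tau> x)))"
        using comp x smooth_on_differentiable[of T f "\<tau> x"] by (intro linear_frechet_derivative) auto
      have "frechet_derivative (\<lambda>x. f (\<tau> x)) (at x) e = frechet_derivative f (at (\<tau> x)) (frechet_derivative \<tau> (at x) e)"
        using frechet_derivative_at[OF d[OF x]] by metis
      also have "\<dots> = frechet_derivative f (at (\<tau> x)) (\<Sum>b\<in>Basis. (frechet_derivative \<tau> (at x) e \<bullet> b) *\<^sub>R b)"
        by (simp add: euclidean_representation)
      also have "\<dots> = ?g x"
        by (simp add: linear_sum[OF lin] linear_cmul[OF lin] mult.commute)
      finally show ?thesis .
    qed
    ultimately show ?case using d by (auto simp: differentiable_def)
  next
    case (add f1 f2)
    then obtain g1 g2 where g: "smooth_algebra S T g1" "smooth_algebra S T g2"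
      "\<And>x. x \<in> S \<Longrightarrow> frechet_derivative f1 (at x) e = g1 x" "\<And>x. x \<in> S \<Longrightarrow> frechet_derivative f2 (at x) e = g2 x"
      by auto
    have d: "((\<lambda>x. f1 x + f2 x) has_derivative
       (\<lambda>h. frechet_derivative f1 (at x) h + frechet_derivative f2 (at x) h)) (at x)" if "x \<in> S" for x
      using add that by (intro has_derivative_add) (auto simp: frechet_derivative_works[symmetric])
    have "frechet_derivative (\<lambda>x. f1 x + f2 x) (at x) e = g1 x + g2 x" if x: "x \<in> S" for x
      using fun_cong[OF frechet_derivative_at[OF d[OF x]], of e] g(3,4)[OF x] by simp
    then show ?case using g d smooth_algebra.add[OF g(1,2)] unfolding differentiable_def by blast
  next
    case (mult f1 f2)
    then obtain g1 g2 where g: "smooth_algebra S T g1" "smooth_algebra S T g2"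
      "\<And>x. x \<in> S \<Longrightarrow> frechet_derivative f1 (at x) e = g1 x" "\<And>x. x \<in> S \<Longrightarrow> frechet_derivative f2 (at x) e = g2 x"
      by auto
    have d: "((\<lambda>x. f1 x * f2 x) has_derivative
       (\<lambda>h. f1 x * frechet_derivative f2 (at x) h + frechet_derivative f1 (at x) h * f2 x)) (at x)" if "x \<in> S" for x
      using mult that by (intro has_derivative_mult) (auto simp: frechet_derivative_works[symmetric])
    have "frechet_derivative (\<lambda>x. f1 x * f2 x) (at x) e = f1 x * g2 x + g1 x * f2 x" if x: "x \<in> S" for x
      using fun_cong[OF frechet_derivative_at[OF d[OF x]], of e] g(3,4)[OF x] by simp
    then show ?case
      using g d smooth_algebra.add[OF smooth_algebra.mult[OF mult(1) g(2)] smooth_algebra.mult[OF g(1) mult(2)]]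
      unfolding differentiable_def by blast
  qed
  show ?thesis
  proof (rule smooth_on_coinduct[where C = "smooth_algebra S T", OF S f])
    fix f x assume "smooth_algebra S T f" "x \<in> S"
    then show "f differentiable (at x)" using step[of f "SOME b. b \<in> Basis"] by (simp add: SOME_Basis)
  qed (use step in simp)
qed

lemma smooth_on_mult:
  fixes f g :: "'e::euclidean_space \<Rightarrow> real"
  assumes "open S" "smooth_on S f" "smooth_on S g"
  shows "smooth_on S (\<lambda>x. f x * g x)"
  by (rule smooth_algebra_smooth[where T = "UNIV :: real set"])
     (use assms in \<open>auto intro: smooth_algebra.intros\<close>)

lemma smooth_on_sum:
  fixes f :: "'i \<Rightarrow> 'e::euclidean_space \<Rightarrow> 'b::real_normed_vector"
  assumes "open S" "\<And>i. i \<in> I \<Longrightarrow> smooth_on S (f i)"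
  shows "smooth_on S (\<lambda>x. \<Sum>i\<in>I. f i x)"
  using assms(2) by (induction I rule: infinite_finite_induct) (auto intro: smooth_on_add[OF assms(1)])

lemma smooth_on_compose:
  fixes f :: "'m::euclidean_space \<Rightarrow> real" and \<tau> :: "'e::euclidean_space \<Rightarrow> 'm"
  assumes "open S" "open T" "smooth_on T f" "smooth_on S \<tau>" "\<tau> ` S \<subseteq> T"
  shows "smooth_on S (\<lambda>x. f (\<tau> x))"
  using smooth_algebra_smooth[OF assms(1,2)] smooth_algebra.comp[OF assms(3,5,4)] by blast

lemma smooth_on_inverse_real: "smooth_on {x::real. x \<noteq> 0} inverse"
proof -
  let ?C = "\<lambda>f. \<exists>a k. f = (\<lambda>x::real. a * inverse x ^ k)"
  have D: "((\<lambda>x::real. a * inverse x ^ k) has_derivative (\<lambda>h. h * (- a * k * inverse x ^ Suc k))) (at x)"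
    if "x \<noteq> 0" for a x k
  proof -
    have "((\<lambda>x::real. a * inverse x ^ k) has_real_derivative (- a * k * inverse x ^ Suc k)) (at x)"
    proof -
      have "((\<lambda>x::real. a * inverse x ^ k) has_real_derivative
          a * (real k * (- (inverse x * 1 * inverse x)) * inverse x ^ (k - 1))) (at x)"
        by (rule derivative_eq_intros refl that)+ simp
      moreover have "a * (real k * (- (y * 1 * y)) * y ^ (k - 1)) = - a * k * y ^ Suc k" for y :: real
        by (cases k) auto
      ultimately show ?thesis by (simp only:)
    qed
    then show ?thesis unfolding has_field_derivative_def mult_commute_abs .
  qed
  show ?thesis
  proof (rule smooth_on_coinduct[where C = ?C])
    show "open {x::real. x \<noteq> 0}" by (simp add: open_Collect_neq)
    show "\<exists>a k. inverse = (\<lambda>x::real. a * inverse x ^ k)"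
      by (rule exI[of _ 1], rule exI[of _ 1]) auto
  next
    fix f and x :: real assume "?C f" "x \<in> {x. x \<noteq> 0}"
    then show "f differentiable (at x)" using D by (auto simp: differentiable_def)
  next
    fix f and b :: real assume "?C f" "b \<in> Basis"
    then obtain a k where f: "f = (\<lambda>x. a * inverse x ^ k)" and b: "b = 1" by auto
    have "frechet_derivative f (at x) b = - a * k * inverse x ^ Suc k" if "x \<noteq> 0" for x
      using fun_cong[OF frechet_derivative_at[OF D[OF that, of a k]], of 1] f b by auto
    then show "\<exists>g. ?C g \<and> (\<forall>x\<in>{x. x \<noteq> 0}. frechet_derivative f (at x) b = g x)"
      by (intro exI[of _ "\<lambda>x. (- a * k) * inverse x ^ Suc k"]) blast
  qed
qed

lemma smooth_on_divide:
  fixes f g :: "'e::euclidean_space \<Rightarrow> real"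
  assumes "open S" "smooth_on S f" "smooth_on S g" "\<And>x. x \<in> S \<Longrightarrow> g x \<noteq> 0"
  shows "smooth_on S (\<lambda>x. f x / g x)"
proof -
  have "smooth_on S (\<lambda>x. inverse (g x))"
    by (rule smooth_on_compose[OF assms(1) _ smooth_on_inverse_real assms(3)])
       (use assms(4) in \<open>auto simp: open_Collect_neq\<close>)
  from smooth_on_mult[OF assms(1,2) this] show ?thesis by (simp add: field_class.field_divide_inverse)
qed

section \<open>Bump functions\<close>

text \<open>The powers of \<open>1/x\<close> are included since they arise on differentiating
  \<open>exp(-1/x)\<close>; they do not affect the vanishing of all derivatives at
  \<open>0\<close>.\<close>

definition flat_fun :: "nat \<Rightarrow> real \<Rightarrow> real"
  where "flat_fun k x = (if x > 0 then inverse x ^ k * exp (- inverse x) else 0)"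

lemma flat_fun_limit: "((\<lambda>h. flat_fun k h / h) \<longlongrightarrow> 0) (at 0)"
proof -
  have "((\<lambda>h. (inverse h) ^ Suc k / exp (inverse h)) \<longlongrightarrow> 0) (at_right (0::real))"
    by (rule filterlim_compose[OF tendsto_power_div_exp_0 filterlim_inverse_at_top_right])
  then have "((\<lambda>h. flat_fun k h / h) \<longlongrightarrow> 0) (at_right 0)"
    by (rule Lim_transform_eventually)
       (auto simp: eventually_at_filter flat_fun_def exp_minus divide_simps)
  moreover have "((\<lambda>h. flat_fun k h / h) \<longlongrightarrow> 0) (at_left 0)"
    by (rule Lim_transform_eventually[OF tendsto_const])
       (auto simp: eventually_at_filter flat_fun_def)
  ultimately show ?thesis by (simp add: filterlim_split_at)
qed

lemma flat_fun_deriv: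
  "(flat_fun k has_real_derivative flat_fun (k + 2) x - k * flat_fun (k + 1) x) (at x)"
proof -
  consider "x > 0" | "x < 0" | "x = 0" by linarith
  then show ?thesis
  proof cases
    case 1
    have "((\<lambda>x::real. inverse x ^ k * exp (- inverse x)) has_real_derivative
      inverse x ^ k * (exp (- inverse x) * (inverse x * 1 * inverse x)) +
      (real k * (- (inverse x * 1 * inverse x)) * inverse x ^ (k - 1)) * exp (- inverse x)) (at x)"
      using 1 by (auto intro!: derivative_eq_intros)
    moreover have "y ^ k * (e * (y * 1 * y)) + (real k * (- (y * 1 * y)) * y ^ (k - 1)) * e
      = y ^ (k + 2) * e - k * (y ^ (k + 1) * e)" for y e :: real
      by (cases k) (auto simp: algebra_simps)
    ultimately have "((\<lambda>x::real. inverse x ^ k * exp (- inverse x)) has_real_derivative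
      flat_fun (k + 2) x - k * flat_fun (k + 1) x) (at x)"
      using 1 by (simp only: flat_fun_def if_True)
    then show ?thesis
      by (rule has_field_derivative_transform_within_open[where S = "{0<..}"])
         (use 1 in \<open>auto simp: flat_fun_def\<close>)
  next
    case 2
    have "((\<lambda>x::real. 0) has_real_derivative 0) (at x)" by simp
    then have "(flat_fun k has_real_derivative 0) (at x)"
      by (rule has_field_derivative_transform_within_open[where S = "{..<0}"])
         (use 2 in \<open>auto simp: flat_fun_def\<close>)
    with 2 show ?thesis by (simp add: flat_fun_def)
  next
    case 3
    then show ?thesis
      unfolding DERIV_def using flat_fun_limit[of k] by (simp add: flat_fun_def)
  qed
qed

inductive flat_span :: "(real \<Rightarrow> real) \<Rightarrow> bool" where
  "flat_span (flat_fun k)"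
| "flat_span f \<Longrightarrow> flat_span g \<Longrightarrow> flat_span (\<lambda>x. f x + g x)"
| "flat_span f \<Longrightarrow> flat_span (\<lambda>x. c * f x)"

lemma smooth_on_flat_fun: "smooth_on UNIV (flat_fun k)"
proof -
  have step: "\<exists>g. flat_span g \<and> (\<forall>x. (f has_real_derivative g x) (at x))" if "flat_span f" for f
    using that
  proof induction
    case (1 k)
    show ?case
      using flat_fun_deriv[of k] flat_span.intros(2)[OF flat_span.intros(1)[of "k+2"]
          flat_span.intros(3)[OF flat_span.intros(1)[of "k+1"], of "- real k"]]
      by auto
  next
    case (2 f g)
    then obtain f' g' where "flat_span f'" "\<And>x. (f has_real_derivative f' x) (at x)"
      "flat_span g'" "\<And>x. (g has_real_derivative g' x) (at x)" by blast
    then show ?case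
      by (intro exI[of _ "\<lambda>x. f' x + g' x"] conjI allI flat_span.intros(2) DERIV_add)
  next
    case (3 f c)
    then obtain g where "flat_span g" "\<And>x. (f has_real_derivative g x) (at x)" by blast
    then show ?case
      by (intro exI[of _ "\<lambda>x. c * g x"] conjI allI flat_span.intros(3) DERIV_cmult)
  qed
  show ?thesis
  proof (rule smooth_on_coinduct[where C = flat_span, OF open_UNIV])
    show "flat_span (flat_fun k)" by (rule flat_span.intros)
  next
    fix f and x :: real assume "flat_span f"
    then show "f differentiable (at x)" using step[of f] real_differentiable_def by blast
  next
    fix f and b :: real assume "flat_span f" and b: "b \<in> Basis"
    then obtain g where g: "flat_span g" "\<And>x. (f has_real_derivative g x) (at x)" using step by blast
    have "frechet_derivative f (at x) b = g x" for x
      using fun_cong[OF frechet_derivative_at[OF g(2)[of x, unfolded has_field_derivative_def]], of b] b by simp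
    with g(1) show "\<exists>g. flat_span g \<and> (\<forall>x\<in>UNIV. frechet_derivative f (at x) b = g x)" by blast
  qed
qed

lemma smooth_bump:
  fixes a :: "'e::euclidean_space"
  assumes "r > 0"
  obtains \<beta> :: "'e \<Rightarrow> real" where "smooth_on UNIV \<beta>" "\<And>x. 0 \<le> \<beta> x" "\<And>x. \<beta> x \<noteq> 0 \<longleftrightarrow> x \<in> ball a r"
proof
  \<comment> \<open>The squared distance is written as a polynomial in the coordinates, in order to be
    smooth by the rules for sums and products.\<close>
  let ?q = "\<lambda>x. r\<^sup>2 - (\<Sum>b\<in>Basis. (x \<bullet> b - a \<bullet> b) * (x \<bullet> b - a \<bullet> b))"
  have s: "smooth_on UNIV (\<lambda>x. x \<bullet> b - a \<bullet> b)" for b :: 'e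
    using smooth_on_add[OF open_UNIV smooth_on_bounded_linear[OF bounded_linear_inner_left] smooth_on_const[of _ "- (a \<bullet> b)"]]
    by simp
  have "smooth_on UNIV (\<lambda>x. (\<Sum>b\<in>Basis. (x \<bullet> b - a \<bullet> b) * (x \<bullet> b - a \<bullet> b)))"
    by (intro smooth_on_sum smooth_on_mult s open_UNIV)
  from smooth_on_add[OF open_UNIV smooth_on_const[of _ "r\<^sup>2"]
      smooth_on_mult[OF open_UNIV smooth_on_const[of _ "-1"] this]]
  have "smooth_on UNIV ?q" by simp
  then show "smooth_on UNIV (\<lambda>x. flat_fun 0 (?q x))"
    by (intro smooth_on_compose[OF open_UNIV open_UNIV smooth_on_flat_fun]) auto
  show "0 \<le> flat_fun 0 (?q x)" for x by (simp add: flat_fun_def)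
  have "?q x = r\<^sup>2 - (dist a x)\<^sup>2" for x
  proof -
    have "(dist a x)\<^sup>2 = (\<Sum>b\<in>Basis. ((x - a) \<bullet> b) * ((x - a) \<bullet> b))"
      by (simp only: dist_norm norm_minus_commute[of a x] power2_norm_eq_inner euclidean_inner[of "x - a" "x - a"])
    then show ?thesis by (simp only: inner_diff_left)
  qed
  then show "flat_fun 0 (?q x) \<noteq> 0 \<longleftrightarrow> x \<in> ball a r" for x
    using assms power2_less_imp_less[of "dist a x" r] power_strict_mono[of "dist a x" r 2]
    by (auto simp: flat_fun_def)
qed

section \<open>Equality of mixed partial derivatives\<close>

text \<open>Two applications of the mean value theorem, first in the first variable and then in the
  second one. In \<open>mixed_partials_eq\<close> this is applied in both orders.\<close>

lemma second_difference:
  fixes \<phi> :: "real \<Rightarrow> real \<Rightarrow> real"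
  assumes h: "0 < h" "h < \<delta>"
    and 1: "\<And>s t. \<bar>s\<bar> < \<delta> \<Longrightarrow> \<bar>t\<bar> < \<delta> \<Longrightarrow> ((\<lambda>s. \<phi> s t) has_real_derivative \<phi>1 s t) (at s)"
    and 2: "\<And>s t. \<bar>s\<bar> < \<delta> \<Longrightarrow> \<bar>t\<bar> < \<delta> \<Longrightarrow> ((\<lambda>t. \<phi>1 s t) has_real_derivative \<phi>12 s t) (at t)"
  shows "\<exists>\<xi> \<eta>. 0 < \<xi> \<and> \<xi> < h \<and> 0 < \<eta> \<and> \<eta> < h \<and> \<phi> h h - \<phi> h 0 - \<phi> 0 h + \<phi> 0 0 = h * h * \<phi>12 \<xi> \<eta>"
proof -
  have "\<exists>z>0. z < h \<and> (\<phi> h h - \<phi> h 0) - (\<phi> 0 h - \<phi> 0 0) = (h - 0) * (\<phi>1 z h - \<phi>1 z 0)"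
    by (rule MVT2[OF h(1)]) (intro DERIV_diff 1; use h in auto)
  then obtain \<xi> where \<xi>: "0 < \<xi>" "\<xi> < h" "(\<phi> h h - \<phi> h 0) - (\<phi> 0 h - \<phi> 0 0) = (h - 0) * (\<phi>1 \<xi> h - \<phi>1 \<xi> 0)"
    by blast
  have "\<exists>z>0. z < h \<and> \<phi>1 \<xi> h - \<phi>1 \<xi> 0 = (h - 0) * \<phi>12 \<xi> z"
    by (rule MVT2[OF h(1)]) (use h \<xi> 2 in auto)
  then obtain \<eta> where \<eta>: "0 < \<eta>" "\<eta> < h" "\<phi>1 \<xi> h - \<phi>1 \<xi> 0 = (h - 0) * \<phi>12 \<xi> \<eta>" by blast
  have "\<phi> h h - \<phi> h 0 - \<phi> 0 h + \<phi> 0 0 = h * h * \<phi>12 \<xi> \<eta>"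
    using \<xi>(3) unfolding \<eta>(3) by simp
  with \<xi> \<eta> show ?thesis by blast
qed

text \<open>Stated for a function of two real variables with explicitly given derivatives, so that it
  applies to the restriction of a function on a locally convex space to a plane, too.\<close>

lemma mixed_partials_eq:
  fixes \<phi> :: "real \<Rightarrow> real \<Rightarrow> real"
  assumes \<delta>: "0 < \<delta>"
    and 1: "\<And>s t. \<bar>s\<bar> < \<delta> \<Longrightarrow> \<bar>t\<bar> < \<delta> \<Longrightarrow> ((\<lambda>s. \<phi> s t) has_real_derivative \<phi>1 s t) (at s)"
    and 12: "\<And>s t. \<bar>s\<bar> < \<delta> \<Longrightarrow> \<bar>t\<bar> < \<delta> \<Longrightarrow> ((\<lambda>t. \<phi>1 s t) has_real_derivative \<phi>12 s t) (at t)"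
    and 2: "\<And>s t. \<bar>s\<bar> < \<delta> \<Longrightarrow> \<bar>t\<bar> < \<delta> \<Longrightarrow> ((\<lambda>t. \<phi> s t) has_real_derivative \<phi>2 s t) (at t)"
    and 21: "\<And>s t. \<bar>s\<bar> < \<delta> \<Longrightarrow> \<bar>t\<bar> < \<delta> \<Longrightarrow> ((\<lambda>s. \<phi>2 s t) has_real_derivative \<phi>21 s t) (at s)"
    and cont: "\<And>s t. s \<longlonglongrightarrow> 0 \<Longrightarrow> t \<longlonglongrightarrow> 0 \<Longrightarrow> (\<And>n. \<bar>s n\<bar> < \<delta>) \<Longrightarrow> (\<And>n. \<bar>t n\<bar> < \<delta>) \<Longrightarrow>
      (\<lambda>n. \<phi>12 (s n) (t n)) \<longlonglongrightarrow> \<phi>12 0 0"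
      "\<And>s t. s \<longlonglongrightarrow> 0 \<Longrightarrow> t \<longlonglongrightarrow> 0 \<Longrightarrow> (\<And>n. \<bar>s n\<bar> < \<delta>) \<Longrightarrow> (\<And>n. \<bar>t n\<bar> < \<delta>) \<Longrightarrow>
      (\<lambda>n. \<phi>21 (s n) (t n)) \<longlonglongrightarrow> \<phi>21 0 0"
  shows "\<phi>12 0 0 = \<phi>21 0 0"
proof -
  \<comment> \<open>Any null sequence in the open interval from \<open>0\<close> to
    \<open>\<delta>\<close> would do.\<close>
  define h where "h = (\<lambda>n. \<delta> * inverse (real (Suc (Suc n))))"
  have h: "0 < h n" "h n < \<delta>" for n
    using \<delta> by (auto simp: h_def field_simps add_pos_nonneg)
  have lim: "h \<longlonglongrightarrow> 0"
    unfolding h_def using tendsto_mult_right[OF LIMSEQ_Suc[OF LIMSEQ_inverse_real_of_nat], of \<delta>]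
    by (simp add: mult.commute)
  have "\<exists>\<xi> \<eta> \<xi>' \<eta>'. 0 < \<xi> \<and> \<xi> < h n \<and> 0 < \<eta> \<and> \<eta> < h n \<and> 0 < \<xi>' \<and> \<xi>' < h n \<and> 0 < \<eta>' \<and> \<eta>' < h n
     \<and> \<phi>12 \<xi> \<eta> = \<phi>21 \<xi>' \<eta>'" for n
  proof -
    obtain \<xi> \<eta> where a: "0 < \<xi>" "\<xi> < h n" "0 < \<eta>" "\<eta> < h n"
        "\<phi> (h n) (h n) - \<phi> (h n) 0 - \<phi> 0 (h n) + \<phi> 0 0 = h n * h n * \<phi>12 \<xi> \<eta>"
      using second_difference[OF h[of n] 1 12] by blast
    obtain \<eta>' \<xi>' where b: "0 < \<xi>'" "\<xi>' < h n" "0 < \<eta>'" "\<eta>' < h n"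
        "\<phi> (h n) (h n) - \<phi> 0 (h n) - \<phi> (h n) 0 + \<phi> 0 0 = h n * h n * \<phi>21 \<xi>' \<eta>'"
      using second_difference[OF h[of n], of "\<lambda>t s. \<phi> s t" "\<lambda>t s. \<phi>2 s t" "\<lambda>t s. \<phi>21 s t"] 2 21 by blast
    from a(5) b(5) have "h n * h n * \<phi>12 \<xi> \<eta> = h n * h n * \<phi>21 \<xi>' \<eta>'" by linarith
    with h(1)[of n] have "\<phi>12 \<xi> \<eta> = \<phi>21 \<xi>' \<eta>'" by simp
    with a b show ?thesis by blast
  qed
  then obtain \<xi> \<eta> \<xi>' \<eta>' where *: "\<And>n. 0 < \<xi> n \<and> \<xi> n < h n \<and> 0 < \<eta> n \<and> \<eta> n < h n \<and>
      0 < \<xi>' n \<and> \<xi>' n < h n \<and> 0 < \<eta>' n \<and> \<eta>' n < h n \<and> \<phi>12 (\<xi> n) (\<eta> n) = \<phi>21 (\<xi>' n) (\<eta>' n)"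
    by metis
  have lims: "u \<longlonglongrightarrow> 0 \<and> (\<forall>n. \<bar>u n\<bar> < \<delta>)" if "\<And>n. 0 < u n \<and> u n < h n" for u
  proof
    show "u \<longlonglongrightarrow> 0"
      by (rule tendsto_sandwich[OF _ _ tendsto_const lim]) (use that in \<open>auto intro!: always_eventually less_imp_le\<close>)
    show "\<forall>n. \<bar>u n\<bar> < \<delta>" using that h(2) by (metis abs_of_pos less_trans)
  qed
  have "(\<lambda>n. \<phi>12 (\<xi> n) (\<eta> n)) \<longlonglongrightarrow> \<phi>12 0 0"
    using lims[of \<xi>] lims[of \<eta>] * by (intro cont(1)) blast+
  moreover have "(\<lambda>n. \<phi>21 (\<xi>' n) (\<eta>' n)) \<longlonglongrightarrow> \<phi>21 0 0"
    using lims[of \<xi>'] lims[of \<eta>'] * by (intro cont(2)) blast+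
  moreover have "(\<lambda>n. \<phi>12 (\<xi> n) (\<eta> n)) = (\<lambda>n. \<phi>21 (\<xi>' n) (\<eta>' n))" using * by auto
  ultimately show ?thesis using LIMSEQ_unique by simp
qed

lemma has_real_derivative_line:
  assumes "f differentiable (at (y + s *\<^sub>R a))"
  shows "((\<lambda>s. f (y + s *\<^sub>R a) :: real) has_real_derivative frechet_derivative f (at (y + s *\<^sub>R a)) a) (at s)"
proof -
  have lin: "linear (frechet_derivative f (at (y + s *\<^sub>R a)))" by (rule linear_frechet_derivative[OF assms])
  have "((\<lambda>s. y + s *\<^sub>R a) has_derivative (\<lambda>t. t *\<^sub>R a)) (at s)"
    by (auto intro!: derivative_eq_intros)
  then have "((\<lambda>s. f (y + s *\<^sub>R a)) has_derivative (\<lambda>t. frechet_derivative f (at (y + s *\<^sub>R a)) (t *\<^sub>R a))) (at s)"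
    by (rule has_derivative_compose) (use assms in \<open>simp add: frechet_derivative_works\<close>)
  then show ?thesis
    unfolding has_field_derivative_def by (simp add: linear_cmul[OF lin] mult_commute_abs)
qed

lemma iter_deriv_commute_real:
  fixes f :: "'e::euclidean_space \<Rightarrow> real"
  assumes S: "open S" "smooth_on S f" "x \<in> S" and ab: "a \<in> Basis" "b \<in> Basis"
  shows "iter_deriv [a, b] f x = iter_deriv [b, a] f x"
proof -
  obtain r where r: "r > 0" "ball x r \<subseteq> S" using S openE by blast
  define y where "y s t = x + s *\<^sub>R a + t *\<^sub>R b" for s t
  have yS: "y s t \<in> S" if "\<bar>s\<bar> < r/2" "\<bar>t\<bar> < r/2" for s t
  proof -
    have "norm (s *\<^sub>R a + t *\<^sub>R b) \<le> \<bar>s\<bar> + \<bar>t\<bar>"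
      using norm_triangle_ineq[of "s *\<^sub>R a" "t *\<^sub>R b"] ab by simp
    then have "dist x (y s t) < r" using that 
      using dist_norm[of "y s t" x] by (simp add: y_def dist_commute add.assoc)
    then show ?thesis using r by auto
  qed
  have d: "iter_deriv vs f differentiable (at (y s t))"
    if "\<bar>s\<bar> < r/2" "\<bar>t\<bar> < r/2" "vs \<in> lists Basis" for vs s t
    using smooth_onD[OF S(2) that(3) yS] that by auto
  have da: "((\<lambda>s. iter_deriv vs f (y s t)) has_real_derivative iter_deriv (a # vs) f (y s t)) (at s)"
    if "\<bar>s\<bar> < r/2" "\<bar>t\<bar> < r/2" "vs \<in> lists Basis" for vs s t
    using has_real_derivative_line[of "iter_deriv vs f" "x + t *\<^sub>R b" s a] d[OF that]
    by (simp add: y_def algebra_simps)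
  have db: "((\<lambda>t. iter_deriv vs f (y s t)) has_real_derivative iter_deriv (b # vs) f (y s t)) (at t)"
    if "\<bar>s\<bar> < r/2" "\<bar>t\<bar> < r/2" "vs \<in> lists Basis" for vs s t
    using has_real_derivative_line[of "iter_deriv vs f" "x + s *\<^sub>R a" t b] d[OF that]
    by (simp add: y_def algebra_simps)
  have cont: "(\<lambda>n. iter_deriv vs f (y (s n) (t n))) \<longlonglongrightarrow> iter_deriv vs f (y 0 0)"
    if "s \<longlonglongrightarrow> 0" "t \<longlonglongrightarrow> 0" "vs \<in> lists Basis" for s t vs
  proof -
    have "isCont (iter_deriv vs f) (y 0 0)"
      using d[of 0 0 vs] that r differentiable_imp_continuous_within by auto
    moreover have "(\<lambda>n. y (s n) (t n)) \<longlonglongrightarrow> y 0 0"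
      unfolding y_def using that by (intro tendsto_intros) auto
    ultimately show ?thesis by (rule isCont_tendsto_compose)
  qed
  have "iter_deriv [b, a] f (y 0 0) = iter_deriv [a, b] f (y 0 0)"
    by (rule mixed_partials_eq[of "r/2" "\<lambda>s t. iter_deriv [] f (y s t)" "\<lambda>s t. iter_deriv [a] f (y s t)"
        "\<lambda>s t. iter_deriv [b, a] f (y s t)" "\<lambda>s t. iter_deriv [b] f (y s t)" "\<lambda>s t. iter_deriv [a, b] f (y s t)"])
       ((rule da db cont)?; use r ab in \<open>simp del: iter_deriv.simps\<close>)+
  then show ?thesis by (simp add: y_def)
qed

lemma iter_deriv_commute:
  fixes f :: "'e::euclidean_space \<Rightarrow> 'm::euclidean_space"
  assumes S: "open S" "smooth_on S f" "x \<in> S" and ab: "a \<in> Basis" "b \<in> Basis"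
  shows "iter_deriv [a, b] f x = iter_deriv [b, a] f x"
proof (rule euclidean_eqI)
  fix e :: 'm assume "e \<in> Basis"
  have "smooth_on S (\<lambda>x. f x \<bullet> e)"
    by (rule smooth_on_compose_bounded_linear[OF bounded_linear_inner_left S(1,2)])
  from iter_deriv_commute_real[OF S(1) this S(3) ab]
  show "iter_deriv [a, b] f x \<bullet> e = iter_deriv [b, a] f x \<bullet> e"
    using iter_deriv_bounded_linear[OF bounded_linear_inner_left S(1,2) _ S(3), of _ e] ab
    by (simp del: iter_deriv.simps)
qed

section \<open>Differentiating determinant and inverse of a matrix\<close>

lemma bounded_bilinear_matrix_mult:
  "bounded_bilinear ((**) :: real ^ 'n ^ 'm \<Rightarrow> real ^ 'k ^ 'n \<Rightarrow> real ^ 'k ^ 'm)"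
  unfolding bilinear_conv_bounded_bilinear[symmetric] bilinear_def
  by (auto intro!: linearI simp: vec_eq_iff matrix_matrix_mult_def sum.distrib sum_distrib_left algebra_simps)

lemmas has_derivative_matrix_mult = bounded_bilinear.FDERIV[OF bounded_bilinear_matrix_mult]

lemma bounded_linear_trace: "bounded_linear (trace :: real ^ 'n ^ 'n \<Rightarrow> real)"
  unfolding linear_conv_bounded_linear[symmetric]
  by (auto intro!: linearI simp: trace_def sum.distrib sum_distrib_left)

lemma bounded_linear_entry: "bounded_linear (\<lambda>A :: real ^ 'n ^ 'm. A $ i $ j)"
  by (rule bounded_linear_compose[OF bounded_linear_vec_nth bounded_linear_vec_nth])

lemmas has_derivative_entry [derivative_intros] = bounded_linear.has_derivative[OF bounded_linear_entry]

lemma matrix_Basis_cases: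
  assumes "(b :: real ^ 'n ^ 'm) \<in> Basis"
  obtains p q where "b = axis p (axis q 1)"
proof -
  obtain p u where "u \<in> Basis" "b = axis p u" using assms by (auto simp: Basis_vec_def)
  moreover from this obtain q where "u = axis q 1" by (auto simp: Basis_vec_def)
  ultimately show ?thesis using that by simp
qed

lemma matrix_inv_right: "det (A :: real ^ 'n ^ 'n) \<noteq> 0 \<Longrightarrow> A ** matrix_inv A = mat 1"
  and matrix_inv_left: "det A \<noteq> 0 \<Longrightarrow> matrix_inv A ** A = mat 1"
proof -
  assume "det A \<noteq> 0"
  then have "\<exists>B. A ** B = mat 1 \<and> B ** A = mat 1"
    using invertible_det_nz[of A] by (simp add: invertible_def)
  then have "A ** matrix_inv A = mat 1 \<and> matrix_inv A ** A = mat 1"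
    unfolding matrix_inv_def by (rule someI_ex)
  then show "A ** matrix_inv A = mat 1" "matrix_inv A ** A = mat 1" by auto
qed

lemma det_has_derivative_prod:
  "(det has_derivative (\<lambda>V. \<Sum>p | p permutes UNIV. of_int (sign p) *
      (\<Sum>i\<in>UNIV. V $ i $ p i * (\<Prod>j\<in>UNIV - {i}. A $ j $ p j)))) (at (A :: real ^ 'n ^ 'n))"
  unfolding det_def
  by (intro has_derivative_sum has_derivative_mult_right has_derivative_prod has_derivative_entry has_derivative_ident)

lemma det_has_derivative_one: "(det has_derivative trace) (at (mat 1 :: real ^ 'n ^ 'n))"
proof (rule has_derivative_eq_rhs[OF det_has_derivative_prod], rule ext)
  fix V :: "real ^ 'n ^ 'n"
  let ?t = "\<lambda>p. of_int (sign p) * (\<Sum>i\<in>UNIV. V $ i $ p i * (\<Prod>j\<in>UNIV - {i}. (mat 1 :: real ^ 'n ^ 'n) $ j $ p j))"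
  have zero: "?t p = 0" if p: "p permutes UNIV" "p \<noteq> id" for p :: "'n \<Rightarrow> 'n"
  proof -
    have "(\<Prod>j\<in>UNIV - {i}. (mat 1 :: real ^ 'n ^ 'n) $ j $ p j) = 0" for i
    proof -
      have "\<exists>j. j \<noteq> i \<and> p j \<noteq> j"
      proof (rule ccontr)
        assume "\<not> (\<exists>j. j \<noteq> i \<and> p j \<noteq> j)"
        then have *: "p j = j" if "j \<noteq> i" for j using that by auto
        have "inj p" using p(1) permutes_inj by auto
        then have "p i = i" using * by (metis injD)
        with * have "p = id" by (metis eq_id_iff)
        with p(2) show False by simp
      qed
      then obtain j where "j \<noteq> i" "p j \<noteq> j" by blast
      then have "\<exists>j\<in>UNIV - {i}. (mat 1 :: real ^ 'n ^ 'n) $ j $ p j = 0"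
        by (intro bexI[of _ j]) (auto simp: mat_def)
      then show ?thesis by simp
    qed
    then show ?thesis by (simp only: mult_zero_right sum.neutral_const)
  qed
  have "(\<Sum>p | p permutes (UNIV :: 'n set). ?t p) = (\<Sum>p \<in> {id}. ?t p)"
    by (rule sum.mono_neutral_right) (use zero in \<open>auto simp: finite_permutations permutes_id\<close>)
  also have "\<dots> = trace V"
    by (simp add: sign_id trace_def mat_def)
  finally show "(\<Sum>p | p permutes (UNIV :: 'n set). ?t p) = trace V" .
qed

text \<open>Jacobi's formula. By multiplicativity of the determinant it is sufficient to know the
  derivative at the unit matrix.\<close>

lemma det_has_derivative:
  fixes A :: "real ^ 'n ^ 'n"
  assumes "det A \<noteq> 0"
  shows "(det has_derivative (\<lambda>V. det A * trace (matrix_inv A ** V))) (at A)"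
proof -
  have "((\<lambda>X. matrix_inv A ** X) has_derivative (\<lambda>V. matrix_inv A ** V)) (at A)"
    by (rule bounded_linear.has_derivative[OF bounded_bilinear.bounded_linear_right[OF bounded_bilinear_matrix_mult] has_derivative_ident])
  then have "((\<lambda>X. det (matrix_inv A ** X)) has_derivative (\<lambda>V. trace (matrix_inv A ** V))) (at A)"
    by (rule has_derivative_compose) (simp add: matrix_inv_left[OF assms] det_has_derivative_one)
  then have "((\<lambda>X. det A * det (matrix_inv A ** X)) has_derivative (\<lambda>V. det A * trace (matrix_inv A ** V))) (at A)"
    by (rule has_derivative_mult_right)
  moreover have "det A * det (matrix_inv A ** X) = det X" for X
    by (simp add: det_mul[symmetric] matrix_mul_assoc matrix_inv_right[OF assms])
  ultimately show ?thesis by simp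
qed

lemma continuous_on_det: "continuous_on S (det :: real ^ 'n ^ 'n \<Rightarrow> real)"
  by (meson continuous_at_imp_continuous_on det_has_derivative_prod has_derivative_continuous)

lemma open_det_nonzero: "open {A :: real ^ 'n ^ 'n. det A \<noteq> 0}"
  by (rule open_Collect_neq[OF continuous_on_det continuous_on_const])

lemma matrix_inv_cramer:
  fixes A :: "real ^ 'n ^ 'n"
  assumes "det A \<noteq> 0"
  shows "matrix_inv A $ k $ m = det (\<chi> i j. if j = k then axis m 1 $ i else A $ i $ j) / det A"
proof -
  have "A *v (matrix_inv A *v axis m 1) = axis m 1"
    by (simp add: matrix_vector_mul_assoc matrix_inv_right[OF assms])
  then have "matrix_inv A *v axis m 1 = (\<chi> k. det (\<chi> i j. if j = k then axis m 1 $ i else A $ i $ j) / det A)"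
    by (simp only: cramer[OF assms])
  then have "(matrix_inv A *v axis m 1) $ k = det (\<chi> i j. if j = k then axis m 1 $ i else A $ i $ j) / det A"
    by simp
  then show ?thesis
    by (simp add: matrix_vector_mul_component inner_axis)
qed

text \<open>Cramer's rule exhibits the entries as quotients of determinants. The value of the derivative
  is found in \<open>matrix_inv_has_derivative\<close> by differentiating \<open>A **
  matrix_inv A = mat 1\<close>.\<close>

lemma matrix_inv_differentiable:
  fixes A :: "real ^ 'n ^ 'n"
  assumes A: "det A \<noteq> 0"
  shows "matrix_inv differentiable (at A)"
proof -
  have "(\<lambda>X. matrix_inv X $ k $ m) differentiable (at A)" for k m
  proof (rule differentiable_cong_open[OF _ open_det_nonzero, of "\<lambda>X. det (\<chi> i j. if j = k then axis m 1 $ i else X $ i $ j) / det X"])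
    have "det differentiable (at X)" for X :: "real ^ 'n ^ 'n"
      using det_has_derivative_prod differentiable_def by blast
    moreover have "(\<lambda>X :: real ^ 'n ^ 'n. (\<chi> i j. if j = k then axis m 1 $ i else X $ i $ j) :: real ^ 'n ^ 'n) differentiable (at A)"
    proof -
      have "(\<lambda>X :: real ^ 'n ^ 'n. ((\<chi> i j. if j = k then axis m 1 $ i else X $ i $ j) :: real ^ 'n ^ 'n) \<bullet> b) differentiable (at A)"
        if b: "b \<in> Basis" for b
      proof -
        obtain p q where "b = axis p (axis q 1)" using b by (rule matrix_Basis_cases)
        then have "(\<lambda>X :: real ^ 'n ^ 'n. ((\<chi> i j. if j = k then axis m 1 $ i else X $ i $ j) :: real ^ 'n ^ 'n) \<bullet> b)
          = (\<lambda>X. if q = k then axis m 1 $ p else X $ p $ q)"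
          by (simp add: inner_axis fun_eq_iff)
        then show ?thesis
          using bounded_linear_imp_differentiable[OF bounded_linear_entry[of p q]] by (cases "q = k") simp_all
      qed
      then show ?thesis by (rule iffD2[OF differentiable_componentwise_within, OF ballI])
    qed
    ultimately show "(\<lambda>X. det (\<chi> i j. if j = k then axis m 1 $ i else X $ i $ j) / det X) differentiable (at A)"
      using A
      by (intro differentiable_divide
          differentiable_compose[of det "\<lambda>X :: real ^ 'n ^ 'n. (\<chi> i j. if j = k then axis m 1 $ i else X $ i $ j) :: real ^ 'n ^ 'n"])
    show "A \<in> {A. det A \<noteq> 0}" using A by simp
    fix X :: "real ^ 'n ^ 'n" assume "X \<in> {A. det A \<noteq> 0}"
    then show "det (\<chi> i j. if j = k then axis m 1 $ i else X $ i $ j) / det X = matrix_inv X $ k $ m"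
      by (intro matrix_inv_cramer[symmetric]) simp
  qed
  note entries = this
  have "(\<lambda>X. matrix_inv X \<bullet> b) differentiable (at A)" if b: "b \<in> Basis" for b
  proof -
    obtain p q where "b = axis p (axis q 1)" using b by (rule matrix_Basis_cases)
    then show ?thesis using entries by (simp add: inner_axis)
  qed
  then show ?thesis by (rule iffD2[OF differentiable_componentwise_within, OF ballI])
qed

lemma matrix_inv_has_derivative:
  fixes A :: "real ^ 'n ^ 'n"
  assumes A: "det A \<noteq> 0"
  shows "(matrix_inv has_derivative (\<lambda>V. - (matrix_inv A ** V ** matrix_inv A))) (at A)"
proof -
  obtain D where D: "(matrix_inv has_derivative D) (at A)"
    using matrix_inv_differentiable[OF A] differentiable_def by blast
  have "((\<lambda>X. X ** matrix_inv X) has_derivative (\<lambda>V. A ** D V + V ** matrix_inv A)) (at A)"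
    by (rule has_derivative_matrix_mult[OF has_derivative_ident D])
  then have const: "((\<lambda>X. mat 1 :: real ^ 'n ^ 'n) has_derivative (\<lambda>V. A ** D V + V ** matrix_inv A)) (at A)"
    by (rule has_derivative_transform_within_open[OF _ open_det_nonzero]) (simp_all add: A matrix_inv_right)
  have "A ** D V + V ** matrix_inv A = 0" for V
    using fun_cong[OF has_derivative_unique[OF const has_derivative_const], of V] by simp
  then have AD: "A ** D V = - (V ** matrix_inv A)" for V
    by (rule eq_neg_iff_add_eq_0[THEN iffD2])
  have "D V = - (matrix_inv A ** V ** matrix_inv A)" for V
  proof -
    have "D V = matrix_inv A ** (A ** D V)"
      by (simp add: matrix_mul_assoc matrix_inv_left[OF A])
    also have "\<dots> = - (matrix_inv A ** (V ** matrix_inv A))"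
      unfolding AD by (rule bounded_bilinear.minus_right[OF bounded_bilinear_matrix_mult])
    finally show ?thesis by (simp add: matrix_mul_assoc)
  qed
  then have "D = (\<lambda>V. - (matrix_inv A ** V ** matrix_inv A))" by (rule ext)
  with D show ?thesis by simp
qed

lemma continuous_on_matrix_inv: "continuous_on {A :: real ^ 'n ^ 'n. det A \<noteq> 0} matrix_inv"
  by (intro continuous_at_imp_continuous_on ballI has_derivative_continuous[OF matrix_inv_has_derivative]) auto

lemma sqrt_det_has_derivative:
  fixes A :: "real ^ 'n ^ 'n"
  assumes A: "det A \<noteq> 0"
  shows "((\<lambda>X. sqrt (det X)) has_derivative (\<lambda>V. 1/2 * trace (matrix_inv A ** V) * sqrt (det A))) (at A)"
proof -
  obtain D where D: "(sqrt has_real_derivative D) (at (det A))" "D * det A = sqrt (det A) / 2"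
  proof (cases "det A > 0")
    case True
    show ?thesis
      by (rule that[OF DERIV_real_sqrt[OF True]]) (use True in \<open>simp add: field_simps flip: power2_eq_square\<close>)
  next
    case False
    then have neg: "det A < 0" using A by simp
    have "(sqrt has_real_derivative - inverse (sqrt (det A)) / 2) (at (det A))"
      by (rule DERIV_real_sqrt_generic) (use neg in auto)
    moreover have "- inverse (sqrt (det A)) / 2 * det A = sqrt (det A) / 2"
    proof -
      have "sqrt (det A) * sqrt (det A) = - det A" using neg by (simp add: real_sqrt_mult_self)
      then show ?thesis using neg by (simp add: field_simps)
    qed
    ultimately show ?thesis by (rule that)
  qed
  have "((\<lambda>X. sqrt (det X)) has_derivative (\<lambda>V. D * (det A * trace (matrix_inv A ** V)))) (at A)"
    by (rule has_derivative_compose[OF det_has_derivative[OF A] D(1)[unfolded has_field_derivative_def]])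
  moreover have "(\<lambda>V. D * (det A * trace (matrix_inv A ** V))) = (\<lambda>V. 1/2 * trace (matrix_inv A ** V) * sqrt (det A))"
    using D(2) by (auto simp: fun_eq_iff mult.assoc[symmetric])
  ultimately show ?thesis by simp
qed

lemma continuous_on_sqrt_det: "continuous_on S (\<lambda>A :: real ^ 'n ^ 'n. sqrt (det A))"
  by (intro continuous_on_real_sqrt continuous_on_det)

section \<open>Nonlinear differential operators given by expressions\<close>

text \<open>Expressions in a metric and further tensor fields, the arguments, at a point of a chart. The
  lists of indices in \<open>Met\<close> and \<open>Arg\<close> denote iterated partial
  derivatives, \<open>Inv\<close> an entry of the inverse metric, \<open>SqrtDet\<close> the
  volume density, and \<open>Arg m\<close> refers to the \<open>m\<close>-th argument.\<close>

datatype 'n expr =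
    Const real
  | Met "'n list" 'n 'n
  | Arg nat "'n list" 'n 'n
  | Inv 'n 'n
  | SqrtDet
  | Add "'n expr" "'n expr"
  | Mul "'n expr" "'n expr"
  | Sum "'n \<Rightarrow> 'n expr"

type_synonym 'n mfield = "real ^ 'n \<Rightarrow> real ^ 'n ^ 'n"

definition dirs :: "'n list \<Rightarrow> (real ^ 'n) list"
  where "dirs = map (\<lambda>i. axis i 1)"

lemma dirs_simps [simp]: "dirs [] = []" "dirs (k # \<alpha>) = axis k 1 # dirs \<alpha>"
  by (auto simp: dirs_def)

lemma dirs_Basis [simp]: "dirs \<alpha> \<in> lists Basis"
  by (auto simp: dirs_def in_lists_conv_set axis_in_Basis_iff)

lemma dirs_surj: "vs \<in> lists Basis \<Longrightarrow> \<exists>\<alpha>. vs = dirs \<alpha>"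
proof (induction vs)
  case (Cons v vs)
  then obtain \<alpha> where "vs = dirs \<alpha>" by auto
  moreover obtain k where "v = axis k 1" using Cons.prems by (auto simp: Basis_vec_def)
  ultimately have "v # vs = dirs (k # \<alpha>)" by simp
  then show ?case by blast
qed (auto intro: exI[of _ "[]"])

primrec eval :: "'n::finite expr \<Rightarrow> 'n mfield list \<Rightarrow> 'n mfield \<Rightarrow> real ^ 'n \<Rightarrow> real" where
  "eval (Const c) hs G x = c"
| "eval (Met \<alpha> i j) hs G x = iter_deriv (dirs \<alpha>) G x $ i $ j"
| "eval (Arg m \<alpha> i j) hs G x = (if m < length hs then iter_deriv (dirs \<alpha>) (hs ! m) x $ i $ j else 0)"
| "eval (Inv i j) hs G x = matrix_inv (G x) $ i $ j"
| "eval SqrtDet hs G x = sqrt (det (G x))"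
| "eval (Add e f) hs G x = eval e hs G x + eval f hs G x"
| "eval (Mul e f) hs G x = eval e hs G x * eval f hs G x"
| "eval (Sum e) hs G x = (\<Sum>a\<in>UNIV. eval (e a) hs G x)"

lemmas eval_abs = eval.simps[abs_def]

text \<open>Partial derivative with respect to the \<open>k\<close>-th coordinate.\<close>

primrec dx :: "'n \<Rightarrow> 'n expr \<Rightarrow> 'n expr" where
  "dx k (Const c) = Const 0"
| "dx k (Met \<alpha> i j) = Met (k # \<alpha>) i j"
| "dx k (Arg m \<alpha> i j) = Arg m (k # \<alpha>) i j"
| "dx k (Inv i j) = Mul (Const (-1)) (Sum (\<lambda>a. Sum (\<lambda>b. Mul (Inv i a) (Mul (Met [k] a b) (Inv b j)))))"
| "dx k SqrtDet = Mul (Mul (Const (1/2)) (Sum (\<lambda>a. Sum (\<lambda>b. Mul (Inv a b) (Met [k] b a))))) SqrtDet"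
| "dx k (Add e f) = Add (dx k e) (dx k f)"
| "dx k (Mul e f) = Add (Mul e (dx k f)) (Mul (dx k e) f)"
| "dx k (Sum e) = Sum (\<lambda>a. dx k (e a))"

primrec shift :: "'n expr \<Rightarrow> 'n expr" where
  "shift (Const c) = Const c"
| "shift (Met \<alpha> i j) = Met \<alpha> i j"
| "shift (Arg m \<alpha> i j) = Arg (Suc m) \<alpha> i j"
| "shift (Inv i j) = Inv i j"
| "shift SqrtDet = SqrtDet"
| "shift (Add e f) = Add (shift e) (shift f)"
| "shift (Mul e f) = Mul (shift e) (shift f)"
| "shift (Sum e) = Sum (\<lambda>a. shift (e a))"

text \<open>Derivative with respect to the metric. The direction becomes argument \<open>0\<close>, so
  the arguments present before are renumbered by \<open>shift\<close>, and iterating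
  \<open>dg\<close> lists the directions with the latest one first.\<close>

primrec dg :: "'n expr \<Rightarrow> 'n expr" where
  "dg (Const c) = Const 0"
| "dg (Met \<alpha> i j) = Arg 0 \<alpha> i j"
| "dg (Arg m \<alpha> i j) = Const 0"
| "dg (Inv i j) = Mul (Const (-1)) (Sum (\<lambda>a. Sum (\<lambda>b. Mul (Inv i a) (Mul (Arg 0 [] a b) (Inv b j)))))"
| "dg SqrtDet = Mul (Mul (Const (1/2)) (Sum (\<lambda>a. Sum (\<lambda>b. Mul (Inv a b) (Arg 0 [] b a))))) SqrtDet"
| "dg (Add e f) = Add (dg e) (dg f)"
| "dg (Mul e f) = Add (Mul (shift e) (dg f)) (Mul (dg e) (shift f))"
| "dg (Sum e) = Sum (\<lambda>a. dg (e a))"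

lemma eval_shift [simp]: "eval (shift e) (h # hs) G x = eval e hs G x"
  by (induction e) auto

text \<open>The condition on the metric is nondegeneracy rather than positivity, because this is what
  makes the derivatives of \<open>Inv\<close> and \<open>SqrtDet\<close> exist.\<close>

definition regular :: "(real ^ 'n) set \<Rightarrow> 'n mfield list \<Rightarrow> 'n::finite mfield \<Rightarrow> bool"
  where "regular S hs G \<longleftrightarrow> open S \<and> smooth_on S G \<and> (\<forall>x\<in>S. det (G x) \<noteq> 0) \<and> (\<forall>h\<in>set hs. smooth_on S h)"

lemma triple_product_entry:
  fixes A B C :: "real ^ 'n ^ 'n"
  shows "(A ** B ** C) $ i $ j = (\<Sum>a\<in>UNIV. \<Sum>b\<in>UNIV. A $ i $ a * (B $ a $ b * C $ b $ j))"
proof -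
  have "(A ** (B ** C)) $ i $ j = (\<Sum>a\<in>UNIV. \<Sum>b\<in>UNIV. A $ i $ a * (B $ a $ b * C $ b $ j))"
    by (simp add: matrix_matrix_mult_def sum_distrib_left)
  then show ?thesis by (simp only: matrix_mul_assoc)
qed

lemma trace_product:
  fixes A B :: "real ^ 'n ^ 'n"
  shows "trace (A ** B) = (\<Sum>a\<in>UNIV. \<Sum>b\<in>UNIV. A $ a $ b * B $ b $ a)"
  by (simp add: trace_def matrix_matrix_mult_def)

text \<open>A derivative is carried through the induction explicitly, because its values on the
  coordinate vectors are read off from those for the subexpressions.\<close>

lemma eval_dx:
  assumes r: "regular S hs G" and x: "x \<in> S"
  shows "\<exists>D. (eval e hs G has_derivative D) (at x) \<and> (\<forall>k. D (axis k 1) = eval (dx k e) hs G x)"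
proof (induction e)
  case (Const c)
  show ?case by (intro exI[of _ "\<lambda>_. 0"]) (simp add: eval_abs)
next
  case (Met \<alpha> i j)
  have "iter_deriv (dirs \<alpha>) G differentiable (at x)"
    using r x smooth_onD[of S G "dirs \<alpha>" x] by (auto simp: regular_def)
  then have "((\<lambda>x. iter_deriv (dirs \<alpha>) G x $ i $ j) has_derivative
      (\<lambda>u. frechet_derivative (iter_deriv (dirs \<alpha>) G) (at x) u $ i $ j)) (at x)"
    by (intro has_derivative_entry) (simp add: frechet_derivative_works)
  then show ?case
    by (intro exI[of _ "\<lambda>u. frechet_derivative (iter_deriv (dirs \<alpha>) G) (at x) u $ i $ j"]) (simp add: eval_abs)
next
  case (Arg m \<alpha> i j)
  show ?case
  proof (cases "m < length hs")
    case True
    then have "iter_deriv (dirs \<alpha>) (hs ! m) differentiable (at x)"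
      using r x smooth_onD[of S "hs ! m" "dirs \<alpha>" x] by (auto simp: regular_def)
    then have "((\<lambda>x. iter_deriv (dirs \<alpha>) (hs ! m) x $ i $ j) has_derivative
        (\<lambda>u. frechet_derivative (iter_deriv (dirs \<alpha>) (hs ! m)) (at x) u $ i $ j)) (at x)"
      by (intro has_derivative_entry) (simp add: frechet_derivative_works)
    with True show ?thesis
      by (intro exI[of _ "\<lambda>u. frechet_derivative (iter_deriv (dirs \<alpha>) (hs ! m)) (at x) u $ i $ j"])
         (simp add: eval_abs)
  next
    case False
    then show ?thesis by (intro exI[of _ "\<lambda>_. 0"]) (simp add: eval_abs)
  qed
next
  case (Inv i j)
  have d: "det (G x) \<noteq> 0" and "G differentiable (at x)"
    using r x smooth_onD[of S G "[]" x] by (auto simp: regular_def)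
  then have "(G has_derivative frechet_derivative G (at x)) (at x)" by (simp add: frechet_derivative_works)
  from has_derivative_entry[OF has_derivative_compose[OF this matrix_inv_has_derivative[OF d]], of i j]
  show ?case
    by (intro exI[of _ "\<lambda>u. (- (matrix_inv (G x) ** frechet_derivative G (at x) u ** matrix_inv (G x))) $ i $ j"])
       (simp add: eval_abs triple_product_entry)
next
  case SqrtDet
  have d: "det (G x) \<noteq> 0" and "G differentiable (at x)"
    using r x smooth_onD[of S G "[]" x] by (auto simp: regular_def)
  then have "(G has_derivative frechet_derivative G (at x)) (at x)" by (simp add: frechet_derivative_works)
  from has_derivative_compose[OF this sqrt_det_has_derivative[OF d]]
  show ?case
    by (intro exI[of _ "\<lambda>u. 1/2 * trace (matrix_inv (G x) ** frechet_derivative G (at x) u) * sqrt (det (G x))"])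
       (simp add: eval_abs trace_product)
next
  case (Add e f)
  then obtain D E where *: "(eval e hs G has_derivative D) (at x)" "(eval f hs G has_derivative E) (at x)"
    "\<forall>k. D (axis k 1) = eval (dx k e) hs G x" "\<forall>k. E (axis k 1) = eval (dx k f) hs G x" by blast
  show ?case
    by (rule exI[of _ "\<lambda>u. D u + E u"]) (use * has_derivative_add[OF *(1,2)] in \<open>simp add: eval_abs\<close>)
next
  case (Mul e f)
  then obtain D E where *: "(eval e hs G has_derivative D) (at x)" "(eval f hs G has_derivative E) (at x)"
    "\<forall>k. D (axis k 1) = eval (dx k e) hs G x" "\<forall>k. E (axis k 1) = eval (dx k f) hs G x" by blast
  show ?case
    by (rule exI[of _ "\<lambda>u. eval e hs G x * E u + D u * eval f hs G x"])
       (use * has_derivative_mult[OF *(1,2)] in \<open>simp add: eval_abs\<close>)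
next
  case (Sum e)
  then have "\<forall>a. \<exists>D. (eval (e a) hs G has_derivative D) (at x) \<and> (\<forall>k. D (axis k 1) = eval (dx k (e a)) hs G x)"
    by simp
  then obtain D where *: "\<And>a. (eval (e a) hs G has_derivative D a) (at x)"
    "\<And>a k. D a (axis k 1) = eval (dx k (e a)) hs G x" by metis
  have "((\<lambda>x. \<Sum>a\<in>UNIV. eval (e a) hs G x) has_derivative (\<lambda>u. \<Sum>a\<in>UNIV. D a u)) (at x)"
    using *(1) by (intro has_derivative_sum)
  with *(2) show ?case
    by (intro exI[of _ "\<lambda>u. \<Sum>a\<in>UNIV. D a u"]) (simp add: eval_abs)
qed

lemma eval_differentiable: "regular S hs G \<Longrightarrow> x \<in> S \<Longrightarrow> eval e hs G differentiable (at x)"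
  using eval_dx differentiable_def by blast

lemma frechet_derivative_eval:
  assumes "regular S hs G" "x \<in> S"
  shows "frechet_derivative (eval e hs G) (at x) (axis k 1) = eval (dx k e) hs G x"
  using eval_dx[OF assms, of e] frechet_derivative_at by metis

lemma iter_deriv_eval:
  assumes r: "regular S hs G" and "x \<in> S"
  shows "iter_deriv (dirs \<alpha>) (eval e hs G) x = eval (foldr dx \<alpha> e) hs G x"
  using assms(2)
proof (induction \<alpha> arbitrary: x)
  case (Cons k \<alpha>)
  have "(eval (foldr dx \<alpha> e) hs G has_derivative frechet_derivative (eval (foldr dx \<alpha> e) hs G) (at x)) (at x)"
    using eval_differentiable[OF r Cons.prems] by (simp add: frechet_derivative_works)
  then have "(iter_deriv (dirs \<alpha>) (eval e hs G) has_derivative frechet_derivative (eval (foldr dx \<alpha> e) hs G) (at x)) (at x)"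
    by (rule has_derivative_transform_within_open[where s = S]) (use r Cons in \<open>auto simp: regular_def\<close>)
  from fun_cong[OF frechet_derivative_at[OF this], of "axis k 1"] show ?case
    by (simp add: frechet_derivative_eval[OF r Cons.prems])
qed simp

text \<open>Coinduction with the class of all expressions, which is closed under \<open>dx\<close>.\<close>

lemma smooth_on_eval:
  assumes r: "regular S hs G"
  shows "smooth_on S (eval e hs G)"
proof (rule smooth_on_coinduct[where C = "\<lambda>f. \<exists>e. f = eval e hs G"])
  show "open S" using r by (simp add: regular_def)
next
  fix f x assume "\<exists>e. f = eval e hs G" "x \<in> S"
  then show "f differentiable (at x)" using eval_differentiable[OF r] by auto
next
  fix f :: "real ^ 'a \<Rightarrow> real" and b :: "real ^ 'a" assume "\<exists>e. f = eval e hs G" "b \<in> Basis"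
  then obtain e k where e: "f = eval e hs G" "b = axis k 1" by (auto simp: Basis_vec_def)
  have "\<forall>x\<in>S. frechet_derivative f (at x) b = eval (dx k e) hs G x"
    unfolding e using frechet_derivative_eval[OF r] by blast
  then show "\<exists>g. (\<exists>e. g = eval e hs G) \<and> (\<forall>x\<in>S. frechet_derivative f (at x) b = g x)" by blast
qed blast

lemma iter_deriv_add_scaleR:
  assumes S: "open S" "smooth_on S G" "smooth_on S v" "x \<in> S" and vs: "vs \<in> lists Basis"
  shows "iter_deriv vs (\<lambda>y. G y + t *\<^sub>R v y) x = iter_deriv vs G x + t *\<^sub>R iter_deriv vs v x"
  using iter_deriv_add[OF S(1,2) smooth_on_compose_bounded_linear[OF bounded_linear_scaleR_right S(1,3), of t] vs S(4)]
    iter_deriv_bounded_linear[OF bounded_linear_scaleR_right S(1,3) vs S(4), of t] by simp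

lemma smooth_on_add_scaleR:
  assumes S: "open S" "smooth_on S G" "smooth_on S v"
  shows "smooth_on S (\<lambda>y. G y + t *\<^sub>R v y)"
  by (intro smooth_on_add smooth_on_compose_bounded_linear[OF bounded_linear_scaleR_right] S)

text \<open>At a fixed point \<open>x\<close> only finitely many numbers attached to the metric vary
  with \<open>t\<close>, and those coming from derivatives of the metric do so affinely. It
  thus amounts to the derivatives of inverse and determinant.\<close>

lemma eval_dg:
  assumes r: "regular S (v # hs) G" and x: "x \<in> S"
  shows "((\<lambda>t. eval e hs (\<lambda>y. G y + t *\<^sub>R v y) x) has_real_derivative eval (dg e) (v # hs) G x) (at 0)"
proof (induction e)
  case (Const c)
  show ?case by simp
next
  case (Met \<alpha> i j)
  have "iter_deriv (dirs \<alpha>) (\<lambda>y. G y + t *\<^sub>R v y) x = iter_deriv (dirs \<alpha>) G x + t *\<^sub>R iter_deriv (dirs \<alpha>) v x" for t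
    using r x by (intro iter_deriv_add_scaleR[of S]) (auto simp: regular_def)
  then show ?case by (auto intro!: derivative_eq_intros)
next
  case (Arg m \<alpha> i j)
  show ?case by simp
next
  case (Inv i j)
  have d: "det (G x + 0 *\<^sub>R v x) \<noteq> 0" using r x by (auto simp: regular_def)
  have "((\<lambda>t. G x + t *\<^sub>R v x) has_derivative (\<lambda>t. t *\<^sub>R v x)) (at 0)"
    by (auto intro!: derivative_eq_intros)
  from has_derivative_entry[OF has_derivative_compose[OF this matrix_inv_has_derivative[OF d]], of i j]
  show ?case unfolding has_field_derivative_def eval.simps
    by (rule has_derivative_eq_rhs) (simp add: triple_product_entry fun_eq_iff sum_distrib_left sum_distrib_right sum_negf mult_ac)
next
  case SqrtDet
  have d: "det (G x + 0 *\<^sub>R v x) \<noteq> 0" using r x by (auto simp: regular_def)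
  have "((\<lambda>t. G x + t *\<^sub>R v x) has_derivative (\<lambda>t. t *\<^sub>R v x)) (at 0)"
    by (auto intro!: derivative_eq_intros)
  from has_derivative_compose[OF this sqrt_det_has_derivative[OF d]]
  show ?case unfolding has_field_derivative_def eval.simps
    by (rule has_derivative_eq_rhs) (simp add: trace_product fun_eq_iff sum_distrib_left sum_distrib_right mult_ac)
next
  case (Add e f)
  then show ?case by (auto intro!: derivative_eq_intros)
next
  case (Mul e f)
  from DERIV_mult[OF this] show ?case by (simp add: algebra_simps)
next
  case (Sum e)
  then show ?case by (auto intro!: derivative_eq_intros)
qed

text \<open>Values near the compact set \<open>g ` K\<close> stay in a compact set, on which
  \<open>\<phi>\<close> is uniformly continuous. This is applied to the inverse and the
  determinant of a matrix.\<close>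

lemma uniform_limit_compose_continuous:
  fixes f :: "'i \<Rightarrow> 'x \<Rightarrow> 'b::euclidean_space" and \<phi> :: "'b \<Rightarrow> 'c::metric_space"
  assumes lim: "uniform_limit K f g F" and K: "compact (g ` K)" "g ` K \<subseteq> U" "open U" and \<phi>: "continuous_on U \<phi>"
  shows "uniform_limit K (\<lambda>i x. \<phi> (f i x)) (\<lambda>x. \<phi> (g x)) F"
proof -
  obtain e where e: "e > 0" "(\<Union>x\<in>g ` K. cball x e) \<subseteq> U"
    using compact_subset_open_imp_cball_epsilon_subset[OF K(1,3,2)] by blast
  let ?V = "\<Union>x\<in>g ` K. cball x e"
  have V: "compact ?V" by (rule compact_minkowski_sum_cball[OF K(1)])
  show ?thesis
  proof (rule uniform_limit_compose_uniformly_continuous_on[OF lim])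
    show "uniformly_continuous_on ?V \<phi>"
      by (rule compact_uniformly_continuous[OF continuous_on_subset[OF \<phi> e(2)] V])
    show "\<forall>\<^sub>F i in F. \<forall>x\<in>K. f i x \<in> ?V"
      using uniform_limitD[OF lim e(1)]
      by eventually_elim (auto simp: dist_commute less_imp_le intro!: bexI)
    show "closed ?V" by (rule compact_imp_closed[OF V])
  qed
qed

lemma regular_continuous_on:
  assumes "regular S hs G" "K \<subseteq> S"
  shows "continuous_on K (iter_deriv (dirs \<alpha>) G)" "continuous_on K (eval e hs G)"
proof -
  have "smooth_on S G" using assms by (simp add: regular_def)
  from continuous_on_subset[OF smooth_on_iter_deriv_continuous[OF this dirs_Basis] assms(2)]
  show "continuous_on K (iter_deriv (dirs \<alpha>) G)" .
  show "continuous_on K (eval e hs G)"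
    by (rule continuous_on_subset[OF smooth_on_continuous[OF smooth_on_eval[OF assms(1)]] assms(2)])
qed

text \<open>This gives both the continuity of the derivatives of a differential operator and, by the
  mean value theorem, their existence in the topology of uniform convergence on compact sets.\<close>

lemma uniform_limit_eval:
  assumes r: "regular S hs G" and K: "compact K" "K \<subseteq> S"
    and G: "\<And>\<alpha>. uniform_limit K (\<lambda>i. iter_deriv (dirs \<alpha>) (Gs i)) (iter_deriv (dirs \<alpha>) G) F"
    and len: "\<And>i. length (Hs i) = length hs"
    and H: "\<And>m \<alpha>. m < length hs \<Longrightarrow> uniform_limit K (\<lambda>i. iter_deriv (dirs \<alpha>) (Hs i ! m)) (iter_deriv (dirs \<alpha>) (hs ! m)) F"
  shows "uniform_limit K (\<lambda>i. eval e (Hs i) (Gs i)) (eval e hs G) F"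
proof (induction e)
  case (Const c)
  show ?case by (simp add: uniform_limit_const[where c = "\<lambda>_. c"])
next
  case (Met \<alpha> i j)
  show ?case unfolding eval_abs by (rule bounded_linear.uniform_limit[OF bounded_linear_entry G])
next
  case (Arg m \<alpha> i j)
  show ?case
    using bounded_linear.uniform_limit[OF bounded_linear_entry H, of m \<alpha> i j]
    by (cases "m < length hs") (simp_all add: len eval_abs uniform_limit_const[where c = "\<lambda>_. 0"])
next
  case (Inv i j)
  have "continuous_on K G" using regular_continuous_on(1)[OF r K(2), of "[]"] by simp
  then have "compact (G ` K)" using K(1) compact_continuous_image by blast
  moreover have "G ` K \<subseteq> {A. det A \<noteq> 0}" using r K(2) by (auto simp: regular_def)
  ultimately show ?case
    unfolding eval_abs
    by (rule uniform_limit_compose_continuous[OF G[of "[]", simplified] _ _ open_det_nonzero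
          bounded_linear.continuous_on[OF bounded_linear_entry continuous_on_matrix_inv]])
next
  case SqrtDet
  have "continuous_on K G" using regular_continuous_on(1)[OF r K(2), of "[]"] by simp
  then have "compact (G ` K)" using K(1) compact_continuous_image by blast
  then show ?case
    using uniform_limit_compose_continuous[OF G[of "[]", simplified] _ _ open_UNIV continuous_on_sqrt_det] by simp
next
  case (Add e f)
  from uniform_limit_add[OF this] show ?case by simp
next
  case (Mul e f)
  have "bounded (eval e' hs G ` K)" for e'
    using regular_continuous_on(2)[OF r K(2)] K(1) compact_continuous_image compact_imp_bounded by blast
  from uniform_lim_mult[OF Mul this this] show ?case by simp
next
  case (Sum e)
  have "uniform_limit K (\<lambda>i x. \<Sum>a\<in>A. eval (e a) (Hs i) (Gs i) x) (\<lambda>x. \<Sum>a\<in>A. eval (e a) hs G x) F"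
    if "finite A" for A
    using that
  proof induction
    case empty
    show ?case by (simp add: uniform_limit_const[where c = "\<lambda>_. 0"])
  next
    case (insert a A)
    have "uniform_limit K (\<lambda>i. eval (e a) (Hs i) (Gs i)) (eval (e a) hs G) F" using Sum by simp
    from uniform_limit_add[OF this insert(3)] show ?case using insert by simp
  qed
  from this[of UNIV] show ?case by simp
qed

section \<open>The Ricci tensor in coordinates\<close>

definition pd :: "'n::finite \<Rightarrow> (real ^ 'n \<Rightarrow> 'b::real_normed_vector) \<Rightarrow> real ^ 'n \<Rightarrow> 'b"
  where "pd k f x = frechet_derivative f (at x) (axis k 1)"

lemma pd_eqI: "(f has_derivative D) (at x) \<Longrightarrow> pd k f x = D (axis k 1)"
  unfolding pd_def using frechet_derivative_at[of f D x] by simp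

lemmas has_frechet_derivative = frechet_derivative_works[THEN iffD1]

lemma pd_has_derivative:
  fixes f :: "real ^ 'n::finite \<Rightarrow> 'b::real_normed_vector"
  assumes "f differentiable (at x)"
  shows "(f has_derivative (\<lambda>u. \<Sum>k\<in>UNIV. u $ k *\<^sub>R pd k f x)) (at x)"
proof -
  have lin: "linear (frechet_derivative f (at x))" by (rule linear_frechet_derivative[OF assms])
  have "frechet_derivative f (at x) u = (\<Sum>k\<in>UNIV. u $ k *\<^sub>R pd k f x)" for u
  proof -
    have "frechet_derivative f (at x) u = frechet_derivative f (at x) (\<Sum>k\<in>UNIV. u $ k *\<^sub>R axis k 1)"
      by (simp only: basis_expansion[of u, unfolded scalar_mult_eq_scaleR])
    then show ?thesis by (simp add: linear_sum[OF lin] linear_cmul[OF lin] pd_def)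
  qed
  then have "frechet_derivative f (at x) = (\<lambda>u. \<Sum>k\<in>UNIV. u $ k *\<^sub>R pd k f x)" by (rule ext)
  then show ?thesis using assms by (simp add: frechet_derivative_works)
qed

lemma pd_cong:
  assumes "open S" "x \<in> S" "\<And>y. y \<in> S \<Longrightarrow> f y = g y"
  shows "pd k f x = pd k g x"
  using iter_deriv_cong[OF assms(1,3,2), where vs = "[axis k 1]"] by (simp add: pd_def)

lemma pd_add: "f differentiable (at x) \<Longrightarrow> g differentiable (at x) \<Longrightarrow> pd k (\<lambda>x. f x + g x) x = pd k f x + pd k g x"
  by (rule pd_eqI[OF has_derivative_add[OF has_frechet_derivative has_frechet_derivative], folded pd_def])

lemma pd_matrix_mult:
  fixes f :: "real ^ 'k::finite \<Rightarrow> real ^ 'n ^ 'm" and g :: "real ^ 'k \<Rightarrow> real ^ 'l ^ 'n"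
  shows "f differentiable (at x) \<Longrightarrow> g differentiable (at x) \<Longrightarrow>
    pd k (\<lambda>x. f x ** g x) x = f x ** pd k g x + pd k f x ** g x"
  by (rule pd_eqI[OF has_derivative_matrix_mult[OF has_frechet_derivative has_frechet_derivative], folded pd_def])

lemma differentiable_matrix_mult:
  fixes f :: "real ^ 'k::finite \<Rightarrow> real ^ 'n ^ 'm" and g :: "real ^ 'k \<Rightarrow> real ^ 'l ^ 'n"
  shows "f differentiable (at x) \<Longrightarrow> g differentiable (at x) \<Longrightarrow> (\<lambda>x. f x ** g x) differentiable (at x)"
  by (rule differentiableI[OF has_derivative_matrix_mult[OF has_frechet_derivative has_frechet_derivative]])

lemma pd_entry:
  fixes f :: "real ^ 'k::finite \<Rightarrow> real ^ 'n ^ 'm"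
  shows "f differentiable (at x) \<Longrightarrow> pd k (\<lambda>x. f x $ i $ j) x = pd k f x $ i $ j"
  by (rule pd_eqI[OF has_derivative_entry[OF has_frechet_derivative], folded pd_def])

lemma has_derivative_vec_lambda:
  fixes f :: "'i::finite \<Rightarrow> 'e::euclidean_space \<Rightarrow> 'b::euclidean_space"
  assumes "\<And>i. (f i has_derivative D i) (at x)"
  shows "((\<lambda>x. \<chi> i. f i x) has_derivative (\<lambda>u. \<chi> i. D i u)) (at x)"
proof (rule iffD2[OF has_derivative_componentwise_within], rule ballI)
  fix b :: "'b ^ 'i" assume "b \<in> Basis"
  then obtain i u where b: "b = axis i u" by (auto simp: Basis_vec_def)
  have "((\<lambda>x. f i x \<bullet> u) has_derivative (\<lambda>h. D i h \<bullet> u)) (at x)"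
    by (rule has_derivative_inner_left[OF assms])
  then show "((\<lambda>x. (\<chi> i. f i x) \<bullet> b) has_derivative (\<lambda>u. (\<chi> i. D i u) \<bullet> b)) (at x)"
    by (simp add: b inner_axis)
qed

lemma smooth_on_matrix_entries:
  fixes f :: "'e::euclidean_space \<Rightarrow> real ^ 'n ^ 'm"
  assumes "open S" "\<And>i j. smooth_on S (\<lambda>x. f x $ i $ j)"
  shows "smooth_on S f"
proof (rule iffD2[OF smooth_on_componentwise[OF assms(1)]], rule ballI)
  fix b :: "real ^ 'n ^ 'm" assume "b \<in> Basis"
  then obtain p q where "b = axis p (axis q 1)" by (rule matrix_Basis_cases)
  then show "smooth_on S (\<lambda>x. f x \<bullet> b)" using assms(2)[of p q] by (simp add: inner_axis)
qed

subsection \<open>Christoffel symbols and curvature as expressions\<close>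

definition GamE :: "'n \<Rightarrow> 'n \<Rightarrow> 'n \<Rightarrow> 'n expr"
  where "GamE k i j = Mul (Const (1/2)) (Sum (\<lambda>l. Mul (Inv k l)
    (Add (Add (Met [i] j l) (Met [j] i l)) (Mul (Const (-1)) (Met [l] i j)))))"

definition RicE :: "'n \<Rightarrow> 'n \<Rightarrow> 'n expr"
  where "RicE i j = Sum (\<lambda>k. Add (Add (dx k (GamE k i j)) (Mul (Const (-1)) (dx i (GamE k k j))))
    (Sum (\<lambda>a. Add (Mul (GamE k k a) (GamE a i j)) (Mul (Const (-1)) (Mul (GamE k i a) (GamE a k j))))))"

text \<open>The connection is encoded by the matrices \<open>\<omega>\<^sub>i\<close> with
  \<open>\<nabla>\<^sub>i Y = \<partial>\<^sub>i Y + \<omega>\<^sub>i Y\<close>, and its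
  curvature by \<open>\<partial>\<^sub>i \<omega>\<^sub>j - \<partial>\<^sub>j
  \<omega>\<^sub>i + [\<omega>\<^sub>i, \<omega>\<^sub>j]\<close>; in this form the behaviour
  under a change of coordinates is a gauge transformation.\<close>

definition conn :: "'n::finite mfield \<Rightarrow> 'n \<Rightarrow> 'n mfield"
  where "conn G i x = (\<chi> k j. christoffel G x k i j)"

definition curv :: "'n::finite mfield \<Rightarrow> 'n \<Rightarrow> 'n \<Rightarrow> 'n mfield"
  where "curv G i j x = pd i (conn G j) x - pd j (conn G i) x + conn G i x ** conn G j x - conn G j x ** conn G i x"

lemma regular_differentiable: "regular S hs G \<Longrightarrow> x \<in> S \<Longrightarrow> G differentiable (at x)"
  by (auto simp: regular_def smooth_on_differentiable)

lemma christoffel_eq_eval: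
  assumes "regular S [] G" "x \<in> S"
  shows "christoffel G x k i j = eval (GamE k i j) [] G x"
proof -
  have "partial_deriv i (\<lambda>y. G y $ j $ l) x = pd i G x $ j $ l" for i j l
    using pd_entry[OF regular_differentiable[OF assms]] by (simp add: partial_deriv_def pd_def)
  then show ?thesis by (simp add: christoffel_def GamE_def pd_def)
qed

lemma conn_entry_has_derivative:
  assumes r: "regular S [] G" and x: "x \<in> S"
  shows "\<exists>D. ((\<lambda>x. christoffel G x k i j) has_derivative D) (at x) \<and> (\<forall>l. D (axis l 1) = eval (dx l (GamE k i j)) [] G x)"
proof -
  have S: "open S" using r by (simp add: regular_def)
  obtain D where D: "(eval (GamE k i j) [] G has_derivative D) (at x)" "\<forall>l. D (axis l 1) = eval (dx l (GamE k i j)) [] G x"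
    using eval_dx[OF r x] by blast
  have "((\<lambda>x. christoffel G x k i j) has_derivative D) (at x)"
    by (rule has_derivative_transform_within_open[OF D(1) S x]) (simp add: christoffel_eq_eval[OF r])
  with D show ?thesis by blast
qed

lemma christoffel_differentiable:
  assumes "regular S [] G" "x \<in> S"
  shows "(\<lambda>x. christoffel G x k i j) differentiable (at x)"
    "pd l (\<lambda>x. christoffel G x k i j) x = eval (dx l (GamE k i j)) [] G x"
proof -
  obtain D where D: "((\<lambda>x. christoffel G x k i j) has_derivative D) (at x)"
    "\<forall>l. D (axis l 1) = eval (dx l (GamE k i j)) [] G x"
    using conn_entry_has_derivative[OF assms] by blast
  show "(\<lambda>x. christoffel G x k i j) differentiable (at x)" by (rule differentiableI[OF D(1)])
  show "pd l (\<lambda>x. christoffel G x k i j) x = eval (dx l (GamE k i j)) [] G x"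
    using pd_eqI[OF D(1), of l] D(2) by simp
qed

lemma conn_differentiable:
  assumes r: "regular S [] G" and x: "x \<in> S"
  shows "conn G i differentiable (at x)"
    and "pd l (conn G i) x $ k $ j = pd l (\<lambda>x. christoffel G x k i j) x"
proof -
  have "((\<lambda>x. \<chi> k j. christoffel G x k i j) has_derivative
    (\<lambda>u. \<chi> k j. frechet_derivative (\<lambda>x. christoffel G x k i j) (at x) u)) (at x)"
    using christoffel_differentiable(1)[OF assms]
    by (intro has_derivative_vec_lambda) (simp add: frechet_derivative_works)
  then have d: "(conn G i has_derivative
    (\<lambda>u. \<chi> k j. frechet_derivative (\<lambda>x. christoffel G x k i j) (at x) u)) (at x)"
    by (simp add: conn_def[abs_def])
  then show "conn G i differentiable (at x)" by (auto simp: differentiable_def)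
  show "pd l (conn G i) x $ k $ j = pd l (\<lambda>x. christoffel G x k i j) x"
    using pd_eqI[OF d, of l] by (simp add: pd_def)
qed

lemma cov_deriv_axis:
  "cov_deriv G (\<lambda>_. axis i 1) Y x = frechet_derivative Y (at x) (axis i 1) +
    (\<chi> k. \<Sum>b\<in>UNIV. christoffel G x k i b * Y x $ b)"
proof -
  have "(\<Sum>i'\<in>UNIV. \<Sum>j\<in>UNIV. christoffel G x k i' j * axis i 1 $ i' * Y x $ j)
    = (\<Sum>i'\<in>UNIV. if i' = i then \<Sum>j\<in>UNIV. christoffel G x k i j * Y x $ j else 0)" for k
    by (intro sum.cong) (auto simp: axis_def)
  then show ?thesis by (simp add: cov_deriv_def)
qed

lemma curvature_eq_curv:
  assumes r: "regular S [] G" and x: "x \<in> S"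
  shows "curvature G (\<lambda>_. axis i 1) (\<lambda>_. axis j 1) (\<lambda>_. axis l 1) x $ k = curv G i j x $ k $ l"
proof -
  have c: "cov_deriv G (\<lambda>_. axis j 1) (\<lambda>_. axis l 1) = (\<lambda>y. \<chi> k. christoffel G y k j l)" for j
  proof
    fix y
    have "(\<Sum>b\<in>UNIV. christoffel G y k j b * axis l 1 $ b) = (\<Sum>b\<in>UNIV. if b = l then christoffel G y k j l else 0)" for k
      by (intro sum.cong) (auto simp: axis_def)
    then show "cov_deriv G (\<lambda>_. axis j 1) (\<lambda>_. axis l 1) y = (\<chi> k. christoffel G y k j l)"
      by (simp add: cov_deriv_axis)
  qed
  have d: "frechet_derivative (\<lambda>y. \<chi> k. christoffel G y k j l) (at x) (axis i 1) $ k = pd i (conn G j) x $ k $ l" for i j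
  proof -
    have "((\<lambda>x. \<chi> k. christoffel G x k j l) has_derivative
      (\<lambda>u. \<chi> k. frechet_derivative (\<lambda>x. christoffel G x k j l) (at x) u)) (at x)"
      using christoffel_differentiable(1)[OF r x]
      by (intro has_derivative_vec_lambda) (simp add: frechet_derivative_works)
    from pd_eqI[OF this, of i] show ?thesis
      by (simp add: conn_differentiable(2)[OF r x]) (simp add: pd_def)
  qed
  have b: "cov_deriv G (lie_bracket (\<lambda>_. axis i 1) (\<lambda>_. axis j 1)) (\<lambda>_. axis l 1) x $ k = 0"
    by (simp add: cov_deriv_def lie_bracket_def)
  show ?thesis
    unfolding curvature_def c vector_minus_component b
    unfolding cov_deriv_axis curv_def
    by (simp add: d) (simp add: conn_def matrix_matrix_mult_def)
qed

lemma ricci_matrix_eq_curv: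
  assumes r: "regular S [] G" and x: "x \<in> S"
  shows "ricci_matrix G x $ i $ j = (\<Sum>k\<in>UNIV. curv G k i x $ k $ j)"
  by (simp add: ricci_matrix_def trace_def curvature_eq_curv[OF assms])

lemma curv_entry:
  assumes r: "regular S [] G" and x: "x \<in> S"
  shows "curv G i j x $ k $ l = pd i (\<lambda>x. christoffel G x k j l) x - pd j (\<lambda>x. christoffel G x k i l) x
    + (\<Sum>a\<in>UNIV. christoffel G x k i a * christoffel G x a j l - christoffel G x k j a * christoffel G x a i l)"
  by (simp add: curv_def conn_differentiable(2)[OF assms] sum_subtractf) (simp add: conn_def matrix_matrix_mult_def)

lemma ricci_matrix_eq_eval:
  assumes r: "regular S [] G" and x: "x \<in> S"
  shows "ricci_matrix G x $ i $ j = eval (RicE i j) [] G x"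
  by (simp add: ricci_matrix_eq_curv[OF assms] curv_entry[OF assms] RicE_def
      christoffel_differentiable(2)[OF assms] christoffel_eq_eval[OF assms])

subsection \<open>Characterization of the Levi-Civita connection\<close>

lemma transpose_entry: "transpose A $ i $ j = A $ j $ i"
  by (simp add: transpose_def)

lemma christoffel_sym:
  assumes r: "regular S [] G" and x: "x \<in> S" and sym: "\<And>y. y \<in> S \<Longrightarrow> transpose (G y) = G y"
  shows "christoffel G x k i j = christoffel G x k j i"
proof -
  have S: "open S" using r by (simp add: regular_def)
  have s: "G y $ i $ j = G y $ j $ i" if "y \<in> S" for y i j
    using transpose_entry[of "G y" i j] sym[OF that] by simp
  have "pd l (\<lambda>x. G x $ i $ j) x = pd l (\<lambda>x. G x $ j $ i) x" for l i j
    by (rule pd_cong[OF S x]) (rule s)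
  then show ?thesis
    unfolding christoffel_def partial_deriv_def pd_def[symmetric] by (simp add: add.commute)
qed

lemma pd_metric_sym:
  assumes r: "regular S [] G" and x: "x \<in> S" and sym: "\<And>y. y \<in> S \<Longrightarrow> transpose (G y) = G y"
  shows "pd l G x $ i $ j = pd l G x $ j $ i"
proof -
  have S: "open S" using r by (simp add: regular_def)
  have "G y $ i $ j = G y $ j $ i" if "y \<in> S" for y i j
    using transpose_entry[of "G y" i j] sym[OF that] by simp
  then have "pd l (\<lambda>x. G x $ i $ j) x = pd l (\<lambda>x. G x $ j $ i) x" for l i j
    by (intro pd_cong[OF S x])
  then show ?thesis using regular_differentiable[OF r x] by (simp add: pd_entry)
qed

text \<open>\<open>\<nabla> g = 0\<close>, in matrix form.\<close>

lemma conn_compatible: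
  assumes r: "regular S [] G" and x: "x \<in> S" and sym: "\<And>y. y \<in> S \<Longrightarrow> transpose (G y) = G y"
  shows "transpose (conn G i x) ** G x + G x ** conn G i x = pd i G x"
proof -
  let ?D = "\<lambda>i j l. pd i G x $ j $ l"
  define C where "C = (\<chi> m j. 1/2 * (?D i j m + ?D j i m - ?D m i j))"
  have "conn G i x = matrix_inv (G x) ** C"
    by (simp add: vec_eq_iff conn_def C_def christoffel_eq_eval[OF r x] GamE_def pd_def
        matrix_matrix_mult_def sum_distrib_left algebra_simps)
  moreover have "det (G x) \<noteq> 0" using r x by (simp add: regular_def)
  ultimately have GC: "G x ** conn G i x = C"
    by (simp add: matrix_mul_assoc matrix_inv_right)
  have "transpose (conn G i x) ** G x = transpose (G x ** conn G i x)"
    by (simp add: matrix_transpose_mul sym[OF x])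
  then have "transpose (conn G i x) ** G x + G x ** conn G i x = transpose C + C" by (simp add: GC)
  also have "\<dots> = pd i G x"
  proof -
    have "(transpose C + C) $ a $ b = pd i G x $ a $ b" for a b
      using pd_metric_sym[OF r x sym, of i a b] by (simp add: transpose_def C_def field_simps)
    then show ?thesis by (simp add: vec_eq_iff)
  qed
  finally show ?thesis .
qed

text \<open>The difference of two torsion-free metric connections, with all indices lowered, is
  symmetric in one pair of indices and skew in another one. Such an array vanishes:
  alternating the two symmetries leads back to the same entry with the opposite sign.\<close>

lemma connection_unique:
  fixes G :: "real ^ 'n ^ 'n" and w w' :: "'n \<Rightarrow> real ^ 'n ^ 'n"
  assumes G: "transpose G = G" "det G \<noteq> 0"
    and compat: "\<And>i. transpose (w i) ** G + G ** w i = transpose (w' i) ** G + G ** w' i"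
    and torsion: "\<And>i j k. w i $ k $ j = w j $ k $ i" "\<And>i j k. w' i $ k $ j = w' j $ k $ i"
  shows "w i = w' i"
proof -
  define A where "A i = G ** w i - G ** w' i" for i
  have tr: "transpose (w i) ** G = transpose (G ** w i)" for w :: "'n \<Rightarrow> real ^ 'n ^ 'n" and i
    by (simp add: matrix_transpose_mul G)
  have skew: "A i $ l $ j = - A i $ j $ l" for i l j
  proof -
    have "(transpose (G ** w i) + G ** w i) $ l $ j = (transpose (G ** w' i) + G ** w' i) $ l $ j"
      using compat[of i] by (simp add: tr)
    then show ?thesis by (simp add: A_def transpose_def)
  qed
  have sym: "A i $ l $ j = A j $ l $ i" for i l j
    unfolding A_def using torsion by (simp add: matrix_matrix_mult_def)
  have "A i $ l $ j = 0" for l j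
  proof -
    have "A i $ l $ j = - A i $ j $ l" by (rule skew)
    also have "\<dots> = - A l $ j $ i" by (simp add: sym[of i j l])
    also have "\<dots> = A l $ i $ j" by (simp add: skew[of l j i])
    also have "\<dots> = A j $ i $ l" by (rule sym)
    also have "\<dots> = - A j $ l $ i" by (rule skew)
    also have "\<dots> = - A i $ l $ j" by (simp add: sym[of j l i])
    finally show ?thesis by simp
  qed
  then have "G ** w i = G ** w' i" by (simp add: A_def vec_eq_iff)
  then have "matrix_inv G ** (G ** w i) = matrix_inv G ** (G ** w' i)" by simp
  then show ?thesis by (simp add: matrix_mul_assoc matrix_inv_left[OF G(2)])
qed

subsection \<open>Symmetry of the Ricci tensor\<close>

text \<open>\<open>\<Gamma>\<^sup>k\<^sub>j\<^sub>k = \<partial>\<^sub>j log sqrt(det g)\<close>,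
  written without a logarithm. The determinant is not assumed to be positive, but
  \<open>sqrt\<close> is odd and hence differentiable at all nonzero reals.\<close>

lemma trace_conn_sqrt_det:
  assumes r: "regular S [] G" and x: "x \<in> S" and sym: "\<And>y. y \<in> S \<Longrightarrow> transpose (G y) = G y"
  shows "pd j (\<lambda>x. sqrt (det (G x))) x = trace (conn G j x) * sqrt (det (G x))"
proof -
  have "det (G x) \<noteq> 0" using r x by (simp add: regular_def)
  have "trace (matrix_inv (G x) ** pd j G x) = trace (matrix_inv (G x) ** (transpose (conn G j x) ** G x)) + trace (matrix_inv (G x) ** (G x ** conn G j x))"
    using conn_compatible[OF r x sym, of j]
    by (simp add: bounded_bilinear.add_right[OF bounded_bilinear_matrix_mult, symmetric] trace_add[symmetric])
  also have "trace (matrix_inv (G x) ** (transpose (conn G j x) ** G x)) = trace (transpose (conn G j x))"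
    using trace_mul_sym[of "matrix_inv (G x)" "transpose (conn G j x) ** G x"] \<open>det (G x) \<noteq> 0\<close>
    by (simp add: matrix_mul_assoc[symmetric] matrix_inv_right)
  also have "\<dots> = trace (conn G j x)" by (simp add: trace_def transpose_def)
  also have "trace (matrix_inv (G x) ** (G x ** conn G j x)) = trace (conn G j x)"
    using \<open>det (G x) \<noteq> 0\<close> by (simp add: matrix_mul_assoc matrix_inv_left)
  finally have t: "trace (matrix_inv (G x) ** pd j G x) = 2 * trace (conn G j x)" by simp
  have "pd j (eval SqrtDet [] G) x = eval (dx j SqrtDet) [] G x"
    using frechet_derivative_eval[OF r x] by (simp add: pd_def)
  then show ?thesis using t by (simp add: eval_abs trace_product pd_def)
qed

lemma trace_conn_closed:
  assumes r: "regular S [] G" and x: "x \<in> S" and sym: "\<And>y. y \<in> S \<Longrightarrow> transpose (G y) = G y"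
  shows "pd i (\<lambda>x. trace (conn G j x)) x = pd j (\<lambda>x. trace (conn G i x)) x"
proof -
  let ?s = "\<lambda>x. sqrt (det (G x))"
  have S: "open S" using r by (simp add: regular_def)
  have d1: "?s differentiable (at x)" using eval_differentiable[OF r x, of SqrtDet] by (simp add: eval_abs)
  have d2: "(\<lambda>x. trace (conn G j x)) differentiable (at x)" for j
    by (rule differentiableI[OF bounded_linear.has_derivative[OF bounded_linear_trace has_frechet_derivative[OF conn_differentiable(1)[OF r x]]]])
  have e: "pd i (pd j ?s) x = trace (conn G j x) * pd i ?s x + pd i (\<lambda>x. trace (conn G j x)) x * ?s x" for i j
  proof -
    have "pd i (pd j ?s) x = pd i (\<lambda>x. trace (conn G j x) * ?s x) x"
      by (rule pd_cong[OF S x]) (rule trace_conn_sqrt_det[OF r _ sym])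
    also have "\<dots> = trace (conn G j x) * pd i ?s x + pd i (\<lambda>x. trace (conn G j x)) x * ?s x"
      by (rule pd_eqI[OF has_derivative_mult[OF has_frechet_derivative[OF d2] has_frechet_derivative[OF d1]], folded pd_def])
    finally show ?thesis .
  qed
  have "smooth_on S ?s" using smooth_on_eval[OF r, of SqrtDet] by (simp add: eval_abs)
  from iter_deriv_commute[OF S this x, of "axis i 1" "axis j 1"]
  have "pd i (pd j ?s) x = pd j (pd i ?s) x" by (simp add: pd_def[abs_def] axis_in_Basis_iff)
  moreover have "pd j ?s x = trace (conn G j x) * ?s x" for j
    by (rule trace_conn_sqrt_det[OF r x sym])
  moreover have "?s x \<noteq> 0" using r x by (simp add: regular_def)
  ultimately show ?thesis unfolding e by simp
qed

text \<open>In \<open>\<partial>\<^sub>k \<Gamma>\<^sup>k\<^sub>i\<^sub>j - \<partial>\<^sub>i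
  \<Gamma>\<^sup>k\<^sub>k\<^sub>j + \<Gamma>\<^sup>k\<^sub>k\<^sub>a
  \<Gamma>\<^sup>a\<^sub>i\<^sub>j - \<Gamma>\<^sup>k\<^sub>i\<^sub>a
  \<Gamma>\<^sup>a\<^sub>k\<^sub>j\<close> all terms except the second one are symmetric
  because the Christoffel symbols are, and the second one is symmetric by
  \<open>trace_conn_closed\<close>.\<close>

lemma ricci_matrix_sym:
  assumes r: "regular S [] G" and x: "x \<in> S" and sym: "\<And>y. y \<in> S \<Longrightarrow> transpose (G y) = G y"
  shows "ricci_matrix G x $ i $ j = ricci_matrix G x $ j $ i"
proof -
  let ?\<Gamma> = "christoffel G x"
  have S: "open S" using r by (simp add: regular_def)
  have t: "(\<Sum>k\<in>UNIV. pd i (\<lambda>x. christoffel G x k k j) x) = pd i (\<lambda>x. trace (conn G j x)) x" for i j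
  proof -
    have "pd i (\<lambda>x. \<Sum>k\<in>UNIV. christoffel G x k k j) x = (\<Sum>k\<in>UNIV. pd i (\<lambda>x. christoffel G x k k j) x)"
      by (rule pd_eqI[OF has_derivative_sum[OF has_frechet_derivative[OF christoffel_differentiable(1)[OF r x]]], folded pd_def])
    moreover have "pd i (\<lambda>x. \<Sum>k\<in>UNIV. christoffel G x k k j) x = pd i (\<lambda>x. trace (conn G j x)) x"
      by (rule pd_cong[OF S x]) (simp add: trace_def conn_def, intro sum.cong christoffel_sym[OF r _ sym], auto)
    ultimately show ?thesis by simp
  qed
  have p: "pd k (\<lambda>x. christoffel G x k i j) x = pd k (\<lambda>x. christoffel G x k j i) x" for k i j
    by (rule pd_cong[OF S x]) (rule christoffel_sym[OF r _ sym])
  have q: "(\<Sum>k\<in>UNIV. \<Sum>a\<in>UNIV. ?\<Gamma> k i a * ?\<Gamma> a k j) = (\<Sum>k\<in>UNIV. \<Sum>a\<in>UNIV. ?\<Gamma> k j a * ?\<Gamma> a k i)" for i j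
  proof (subst sum.swap, intro sum.cong refl)
    fix a k
    have "?\<Gamma> k i a = ?\<Gamma> k a i" "?\<Gamma> a k j = ?\<Gamma> a j k"
      by (rule christoffel_sym[OF r x sym], assumption)+
    then show "?\<Gamma> k i a * ?\<Gamma> a k j = ?\<Gamma> a j k * ?\<Gamma> k a i" by simp
  qed
  have expand: "ricci_matrix G x $ i $ j = (\<Sum>k\<in>UNIV. pd k (\<lambda>x. christoffel G x k i j) x) -
      (\<Sum>k\<in>UNIV. pd i (\<lambda>x. christoffel G x k k j) x) + (\<Sum>k\<in>UNIV. \<Sum>a\<in>UNIV. ?\<Gamma> k k a * ?\<Gamma> a i j)
      - (\<Sum>k\<in>UNIV. \<Sum>a\<in>UNIV. ?\<Gamma> k i a * ?\<Gamma> a k j)" for i j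
    by (simp add: ricci_matrix_eq_curv[OF r x] curv_entry[OF r x] sum.distrib sum_subtractf)
  have cs: "?\<Gamma> k i j = ?\<Gamma> k j i" for k i j
    by (rule christoffel_sym[OF r x sym])
  have tc: "pd i (\<lambda>x. trace (conn G j x)) x = pd j (\<lambda>x. trace (conn G i x)) x"
    by (rule trace_conn_closed[OF r x sym])
  show ?thesis
    unfolding expand[of i j] expand[of j i] t tc q[of i j] cs[of _ i j] p[of _ i j] by simp
qed

subsection \<open>Behaviour of the Ricci tensor under a change of coordinates\<close>

lemmas matrix_mult_linear = bounded_bilinear.add_left[OF bounded_bilinear_matrix_mult] bounded_bilinear.add_right[OF bounded_bilinear_matrix_mult]
  bounded_bilinear.diff_left[OF bounded_bilinear_matrix_mult] bounded_bilinear.diff_right[OF bounded_bilinear_matrix_mult]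
  bounded_bilinear.sum_left[OF bounded_bilinear_matrix_mult] bounded_bilinear.sum_right[OF bounded_bilinear_matrix_mult]
  bounded_bilinear.scaleR_left[OF bounded_bilinear_matrix_mult] bounded_bilinear.scaleR_right[OF bounded_bilinear_matrix_mult]

lemma bounded_linear_transpose: "bounded_linear (transpose :: real ^ 'n ^ 'm \<Rightarrow> real ^ 'm ^ 'n)"
  unfolding linear_conv_bounded_linear[symmetric]
  by (auto intro!: linearI simp: transpose_def vec_eq_iff)

locale coordinate_change =
  fixes O1 O2 :: "(real ^ 'n::finite) set" and \<tau> :: "real ^ 'n \<Rightarrow> real ^ 'n" and G H :: "'n mfield"
    and J :: "'n mfield"
  assumes smooth_\<tau>: "smooth_on O1 \<tau>" and range_\<tau>: "\<And>x. x \<in> O1 \<Longrightarrow> \<tau> x \<in> O2"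
    and reg_G: "regular O1 [] G" and reg_H: "regular O2 [] H"
    and sym_H: "\<And>y. y \<in> O2 \<Longrightarrow> transpose (H y) = H y"
    and J_def: "\<And>x. J x = matrix (frechet_derivative \<tau> (at x))"
    and G_eq: "\<And>x. x \<in> O1 \<Longrightarrow> G x = transpose (J x) ** H (\<tau> x) ** J x"
begin

lemma open_O1: "open O1"
  using reg_G reg_H by (auto simp: regular_def)

lemma J_entry: "J x $ a $ i = pd i \<tau> x $ a"
  by (simp add: J_def matrix_def pd_def)

lemma J_smooth: "smooth_on O1 J"
proof (rule smooth_on_matrix_entries[OF open_O1])
  fix a i
  have "smooth_on O1 (pd i \<tau>)"
    using smooth_on_iter_deriv[OF smooth_\<tau>, of "dirs [i]"] by (simp add: pd_def[abs_def] axis_in_Basis_iff)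
  from smooth_on_compose_bounded_linear[OF bounded_linear_vec_nth open_O1 this]
  show "smooth_on O1 (\<lambda>x. J x $ a $ i)" by (simp add: J_entry)
qed

lemma J_diff: "x \<in> O1 \<Longrightarrow> J differentiable (at x)"
  by (rule smooth_on_differentiable[OF J_smooth])

lemma \<tau>_diff: "x \<in> O1 \<Longrightarrow> \<tau> differentiable (at x)"
  by (rule smooth_on_differentiable[OF smooth_\<tau>])

definition hess :: "'n \<Rightarrow> 'n mfield" where "hess i = pd i J"

lemma hess_sym:
  assumes x: "x \<in> O1"
  shows "hess i x $ a $ j = hess j x $ a $ i"
proof -
  have e: "hess i x $ a $ j = pd i (pd j \<tau>) x $ a" for i j
  proof -
    have d: "pd j \<tau> differentiable (at x)"
      using smooth_onD[OF smooth_\<tau> _ x, of "dirs [j]"] by (simp add: pd_def[abs_def] axis_in_Basis_iff)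
    have "hess i x $ a $ j = pd i (\<lambda>x. J x $ a $ j) x" by (simp add: hess_def pd_entry[OF J_diff[OF x]])
    also have "\<dots> = pd i (\<lambda>x. pd j \<tau> x $ a) x" by (simp add: J_entry)
    also have "\<dots> = pd i (pd j \<tau>) x $ a"
      by (rule pd_eqI[OF bounded_linear.has_derivative[OF bounded_linear_vec_nth has_frechet_derivative[OF d]], folded pd_def])
    finally show ?thesis .
  qed
  have "iter_deriv [axis i 1, axis j 1] \<tau> x = iter_deriv [axis j 1, axis i 1] \<tau> x"
    by (rule iter_deriv_commute[OF open_O1 smooth_\<tau> x]) (auto simp: axis_in_Basis_iff)
  then have "pd i (pd j \<tau>) x = pd j (pd i \<tau>) x" by (simp add: pd_def[abs_def])
  then show ?thesis by (simp add: e)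
qed

lemma compose_has_derivative:
  fixes f :: "real ^ 'n \<Rightarrow> 'b::real_normed_vector"
  assumes x: "x \<in> O1" and f: "f differentiable (at (\<tau> x))"
  shows "(\<lambda>x. f (\<tau> x)) differentiable (at x)"
    and "pd i (\<lambda>x. f (\<tau> x)) x = (\<Sum>a\<in>UNIV. J x $ a $ i *\<^sub>R pd a f (\<tau> x))"
proof -
  note d = has_derivative_compose[OF has_frechet_derivative[OF \<tau>_diff[OF x]] pd_has_derivative[OF f]]
  show "(\<lambda>x. f (\<tau> x)) differentiable (at x)" by (rule differentiableI[OF d])
  show "pd i (\<lambda>x. f (\<tau> x)) x = (\<Sum>a\<in>UNIV. J x $ a $ i *\<^sub>R pd a f (\<tau> x))"
    using pd_eqI[OF d, of i] by (simp add: J_entry pd_def)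
qed

lemma sym_G: "x \<in> O1 \<Longrightarrow> transpose (G x) = G x"
  by (simp add: G_eq sym_H range_\<tau> matrix_transpose_mul matrix_mul_assoc)

lemma det_J: "x \<in> O1 \<Longrightarrow> det (J x) \<noteq> 0"
  using reg_G G_eq[of x] by (auto simp: regular_def det_mul)

text \<open>The connection matrices of \<open>H\<close> along \<open>\<tau>\<close>, contracted with the
  Jacobian in the form index but still referred to the frame of the target coordinates.\<close>

definition conn_pullback :: "'n \<Rightarrow> 'n mfield"
  where "conn_pullback i x = (\<Sum>a\<in>UNIV. J x $ a $ i *\<^sub>R conn H a (\<tau> x))"

lemma transpose_sum_scaleR: "transpose (\<Sum>a\<in>S. c a *\<^sub>R M a) = (\<Sum>a\<in>S. c a *\<^sub>R transpose (M a :: real ^ 'n ^ 'n))"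
  by (simp add: linear_sum[OF bounded_linear.linear[OF bounded_linear_transpose]]
      linear_cmul[OF bounded_linear.linear[OF bounded_linear_transpose]])

lemma pd_G:
  assumes x: "x \<in> O1"
  shows "pd i G x = transpose (conn_pullback i x ** J x + hess i x) ** H (\<tau> x) ** J x
    + transpose (J x) ** H (\<tau> x) ** (conn_pullback i x ** J x + hess i x)"
proof -
  have Hd: "H differentiable (at (\<tau> x))" using regular_differentiable[OF reg_H range_\<tau>[OF x]] .
  note dH = compose_has_derivative[OF x Hd]
  have dT: "(\<lambda>x. transpose (J x)) differentiable (at x)" "pd i (\<lambda>x. transpose (J x)) x = transpose (hess i x)"
    using bounded_linear.has_derivative[OF bounded_linear_transpose has_frechet_derivative[OF J_diff[OF x]]] pd_eqI[of "\<lambda>x. transpose (J x)"]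
    by (auto simp: differentiable_def hess_def pd_def)
  have "pd i (\<lambda>x. H (\<tau> x)) x = (\<Sum>a\<in>UNIV. J x $ a $ i *\<^sub>R (transpose (conn H a (\<tau> x)) ** H (\<tau> x) + H (\<tau> x) ** conn H a (\<tau> x)))"
    unfolding dH(2) using conn_compatible[OF reg_H range_\<tau>[OF x] sym_H] by simp
  also have "\<dots> = transpose (conn_pullback i x) ** H (\<tau> x) + H (\<tau> x) ** conn_pullback i x"
    by (simp add: conn_pullback_def transpose_sum_scaleR matrix_mult_linear scaleR_add_right sum.distrib)
  finally have pH: "pd i (\<lambda>x. H (\<tau> x)) x = transpose (conn_pullback i x) ** H (\<tau> x) + H (\<tau> x) ** conn_pullback i x" .
  have "pd i G x = pd i (\<lambda>x. transpose (J x) ** H (\<tau> x) ** J x) x"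
    by (rule pd_cong[OF open_O1 x G_eq])
  also have "\<dots> = (transpose (J x) ** H (\<tau> x)) ** hess i x +
     (transpose (J x) ** (transpose (conn_pullback i x) ** H (\<tau> x) + H (\<tau> x) ** conn_pullback i x) + transpose (hess i x) ** H (\<tau> x)) ** J x"
    using pd_matrix_mult[OF differentiable_matrix_mult[OF dT(1) dH(1)] J_diff[OF x], of i]
      pd_matrix_mult[OF dT(1) dH(1), of i] by (simp add: dT(2) pH hess_def)
  also have "\<dots> = transpose (conn_pullback i x ** J x + hess i x) ** H (\<tau> x) ** J x
    + transpose (J x) ** H (\<tau> x) ** (conn_pullback i x ** J x + hess i x)"
  proof -
    have "transpose (conn_pullback i x ** J x + hess i x) = transpose (J x) ** transpose (conn_pullback i x) + transpose (hess i x)"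
      by (simp add: linear_add[OF bounded_linear.linear[OF bounded_linear_transpose]] matrix_transpose_mul)
    then show ?thesis by (simp add: matrix_mult_linear matrix_mul_assoc)
  qed
  finally show ?thesis .
qed

text \<open>The transformation law of the Christoffel symbols, in the form \<open>J \<omega>\<^sub>i =
  \<omega>'\<^sub>i J + \<partial>\<^sub>i J\<close>. The matrices \<open>J\<inverse>
  (\<omega>'\<^sub>i J + \<partial>\<^sub>i J)\<close> are torsion-free, as second derivatives
  of \<open>\<tau>\<close> commute, and compatible with \<open>G\<close> by
  \<open>pd_G\<close>; uniqueness of the Levi-Civita connection identifies them with
  \<open>\<omega>\<^sub>i\<close>.\<close>

lemma conn_transform:
  assumes x: "x \<in> O1"
  shows "J x ** conn G i x = conn_pullback i x ** J x + hess i x"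
proof -
  define w where "w i = matrix_inv (J x) ** (conn_pullback i x ** J x + hess i x)" for i
  have Jw: "J x ** w i = conn_pullback i x ** J x + hess i x" for i
    by (simp add: w_def matrix_mul_assoc matrix_inv_right det_J[OF x])
  have Gw: "G x ** w i = transpose (J x) ** H (\<tau> x) ** (conn_pullback i x ** J x + hess i x)" for i
  proof -
    have "G x ** w i = transpose (J x) ** H (\<tau> x) ** (J x ** w i)"
      by (simp add: G_eq[OF x] matrix_mul_assoc)
    then show ?thesis by (simp only: Jw)
  qed
  have "conn G i x = w i"
  proof (rule connection_unique)
    show "transpose (G x) = G x" by (rule sym_G[OF x])
    show "det (G x) \<noteq> 0" using reg_G x by (simp add: regular_def)
    fix i j k
    show "conn G i x $ k $ j = conn G j x $ k $ i"
      using christoffel_sym[OF reg_G x sym_G] by (simp add: conn_def)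
    show "transpose (conn G i x) ** G x + G x ** conn G i x = transpose (w i) ** G x + G x ** w i"
    proof -
      have "transpose (w i) ** G x = transpose (G x ** w i)"
        by (simp add: matrix_transpose_mul sym_G[OF x])
      also have "\<dots> = transpose (conn_pullback i x ** J x + hess i x) ** H (\<tau> x) ** J x"
        unfolding Gw by (simp add: matrix_transpose_mul sym_H[OF range_\<tau>[OF x]] matrix_mul_assoc)
      finally have "transpose (w i) ** G x + G x ** w i = pd i G x" by (simp add: Gw pd_G[OF x])
      moreover have "transpose (conn G i x) ** G x + G x ** conn G i x = pd i G x"
        by (rule conn_compatible[OF reg_G x sym_G])
      ultimately show ?thesis by simp
    qed
    have "(conn_pullback i x ** J x) $ c $ j = (conn_pullback j x ** J x) $ c $ i" for c
    proof -
      have e: "(conn_pullback i x ** J x) $ c $ j = (\<Sum>b\<in>UNIV. \<Sum>a\<in>UNIV. J x $ a $ i * J x $ b $ j * christoffel H (\<tau> x) c a b)" for i j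
        by (simp add: matrix_matrix_mult_def conn_pullback_def conn_def sum_distrib_left sum_distrib_right mult_ac)
      have s: "christoffel H (\<tau> x) c a b = christoffel H (\<tau> x) c b a" for a b
        by (rule christoffel_sym[OF reg_H range_\<tau>[OF x] sym_H])
      show ?thesis unfolding e by (subst sum.swap) (simp add: s mult_ac)
    qed
    then show "w i $ k $ j = w j $ k $ i"
      unfolding w_def matrix_matrix_mult_def using hess_sym[OF x, of i _ j]
      by (simp add: matrix_matrix_mult_def)
  qed
  then show ?thesis by (simp add: Jw)
qed

lemma conn_pullback_diff:
  assumes x: "x \<in> O1"
  shows "conn_pullback i differentiable (at x)"
    and "pd j (conn_pullback i) x = (\<Sum>a\<in>UNIV. hess j x $ a $ i *\<^sub>R conn H a (\<tau> x)
      + J x $ a $ i *\<^sub>R (\<Sum>b\<in>UNIV. J x $ b $ j *\<^sub>R pd b (conn H a) (\<tau> x)))"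
proof -
  have c: "conn H a differentiable (at (\<tau> x))" for a
    by (rule conn_differentiable(1)[OF reg_H range_\<tau>[OF x]])
  have "((\<lambda>x. \<Sum>a\<in>UNIV. J x $ a $ i *\<^sub>R conn H a (\<tau> x)) has_derivative
    (\<lambda>u. \<Sum>a\<in>UNIV. J x $ a $ i *\<^sub>R frechet_derivative (\<lambda>x. conn H a (\<tau> x)) (at x) u
      + frechet_derivative J (at x) u $ a $ i *\<^sub>R conn H a (\<tau> x))) (at x)"
    by (intro has_derivative_sum has_derivative_scaleR has_derivative_entry has_frechet_derivative J_diff x compose_has_derivative(1) c)
  then have d: "(conn_pullback i has_derivative
    (\<lambda>u. \<Sum>a\<in>UNIV. J x $ a $ i *\<^sub>R frechet_derivative (\<lambda>x. conn H a (\<tau> x)) (at x) u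
      + frechet_derivative J (at x) u $ a $ i *\<^sub>R conn H a (\<tau> x))) (at x)"
    by (simp add: conn_pullback_def[abs_def])
  show "conn_pullback i differentiable (at x)" by (rule differentiableI[OF d])
  show "pd j (conn_pullback i) x = (\<Sum>a\<in>UNIV. hess j x $ a $ i *\<^sub>R conn H a (\<tau> x)
      + J x $ a $ i *\<^sub>R (\<Sum>b\<in>UNIV. J x $ b $ j *\<^sub>R pd b (conn H a) (\<tau> x)))"
    using pd_eqI[OF d, of j] compose_has_derivative(2)[OF x c]
    by (simp add: pd_def[symmetric] hess_def add.commute)
qed

text \<open>Differentiating \<open>conn_transform\<close> and antisymmetrizing, the second derivatives
  of \<open>J\<close> cancel.\<close>

lemma curv_transform_aux:
  assumes x: "x \<in> O1"
  shows "J x ** curv G i j x =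
    (pd i (conn_pullback j) x - pd j (conn_pullback i) x + conn_pullback i x ** conn_pullback j x - conn_pullback j x ** conn_pullback i x) ** J x"
proof -
  have Kd: "hess i differentiable (at x)" for i
    using smooth_onD[OF J_smooth _ x, of "dirs [i]"] by (simp add: hess_def pd_def[abs_def] axis_in_Basis_iff)
  have E: "J x ** pd i (conn G j) x = pd i (conn_pullback j) x ** J x + conn_pullback j x ** hess i x + pd i (hess j) x - hess i x ** conn G j x" for i j
  proof -
    have "pd i (\<lambda>x. J x ** conn G j x) x = pd i (\<lambda>x. conn_pullback j x ** J x + hess j x) x"
      by (rule pd_cong[OF open_O1 x conn_transform])
    then show ?thesis
      using pd_matrix_mult[OF J_diff[OF x] conn_differentiable(1)[OF reg_G x], of i j]
        pd_matrix_mult[OF conn_pullback_diff(1)[OF x] J_diff[OF x], of i j]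
        pd_add[OF differentiable_matrix_mult[OF conn_pullback_diff(1)[OF x] J_diff[OF x]] Kd, of i j j]
      by (simp add: hess_def algebra_simps)
  qed
  have P: "J x ** (conn G i x ** conn G j x) = conn_pullback i x ** conn_pullback j x ** J x + conn_pullback i x ** hess j x + hess i x ** conn G j x" for i j
  proof -
    have "J x ** (conn G i x ** conn G j x) = (J x ** conn G i x) ** conn G j x" by (simp add: matrix_mul_assoc)
    also have "\<dots> = conn_pullback i x ** (J x ** conn G j x) + hess i x ** conn G j x"
      unfolding conn_transform[OF x, of i] by (simp add: matrix_mult_linear matrix_mul_assoc)
    also have "\<dots> = conn_pullback i x ** (conn_pullback j x ** J x + hess j x) + hess i x ** conn G j x"
      unfolding conn_transform[OF x, of j] ..
    finally show ?thesis by (simp add: matrix_mult_linear matrix_mul_assoc)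
  qed
  have KK: "pd i (hess j) x = pd j (hess i) x"
    using iter_deriv_commute[OF open_O1 J_smooth x, of "axis i 1" "axis j 1"]
    by (simp add: hess_def pd_def[abs_def] axis_in_Basis_iff)
  show ?thesis
    unfolding curv_def matrix_mult_linear E P KK by (simp add: algebra_simps)
qed

lemma curv_transform:
  assumes x: "x \<in> O1"
  shows "J x ** curv G i j x = (\<Sum>a\<in>UNIV. \<Sum>b\<in>UNIV. (J x $ a $ i * J x $ b $ j) *\<^sub>R curv H a b (\<tau> x)) ** J x"
proof -
  let ?C = "\<lambda>a. conn H a (\<tau> x)" and ?D = "\<lambda>a b. pd a (conn H b) (\<tau> x)"
  have 1: "pd i (conn_pullback j) x = (\<Sum>a\<in>UNIV. hess i x $ a $ j *\<^sub>R ?C a) + (\<Sum>a\<in>UNIV. \<Sum>b\<in>UNIV. (J x $ a $ i * J x $ b $ j) *\<^sub>R ?D a b)" for i j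
    unfolding conn_pullback_diff(2)[OF x]
    by (simp add: sum.distrib scaleR_sum_right) (subst sum.swap, simp add: mult.commute)
  have 2: "pd j (conn_pullback i) x = (\<Sum>a\<in>UNIV. hess i x $ a $ j *\<^sub>R ?C a) + (\<Sum>a\<in>UNIV. \<Sum>b\<in>UNIV. (J x $ a $ i * J x $ b $ j) *\<^sub>R ?D b a)"
    unfolding conn_pullback_diff(2)[OF x] using hess_sym[OF x, of i _ j]
    by (simp add: sum.distrib scaleR_sum_right)
  have 3: "conn_pullback i x ** conn_pullback j x = (\<Sum>a\<in>UNIV. \<Sum>b\<in>UNIV. (J x $ a $ i * J x $ b $ j) *\<^sub>R (?C a ** ?C b))"
    unfolding conn_pullback_def by (simp add: matrix_mult_linear scaleR_sum_right) (subst sum.swap, simp add: mult.commute)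
  have 4: "conn_pullback j x ** conn_pullback i x = (\<Sum>a\<in>UNIV. \<Sum>b\<in>UNIV. (J x $ a $ i * J x $ b $ j) *\<^sub>R (?C b ** ?C a))"
    unfolding conn_pullback_def by (simp add: matrix_mult_linear scaleR_sum_right mult.commute)
  have "pd i (conn_pullback j) x - pd j (conn_pullback i) x + conn_pullback i x ** conn_pullback j x - conn_pullback j x ** conn_pullback i x
      = (\<Sum>a\<in>UNIV. \<Sum>b\<in>UNIV. (J x $ a $ i * J x $ b $ j) *\<^sub>R curv H a b (\<tau> x))"
    unfolding 1[of i j] 2 3 4 curv_def
    by (simp add: scaleR_add_right scaleR_diff_right sum.distrib sum_subtractf)
  with curv_transform_aux[OF x, of i j] show ?thesis by simp
qed

lemma ricci_matrix_transform:
  assumes x: "x \<in> O1"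
  shows "ricci_matrix G x = transpose (J x) ** ricci_matrix H (\<tau> x) ** J x"
proof -
  let ?I = "matrix_inv (J x)"
  let ?R = "\<lambda>a b. curv H a b (\<tau> x)"
  have c: "curv G k i x $ k $ j = (\<Sum>a\<in>UNIV. \<Sum>c\<in>UNIV. (J x $ a $ k * ?I $ k $ c) * (\<Sum>b\<in>UNIV. J x $ b $ i * (?R a b ** J x) $ c $ j))" for i j k
  proof -
    have "curv G k i x = ?I ** (J x ** curv G k i x)"
      by (simp add: matrix_mul_assoc matrix_inv_left det_J[OF x])
    also have "\<dots> = (\<Sum>a\<in>UNIV. \<Sum>b\<in>UNIV. (J x $ a $ k * J x $ b $ i) *\<^sub>R (?I ** (?R a b ** J x)))"
      unfolding curv_transform[OF x] by (simp add: matrix_mult_linear)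
    finally have "curv G k i x $ k $ j = (\<Sum>a\<in>UNIV. \<Sum>b\<in>UNIV. (J x $ a $ k * J x $ b $ i) * (?I ** (?R a b ** J x)) $ k $ j)"
      by simp
    also have "\<dots> = (\<Sum>a\<in>UNIV. \<Sum>b\<in>UNIV. \<Sum>c\<in>UNIV. (J x $ a $ k * ?I $ k $ c) * (J x $ b $ i * (?R a b ** J x) $ c $ j))"
      by (simp add: matrix_matrix_mult_def[of ?I] sum_distrib_left mult_ac)
    also have "\<dots> = (\<Sum>a\<in>UNIV. \<Sum>c\<in>UNIV. \<Sum>b\<in>UNIV. (J x $ a $ k * ?I $ k $ c) * (J x $ b $ i * (?R a b ** J x) $ c $ j))"
      by (intro sum.cong refl sum.swap)
    finally show ?thesis by (simp only: sum_distrib_left)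
  qed
  have JI: "(\<Sum>k\<in>UNIV. J x $ a $ k * ?I $ k $ c) = (if a = c then 1 else 0)" for a c
  proof -
    have "(J x ** ?I) $ a $ c = (mat 1 :: real ^ 'n ^ 'n) $ a $ c"
      by (simp add: matrix_inv_right det_J[OF x])
    then show ?thesis by (simp add: matrix_matrix_mult_def mat_def)
  qed
  have "ricci_matrix G x $ i $ j = (transpose (J x) ** ricci_matrix H (\<tau> x) ** J x) $ i $ j" for i j
  proof -
    have "ricci_matrix G x $ i $ j = (\<Sum>k\<in>UNIV. \<Sum>a\<in>UNIV. \<Sum>c\<in>UNIV. (J x $ a $ k * ?I $ k $ c) * (\<Sum>b\<in>UNIV. J x $ b $ i * (?R a b ** J x) $ c $ j))"
      by (simp only: ricci_matrix_eq_curv[OF reg_G x] c)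
    also have "\<dots> = (\<Sum>a\<in>UNIV. \<Sum>k\<in>UNIV. \<Sum>c\<in>UNIV. (J x $ a $ k * ?I $ k $ c) * (\<Sum>b\<in>UNIV. J x $ b $ i * (?R a b ** J x) $ c $ j))"
      by (rule sum.swap)
    also have "\<dots> = (\<Sum>a\<in>UNIV. \<Sum>c\<in>UNIV. (\<Sum>k\<in>UNIV. J x $ a $ k * ?I $ k $ c) * (\<Sum>b\<in>UNIV. J x $ b $ i * (?R a b ** J x) $ c $ j))"
      by (simp only: sum_distrib_right) (intro sum.cong refl sum.swap)
    also have "\<dots> = (\<Sum>a\<in>UNIV. \<Sum>c\<in>UNIV. if a = c then (\<Sum>b\<in>UNIV. J x $ b $ i * (?R a b ** J x) $ c $ j) else 0)"
      unfolding JI by (intro sum.cong refl) simp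
    also have "\<dots> = (\<Sum>a\<in>UNIV. \<Sum>b\<in>UNIV. J x $ b $ i * (?R a b ** J x) $ a $ j)"
      by simp
    also have "\<dots> = (\<Sum>b\<in>UNIV. \<Sum>a\<in>UNIV. J x $ b $ i * (?R a b ** J x) $ a $ j)"
      by (rule sum.swap)
    also have "\<dots> = (\<Sum>b\<in>UNIV. J x $ b $ i * (ricci_matrix H (\<tau> x) ** J x) $ b $ j)"
    proof (intro sum.cong refl)
      fix b
      have "(\<Sum>a\<in>UNIV. (?R a b ** J x) $ a $ j) = (\<Sum>a\<in>UNIV. \<Sum>d\<in>UNIV. ?R a b $ a $ d * J x $ d $ j)"
        by (simp add: matrix_matrix_mult_def)
      also have "\<dots> = (\<Sum>d\<in>UNIV. \<Sum>a\<in>UNIV. ?R a b $ a $ d * J x $ d $ j)"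
        by (rule sum.swap)
      also have "\<dots> = (ricci_matrix H (\<tau> x) ** J x) $ b $ j"
        by (simp add: matrix_matrix_mult_def ricci_matrix_eq_curv[OF reg_H range_\<tau>[OF x]] sum_distrib_right)
      finally show "(\<Sum>a\<in>UNIV. J x $ b $ i * (?R a b ** J x) $ a $ j) = J x $ b $ i * (ricci_matrix H (\<tau> x) ** J x) $ b $ j"
        by (simp only: sum_distrib_left[symmetric])
    qed
    also have "\<dots> = (transpose (J x) ** (ricci_matrix H (\<tau> x) ** J x)) $ i $ j"
      by (simp add: matrix_matrix_mult_def[of "transpose (J x)"] transpose_entry)
    finally show ?thesis by (simp only: matrix_mul_assoc)
  qed
  then show ?thesis by (simp add: vec_eq_iff)
qed

end

section \<open>Partitions of unity\<close>

locale compact_manifold =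
  fixes A :: "('a::t2_space, 'n::finite) chart set"
  assumes compact_M: "compact (UNIV :: 'a set)" and smooth_A: "smooth_structure A"
begin

lemma chart: "c \<in> A \<Longrightarrow> homeomorphism (fst c) (chart_image c) (snd c) (chart_inv c)"
  and open_dom: "c \<in> A \<Longrightarrow> open (fst c)" and open_image: "c \<in> A \<Longrightarrow> open (chart_image c)"
  using smooth_A by (auto simp: smooth_structure_def is_chart_def)

lemma chart_inv_dom: "c \<in> A \<Longrightarrow> x \<in> chart_image c \<Longrightarrow> chart_inv c x \<in> fst c"
  and chart_inv_right: "c \<in> A \<Longrightarrow> x \<in> chart_image c \<Longrightarrow> snd c (chart_inv c x) = x"
  and chart_inv_left: "c \<in> A \<Longrightarrow> p \<in> fst c \<Longrightarrow> chart_inv c (snd c p) = p"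
  and chart_in_image: "p \<in> fst c \<Longrightarrow> snd c p \<in> chart_image c"
  and chart_continuous: "c \<in> A \<Longrightarrow> continuous_on (fst c) (snd c)"
  and chart_inv_continuous: "c \<in> A \<Longrightarrow> continuous_on (chart_image c) (chart_inv c)"
proof -
  show "p \<in> fst c \<Longrightarrow> snd c p \<in> chart_image c" by (simp add: chart_image_def)
  assume "c \<in> A"
  note h = chart[OF this, unfolded homeomorphism_def]
  show "x \<in> chart_image c \<Longrightarrow> chart_inv c x \<in> fst c" using h by blast
  show "x \<in> chart_image c \<Longrightarrow> snd c (chart_inv c x) = x" using h by blast
  show "p \<in> fst c \<Longrightarrow> chart_inv c (snd c p) = p" using h by blast
  show "continuous_on (fst c) (snd c)" "continuous_on (chart_image c) (chart_inv c)" using h by blast+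
qed

lemma chart_exists: obtains c where "c \<in> A" "p \<in> fst c"
proof -
  have "(\<Union>c\<in>A. fst c) = UNIV" using smooth_A unfolding smooth_structure_def by (elim conjE)
  then have "p \<in> (\<Union>c\<in>A. fst c)" by simp
  then show ?thesis using that by blast
qed

definition overlap :: "('a, 'n) chart \<Rightarrow> ('a, 'n) chart \<Rightarrow> (real ^ 'n) set"
  where "overlap c d = snd c ` (fst c \<inter> fst d)"

lemma overlap_iff: "c \<in> A \<Longrightarrow> x \<in> overlap c d \<longleftrightarrow> x \<in> chart_image c \<and> chart_inv c x \<in> fst d"
proof -
  assume c: "c \<in> A"
  show ?thesis
  proof
    assume "x \<in> overlap c d"
    then obtain p where "p \<in> fst c" "p \<in> fst d" "x = snd c p" by (auto simp: overlap_def)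
    then show "x \<in> chart_image c \<and> chart_inv c x \<in> fst d"
      using chart_inv_left[OF c, of p] chart_in_image[of p c] by simp
  next
    assume x: "x \<in> chart_image c \<and> chart_inv c x \<in> fst d"
    then have "x = snd c (chart_inv c x)" "chart_inv c x \<in> fst c \<inter> fst d"
      using chart_inv_right[OF c, of x] chart_inv_dom[OF c, of x] by auto
    then show "x \<in> overlap c d" unfolding overlap_def by (rule image_eqI)
  qed
qed

lemma overlap_image: "overlap c d \<subseteq> chart_image c"
  by (auto simp: overlap_def chart_image_def)

lemma open_overlap: "c \<in> A \<Longrightarrow> d \<in> A \<Longrightarrow> open (overlap c d)"
proof -
  assume c: "c \<in> A" and d: "d \<in> A"
  have "overlap c d = chart_image c \<inter> chart_inv c -` fst d" by (auto simp: overlap_iff[OF c])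
  then show ?thesis
    using continuous_open_preimage[OF chart_inv_continuous[OF c] open_image[OF c] open_dom[OF d]] by simp
qed

lemma transition_in: "c \<in> A \<Longrightarrow> x \<in> overlap c d \<Longrightarrow> transition c d x \<in> chart_image d"
  and transition_inv: "c \<in> A \<Longrightarrow> d \<in> A \<Longrightarrow> x \<in> overlap c d \<Longrightarrow> chart_inv d (transition c d x) = chart_inv c x"
  using chart_in_image[of "chart_inv c x" d] chart_inv_left[of d "chart_inv c x"] overlap_iff[of c x d]
  by (simp_all add: transition_def)

lemma transition_smooth: "c \<in> A \<Longrightarrow> d \<in> A \<Longrightarrow> smooth_on (overlap c d) (transition c d)"
proof -
  assume "c \<in> A" "d \<in> A"
  moreover have "\<forall>c\<in>A. \<forall>d\<in>A. smoothly_compatible c d"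
    using smooth_A unfolding smooth_structure_def by (elim conjE)
  ultimately show ?thesis by (simp add: smoothly_compatible_def overlap_def)
qed

lemma local_bump:
  "\<exists>c\<in>A. \<exists>u. smooth_fun_on_manifold A u \<and> (\<forall>q. 0 \<le> u q) \<and> u p \<noteq> 0 \<and> open {q. u q \<noteq> 0} \<and> closure {q. u q \<noteq> 0} \<subseteq> fst c"
proof -
  obtain c where c: "c \<in> A" "p \<in> fst c" by (rule chart_exists)
  obtain r where r: "r > 0" "cball (snd c p) r \<subseteq> chart_image c"
    using open_image[OF c(1)] chart_in_image[OF c(2)] open_contains_cball by blast
  obtain \<beta> :: "real ^ 'n \<Rightarrow> real" where \<beta>: "smooth_on UNIV \<beta>" "\<And>x. 0 \<le> \<beta> x" "\<And>x. \<beta> x \<noteq> 0 \<longleftrightarrow> x \<in> ball (snd c p) r"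
    using smooth_bump[OF r(1)] by blast
  define u where "u q = (if q \<in> fst c then \<beta> (snd c q) else 0)" for q
  define K where "K = chart_inv c ` cball (snd c p) r"
  have "compact K"
    unfolding K_def
    by (rule compact_continuous_image[OF continuous_on_subset[OF chart_inv_continuous[OF c(1)] r(2)] compact_cball])
  then have K: "closed K" "K \<subseteq> fst c"
    unfolding K_def using r(2) chart_inv_dom[OF c(1)] compact_imp_closed by blast+
  have supp: "{q. u q \<noteq> 0} = fst c \<inter> snd c -` ball (snd c p) r"
    by (auto simp: u_def \<beta>(3))
  have uK: "q \<in> K" if "u q \<noteq> 0" for q
  proof -
    have "q \<in> fst c \<inter> snd c -` ball (snd c p) r" using that unfolding supp[symmetric] by simp
    then have "q \<in> fst c" "snd c q \<in> cball (snd c p) r" by auto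
    then show ?thesis unfolding K_def
      by (intro image_eqI[of q _ "snd c q"]) (simp_all add: chart_inv_left[OF c(1)])
  qed
  show ?thesis
  proof (intro bexI[OF _ c(1)] exI[of _ u] conjI allI)
    show "smooth_fun_on_manifold A u"
      unfolding smooth_fun_on_manifold_def
    proof (intro ballI smooth_on_local)
      fix d x assume d: "d \<in> A" and x: "x \<in> chart_image d"
      \<comment> \<open>Near points outside the domain of \<open>c\<close> the function vanishes, since
        \<open>K\<close> is compact and hence closed.\<close>
      show "\<exists>T. x \<in> T \<and> smooth_on T (u \<circ> chart_inv d)"
      proof (cases "chart_inv d x \<in> fst c")
        case True
        have "smooth_on (overlap d c) (\<lambda>y. \<beta> (transition d c y))"
          by (rule smooth_on_compose[OF open_overlap[OF d c(1)] open_UNIV \<beta>(1) transition_smooth[OF d c(1)]]) simp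
        then have "smooth_on (overlap d c) (u \<circ> chart_inv d)"
          by (rule smooth_on_cong[OF open_overlap[OF d c(1)], rotated])
             (simp add: u_def overlap_iff[OF d] transition_def)
        moreover have "x \<in> overlap d c" using True x by (simp add: overlap_iff[OF d])
        ultimately show ?thesis by (intro exI[of _ "overlap d c"] conjI)
      next
        case False
        let ?T = "chart_image d \<inter> chart_inv d -` (- K)"
        have T: "open ?T"
          by (rule continuous_open_preimage[OF chart_inv_continuous[OF d] open_image[OF d]]) (simp add: K(1) open_Compl)
        have "smooth_on ?T (u \<circ> chart_inv d)"
        proof (rule smooth_on_cong[OF T _ smooth_on_const[of _ 0]])
          fix y assume "y \<in> ?T"
          then show "0 = (u \<circ> chart_inv d) y" using uK[of "chart_inv d y"] by auto
        qed
        moreover have "chart_inv d x \<notin> K" using False subsetD[OF K(2), of "chart_inv d x"] by argo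
        then have "x \<in> ?T" using x by simp
        ultimately show ?thesis by (intro exI[of _ ?T] conjI)
      qed
    qed
    show "0 \<le> u q" for q using \<beta>(2) by (simp add: u_def)
    show "u p \<noteq> 0" using c(2) r(1) by (simp add: u_def \<beta>(3))
    show "open {q. u q \<noteq> 0}" unfolding supp
      by (rule continuous_open_preimage[OF chart_continuous[OF c(1)] open_dom[OF c(1)] open_ball])
    have "closure {q. u q \<noteq> 0} \<subseteq> K" by (rule closure_minimal[OF _ K(1)]) (use uK in auto)
    then show "closure {q. u q \<noteq> 0} \<subseteq> fst c" using K(2) by blast
  qed
qed

text \<open>The volume integral is defined by means of a chosen partition of unity, which is meaningful
  only if there is one. Bump functions are normalized by their sum, after adding up those
  supported in the same chart.\<close>

lemma partition_of_unity_exists: "\<exists>C \<rho>. partition_of_unity A C \<rho>"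
proof -
  define good where "good p cu \<longleftrightarrow> fst cu \<in> A \<and> smooth_fun_on_manifold A (snd cu) \<and> (\<forall>q. 0 \<le> snd cu q) \<and>
    snd cu p \<noteq> (0::real) \<and> open {q. snd cu q \<noteq> 0} \<and> closure {q. snd cu q \<noteq> 0} \<subseteq> fst (fst cu)" for p cu
  have "\<exists>cu. good p cu" for p
  proof -
    obtain c v where "c \<in> A" "smooth_fun_on_manifold A v \<and> (\<forall>q. 0 \<le> v q) \<and> v p \<noteq> 0 \<and>
        open {q. v q \<noteq> 0} \<and> closure {q. v q \<noteq> 0} \<subseteq> fst c"
      using local_bump[of p] by (elim bexE exE) (rule that)
    then have "good p (c, v)" unfolding good_def by simp
    then show ?thesis by (rule exI)
  qed
  then have good: "good p (SOME cu. good p cu)" for p by (rule someI_ex)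
  define cu where "cu p = (SOME cu. good p cu)" for p
  define cc u where "cc p = fst (cu p)" and "u p = snd (cu p)" for p
  have cu: "\<And>p. cc p \<in> A" "\<And>p. smooth_fun_on_manifold A (u p)" "\<And>p q. 0 \<le> u p q" "\<And>p. u p p \<noteq> (0::real)"
    "\<And>p. open {q. u p q \<noteq> 0}" "\<And>p. closure {q. u p q \<noteq> 0} \<subseteq> fst (cc p)"
  proof -
    fix p q
    note g = good[of p, folded cu_def, unfolded good_def]
    show "cc p \<in> A" unfolding cc_def u_def by (rule conjunct1[OF g])
    show "smooth_fun_on_manifold A (u p)" unfolding cc_def u_def by (rule conjunct1[OF conjunct2[OF g]])
    show "0 \<le> u p q" unfolding cc_def u_def by (rule spec[OF conjunct1[OF conjunct2[OF conjunct2[OF g]]]])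
    show "u p p \<noteq> 0" unfolding cc_def u_def by (rule conjunct1[OF conjunct2[OF conjunct2[OF conjunct2[OF g]]]])
    show "open {q. u p q \<noteq> 0}" unfolding cc_def u_def by (rule conjunct1[OF conjunct2[OF conjunct2[OF conjunct2[OF conjunct2[OF g]]]]])
    show "closure {q. u p q \<noteq> 0} \<subseteq> fst (cc p)" unfolding cc_def u_def by (rule conjunct2[OF conjunct2[OF conjunct2[OF conjunct2[OF conjunct2[OF g]]]]])
  qed
  have cover: "UNIV \<subseteq> (\<Union>p\<in>UNIV. {q. u p q \<noteq> 0})"
  proof
    fix q show "q \<in> (\<Union>p\<in>UNIV. {q. u p q \<noteq> 0})"
      by (rule UN_I[of q]) (simp_all add: cu(4))
  qed
  obtain X where X: "finite X" "UNIV \<subseteq> (\<Union>p\<in>X. {q. u p q \<noteq> 0})"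
    by (rule compactE_image[OF compact_M cu(5) cover])
  define \<sigma> where "\<sigma> q = (\<Sum>p\<in>X. u p q)" for q
  have \<sigma>: "\<sigma> q > 0" for q
  proof -
    have "q \<in> (\<Union>p\<in>X. {q. u p q \<noteq> 0})" by (rule subsetD[OF X(2) UNIV_I])
    then obtain p where "p \<in> X" "u p q \<noteq> 0" by blast
    moreover from this cu(3)[of p q] have "0 < u p q" by simp
    ultimately show ?thesis unfolding \<sigma>_def using cu(3) X(1) by (intro sum_pos2[of X p])
  qed
  define \<rho> where "\<rho> c q = (\<Sum>p\<in>{p\<in>X. cc p = c}. u p q) / \<sigma> q" for c q
  have smooth_sum: "smooth_on (chart_image d) (\<lambda>x. \<Sum>p\<in>Y. u p (chart_inv d x))" if "d \<in> A" for d Y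
    using cu(2)[unfolded smooth_fun_on_manifold_def comp_def] that by (intro smooth_on_sum open_image) simp_all
  have "partition_of_unity A (cc ` X) \<rho>"
    unfolding partition_of_unity_def
  proof (intro conjI ballI allI)
    show "finite (cc ` X)" "cc ` X \<subseteq> A" by (intro finite_imageI X(1) image_subsetI cu(1))+
    fix c assume "c \<in> cc ` X"
    show "smooth_fun_on_manifold A (\<rho> c)"
      unfolding smooth_fun_on_manifold_def
    proof
      fix d assume d: "d \<in> A"
      have "\<sigma> (chart_inv d x) \<noteq> 0" for x using \<sigma>[of "chart_inv d x"] by simp
      then show "smooth_on (chart_image d) (\<rho> c \<circ> chart_inv d)"
        using smooth_on_divide[OF open_image[OF d] smooth_sum[OF d] smooth_sum[OF d, of X]]
        by (simp add: \<rho>_def \<sigma>_def comp_def)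
    qed
    show "0 \<le> \<rho> c q" for q
      unfolding \<rho>_def by (intro divide_nonneg_pos sum_nonneg cu(3) \<sigma>)
    have "{q. \<rho> c q \<noteq> 0} \<subseteq> (\<Union>p\<in>{p\<in>X. cc p = c}. closure {q. u p q \<noteq> 0})"
    proof
      fix q assume "q \<in> {q. \<rho> c q \<noteq> 0}"
      then have "(\<Sum>p\<in>{p\<in>X. cc p = c}. u p q) \<noteq> 0" by (simp add: \<rho>_def)
      then obtain p where p: "p \<in> {p\<in>X. cc p = c}" "u p q \<noteq> 0"
        by (rule sum.not_neutral_contains_not_neutral)
      have "q \<in> closure {q. u p q \<noteq> 0}" by (rule subsetD[OF closure_subset]) (simp add: p(2))
      then show "q \<in> (\<Union>p\<in>{p\<in>X. cc p = c}. closure {q. u p q \<noteq> 0})" by (rule UN_I[OF p(1)])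
    qed
    then have "closure {q. \<rho> c q \<noteq> 0} \<subseteq> (\<Union>p\<in>{p\<in>X. cc p = c}. closure {q. u p q \<noteq> 0})"
      by (rule closure_minimal) (simp add: closed_UN X(1))
    moreover have "(\<Union>p\<in>{p\<in>X. cc p = c}. closure {q. u p q \<noteq> 0}) \<subseteq> fst c"
    proof (rule UN_least)
      fix p assume "p \<in> {p \<in> X. cc p = c}"
      with cu(6)[of p] show "closure {q. u p q \<noteq> 0} \<subseteq> fst c" by simp
    qed
    ultimately show "closure {q. \<rho> c q \<noteq> 0} \<subseteq> fst c" by (rule order_trans)
  next
    fix q
    have "(\<Sum>c\<in>cc ` X. \<rho> c q) = (\<Sum>c\<in>cc ` X. \<Sum>p\<in>{p\<in>X. cc p = c}. u p q) / \<sigma> q"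
      unfolding \<rho>_def by (rule sum_divide_distrib[symmetric])
    also have "(\<Sum>c\<in>cc ` X. \<Sum>p\<in>{p\<in>X. cc p = c}. u p q) = \<sigma> q"
      unfolding \<sigma>_def by (rule sum.image_gen[OF X(1), symmetric])
    finally show "(\<Sum>c\<in>cc ` X. \<rho> c q) = 1" using \<sigma>[of q] by simp
  qed
  then show ?thesis by (intro exI)
qed

end

section \<open>The space of symmetric tensor fields\<close>

definition pos_def :: "real ^ 'n ^ 'n \<Rightarrow> bool"
  where "pos_def M \<longleftrightarrow> (\<forall>v. v \<noteq> 0 \<longrightarrow> 0 < v \<bullet> (M *v v))"

lemma pos_def_det: "pos_def M \<Longrightarrow> det M \<noteq> 0"
proof -
  assume M: "pos_def M"
  have "\<forall>v. M *v v = 0 \<longrightarrow> v = 0"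
    using M unfolding pos_def_def by (metis inner_zero_right less_irrefl)
  then have "\<exists>B. B ** M = mat 1" by (simp only: matrix_left_invertible_ker)
  then show ?thesis
    using invertible_left_inverse[of M] invertible_det_nz[of M] by simp
qed

lemma transpose_inner: "v \<bullet> ((transpose J ** M ** J) *v v) = (J *v v) \<bullet> (M *v (J *v v))"
  for J M :: "real ^ 'n ^ 'n"
proof -
  have "v \<bullet> ((transpose J ** M ** J) *v v) = v \<bullet> (transpose J *v (M *v (J *v v)))"
    by (simp only: matrix_vector_mul_assoc matrix_mul_assoc)
  also have "\<dots> = (v v* transpose J) \<bullet> (M *v (J *v v))" by (rule dot_lmul_matrix[symmetric])
  finally show ?thesis by (simp add: vector_transpose_matrix)
qed

text \<open>Charts are pairs, and quantifiers over charts are to remain intact.\<close>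

declare split_paired_All [simp del] split_paired_Ex [simp del]

context compact_manifold
begin

abbreviation "\<S> \<equiv> sym_tensor_fields A"
abbreviation "\<M> \<equiv> metrics A"

definition jac :: "('a, 'n) chart \<Rightarrow> ('a, 'n) chart \<Rightarrow> real ^ 'n \<Rightarrow> real ^ 'n ^ 'n"
  where "jac c d x = matrix (frechet_derivative (transition c d) (at x))"

lemma sym_tensor_iff:
  "h \<in> \<S> \<longleftrightarrow> (\<forall>c x. \<not> (c \<in> A \<and> x \<in> chart_image c) \<longrightarrow> h c x = 0) \<and>
    (\<forall>c\<in>A. smooth_on (chart_image c) (h c)) \<and>
    (\<forall>c\<in>A. \<forall>x\<in>chart_image c. transpose (h c x) = h c x) \<and>
    (\<forall>c\<in>A. \<forall>d\<in>A. \<forall>x\<in>overlap c d.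
      h c x = transpose (jac c d x) ** h d (transition c d x) ** jac c d x)"
  unfolding sym_tensor_fields_def overlap_def jac_def Let_def mem_Collect_eq ..

lemma sym_tensorI:
  assumes "\<And>c x. \<not> (c \<in> A \<and> x \<in> chart_image c) \<Longrightarrow> h c x = 0"
    and "\<And>c. c \<in> A \<Longrightarrow> smooth_on (chart_image c) (h c)"
    and "\<And>c x. c \<in> A \<Longrightarrow> x \<in> chart_image c \<Longrightarrow> transpose (h c x) = h c x"
    and "\<And>c d x. c \<in> A \<Longrightarrow> d \<in> A \<Longrightarrow> x \<in> overlap c d \<Longrightarrow>
      h c x = transpose (jac c d x) ** h d (transition c d x) ** jac c d x"
  shows "h \<in> \<S>"
  unfolding sym_tensor_iff by (intro conjI allI impI ballI assms)

lemma
  assumes "h \<in> \<S>"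
  shows tensor_zero: "\<not> (c \<in> A \<and> x \<in> chart_image c) \<Longrightarrow> h c x = 0"
    and tensor_smooth: "c \<in> A \<Longrightarrow> smooth_on (chart_image c) (h c)"
    and tensor_sym: "c \<in> A \<Longrightarrow> x \<in> chart_image c \<Longrightarrow> transpose (h c x) = h c x"
    and tensor_trans: "c \<in> A \<Longrightarrow> d \<in> A \<Longrightarrow> x \<in> overlap c d \<Longrightarrow>
      h c x = transpose (jac c d x) ** h d (transition c d x) ** jac c d x"
  using assms unfolding sym_tensor_iff by simp_all

lemma tensor_field_apply: "(h + k) c x = h c x + k c x" "(h - k) c x = h c x - k c x"
  "(r *\<^sub>R h) c x = r *\<^sub>R h c x" "(0 :: ('a, 'n) tensor2_field) c x = 0"
  for h k :: "('a, 'n) tensor2_field"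
  by (simp_all add: scaleR_fun_def)

lemma add_scaleR_field: "(h + t *\<^sub>R k) c = (\<lambda>x. h c x + t *\<^sub>R k c x)" for h k :: "('a, 'n) tensor2_field"
  by (rule ext) (simp add: tensor_field_apply scaleR_fun_def)

lemma tensor_lincomb:
  assumes h: "h \<in> \<S>" and k: "k \<in> \<S>"
  shows "h + t *\<^sub>R k \<in> \<S>"
proof (rule sym_tensorI)
  show "(h + t *\<^sub>R k) c x = 0" if "\<not> (c \<in> A \<and> x \<in> chart_image c)" for c x
    using tensor_zero[OF h that] tensor_zero[OF k that] by (simp add: tensor_field_apply)
  show "smooth_on (chart_image c) ((h + t *\<^sub>R k) c)" if "c \<in> A" for c
    unfolding add_scaleR_field by (intro smooth_on_add_scaleR open_image tensor_smooth h k that)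
  show "transpose ((h + t *\<^sub>R k) c x) = (h + t *\<^sub>R k) c x" if "c \<in> A" "x \<in> chart_image c" for c x
    using tensor_sym[OF h that] tensor_sym[OF k that]
    by (simp add: tensor_field_apply linear_add[OF bounded_linear.linear[OF bounded_linear_transpose]]
        linear_cmul[OF bounded_linear.linear[OF bounded_linear_transpose]])
  show "(h + t *\<^sub>R k) c x = transpose (jac c d x) ** (h + t *\<^sub>R k) d (transition c d x) ** jac c d x"
    if "c \<in> A" "d \<in> A" "x \<in> overlap c d" for c d x
    unfolding add_scaleR_field tensor_trans[OF h that] tensor_trans[OF k that] by (simp add: matrix_mult_linear)
qed

lemma zero_tensor: "0 \<in> \<S>"
proof (rule sym_tensorI)
  show "(0 :: ('a, 'n) tensor2_field) c x = 0" for c x by simp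
  have "(0 :: ('a, 'n) tensor2_field) c = (\<lambda>x. 0)" for c by (rule ext) simp
  then show "smooth_on (chart_image c) ((0 :: ('a, 'n) tensor2_field) c)" for c by (simp only: smooth_on_const)
  show "transpose ((0 :: ('a, 'n) tensor2_field) c x) = (0 :: ('a, 'n) tensor2_field) c x" for c x
    by (simp add: transpose_def vec_eq_iff)
  show "(0 :: ('a, 'n) tensor2_field) c x = transpose (jac c d x) ** (0 :: ('a, 'n) tensor2_field) d (transition c d x) ** jac c d x" for c d x
    by (simp add: matrix_matrix_mult_def vec_eq_iff)
qed

lemma tensor_scaleR: "h \<in> \<S> \<Longrightarrow> t *\<^sub>R h \<in> \<S>"
  using tensor_lincomb[OF zero_tensor, of h t] by simp

lemma tensor_diff: "h \<in> \<S> \<Longrightarrow> k \<in> \<S> \<Longrightarrow> h - k \<in> \<S>"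
  using tensor_lincomb[of h k "-1"] by simp

subsection \<open>Seminorms\<close>

definition seminorm_on :: "('a, 'n) chart \<Rightarrow> (real ^ 'n) set \<Rightarrow> (real ^ 'n) list \<Rightarrow> ('a, 'n) tensor2_field \<Rightarrow> real"
  where "seminorm_on c K vs h = Sup (insert 0 ((\<lambda>x. norm (iter_deriv vs (h c) x)) ` K))"

lemma tensor_seminorms_eq:
  "p \<in> tensor_seminorms A \<longleftrightarrow> (\<exists>c K vs. p = seminorm_on c K vs \<and> c \<in> A \<and> compact K \<and> K \<subseteq> chart_image c \<and> vs \<in> lists Basis)"
  unfolding tensor_seminorms_def seminorm_on_def[abs_def] mem_Collect_eq ..

lemma seminorm_bdd:
  assumes "h \<in> \<S>" "c \<in> A" "compact K" "K \<subseteq> chart_image c" "vs \<in> lists Basis"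
  shows "bdd_above (insert 0 ((\<lambda>x. norm (iter_deriv vs (h c) x)) ` K))"
proof -
  have "compact ((\<lambda>x. norm (iter_deriv vs (h c) x)) ` K)"
    using continuous_on_subset[OF smooth_on_iter_deriv_continuous[OF tensor_smooth[OF assms(1,2)] assms(5)] assms(4)] assms(3)
    by (intro compact_continuous_image continuous_on_norm)
  then show ?thesis by (simp add: compact_imp_bounded bounded_imp_bdd_above)
qed

lemma seminorm_upper:
  assumes "h \<in> \<S>" "c \<in> A" "compact K" "K \<subseteq> chart_image c" "vs \<in> lists Basis" "x \<in> K"
  shows "norm (iter_deriv vs (h c) x) \<le> seminorm_on c K vs h"
  unfolding seminorm_on_def by (rule cSup_upper[OF _ seminorm_bdd[OF assms(1-5)]]) (use assms(6) in simp)

lemma seminorm_nonneg: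
  assumes "h \<in> \<S>" "c \<in> A" "compact K" "K \<subseteq> chart_image c" "vs \<in> lists Basis"
  shows "0 \<le> seminorm_on c K vs h"
  unfolding seminorm_on_def by (rule cSup_upper[OF _ seminorm_bdd[OF assms(1-5)]]) simp

lemma seminorm_least:
  assumes "0 \<le> B" "\<And>x. x \<in> K \<Longrightarrow> norm (iter_deriv vs (h c) x) \<le> B"
  shows "seminorm_on c K vs h \<le> B"
  unfolding seminorm_on_def by (rule cSup_least) (use assms in auto)

lemma iter_deriv_tensor_lincomb:
  assumes "h \<in> \<S>" "k \<in> \<S>" "c \<in> A" "x \<in> chart_image c" "vs \<in> lists Basis"
  shows "iter_deriv vs ((h + t *\<^sub>R k) c) x = iter_deriv vs (h c) x + t *\<^sub>R iter_deriv vs (k c) x"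
  unfolding add_scaleR_field
  by (rule iter_deriv_add_scaleR[OF open_image[OF assms(3)] tensor_smooth[OF assms(1,3)] tensor_smooth[OF assms(2,3)] assms(4,5)])

lemma iter_deriv_tensor_diff:
  assumes "h \<in> \<S>" "k \<in> \<S>" "c \<in> A" "x \<in> chart_image c" "vs \<in> lists Basis"
  shows "iter_deriv vs ((h - k) c) x = iter_deriv vs (h c) x - iter_deriv vs (k c) x"
  using iter_deriv_tensor_lincomb[OF assms, of "-1"] by simp

text \<open>Uniform limits are what the continuity and differentiability of expressions are stated with;
  \<open>lcs_tendsto_field\<close> relates them to the seminorms.\<close>

definition field_converges :: "('i \<Rightarrow> ('a, 'n) tensor2_field) \<Rightarrow> ('a, 'n) tensor2_field \<Rightarrow> 'i filter \<Rightarrow> bool"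
  where "field_converges hs h F \<longleftrightarrow> (\<forall>c\<in>A. \<forall>K. compact K \<and> K \<subseteq> chart_image c \<longrightarrow>
    (\<forall>\<alpha>. uniform_limit K (\<lambda>i. iter_deriv (dirs \<alpha>) (hs i c)) (iter_deriv (dirs \<alpha>) (h c)) F))"

lemma field_convergesD:
  "field_converges hs h F \<Longrightarrow> c \<in> A \<Longrightarrow> compact K \<Longrightarrow> K \<subseteq> chart_image c \<Longrightarrow>
    uniform_limit K (\<lambda>i. iter_deriv (dirs \<alpha>) (hs i c)) (iter_deriv (dirs \<alpha>) (h c)) F"
  unfolding field_converges_def by simp

lemma lcs_tendsto_field:
  assumes hs: "\<forall>\<^sub>F i in F. hs i \<in> \<S>" and h: "h \<in> \<S>"
  shows "lcs_tendsto (tensor_seminorms A) hs h F \<longleftrightarrow> field_converges hs h F"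
proof
  assume l: "lcs_tendsto (tensor_seminorms A) hs h F"
  show "field_converges hs h F"
    unfolding field_converges_def
  proof (intro ballI allI impI, elim conjE)
    fix c K \<alpha> assume c: "c \<in> A" "compact K" "K \<subseteq> chart_image c"
    have "seminorm_on c K (dirs \<alpha>) \<in> tensor_seminorms A"
      unfolding tensor_seminorms_eq using c dirs_Basis by (intro exI conjI) (rule refl)
    with l have lim: "((\<lambda>i. seminorm_on c K (dirs \<alpha>) (hs i - h)) \<longlongrightarrow> 0) F" unfolding lcs_tendsto_def by simp
    show "uniform_limit K (\<lambda>i. iter_deriv (dirs \<alpha>) (hs i c)) (iter_deriv (dirs \<alpha>) (h c)) F"
    proof (rule uniform_limitI)
      fix e :: real assume "e > 0"
      from order_tendstoD(2)[OF lim this] hs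
      show "\<forall>\<^sub>F i in F. \<forall>x\<in>K. dist (iter_deriv (dirs \<alpha>) (hs i c) x) (iter_deriv (dirs \<alpha>) (h c) x) < e"
      proof eventually_elim
        case (elim i)
        show ?case
        proof
          fix x assume x: "x \<in> K"
          have "x \<in> chart_image c" using x c by auto
          then show "dist (iter_deriv (dirs \<alpha>) (hs i c) x) (iter_deriv (dirs \<alpha>) (h c) x) < e"
            unfolding dist_norm iter_deriv_tensor_diff[OF elim(2) h c(1) \<open>x \<in> chart_image c\<close> dirs_Basis, symmetric]
            by (intro order.strict_trans1[OF seminorm_upper[OF tensor_diff[OF elim(2) h] c dirs_Basis x] elim(1)])
        qed
      qed
    qed
  qed
next
  assume f: "field_converges hs h F"
  show "lcs_tendsto (tensor_seminorms A) hs h F"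
    unfolding lcs_tendsto_def
  proof
    fix p assume "p \<in> tensor_seminorms A"
    then obtain c K vs where p: "p = seminorm_on c K vs" and c: "c \<in> A" "compact K" "K \<subseteq> chart_image c" and vs: "vs \<in> lists Basis"
      unfolding tensor_seminorms_eq by (elim exE conjE) (rule that)
    obtain \<alpha> where \<alpha>: "vs = dirs \<alpha>" using dirs_surj[OF vs] by (elim exE)
    have u: "uniform_limit K (\<lambda>i. iter_deriv vs (hs i c)) (iter_deriv vs (h c)) F"
      unfolding \<alpha> by (rule field_convergesD[OF f c])
    show "((\<lambda>i. p (hs i - h)) \<longlongrightarrow> 0) F"
    proof (rule tendstoI)
      fix e :: real assume e: "e > 0"
      then have "e / 2 > 0" by simp
      from uniform_limitD[OF u this] hs show "\<forall>\<^sub>F i in F. dist (p (hs i - h)) 0 < e"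
      proof eventually_elim
        case (elim i)
        have "p (hs i - h) \<le> e / 2"
          unfolding p
        proof (rule seminorm_least)
          fix x assume x: "x \<in> K"
          then have "x \<in> chart_image c" using c by auto
          then show "norm (iter_deriv vs ((hs i - h) c) x) \<le> e / 2"
            using bspec[OF elim(1) x]
            unfolding iter_deriv_tensor_diff[OF elim(2) h c(1) \<open>x \<in> chart_image c\<close> vs] dist_norm by simp
        qed (use e in simp)
        moreover have "0 \<le> p (hs i - h)" unfolding p by (rule seminorm_nonneg[OF tensor_diff[OF elim(2) h] c vs])
        ultimately show ?case using e by simp
      qed
    qed
  qed
qed

lemma seminorm_props:
  assumes "p \<in> tensor_seminorms A" "h \<in> \<S>" "k \<in> \<S>"
  shows "p (h + k) \<le> p h + p k" "p (t *\<^sub>R h) \<le> \<bar>t\<bar> * p h" "0 \<le> p h"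
proof -
  obtain c K vs where p: "p = seminorm_on c K vs" and c: "c \<in> A" "compact K" "K \<subseteq> chart_image c" and vs: "vs \<in> lists Basis"
    using assms(1) unfolding tensor_seminorms_eq by (elim exE conjE) (rule that)
  note u = seminorm_upper[OF _ c vs] and nn = seminorm_nonneg[OF _ c vs]
  show "0 \<le> p h" unfolding p by (rule nn[OF assms(2)])
  show "p (h + k) \<le> p h + p k"
    unfolding p
  proof (rule seminorm_least)
    show "0 \<le> seminorm_on c K vs h + seminorm_on c K vs k" using nn[OF assms(2)] nn[OF assms(3)] by simp
    fix x assume x: "x \<in> K"
    then have "x \<in> chart_image c" using c by auto
    then have e: "iter_deriv vs ((h + k) c) x = iter_deriv vs (h c) x + iter_deriv vs (k c) x"
      using iter_deriv_tensor_lincomb[OF assms(2,3) c(1) _ vs, of x 1] by simp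
    show "norm (iter_deriv vs ((h + k) c) x) \<le> seminorm_on c K vs h + seminorm_on c K vs k"
      unfolding e using norm_triangle_ineq[of "iter_deriv vs (h c) x" "iter_deriv vs (k c) x"] u[OF assms(2) x] u[OF assms(3) x]
      by linarith
  qed
  show "p (t *\<^sub>R h) \<le> \<bar>t\<bar> * p h"
    unfolding p
  proof (rule seminorm_least)
    show "0 \<le> \<bar>t\<bar> * seminorm_on c K vs h" using nn[OF assms(2)] by simp
    fix x assume x: "x \<in> K"
    then have xc: "x \<in> chart_image c" using c by auto
    have "iter_deriv vs ((0 :: ('a, 'n) tensor2_field) c) x = 0"
      using iter_deriv_tensor_diff[OF assms(2,2) c(1) xc vs] by simp
    then have "iter_deriv vs ((t *\<^sub>R h) c) x = t *\<^sub>R iter_deriv vs (h c) x"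
      using iter_deriv_tensor_lincomb[OF zero_tensor assms(2) c(1) xc vs, of t] by simp
    then show "norm (iter_deriv vs ((t *\<^sub>R h) c) x) \<le> \<bar>t\<bar> * seminorm_on c K vs h"
      using u[OF assms(2) x] by (simp add: mult_left_mono)
  qed
qed

lemma seminorm_separating:
  assumes h: "h \<in> \<S>" and z: "\<And>p. p \<in> tensor_seminorms A \<Longrightarrow> p h = 0"
  shows "h = 0"
proof (rule ext, rule ext)
  fix c x
  show "h c x = (0 :: ('a, 'n) tensor2_field) c x"
  proof (cases "c \<in> A \<and> x \<in> chart_image c")
    case True
    then have "seminorm_on c {x} [] \<in> tensor_seminorms A"
      unfolding tensor_seminorms_eq by (intro exI[of _ c] exI[of _ "{x}"] exI[of _ "[]"]) simp
    moreover have "norm (iter_deriv [] (h c) x) \<le> seminorm_on c {x} [] h"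
      using True by (intro seminorm_upper[OF h]) simp_all
    ultimately show ?thesis using z[of "seminorm_on c {x} []"] by simp
  next
    case False
    then show ?thesis using tensor_zero[OF h] by simp
  qed
qed

subsection \<open>Metrics\<close>

lemma metric_iff: "g \<in> \<M> \<longleftrightarrow> g \<in> \<S> \<and> (\<forall>c\<in>A. \<forall>x\<in>chart_image c. pos_def (g c x))"
  unfolding metrics_def pos_def_def mem_Collect_eq ..

lemma metric_tensor: "g \<in> \<M> \<Longrightarrow> g \<in> \<S>"
  and metric_pos_def: "g \<in> \<M> \<Longrightarrow> c \<in> A \<Longrightarrow> x \<in> chart_image c \<Longrightarrow> pos_def (g c x)"
  unfolding metric_iff by simp_all

lemma metric_det: "g \<in> \<M> \<Longrightarrow> c \<in> A \<Longrightarrow> x \<in> chart_image c \<Longrightarrow> det (g c x) \<noteq> 0"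
  by (rule pos_def_det[OF metric_pos_def])

lemma metric_regular:
  assumes "g \<in> \<M>" "c \<in> A" "set hs \<subseteq> \<S>"
  shows "regular (chart_image c) (map (\<lambda>h. h c) hs) (g c)"
  unfolding regular_def
  using assms open_image tensor_smooth metric_tensor metric_det by (simp add: subset_iff)

lemma metrics_convex:
  assumes "g \<in> \<M>" "k \<in> \<M>" "0 \<le> t" "t \<le> 1"
  shows "g + t *\<^sub>R (k - g) \<in> \<M>"
  unfolding metric_iff
proof (intro conjI ballI)
  show "g + t *\<^sub>R (k - g) \<in> \<S>"
    by (intro tensor_lincomb tensor_diff metric_tensor assms)
  fix c x assume c: "c \<in> A" "x \<in> chart_image c"
  show "pos_def ((g + t *\<^sub>R (k - g)) c x)"
    unfolding pos_def_def
  proof (intro allI impI)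
    fix v :: "real ^ 'n" assume v: "v \<noteq> 0"
    have "(g + t *\<^sub>R (k - g)) c x = (1 - t) *\<^sub>R g c x + t *\<^sub>R k c x"
      by (simp add: tensor_field_apply algebra_simps scaleR_fun_def)
    then have "v \<bullet> ((g + t *\<^sub>R (k - g)) c x *v v) = (1 - t) * (v \<bullet> (g c x *v v)) + t * (v \<bullet> (k c x *v v))"
      by (simp add: matrix_vector_mult_add_rdistrib scaleR_matrix_vector_assoc[symmetric] inner_add_right)
    moreover have "0 < v \<bullet> (g c x *v v)" "0 < v \<bullet> (k c x *v v)"
      using metric_pos_def[OF assms(1) c] metric_pos_def[OF assms(2) c] v unfolding pos_def_def by simp_all
    ultimately show "0 < v \<bullet> ((g + t *\<^sub>R (k - g)) c x *v v)"
      using assms(3,4) by (cases "t = 0") (auto intro: add_nonneg_pos)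
  qed
qed

lemma det_jac:
  assumes "g \<in> \<M>" "c \<in> A" "d \<in> A" "x \<in> overlap c d"
  shows "det (jac c d x) \<noteq> 0"
proof -
  have "x \<in> chart_image c" using assms(4) by (rule subsetD[OF overlap_image])
  from metric_det[OF assms(1,2) this] tensor_trans[OF metric_tensor[OF assms(1)] assms(2-4)]
  show ?thesis by (auto simp: det_mul)
qed

end

section \<open>Calculus in locally convex spaces\<close>

lemma lcs_tendsto_real: "lcs_tendsto {abs} f l F \<longleftrightarrow> (f \<longlongrightarrow> (l::real)) F"
  by (simp add: lcs_tendsto_def tendsto_rabs_zero_iff LIM_zero_iff)

lemma lcs_tendsto_compose: "lcs_tendsto PS f l F \<Longrightarrow> filterlim s F G \<Longrightarrow> lcs_tendsto PS (\<lambda>i. f (s i)) l G"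
  unfolding lcs_tendsto_def 
proof
  fix p assume f: "\<forall>p\<in>PS. ((\<lambda>i. p (f i - l)) \<longlongrightarrow> 0) F" and s: "filterlim s F G" and p: "p \<in> PS"
  show "((\<lambda>i. p (f (s i) - l)) \<longlongrightarrow> 0) G" by (rule filterlim_compose[OF bspec[OF f p] s])
qed

lemma lcs_tendsto_cong:
  "\<forall>\<^sub>F i in F. f i = g i \<Longrightarrow> lcs_tendsto PS f l F \<Longrightarrow> lcs_tendsto PS g l F"
  unfolding lcs_tendsto_def
proof
  fix p assume fg: "\<forall>\<^sub>F i in F. f i = g i" and f: "\<forall>p\<in>PS. ((\<lambda>i. p (f i - l)) \<longlongrightarrow> 0) F" and p: "p \<in> PS"
  have "\<forall>\<^sub>F i in F. p (f i - l) = p (g i - l)" using fg by eventually_elim simp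
  then show "((\<lambda>i. p (g i - l)) \<longlongrightarrow> 0) F" by (rule Lim_transform_eventually[OF bspec[OF f p]])
qed

lemma filterlim_at_0_seq: "s \<longlonglongrightarrow> 0 \<Longrightarrow> (\<And>n. s n \<noteq> 0) \<Longrightarrow> filterlim s (at (0::real)) sequentially"
  by (simp add: filterlim_at)

lemma eventually_at_0: "0 < \<delta> \<Longrightarrow> (\<And>t. t \<noteq> 0 \<Longrightarrow> \<bar>t\<bar> < \<delta> \<Longrightarrow> Q t) \<Longrightarrow> \<forall>\<^sub>F t in at (0::real). Q t"
  unfolding eventually_at by (intro exI[of _ \<delta>]) (simp add: dist_real_def)

lemma lcs_tendsto_at_seqI:
  assumes "0 < \<delta>"
    and "\<And>s. s \<longlonglongrightarrow> 0 \<Longrightarrow> (\<And>n. s n \<noteq> 0) \<Longrightarrow> (\<And>n. \<bar>s n\<bar> < \<delta>) \<Longrightarrow> lcs_tendsto PS (\<lambda>n. f (s n)) l sequentially"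
  shows "lcs_tendsto PS f l (at (0::real))"
  unfolding lcs_tendsto_def
proof
  fix p assume p: "p \<in> PS"
  have "((\<lambda>t. p (f t - l)) \<longlongrightarrow> 0) (at 0 within ball 0 \<delta>)"
    unfolding tendsto_at_iff_sequentially
  proof (intro allI impI)
    fix s :: "nat \<Rightarrow> real" assume "\<forall>n. s n \<in> ball 0 \<delta> - {0}" "s \<longlonglongrightarrow> 0"
    then have "lcs_tendsto PS (\<lambda>n. f (s n)) l sequentially" by (intro assms(2)) simp_all
    with p show "((\<lambda>t. p (f t - l)) \<circ> s) \<longlonglongrightarrow> 0" by (simp add: lcs_tendsto_def comp_def)
  qed
  moreover have "at (0::real) within ball 0 \<delta> = at 0"
    by (rule at_within_open) (simp_all add: assms(1))
  ultimately show "((\<lambda>t. p (f t - l)) \<longlongrightarrow> 0) (at 0)" by simp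
qed

locale seminormed =
  fixes E :: "'v::real_vector set" and PS :: "('v \<Rightarrow> real) set"
  assumes zero: "0 \<in> E" and lincomb: "x \<in> E \<Longrightarrow> y \<in> E \<Longrightarrow> x + t *\<^sub>R y \<in> E"
    and triangle: "p \<in> PS \<Longrightarrow> x \<in> E \<Longrightarrow> y \<in> E \<Longrightarrow> p (x + y) \<le> p x + p y"
    and scale: "p \<in> PS \<Longrightarrow> x \<in> E \<Longrightarrow> p (t *\<^sub>R x) \<le> \<bar>t\<bar> * p x"
    and nonneg: "p \<in> PS \<Longrightarrow> x \<in> E \<Longrightarrow> 0 \<le> p x"
    and separating: "x \<in> E \<Longrightarrow> (\<And>p. p \<in> PS \<Longrightarrow> p x = 0) \<Longrightarrow> x = 0"
begin

lemma add: "x \<in> E \<Longrightarrow> y \<in> E \<Longrightarrow> x + y \<in> E"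
  using lincomb[of x y 1] by simp

lemma scaleR: "x \<in> E \<Longrightarrow> t *\<^sub>R x \<in> E"
  using lincomb[OF zero, of x t] by simp

lemma diff: "x \<in> E \<Longrightarrow> y \<in> E \<Longrightarrow> x - y \<in> E"
  using lincomb[of x y "-1"] by simp

lemma p_zero: "p \<in> PS \<Longrightarrow> p 0 = 0"
  using scale[OF _ zero, of p 0] nonneg[OF _ zero, of p] by simp

lemma lim_const [simp]: "lcs_tendsto PS (\<lambda>i. l) l F"
  by (simp add: lcs_tendsto_def p_zero)

lemma lim_lincomb:
  assumes f: "lcs_tendsto PS f a F" and g: "lcs_tendsto PS g b F" and s: "(s \<longlongrightarrow> r) F"
    and E: "\<forall>\<^sub>F i in F. f i \<in> E" "\<forall>\<^sub>F i in F. g i \<in> E" "a \<in> E" "b \<in> E"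
  shows "lcs_tendsto PS (\<lambda>i. f i + s i *\<^sub>R g i) (a + r *\<^sub>R b) F"
  unfolding lcs_tendsto_def
proof
  fix p assume p: "p \<in> PS"
  have "((\<lambda>i. p (f i - a) + \<bar>s i\<bar> * p (g i - b) + \<bar>s i - r\<bar> * p b) \<longlongrightarrow> 0 + \<bar>r\<bar> * 0 + \<bar>r - r\<bar> * p b) F"
    using f g p s by (intro tendsto_intros) (simp_all add: lcs_tendsto_def)
  then have lim: "((\<lambda>i. p (f i - a) + \<bar>s i\<bar> * p (g i - b) + \<bar>s i - r\<bar> * p b) \<longlongrightarrow> 0) F" by simp
  show "((\<lambda>i. p (f i + s i *\<^sub>R g i - (a + r *\<^sub>R b))) \<longlongrightarrow> 0) F"
  proof (rule tendsto_sandwich[OF _ _ tendsto_const lim])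
    show "\<forall>\<^sub>F i in F. 0 \<le> p (f i + s i *\<^sub>R g i - (a + r *\<^sub>R b))"
      using E(1,2) by eventually_elim (intro nonneg[OF p] diff lincomb E)
    show "\<forall>\<^sub>F i in F. p (f i + s i *\<^sub>R g i - (a + r *\<^sub>R b)) \<le> p (f i - a) + \<bar>s i\<bar> * p (g i - b) + \<bar>s i - r\<bar> * p b"
      using E(1,2)
    proof eventually_elim
      case (elim i)
      have "f i + s i *\<^sub>R g i - (a + r *\<^sub>R b) = ((f i - a) + s i *\<^sub>R (g i - b)) + (s i - r) *\<^sub>R b"
        by (simp add: algebra_simps)
      also have "p \<dots> \<le> p ((f i - a) + s i *\<^sub>R (g i - b)) + p ((s i - r) *\<^sub>R b)"
        by (intro triangle[OF p] lincomb diff scaleR elim E)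
      also have "p ((f i - a) + s i *\<^sub>R (g i - b)) \<le> p (f i - a) + p (s i *\<^sub>R (g i - b))"
        by (intro triangle[OF p] diff scaleR elim E)
      finally show ?case
        using scale[OF p diff[OF elim(2) E(4)], of "s i"] scale[OF p E(4), of "s i - r"] by linarith
    qed
  qed
qed

lemma lim_add:
  assumes "lcs_tendsto PS f a F" "lcs_tendsto PS g b F"
    "\<forall>\<^sub>F i in F. f i \<in> E" "\<forall>\<^sub>F i in F. g i \<in> E" "a \<in> E" "b \<in> E"
  shows "lcs_tendsto PS (\<lambda>i. f i + g i) (a + b) F"
  using lim_lincomb[OF assms(1,2) tendsto_const assms(3-6), of 1] by simp

lemma limit_unique:
  assumes "F \<noteq> bot" "lcs_tendsto PS f a F" "lcs_tendsto PS f b F" "\<forall>\<^sub>F i in F. f i \<in> E" "a \<in> E" "b \<in> E"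
  shows "a = b"
proof -
  have "lcs_tendsto PS (\<lambda>i. f i + (-1) *\<^sub>R f i) (a + (-1) *\<^sub>R b) F"
    by (rule lim_lincomb[OF assms(2,3) tendsto_const assms(4,4,5,6)])
  then have l: "lcs_tendsto PS (\<lambda>i. 0) (a - b) F" by simp
  have "b - a = 0"
  proof (rule separating[OF diff[OF assms(6,5)]])
    fix p assume "p \<in> PS"
    with l have "((\<lambda>i. p (b - a)) \<longlongrightarrow> 0) F" by (simp add: lcs_tendsto_def)
    then show "p (b - a) = 0" using assms(1) by (simp add: tendsto_const_iff)
  qed
  then show ?thesis by simp
qed

end

lemma seminormed_real: "seminormed (UNIV :: real set) {abs}"
  by standard (auto simp: abs_mult)

definition diff_quot :: "('v::real_vector \<Rightarrow> 'w::real_vector) \<Rightarrow> 'v \<Rightarrow> 'v \<Rightarrow> real \<Rightarrow> 'w"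
  where "diff_quot F x v t = inverse t *\<^sub>R (F (x + t *\<^sub>R v) - F x)"

text \<open>An open convex set. Openness is required along lines only; together with convexity this
  makes the intersections with planes open, which is all that the equality of mixed
  derivatives uses.\<close>

locale lcs_domain = seminormed E PS for E :: "'v::real_vector set" and PS +
  fixes U :: "'v set"
  assumes U_sub: "x \<in> U \<Longrightarrow> x \<in> E"
    and U_open: "x \<in> U \<Longrightarrow> v \<in> E \<Longrightarrow> \<exists>\<delta>>0. \<forall>t. \<bar>t\<bar> < \<delta> \<longrightarrow> x + t *\<^sub>R v \<in> U"
    and U_convex: "x \<in> U \<Longrightarrow> y \<in> U \<Longrightarrow> 0 \<le> t \<Longrightarrow> t \<le> 1 \<Longrightarrow> x + t *\<^sub>R (y - x) \<in> U"
begin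

lemma eventually_U: "x \<in> U \<Longrightarrow> v \<in> E \<Longrightarrow> \<forall>\<^sub>F t in at 0. x + t *\<^sub>R v \<in> U"
proof -
  assume "x \<in> U" "v \<in> E"
  then obtain \<delta> where \<delta>: "\<delta> > 0" "\<forall>t. \<bar>t\<bar> < \<delta> \<longrightarrow> x + t *\<^sub>R v \<in> U" using U_open[of x v] by blast
  show ?thesis by (rule eventually_at_0[OF \<delta>(1)]) (simp add: \<delta>(2))
qed

lemma tendsto_line:
  assumes "s \<longlonglongrightarrow> r" "x \<in> E" "v \<in> E"
  shows "lcs_tendsto PS (\<lambda>n. x + s n *\<^sub>R v) (x + r *\<^sub>R v) sequentially"
  by (rule lim_lincomb[OF lim_const lim_const assms(1)]) (simp_all add: assms)

definition lists_conv :: "(nat \<Rightarrow> 'v list) \<Rightarrow> 'v list \<Rightarrow> bool"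
  where "lists_conv X xs \<longleftrightarrow> xs \<in> lists E \<and> (\<forall>n. X n \<in> lists E \<and> length (X n) = length xs) \<and>
    (\<forall>i<length xs. lcs_tendsto PS (\<lambda>n. X n ! i) (xs ! i) sequentially)"

lemma lists_conv_Nil: "lists_conv X [] \<longleftrightarrow> (\<forall>n. X n = [])"
  by (auto simp: lists_conv_def)

lemma lists_conv_const: "xs \<in> lists E \<Longrightarrow> lists_conv (\<lambda>n. xs) xs"
  by (simp add: lists_conv_def)

lemma lists_conv_Cons:
  assumes "\<And>n. f n \<in> E" "x \<in> E" "lcs_tendsto PS f x sequentially" "lists_conv X xs"
  shows "lists_conv (\<lambda>n. f n # X n) (x # xs)"
proof -
  note c = assms(4)[unfolded lists_conv_def]
  have "lcs_tendsto PS (\<lambda>n. (f n # X n) ! i) ((x # xs) ! i) sequentially" if "i < length (x # xs)" for i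
    using assms(3) c that by (cases i) simp_all
  then show ?thesis unfolding lists_conv_def using assms(1,2) c by simp
qed

lemma lists_conv_ConsE:
  assumes "lists_conv X (x # xs)"
  obtains f Y where "X = (\<lambda>n. f n # Y n)" "\<And>n. f n \<in> E" "x \<in> E" "lcs_tendsto PS f x sequentially" "lists_conv Y xs"
proof
  have len: "length (X n) = Suc (length xs)" for n using assms by (simp add: lists_conv_def)
  then have ne: "X n \<noteq> []" for n by (metis list.size(3) nat.distinct(1))
  then show "X = (\<lambda>n. hd (X n) # tl (X n))" by simp
  have XE: "set (X n) \<subseteq> E" for n using assms by (simp add: lists_conv_def lists_eq_set)
  show "hd (X n) \<in> E" for n using subsetD[OF XE hd_in_set[OF ne]] .
  show "x \<in> E" using assms by (simp add: lists_conv_def)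
  have lim: "lcs_tendsto PS (\<lambda>n. X n ! i) ((x # xs) ! i) sequentially" if "i < Suc (length xs)" for i
    using assms that by (simp add: lists_conv_def)
  show "lcs_tendsto PS (\<lambda>n. hd (X n)) x sequentially" using lim[of 0] by (simp add: hd_conv_nth ne)
  show "lists_conv (\<lambda>n. tl (X n)) xs"
    unfolding lists_conv_def
  proof (intro conjI allI impI)
    show "xs \<in> lists E" using assms by (simp add: lists_conv_def)
    show "tl (X n) \<in> lists E" for n
      using XE[of n] list.set_sel(2)[OF ne, of _ n] by (auto simp: lists_eq_set)
    show "length (tl (X n)) = length xs" for n by (simp add: len)
    fix i assume "i < length xs"
    then show "lcs_tendsto PS (\<lambda>n. tl (X n) ! i) (xs ! i) sequentially"
      using lim[of "Suc i"] by (simp add: nth_tl len)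
  qed
qed

lemma lists_conv_append:
  "lists_conv X xs \<Longrightarrow> lists_conv Y ys \<Longrightarrow> lists_conv (\<lambda>n. X n @ Y n) (xs @ ys)"
proof (induction xs arbitrary: X)
  case Nil
  then show ?case by (simp add: lists_conv_Nil)
next
  case (Cons x xs)
  obtain f Y' where f: "X = (\<lambda>n. f n # Y' n)" "\<And>n. f n \<in> E" "x \<in> E" "lcs_tendsto PS f x sequentially" "lists_conv Y' xs"
    using Cons.prems(1) by (rule lists_conv_ConsE) (rule that)
  show ?case
    using lists_conv_Cons[OF f(2-4) Cons.IH[OF f(5) Cons.prems(2)]] by (simp add: f(1))
qed

lemma lists_conv_rev: "lists_conv X xs \<Longrightarrow> lists_conv (\<lambda>n. rev (X n)) (rev xs)"
proof (induction xs arbitrary: X)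
  case Nil
  then show ?case by (simp add: lists_conv_Nil)
next
  case (Cons x xs)
  obtain f Y where f: "X = (\<lambda>n. f n # Y n)" "\<And>n. f n \<in> E" "x \<in> E" "lcs_tendsto PS f x sequentially" "lists_conv Y xs"
    using Cons.prems by (rule lists_conv_ConsE) (rule that)
  have "lists_conv (\<lambda>n. [f n]) [x]"
    using lists_conv_Cons[OF f(2-4) lists_conv_const[of "[]"]] by simp
  from lists_conv_append[OF Cons.IH[OF f(5)] this] show ?case by (simp add: f(1))
qed

text \<open>\<open>D vs z\<close> stands for the iterated derivative, in the directions
  \<open>vs\<close>, of a function on \<open>U\<close> depending on a parameter \<open>z \<in>
  E\<close>. For a one-form \<open>z\<close> is the vector to which it is applied; maps
  without a parameter ignore it. Continuity is joint in directions, parameter and point, and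
  the directions are ordered such that the latest one comes first.\<close>

definition smooth_family :: "'w::real_vector set \<Rightarrow> ('w \<Rightarrow> real) set \<Rightarrow> ('v list \<Rightarrow> 'v \<Rightarrow> 'v \<Rightarrow> 'w) \<Rightarrow> bool"
  where "smooth_family E' PS' D \<longleftrightarrow>
    (\<forall>vs\<in>lists E. \<forall>z\<in>E. \<forall>x\<in>U. D vs z x \<in> E') \<and>
    (\<forall>vs\<in>lists E. \<forall>z\<in>E. \<forall>v\<in>E. \<forall>x\<in>U. lcs_tendsto PS' (diff_quot (D vs z) x v) (D (v # vs) z x) (at 0)) \<and>
    (\<forall>X V Z x vs z. lists_conv V vs \<longrightarrow> (\<forall>n. X n \<in> U) \<longrightarrow> x \<in> U \<longrightarrow> (\<forall>n. Z n \<in> E) \<longrightarrow> z \<in> E \<longrightarrow>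
      lcs_tendsto PS X x sequentially \<longrightarrow> lcs_tendsto PS Z z sequentially \<longrightarrow>
      lcs_tendsto PS' (\<lambda>n. D (V n) (Z n) (X n)) (D vs z x) sequentially)"

lemma smooth_familyD:
  assumes "smooth_family E' PS' D"
  shows "vs \<in> lists E \<Longrightarrow> z \<in> E \<Longrightarrow> x \<in> U \<Longrightarrow> D vs z x \<in> E'"
    and "vs \<in> lists E \<Longrightarrow> z \<in> E \<Longrightarrow> v \<in> E \<Longrightarrow> x \<in> U \<Longrightarrow> lcs_tendsto PS' (diff_quot (D vs z) x v) (D (v # vs) z x) (at 0)"
    and "lists_conv V vs \<Longrightarrow> (\<And>n. X n \<in> U) \<Longrightarrow> x \<in> U \<Longrightarrow> (\<And>n. Z n \<in> E) \<Longrightarrow> z \<in> E \<Longrightarrow>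
      lcs_tendsto PS X x sequentially \<Longrightarrow> lcs_tendsto PS Z z sequentially \<Longrightarrow>
      lcs_tendsto PS' (\<lambda>n. D (V n) (Z n) (X n)) (D vs z x) sequentially"
proof -
  note c = assms[unfolded smooth_family_def]
  show "vs \<in> lists E \<Longrightarrow> z \<in> E \<Longrightarrow> x \<in> U \<Longrightarrow> D vs z x \<in> E'"
    by (rule conjunct1[OF c, rule_format])
  show "vs \<in> lists E \<Longrightarrow> z \<in> E \<Longrightarrow> v \<in> E \<Longrightarrow> x \<in> U \<Longrightarrow> lcs_tendsto PS' (diff_quot (D vs z) x v) (D (v # vs) z x) (at 0)"
    by (rule conjunct1[OF conjunct2[OF c], rule_format])
  show "lists_conv V vs \<Longrightarrow> (\<And>n. X n \<in> U) \<Longrightarrow> x \<in> U \<Longrightarrow> (\<And>n. Z n \<in> E) \<Longrightarrow> z \<in> E \<Longrightarrow>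
      lcs_tendsto PS X x sequentially \<Longrightarrow> lcs_tendsto PS Z z sequentially \<Longrightarrow>
      lcs_tendsto PS' (\<lambda>n. D (V n) (Z n) (X n)) (D vs z x) sequentially"
    by (rule conjunct2[OF conjunct2[OF c], rule_format])
qed

end

subsection \<open>Product rule\<close>

text \<open>The derivative of \<open>T z x (R x)\<close>, \<open>T\<close> being linear in its last
  slot, in directions \<open>us\<close>: each direction differentiates either \<open>T\<close>
  or \<open>R\<close>, and \<open>as\<close> and \<open>bs\<close> collect the choices made so
  far. The directions are consumed from the front, so \<open>us\<close> lists the earliest one
  first.\<close>

primrec leibniz :: "('v list \<Rightarrow> 'v \<Rightarrow> 'v \<Rightarrow> 'v \<Rightarrow> 'w::real_vector) \<Rightarrow> ('v list \<Rightarrow> 'v \<Rightarrow> 'v) \<Rightarrow>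
    'v list \<Rightarrow> 'v list \<Rightarrow> 'v list \<Rightarrow> 'v \<Rightarrow> 'v \<Rightarrow> 'w" where
  "leibniz T R [] as bs z x = T as z x (R bs x)"
| "leibniz T R (v # us) as bs z x = leibniz T R us (v # as) bs z x + leibniz T R us as (v # bs) z x"

text \<open>The derivatives of \<open>T\<close> concern the point \<open>x\<close> only; by linearity no
  derivatives in the last slot are needed for the product rule.\<close>

locale linear_family = lcs_domain E PS U + target: seminormed E' PS'
  for E :: "'v::real_vector set" and PS U and E' :: "'w::real_vector set" and PS' +
  fixes T :: "'v list \<Rightarrow> 'v \<Rightarrow> 'v \<Rightarrow> 'v \<Rightarrow> 'w" and R :: "'v list \<Rightarrow> 'v \<Rightarrow> 'v"
  assumes T_in: "as \<in> lists E \<Longrightarrow> z \<in> E \<Longrightarrow> x \<in> U \<Longrightarrow> u \<in> E \<Longrightarrow> T as z x u \<in> E'"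
    and T_lin: "z \<in> E \<Longrightarrow> x \<in> U \<Longrightarrow> u \<in> E \<Longrightarrow> u' \<in> E \<Longrightarrow> T [] z x (u + t *\<^sub>R u') = T [] z x u + t *\<^sub>R T [] z x u'"
    and T_deriv: "as \<in> lists E \<Longrightarrow> z \<in> E \<Longrightarrow> x \<in> U \<Longrightarrow> u \<in> E \<Longrightarrow> v \<in> E \<Longrightarrow>
      lcs_tendsto PS' (diff_quot (\<lambda>x. T as z x u) x v) (T (v # as) z x u) (at 0)"
    and T_cont: "lists_conv V vs \<Longrightarrow> (\<And>n. X n \<in> U) \<Longrightarrow> x \<in> U \<Longrightarrow> (\<And>n. Z n \<in> E) \<Longrightarrow> z \<in> E \<Longrightarrow>
      (\<And>n. Y n \<in> E) \<Longrightarrow> u \<in> E \<Longrightarrow>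
      lcs_tendsto PS X x sequentially \<Longrightarrow> lcs_tendsto PS Z z sequentially \<Longrightarrow> lcs_tendsto PS Y u sequentially \<Longrightarrow>
      lcs_tendsto PS' (\<lambda>n. T (V n) (Z n) (X n) (Y n)) (T vs z x u) sequentially"
    and R_family: "smooth_family E PS (\<lambda>vs z. R vs)"
begin

lemma R_in: "vs \<in> lists E \<Longrightarrow> x \<in> U \<Longrightarrow> R vs x \<in> E"
  by (rule smooth_familyD(1)[OF R_family _ zero])

text \<open>A limit of linear maps is linear.\<close>

lemma T_linear:
  assumes "as \<in> lists E" "z \<in> E" "x \<in> U" "u \<in> E" "u' \<in> E"
  shows "T as z x (u + t *\<^sub>R u') = T as z x u + t *\<^sub>R T as z x u'"
  using assms(1,3)
proof (induction as arbitrary: x rule: list.induct)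
  case Nil
  show ?case by (rule T_lin[OF assms(2) Nil(2) assms(4,5)])
next
  case (Cons v as)
  then have v: "v \<in> E" "as \<in> lists E" by simp_all
  note in_E = T_in[OF v(2) assms(2)]
  have ev: "\<forall>\<^sub>F s in at 0. x + s *\<^sub>R v \<in> U" by (rule eventually_U[OF Cons.prems(2) v(1)])
  have dqE: "\<forall>\<^sub>F s in at 0. diff_quot (\<lambda>x. T as z x w) x v s \<in> E'" if "w \<in> E" for w
    using ev by eventually_elim (simp only: diff_quot_def, intro target.scaleR target.diff in_E Cons.prems that)
  let ?w = "u + t *\<^sub>R u'"
  have w: "?w \<in> E" by (rule lincomb[OF assms(4,5)])
  have "lcs_tendsto PS' (\<lambda>s. diff_quot (\<lambda>x. T as z x u) x v s + t *\<^sub>R diff_quot (\<lambda>x. T as z x u') x v s)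
      (T (v # as) z x u + t *\<^sub>R T (v # as) z x u') (at 0)"
    by (rule target.lim_lincomb[OF T_deriv[OF v(2) assms(2) Cons.prems(2) assms(4) v(1)]
          T_deriv[OF v(2) assms(2) Cons.prems(2) assms(5) v(1)] tendsto_const dqE[OF assms(4)] dqE[OF assms(5)]
          T_in[OF Cons.prems(1) assms(2) Cons.prems(2) assms(4)] T_in[OF Cons.prems(1) assms(2) Cons.prems(2) assms(5)]])
  moreover have "\<forall>\<^sub>F s in at 0. diff_quot (\<lambda>x. T as z x u) x v s + t *\<^sub>R diff_quot (\<lambda>x. T as z x u') x v s = diff_quot (\<lambda>x. T as z x ?w) x v s"
    using ev
  proof eventually_elim
    case (elim s)
    note IH = Cons.IH[OF v(2) elim] Cons.IH[OF v(2) Cons.prems(2)]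
    show ?case unfolding diff_quot_def IH by (simp add: algebra_simps)
  qed
  ultimately have 1: "lcs_tendsto PS' (diff_quot (\<lambda>x. T as z x ?w) x v) (T (v # as) z x u + t *\<^sub>R T (v # as) z x u') (at 0)"
    by (rule lcs_tendsto_cong[rotated])
  have 2: "lcs_tendsto PS' (diff_quot (\<lambda>x. T as z x ?w) x v) (T (v # as) z x ?w) (at 0)"
    by (rule T_deriv[OF v(2) assms(2) Cons.prems(2) w v(1)])
  note in_E' = T_in[OF Cons.prems(1) assms(2) Cons.prems(2)]
  show ?case
    by (rule target.limit_unique[OF at_neq_bot 2 1 dqE[OF w] in_E'[OF w] target.lincomb[OF in_E'[OF assms(4)] in_E'[OF assms(5)]]])
qed

text \<open>As usual, the difference quotient splits into that of \<open>T\<close> with \<open>R\<close>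
  fixed and the value of \<open>T\<close> at the difference quotient of \<open>R\<close>. The
  latter converges by the joint continuity of \<open>T\<close>.\<close>

lemma leibniz_deriv_base:
  assumes "as \<in> lists E" "bs \<in> lists E" "z \<in> E" "x \<in> U" "w \<in> E"
  shows "lcs_tendsto PS' (diff_quot (\<lambda>x. T as z x (R bs x)) x w) (T (w # as) z x (R bs x) + T as z x (R (w # bs) x)) (at 0)"
proof -
  let ?s = "diff_quot (R bs) x w"
  obtain \<delta> where \<delta>: "\<delta> > 0" "\<And>t. \<bar>t\<bar> < \<delta> \<Longrightarrow> x + t *\<^sub>R w \<in> U"
    using U_open[OF assms(4,5)] by (elim exE conjE) (rule that, assumption, erule allE, erule mp)
  have sE: "?s t \<in> E" if "\<bar>t\<bar> < \<delta>" for t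
    unfolding diff_quot_def by (intro scaleR diff R_in assms \<delta> that)
  have R_lim: "lcs_tendsto PS ?s (R (w # bs) x) (at 0)"
    by (rule smooth_familyD(2)[OF R_family assms(2) zero assms(5,4)])
  have R0: "R bs x \<in> E" by (rule R_in[OF assms(2,4)])
  have RwE: "R (w # bs) x \<in> E" using assms by (intro R_in) simp_all
  have 1: "lcs_tendsto PS' (diff_quot (\<lambda>y. T as z y (R bs x)) x w) (T (w # as) z x (R bs x)) (at 0)"
    by (rule T_deriv[OF assms(1,3,4) R0 assms(5)])
  have 2: "lcs_tendsto PS' (\<lambda>t. T as z (x + t *\<^sub>R w) (?s t)) (T as z x (R (w # bs) x)) (at 0)"
  proof (rule lcs_tendsto_at_seqI[OF \<delta>(1)])
    fix r :: "nat \<Rightarrow> real" assume r: "r \<longlonglongrightarrow> 0" "\<And>n. r n \<noteq> 0" "\<And>n. \<bar>r n\<bar> < \<delta>"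
    have "lcs_tendsto PS (\<lambda>n. x + r n *\<^sub>R w) x sequentially"
      using tendsto_line[OF r(1) U_sub[OF assms(4)] assms(5)] by simp
    moreover have "lcs_tendsto PS (\<lambda>n. ?s (r n)) (R (w # bs) x) sequentially"
      by (rule lcs_tendsto_compose[OF R_lim filterlim_at_0_seq[OF r(1,2)]])
    ultimately show "lcs_tendsto PS' (\<lambda>n. T as z (x + r n *\<^sub>R w) (?s (r n))) (T as z x (R (w # bs) x)) sequentially"
      by (intro T_cont lists_conv_const lim_const \<delta>(2) r(3) sE RwE assms)
  qed
  have 3: "\<forall>\<^sub>F t in at 0. diff_quot (\<lambda>y. T as z y (R bs x)) x w t + T as z (x + t *\<^sub>R w) (?s t) = diff_quot (\<lambda>y. T as z y (R bs y)) x w t"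
  proof (rule eventually_at_0[OF \<delta>(1)])
    fix t :: real assume t: "t \<noteq> 0" "\<bar>t\<bar> < \<delta>"
    have "R bs (x + t *\<^sub>R w) = R bs x + t *\<^sub>R ?s t" using t(1) by (simp add: diff_quot_def)
    then have "T as z (x + t *\<^sub>R w) (R bs (x + t *\<^sub>R w)) = T as z (x + t *\<^sub>R w) (R bs x) + t *\<^sub>R T as z (x + t *\<^sub>R w) (?s t)"
      using T_linear[OF assms(1,3) \<delta>(2)[OF t(2)] R0 sE[OF t(2)], of t] by (simp only:)
    then have "diff_quot (\<lambda>y. T as z y (R bs y)) x w t = inverse t *\<^sub>R (T as z (x + t *\<^sub>R w) (R bs x) + t *\<^sub>R T as z (x + t *\<^sub>R w) (?s t) - T as z x (R bs x))"
      unfolding diff_quot_def[of "\<lambda>y. T as z y (R bs y)"] by (simp only:)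
    also have "\<dots> = diff_quot (\<lambda>y. T as z y (R bs x)) x w t + T as z (x + t *\<^sub>R w) (?s t)"
      unfolding diff_quot_def[of "\<lambda>y. T as z y (R bs x)"] using t(1) by (simp add: scaleR_add_right scaleR_diff_right)
    finally show "diff_quot (\<lambda>y. T as z y (R bs x)) x w t + T as z (x + t *\<^sub>R w) (?s t) = diff_quot (\<lambda>y. T as z y (R bs y)) x w t" ..
  qed
  have 4: "\<forall>\<^sub>F t in at 0. diff_quot (\<lambda>y. T as z y (R bs x)) x w t \<in> E'"
    unfolding diff_quot_def by (rule eventually_at_0[OF \<delta>(1)]) (intro target.scaleR target.diff T_in assms R0 \<delta>(2))
  have 5: "\<forall>\<^sub>F t in at 0. T as z (x + t *\<^sub>R w) (?s t) \<in> E'"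
    by (rule eventually_at_0[OF \<delta>(1)]) (intro T_in assms \<delta>(2) sE)
  have "w # as \<in> lists E" using assms by simp
  then have "lcs_tendsto PS' (\<lambda>t. diff_quot (\<lambda>y. T as z y (R bs x)) x w t + T as z (x + t *\<^sub>R w) (?s t))
      (T (w # as) z x (R bs x) + T as z x (R (w # bs) x)) (at 0)"
    by (intro target.lim_add[OF 1 2 4 5] T_in assms R0 RwE)
  then show ?thesis by (rule lcs_tendsto_cong[OF 3])
qed

lemma leibniz_in:
  "us \<in> lists E \<Longrightarrow> as \<in> lists E \<Longrightarrow> bs \<in> lists E \<Longrightarrow> z \<in> E \<Longrightarrow> x \<in> U \<Longrightarrow> leibniz T R us as bs z x \<in> E'"
  by (induction us arbitrary: as bs) (simp_all add: T_in R_in target.add)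

lemma leibniz_deriv:
  assumes "z \<in> E" "x \<in> U" "w \<in> E"
  shows "us \<in> lists E \<Longrightarrow> as \<in> lists E \<Longrightarrow> bs \<in> lists E \<Longrightarrow>
    lcs_tendsto PS' (diff_quot (leibniz T R us as bs z) x w) (leibniz T R (us @ [w]) as bs z x) (at 0)"
proof (induction us arbitrary: as bs)
  case Nil
  have "diff_quot (leibniz T R [] as bs z) x w = diff_quot (\<lambda>y. T as z y (R bs y)) x w" by (rule ext) (simp add: diff_quot_def)
  then show ?case using leibniz_deriv_base[OF Nil(2,3) assms] by (simp only: append_Nil leibniz.simps)
next
  case (Cons v us)
  then have v: "v \<in> E" "us \<in> lists E" by simp_all
  have ev: "\<forall>\<^sub>F t in at 0. x + t *\<^sub>R w \<in> U" by (rule eventually_U[OF assms(2,3)])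
  have dqE: "\<forall>\<^sub>F t in at 0. diff_quot (leibniz T R us as bs z) x w t \<in> E'" if "as \<in> lists E" "bs \<in> lists E" for as bs
    unfolding diff_quot_def using ev by eventually_elim (intro target.scaleR target.diff leibniz_in v that assms)
  have "lcs_tendsto PS' (\<lambda>t. diff_quot (leibniz T R us (v # as) bs z) x w t + diff_quot (leibniz T R us as (v # bs) z) x w t)
    (leibniz T R (us @ [w]) (v # as) bs z x + leibniz T R (us @ [w]) as (v # bs) z x) (at 0)"
  proof -
    have l: "v # as \<in> lists E" "v # bs \<in> lists E" "as \<in> lists E" "bs \<in> lists E" "us @ [w] \<in> lists E"
      using v assms(3) Cons.prems by simp_all
    show ?thesis
      by (rule target.lim_add[OF Cons.IH[OF v(2) l(1,4)] Cons.IH[OF v(2) l(3,2)] dqE[OF l(1,4)] dqE[OF l(3,2)]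
            leibniz_in[OF l(5,1,4) assms(1,2)] leibniz_in[OF l(5,3,2) assms(1,2)]])
  qed
  moreover have "diff_quot (leibniz T R us (v # as) bs z) x w t + diff_quot (leibniz T R us as (v # bs) z) x w t
    = diff_quot (leibniz T R (v # us) as bs z) x w t" for t
    unfolding diff_quot_def leibniz.simps by (simp add: algebra_simps)
  then have e: "(\<lambda>t. diff_quot (leibniz T R us (v # as) bs z) x w t + diff_quot (leibniz T R us as (v # bs) z) x w t)
    = diff_quot (leibniz T R (v # us) as bs z) x w" by (rule ext)
  ultimately show ?case unfolding append_Cons leibniz.simps(2)[of T R v "us @ [w]" as bs z x] by (simp only:)
qed

lemma leibniz_cont:
  assumes "\<And>n. X n \<in> U" "x \<in> U" "\<And>n. Z n \<in> E" "z \<in> E" "lcs_tendsto PS X x sequentially" "lcs_tendsto PS Z z sequentially"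
  shows "lists_conv Us us \<Longrightarrow> lists_conv As as \<Longrightarrow> lists_conv Bs bs \<Longrightarrow>
    lcs_tendsto PS' (\<lambda>n. leibniz T R (Us n) (As n) (Bs n) (Z n) (X n)) (leibniz T R us as bs z x) sequentially"
proof (induction us arbitrary: Us as bs As Bs)
  case Nil
  then have Us: "Us = (\<lambda>n. [])" by (auto simp: lists_conv_Nil)
  have l: "as \<in> lists E" "bs \<in> lists E" "\<And>n. As n \<in> lists E" "\<And>n. Bs n \<in> lists E"
    using Nil by (simp_all add: lists_conv_def)
  have "lcs_tendsto PS (\<lambda>n. R (Bs n) (X n)) (R bs x) sequentially"
    by (rule smooth_familyD(3)[OF R_family Nil(3) assms(1,2) zero zero assms(5) lim_const])
  then show ?case
    unfolding Us leibniz.simps by (intro T_cont Nil assms R_in l)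
next
  case (Cons v us)
  obtain f Y where f: "Us = (\<lambda>n. f n # Y n)" "\<And>n. f n \<in> E" "v \<in> E" "lcs_tendsto PS f v sequentially" "lists_conv Y us"
    using Cons.prems(1) by (rule lists_conv_ConsE) (rule that)
  have l: "us \<in> lists E" "\<And>n. Y n \<in> lists E" "as \<in> lists E" "bs \<in> lists E" "\<And>n. As n \<in> lists E" "\<And>n. Bs n \<in> lists E"
    using Cons.prems f(5) by (simp_all add: lists_conv_def)
  show ?case
    unfolding f(1) leibniz.simps
    by (intro target.lim_add Cons.IH lists_conv_Cons f Cons.prems always_eventually allI leibniz_in
          Cons_in_lists_iff[THEN iffD2] conjI l assms)
qed

theorem leibniz_family: "smooth_family E' PS' (\<lambda>vs. leibniz T R (rev vs) [] [])"
  unfolding smooth_family_def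
proof (intro conjI ballI allI impI)
  show "leibniz T R (rev vs) [] [] z x \<in> E'" if "vs \<in> lists E" "z \<in> E" "x \<in> U" for vs z x
    using that by (intro leibniz_in) (auto simp: in_lists_conv_set)
  show "lcs_tendsto PS' (diff_quot (leibniz T R (rev vs) [] [] z) x v) (leibniz T R (rev (v # vs)) [] [] z x) (at 0)"
    if "vs \<in> lists E" "z \<in> E" "v \<in> E" "x \<in> U" for vs z v x
    unfolding rev.simps by (rule leibniz_deriv[OF that(2,4,3)]) (use that(1) in \<open>simp_all add: in_lists_conv_set\<close>)
  show "lcs_tendsto PS' (\<lambda>n. leibniz T R (rev (V n)) [] [] (Z n) (X n)) (leibniz T R (rev vs) [] [] z x) sequentially"
    if "lists_conv V vs" "\<forall>n. X n \<in> U" "x \<in> U" "\<forall>n. Z n \<in> E" "z \<in> E" "lcs_tendsto PS X x sequentially"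
      "lcs_tendsto PS Z z sequentially" for V vs X x Z z
    using that by (intro leibniz_cont lists_conv_rev lists_conv_const) simp_all
qed

end

subsection \<open>Closed and exact one-forms\<close>

lemma line_deriv:
  assumes "(diff_quot f (x + s *\<^sub>R h) h \<longlongrightarrow> (d::real)) (at 0)"
  shows "((\<lambda>s. f (x + s *\<^sub>R h)) has_real_derivative d) (at s)"
proof -
  have "diff_quot f (x + s *\<^sub>R h) h = (\<lambda>t. (f (x + (s + t) *\<^sub>R h) - f (x + s *\<^sub>R h)) / t)"
    by (rule ext) (simp add: diff_quot_def scaleR_add_left add.assoc divide_inverse mult.commute)
  with assms show ?thesis unfolding DERIV_def by simp
qed

lemma dir_deriv_real_eq:
  assumes "(diff_quot F x h \<longlongrightarrow> (d::real)) (at 0)"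
  shows "dir_deriv UNIV {abs} F x h = d"
proof -
  have l: "lcs_tendsto {abs} (\<lambda>t. inverse t *\<^sub>R (F (x + t *\<^sub>R h) - F x)) e (at 0) \<longleftrightarrow> (diff_quot F x h \<longlongrightarrow> e) (at 0)" for e
    unfolding diff_quot_def[abs_def] by (rule lcs_tendsto_real)
  show ?thesis
    unfolding dir_deriv_def l
  proof (rule the_equality)
    show "d \<in> UNIV \<and> (diff_quot F x h \<longlongrightarrow> d) (at 0)" using assms by simp
    fix e assume "e \<in> UNIV \<and> (diff_quot F x h \<longlongrightarrow> e) (at 0)"
    then show "e = d" using tendsto_unique[OF at_neq_bot _ assms, of e] by simp
  qed
qed

locale one_form = lcs_domain E PS U for E :: "'v::real_vector set" and PS U +
  fixes D :: "'v list \<Rightarrow> 'v \<Rightarrow> 'v \<Rightarrow> real"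
  assumes D_family: "smooth_family UNIV {abs} D"
    and D_lin: "x \<in> U \<Longrightarrow> z \<in> E \<Longrightarrow> z' \<in> E \<Longrightarrow> D [] (z + t *\<^sub>R z') x = D [] z x + t * D [] z' x"
begin

lemma D_deriv: "vs \<in> lists E \<Longrightarrow> z \<in> E \<Longrightarrow> v \<in> E \<Longrightarrow> x \<in> U \<Longrightarrow> (diff_quot (D vs z) x v \<longlongrightarrow> D (v # vs) z x) (at 0)"
  by (rule smooth_familyD(2)[OF D_family, unfolded lcs_tendsto_real])

lemma D_cont:
  assumes "lists_conv V vs" "\<And>n. X n \<in> U" "x \<in> U" "\<And>n. Z n \<in> E" "z \<in> E"
    "lcs_tendsto PS X x sequentially" "lcs_tendsto PS Z z sequentially"
  shows "(\<lambda>n. D (V n) (Z n) (X n)) \<longlonglongrightarrow> D vs z x"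
  using smooth_familyD(3)[OF D_family assms] unfolding lcs_tendsto_real .

lemma D_lin1:
  assumes x: "x \<in> U" and v: "v \<in> E" and z: "z \<in> E" "z' \<in> E"
  shows "D [v] (z + t *\<^sub>R z') x = D [v] z x + t * D [v] z' x"
proof (rule tendsto_unique[OF at_neq_bot])
  have n: "[] \<in> lists E" by simp
  show "(diff_quot (D [] (z + t *\<^sub>R z')) x v \<longlongrightarrow> D [v] (z + t *\<^sub>R z') x) (at 0)"
    by (rule D_deriv[OF n lincomb[OF z] v x])
  have "((\<lambda>s. diff_quot (D [] z) x v s + t * diff_quot (D [] z') x v s) \<longlongrightarrow> D [v] z x + t * D [v] z' x) (at 0)"
    by (intro tendsto_intros D_deriv n z v x)
  moreover have "\<forall>\<^sub>F s in at 0. diff_quot (D [] z) x v s + t * diff_quot (D [] z') x v s = diff_quot (D [] (z + t *\<^sub>R z')) x v s"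
    using eventually_U[OF x v]
  proof eventually_elim
    case (elim s)
    show ?case unfolding diff_quot_def D_lin[OF elim z] D_lin[OF x z] by (simp add: algebra_simps)
  qed
  ultimately show "(diff_quot (D [] (z + t *\<^sub>R z')) x v \<longlongrightarrow> D [v] z x + t * D [v] z' x) (at 0)"
    by (rule Lim_transform_eventually)
qed

lemma D_lin_scale:
  assumes x: "x \<in> U" and v: "v \<in> E" and z: "z \<in> E"
  shows "D [] 0 x = 0" "D [v] (t *\<^sub>R z) x = t * D [v] z x"
  using D_lin[OF x zero zero, of 1] D_lin1[OF x v zero zero, of 1] D_lin1[OF x v zero z, of t] by simp_all

text \<open>The mixed derivatives of a potential are equal, by restriction to the plane spanned by
  \<open>h\<close> and \<open>k\<close>.\<close>

lemma exact_imp_closed: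
  assumes F: "lcs_smooth E PS U UNIV {abs} F"
    and dF: "\<And>x h. x \<in> U \<Longrightarrow> h \<in> E \<Longrightarrow> dir_deriv UNIV {abs} F x h = D [] h x"
    and x: "x \<in> U" and h: "h \<in> E" and k: "k \<in> E"
  shows "D [k] h x = D [h] k x"
proof -
  obtain DD :: "'v list \<Rightarrow> 'v \<Rightarrow> real" where DD: "(\<forall>x\<in>U. DD [] x = F x) \<and>
    (\<forall>vs\<in>lists E. \<forall>x\<in>U. DD vs x \<in> UNIV) \<and>
    (\<forall>vs\<in>lists E. \<forall>v\<in>E. \<forall>x\<in>U.
      lcs_tendsto {abs} (\<lambda>t. inverse t *\<^sub>R (DD vs (x + t *\<^sub>R v) - DD vs x)) (DD (v # vs) x) (at (0::real))) \<and>
    (\<forall>X V x. \<forall>vs\<in>lists E. (\<forall>n::nat. X n \<in> U) \<and> x \<in> U \<and>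
      (\<forall>n. V n \<in> lists E \<and> length (V n) = length vs) \<and>
      lcs_tendsto PS X x sequentially \<and>
      (\<forall>i<length vs. lcs_tendsto PS (\<lambda>n. V n ! i) (vs ! i) sequentially) \<longrightarrow>
      lcs_tendsto {abs} (\<lambda>n. DD (V n) (X n)) (DD vs x) sequentially)"
    using F unfolding lcs_smooth_def by (elim exE) (rule that)
  have DD0: "DD [] x = F x" if "x \<in> U" for x using conjunct1[OF DD] that by simp
  have DD1: "(diff_quot (DD vs) x v \<longlongrightarrow> DD (v # vs) x) (at 0)" if "vs \<in> lists E" "v \<in> E" "x \<in> U" for vs v x
    using conjunct1[OF conjunct2[OF conjunct2[OF DD]], rule_format, OF that]
    unfolding lcs_tendsto_real diff_quot_def[abs_def] .
  have DD2: "(\<lambda>n. DD vs (X n)) \<longlonglongrightarrow> DD vs x"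
    if "vs \<in> lists E" "\<And>n. X n \<in> U" "x \<in> U" "lcs_tendsto PS X x sequentially" for vs X x
    using conjunct2[OF conjunct2[OF conjunct2[OF DD]], rule_format, of vs X x "\<lambda>n. vs"] that
    unfolding lcs_tendsto_real by simp
  have first: "D [] h x = DD [h] x" if "x \<in> U" "h \<in> E" for x h
  proof -
    have "(diff_quot (DD []) x h \<longlongrightarrow> DD [h] x) (at 0)" by (rule DD1) (use that in simp_all)
    moreover have "\<forall>\<^sub>F t in at 0. diff_quot (DD []) x h t = diff_quot F x h t"
      using eventually_U[OF that] by eventually_elim (simp add: diff_quot_def DD0 that)
    ultimately have "(diff_quot F x h \<longlongrightarrow> DD [h] x) (at 0)" by (rule Lim_transform_eventually)
    from dir_deriv_real_eq[OF this] dF[OF that] show ?thesis by simp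
  qed
  have second: "D [k] h x = DD [k, h] x" if h: "h \<in> E" and k: "k \<in> E" for h k
  proof (rule tendsto_unique[OF at_neq_bot])
    show "(diff_quot (D [] h) x k \<longlongrightarrow> D [k] h x) (at 0)" by (rule D_deriv) (use x h k in simp_all)
    have "(diff_quot (DD [h]) x k \<longlongrightarrow> DD [k, h] x) (at 0)" by (rule DD1) (use x h k in simp_all)
    moreover have "\<forall>\<^sub>F t in at 0. diff_quot (DD [h]) x k t = diff_quot (D [] h) x k t"
      using eventually_U[OF x k] by eventually_elim (simp add: diff_quot_def first x h)
    ultimately show "(diff_quot (D [] h) x k \<longlongrightarrow> DD [k, h] x) (at 0)" by (rule Lim_transform_eventually)
  qed
  define y where "y s t = x + s *\<^sub>R h + t *\<^sub>R k" for s t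
  \<comment> \<open>Twice the directions, since \<open>y s t\<close> is the midpoint of \<open>x + 2 s
    h\<close> and \<open>x + 2 t k\<close>.\<close>
  obtain d1 where d1: "d1 > 0" "\<forall>t. \<bar>t\<bar> < d1 \<longrightarrow> x + t *\<^sub>R (2 *\<^sub>R h) \<in> U"
    using U_open[OF x scaleR[OF h, of 2]] by (elim exE conjE) (rule that)
  obtain d2 where d2: "d2 > 0" "\<forall>t. \<bar>t\<bar> < d2 \<longrightarrow> x + t *\<^sub>R (2 *\<^sub>R k) \<in> U"
    using U_open[OF x scaleR[OF k, of 2]] by (elim exE conjE) (rule that)
  define \<delta> where "\<delta> = min d1 d2"
  have \<delta>: "\<delta> > 0" using d1 d2 by (simp add: \<delta>_def)
  have yU: "y s t \<in> U" if "\<bar>s\<bar> < \<delta>" "\<bar>t\<bar> < \<delta>" for s t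
  proof -
    have "x + s *\<^sub>R (2 *\<^sub>R h) \<in> U" "x + t *\<^sub>R (2 *\<^sub>R k) \<in> U" using that d1(2) d2(2) by (simp_all add: \<delta>_def)
    from U_convex[OF this, of "1/2"]
    have "x + s *\<^sub>R (2 *\<^sub>R h) + (1/2) *\<^sub>R (x + t *\<^sub>R (2 *\<^sub>R k) - (x + s *\<^sub>R (2 *\<^sub>R h))) \<in> U" by simp
    moreover have "x + s *\<^sub>R (2 *\<^sub>R h) + (1/2) *\<^sub>R (x + t *\<^sub>R (2 *\<^sub>R k) - (x + s *\<^sub>R (2 *\<^sub>R h))) = y s t"
      by (simp add: y_def scaleR_right_diff_distrib scaleR_add_right)
        (simp add: algebra_simps scaleR_add_left[symmetric] flip: scaleR_add_left)
    ultimately show ?thesis by simp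
  qed
  have ds: "((\<lambda>s. DD vs (y s t)) has_real_derivative DD (h # vs) (y s t)) (at s)"
    if "\<bar>s\<bar> < \<delta>" "\<bar>t\<bar> < \<delta>" "vs \<in> lists E" for vs s t
  proof -
    have e: "y s t = (x + t *\<^sub>R k) + s *\<^sub>R h" for s by (simp add: y_def algebra_simps)
    show ?thesis unfolding e by (rule line_deriv, rule DD1[OF that(3) h]) (use yU[OF that(1,2)] e in simp)
  qed
  have dt: "((\<lambda>t. DD vs (y s t)) has_real_derivative DD (k # vs) (y s t)) (at t)"
    if "\<bar>s\<bar> < \<delta>" "\<bar>t\<bar> < \<delta>" "vs \<in> lists E" for vs s t
    unfolding y_def by (rule line_deriv, rule DD1[OF that(3) k]) (use yU[OF that(1,2)] y_def in simp)
  have cont: "(\<lambda>n. DD vs (y (s n) (t n))) \<longlonglongrightarrow> DD vs (y 0 0)"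
    if "s \<longlonglongrightarrow> 0" "t \<longlonglongrightarrow> 0" "\<And>n. \<bar>s n\<bar> < \<delta>" "\<And>n. \<bar>t n\<bar> < \<delta>" "vs \<in> lists E" for s t vs
  proof (rule DD2[OF that(5) yU[OF that(3,4)] yU])
    have "lcs_tendsto PS (\<lambda>n. x + s n *\<^sub>R h) (x + 0 *\<^sub>R h) sequentially"
      by (rule tendsto_line[OF that(1) U_sub[OF x] h])
    from lim_lincomb[OF this lim_const that(2) _ _ _ k]
    show "lcs_tendsto PS (\<lambda>n. y (s n) (t n)) (y 0 0) sequentially"
      unfolding y_def using U_sub[OF x] h k lincomb by simp
  qed (use \<delta> in simp_all)
  have "DD [k, h] (y 0 0) = DD [h, k] (y 0 0)"
  proof (rule mixed_partials_eq[OF \<delta>, of "\<lambda>s t. DD [] (y s t)" "\<lambda>s t. DD [h] (y s t)" "\<lambda>s t. DD [k, h] (y s t)"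
        "\<lambda>s t. DD [k] (y s t)" "\<lambda>s t. DD [h, k] (y s t)"])
    fix s t :: real assume st: "\<bar>s\<bar> < \<delta>" "\<bar>t\<bar> < \<delta>"
    show "((\<lambda>s. DD [] (y s t)) has_real_derivative DD [h] (y s t)) (at s)" by (rule ds[OF st]) simp
    show "((\<lambda>t. DD [h] (y s t)) has_real_derivative DD [k, h] (y s t)) (at t)" by (rule dt[OF st]) (simp add: h)
    show "((\<lambda>t. DD [] (y s t)) has_real_derivative DD [k] (y s t)) (at t)" by (rule dt[OF st]) simp
    show "((\<lambda>s. DD [k] (y s t)) has_real_derivative DD [h, k] (y s t)) (at s)" by (rule ds[OF st]) (simp add: k)
  next
    fix s t :: "nat \<Rightarrow> real" assume st: "s \<longlonglongrightarrow> 0" "t \<longlonglongrightarrow> 0" "\<And>n. \<bar>s n\<bar> < \<delta>" "\<And>n. \<bar>t n\<bar> < \<delta>"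
    show "(\<lambda>n. DD [k, h] (y (s n) (t n))) \<longlonglongrightarrow> DD [k, h] (y 0 0)" by (rule cont[OF st]) (simp add: h k)
    show "(\<lambda>n. DD [h, k] (y (s n) (t n))) \<longlonglongrightarrow> DD [h, k] (y 0 0)" by (rule cont[OF st]) (simp add: h k)
  qed
  then show ?thesis using second[OF h k] second[OF k h] by (simp add: y_def)
qed

text \<open>Line integral along the segment from the base point.\<close>

definition potential :: "'v \<Rightarrow> 'v \<Rightarrow> real"
  where "potential x0 x = integral {0..1} (\<lambda>t. D [] (x - x0) (x0 + t *\<^sub>R (x - x0)))"

text \<open>Differentiation under the integral sign yields \<open>\<integral> t D\<omega>(h)(x -
  x\<^sub>0) + \<omega>(h)\<close> along the segment; by closedness the integrand is the
  derivative of \<open>t \<omega>(h)\<close> with respect to \<open>t\<close>.\<close>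

lemma potential_deriv:
  assumes closed: "\<And>x h k. x \<in> U \<Longrightarrow> h \<in> E \<Longrightarrow> k \<in> E \<Longrightarrow> D [k] h x = D [h] k x"
    and x0: "x0 \<in> U" and x: "x \<in> U" and h: "h \<in> E"
  shows "(diff_quot (potential x0) x h \<longlongrightarrow> D [] h x) (at 0)"
proof -
  obtain \<delta> where \<delta>: "\<delta> > 0" "\<forall>t. \<bar>t\<bar> < \<delta> \<longrightarrow> x + t *\<^sub>R h \<in> U"
    using U_open[OF x h] by (elim exE conjE) (rule that)
  let ?I = "{-\<delta><..<\<delta>}"
  define a where "a = x - x0"
  have aE: "a \<in> E" unfolding a_def by (intro diff U_sub x x0)
  have x0E: "x0 \<in> E" by (rule U_sub[OF x0])
  define u where "u s = a + s *\<^sub>R h" for s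
  have uE: "u s \<in> E" for s unfolding u_def by (rule lincomb[OF aE h])
  define \<gamma> where "\<gamma> s t = x0 + t *\<^sub>R u s" for s t
  have \<gamma>U: "\<gamma> s t \<in> U" if "s \<in> ?I" "t \<in> cbox 0 1" for s t
  proof -
    have "x + s *\<^sub>R h \<in> U" using \<delta>(2) that(1) by (simp add: abs_less_iff)
    from U_convex[OF x0 this, of t] that(2) have "x0 + t *\<^sub>R (x + s *\<^sub>R h - x0) \<in> U" by simp
    then show ?thesis by (simp add: \<gamma>_def u_def a_def algebra_simps)
  qed
  define f where "f s t = D [] (u s) (\<gamma> s t)" for s t
  \<comment> \<open>By linearity of the form, \<open>f s t = \<omega>(a) + s \<omega>(h)\<close> at
    \<open>\<gamma> s t\<close>; a derivative in the vector slot is avoided in this way.\<close>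
  define f' where "f' s t = D [t *\<^sub>R h] a (\<gamma> s t) + (s * D [t *\<^sub>R h] h (\<gamma> s t) + D [] h (\<gamma> s t))" for s t
  have nil: "[] \<in> lists E" by simp
  have along: "((\<lambda>s. D [] z (\<gamma> s t)) has_real_derivative D [t *\<^sub>R h] z (\<gamma> s t)) (at s)"
    if "s \<in> ?I" "t \<in> cbox 0 1" "z \<in> E" for s t z
  proof -
    have e: "\<gamma> s t = (x0 + t *\<^sub>R a) + s *\<^sub>R (t *\<^sub>R h)" for s by (simp add: \<gamma>_def u_def algebra_simps)
    show ?thesis unfolding e by (rule line_deriv, rule D_deriv[OF nil that(3) scaleR[OF h]]) (use \<gamma>U[OF that(1,2)] e in simp)
  qed
  have f_eq: "f s t = D [] a (\<gamma> s t) + s * D [] h (\<gamma> s t)" if "s \<in> ?I" "t \<in> cbox 0 1" for s t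
    unfolding f_def u_def by (rule D_lin[OF \<gamma>U[OF that] aE h])
  have f_deriv: "((\<lambda>s. f s t) has_real_derivative f' s t) (at s within ?I)" if st: "s \<in> ?I" "t \<in> cbox 0 1" for s t
  proof -
    have "((\<lambda>s. D [] a (\<gamma> s t) + s * D [] h (\<gamma> s t)) has_real_derivative
        D [t *\<^sub>R h] a (\<gamma> s t) + (s * D [t *\<^sub>R h] h (\<gamma> s t) + 1 * D [] h (\<gamma> s t))) (at s)"
      using DERIV_add[OF along[OF st aE] DERIV_mult[OF DERIV_ident along[OF st h]]] by (simp add: ac_simps)
    then have "((\<lambda>s. f s t) has_real_derivative f' s t) (at s)"
      unfolding f'_def mult_1
      by (rule has_field_derivative_transform_within_open[where S = ?I]) (use st f_eq in simp_all)
    then show ?thesis by (rule has_field_derivative_at_within)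
  qed
  have \<gamma>_lim: "lcs_tendsto PS (\<lambda>n. \<gamma> (s n) (t n)) (\<gamma> l m) sequentially" if "s \<longlonglongrightarrow> l" "t \<longlonglongrightarrow> m" for s t l m
    unfolding \<gamma>_def
    by (rule lim_lincomb[OF lim_const _ that(2)]) (use tendsto_line[OF that(1) aE h] uE x0E in \<open>simp_all add: u_def\<close>)
  have cont2: "continuous_on (?I \<times> cbox 0 1) (\<lambda>(s, t). D (V t) z (\<gamma> s t))"
    if V: "\<And>s l. s \<longlonglongrightarrow> l \<Longrightarrow> lists_conv (\<lambda>n. V (s n)) (V l)" and z: "z \<in> E" for V :: "real \<Rightarrow> 'v list" and z
    unfolding continuous_on_sequentially
  proof (intro ballI allI impI, elim conjE)
    fix q p assume p: "p \<in> ?I \<times> cbox (0::real) 1" and q: "\<forall>n. q n \<in> ?I \<times> cbox 0 1" "q \<longlonglongrightarrow> p"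
    have "(\<lambda>n. D (V (snd (q n))) z (\<gamma> (fst (q n)) (snd (q n)))) \<longlonglongrightarrow> D (V (snd p)) z (\<gamma> (fst p) (snd p))"
    proof (rule D_cont[OF V[OF tendsto_snd[OF q(2)]] _ _ _ _ \<gamma>_lim[OF tendsto_fst[OF q(2)] tendsto_snd[OF q(2)]] lim_const])
      show "\<gamma> (fst (q n)) (snd (q n)) \<in> U" for n using q(1)[rule_format, of n] by (intro \<gamma>U) (simp_all add: mem_Times_iff)
      show "\<gamma> (fst p) (snd p) \<in> U" using p by (intro \<gamma>U) (simp_all add: mem_Times_iff)
    qed (use z in simp_all)
    then show "((\<lambda>(s, t). D (V t) z (\<gamma> s t)) \<circ> q) \<longlonglongrightarrow> (\<lambda>(s, t). D (V t) z (\<gamma> s t)) p"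
      by (simp add: comp_def case_prod_unfold)
  qed
  have V1: "lists_conv (\<lambda>n. [s n *\<^sub>R h]) [l *\<^sub>R h]" if "s \<longlonglongrightarrow> l" for s l
    using tendsto_line[OF that zero h] by (intro lists_conv_Cons scaleR h lists_conv_const) simp_all
  have V0: "lists_conv (\<lambda>n. []) []" by (rule lists_conv_const) simp
  note c = cont2[of "\<lambda>t. [t *\<^sub>R h]", OF V1, unfolded case_prod_unfold] cont2[of "\<lambda>t. []", OF V0, unfolded case_prod_unfold]
  have cont_f': "continuous_on (?I \<times> cbox 0 1) (\<lambda>(s, t). f' s t)"
    unfolding f'_def case_prod_unfold
    by (intro continuous_on_add continuous_on_mult continuous_on_fst continuous_on_id c aE h)
  have int_f: "f s integrable_on cbox 0 1" if s: "s \<in> ?I" for s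
  proof (rule integrable_continuous)
    have "continuous_on (cbox 0 1) (\<lambda>t. (\<lambda>(s, t). D [] z (\<gamma> s t)) (s, t))" if z: "z \<in> E" for z
      by (rule continuous_on_compose2[OF cont2[of "\<lambda>t. []", OF V0 z]]) (use s in \<open>auto intro!: continuous_intros\<close>)
    then show "continuous_on (cbox 0 1) (f s)" unfolding f_def[abs_def] using uE by simp
  qed
  have "((\<lambda>s. integral (cbox 0 1) (f s)) has_field_derivative integral (cbox 0 1) (f' 0)) (at 0 within ?I)"
    by (rule leibniz_rule_field_derivative[OF f_deriv int_f cont_f']) (use \<delta> in simp_all)
  then have deriv: "((\<lambda>s. integral (cbox 0 1) (f s)) has_real_derivative integral (cbox 0 1) (f' 0)) (at 0)"
    using at_within_open[of "0::real" ?I] \<delta>(1) by simp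
  have "(f' 0 has_integral (1 * D [] h (\<gamma> 0 1) - 0 * D [] h (\<gamma> 0 0))) {0..1}"
  proof (rule fundamental_theorem_of_calculus)
    fix t :: real assume t: "t \<in> {0..1}"
    then have t': "t \<in> cbox 0 1" and s0: "0 \<in> ?I" using \<delta>(1) by simp_all
    note U = \<gamma>U[OF s0 t']
    have d: "((\<lambda>t. D [] h (x0 + t *\<^sub>R u 0)) has_real_derivative D [u 0] h (\<gamma> 0 t)) (at t)"
      unfolding \<gamma>_def by (rule line_deriv, rule D_deriv[OF nil h uE]) (use U \<gamma>_def in simp)
    have "((\<lambda>t. t * D [] h (\<gamma> 0 t)) has_real_derivative t * D [u 0] h (\<gamma> 0 t) + 1 * D [] h (\<gamma> 0 t)) (at t)"
      using DERIV_mult[OF DERIV_ident d[folded \<gamma>_def]] by (simp add: ac_simps)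
    moreover have "t * D [u 0] h (\<gamma> 0 t) + 1 * D [] h (\<gamma> 0 t) = f' 0 t"
      using closed[OF U aE scaleR[OF h, of t]] D_lin_scale(2)[OF U aE h, of t] by (simp add: f'_def u_def)
    ultimately have "((\<lambda>t. t * D [] h (\<gamma> 0 t)) has_real_derivative f' 0 t) (at t)" by simp
    then show "((\<lambda>t. t * D [] h (\<gamma> 0 t)) has_vector_derivative f' 0 t) (at t within {0..1})"
      using has_field_derivative_at_within has_real_derivative_iff_has_vector_derivative by metis
  qed simp
  then have I: "integral (cbox 0 1) (f' 0) = D [] h x"
    by (simp add: integral_unique \<gamma>_def u_def a_def)
  have pot: "potential x0 (x + s *\<^sub>R h) = integral (cbox 0 1) (f s)" for s
    unfolding potential_def f_def[abs_def] \<gamma>_def u_def a_def by (simp add: algebra_simps)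
  have "diff_quot (potential x0) x h = (\<lambda>t. (integral (cbox 0 1) (f (0 + t)) - integral (cbox 0 1) (f 0)) / t)"
    unfolding diff_quot_def using pot pot[of 0] by (simp add: fun_eq_iff divide_inverse mult.commute)
  then show ?thesis using deriv unfolding DERIV_def I by simp
qed

text \<open>The higher derivatives of the potential are those of the one-form, the direction taken first
  being the vector it is applied to. Continuity of the potential itself follows from the mean
  value theorem.\<close>

lemma potential_smooth:
  assumes closed: "\<And>x h k. x \<in> U \<Longrightarrow> h \<in> E \<Longrightarrow> k \<in> E \<Longrightarrow> D [k] h x = D [h] k x"
    and x0: "x0 \<in> U"
  shows "lcs_smooth E PS U UNIV {abs} (potential x0)"
proof -
  let ?F = "potential x0"
  define DD where "DD vs x = (if vs = [] then ?F x else D (butlast vs) (last vs) x)" for vs x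
  have dF: "(diff_quot ?F x h \<longlongrightarrow> D [] h x) (at 0)" if "x \<in> U" "h \<in> E" for x h
    by (rule potential_deriv[OF closed x0 that])
  have lastE: "last vs \<in> E" and butlastE: "butlast vs \<in> lists E" if "vs \<in> lists E" "vs \<noteq> []" for vs
    using that last_in_set[of vs] in_set_butlastD[of _ vs] by (auto simp: in_lists_conv_set)
  show ?thesis
    unfolding lcs_smooth_def
  proof (intro exI[of _ DD] conjI ballI allI impI)
    show "DD [] x = ?F x" for x by (simp add: DD_def)
    show "DD vs x \<in> UNIV" for vs x by simp
    fix vs assume vs: "vs \<in> lists E"
    show "lcs_tendsto {abs} (\<lambda>t. inverse t *\<^sub>R (DD vs (x + t *\<^sub>R v) - DD vs x)) (DD (v # vs) x) (at 0)"
      if "v \<in> E" "x \<in> U" for v x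
    proof (cases "vs = []")
      case True
      then have "DD vs = ?F" by (simp add: DD_def fun_eq_iff)
      then show ?thesis
        using dF[OF that(2,1)] unfolding lcs_tendsto_real diff_quot_def[abs_def] True by (simp add: DD_def)
    next
      case False
      then have "DD vs = D (butlast vs) (last vs)" by (simp add: DD_def fun_eq_iff)
      then show ?thesis
        using D_deriv[OF butlastE[OF vs False] lastE[OF vs False] that] False
        unfolding lcs_tendsto_real diff_quot_def[abs_def] by (simp add: DD_def)
    qed
    fix X V x
    assume *: "(\<forall>n::nat. X n \<in> U) \<and> x \<in> U \<and> (\<forall>n. V n \<in> lists E \<and> length (V n) = length vs) \<and>
      lcs_tendsto PS X x sequentially \<and> (\<forall>i<length vs. lcs_tendsto PS (\<lambda>n. V n ! i) (vs ! i) sequentially)"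
    show "lcs_tendsto {abs} (\<lambda>n. DD (V n) (X n)) (DD vs x) sequentially"
      unfolding lcs_tendsto_real
    proof (cases "vs = []")
      case False
      have VE: "V n \<noteq> []" "V n \<in> lists E" for n
      proof -
        have "length (V n) = length vs" and "V n \<in> lists E" using * by simp_all
        then show "V n \<noteq> []" "V n \<in> lists E" using False by auto
      qed
      have V: "DD (V n) (X n) = D (butlast (V n)) (last (V n)) (X n)" for n using VE by (simp add: DD_def)
      have "(\<lambda>n. D (butlast (V n)) (last (V n)) (X n)) \<longlonglongrightarrow> D (butlast vs) (last vs) x"
      proof (rule D_cont)
        show "lists_conv (\<lambda>n. butlast (V n)) (butlast vs)"
          unfolding lists_conv_def using * butlastE VE vs False by (simp add: nth_butlast)
        show "last (V n) \<in> E" for n by (rule lastE[OF VE(2,1)])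
        have "length vs - 1 < length vs" using False by simp
        then have "lcs_tendsto PS (\<lambda>n. V n ! (length vs - 1)) (vs ! (length vs - 1)) sequentially" using * by simp
        then show "lcs_tendsto PS (\<lambda>n. last (V n)) (last vs) sequentially"
          using * by (simp add: last_conv_nth[OF False] last_conv_nth[OF VE(1)])
      qed (use * lastE[OF vs False] in simp_all)
      then show "(\<lambda>n. DD (V n) (X n)) \<longlonglongrightarrow> DD vs x" unfolding V using False by (simp add: DD_def)
    next
      case True
      then have V: "V n = []" for n using * by simp
      have XU: "X n \<in> U" and xU: "x \<in> U" and X: "lcs_tendsto PS X x sequentially" for n using * by simp_all
      have XE: "X n \<in> E" and xE: "x \<in> E" for n using U_sub XU xU by simp_all
      have "\<exists>\<theta>. 0 < \<theta> \<and> \<theta> < 1 \<and> ?F (X n) - ?F x = D [] (X n - x) (x + \<theta> *\<^sub>R (X n - x))" for n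
      proof -
        have "\<exists>z>0. z < 1 \<and> ?F (x + 1 *\<^sub>R (X n - x)) - ?F (x + 0 *\<^sub>R (X n - x)) = (1 - 0) * D [] (X n - x) (x + z *\<^sub>R (X n - x))"
        proof (rule MVT2)
          fix s :: real assume s: "0 \<le> s" "s \<le> 1"
          show "((\<lambda>s. ?F (x + s *\<^sub>R (X n - x))) has_real_derivative D [] (X n - x) (x + s *\<^sub>R (X n - x))) (at s)"
            by (rule line_deriv, rule dF[OF U_convex[OF xU XU s] diff[OF XE xE]])
        qed simp
        then show ?thesis by simp
      qed
      then obtain \<theta> where \<theta>: "\<And>n. 0 < \<theta> n" "\<And>n. \<theta> n < 1"
        "\<And>n. ?F (X n) - ?F x = D [] (X n - x) (x + \<theta> n *\<^sub>R (X n - x))" by metis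
      have lim0: "lcs_tendsto PS (\<lambda>n. X n - x) 0 sequentially" using X by (simp add: lcs_tendsto_def)
      have "lcs_tendsto PS (\<lambda>n. x + \<theta> n *\<^sub>R (X n - x)) x sequentially"
        unfolding lcs_tendsto_def
      proof
        fix p assume p: "p \<in> PS"
        have l: "(\<lambda>n. p (X n - x)) \<longlonglongrightarrow> 0" using X p by (simp add: lcs_tendsto_def)
        show "(\<lambda>n. p (x + \<theta> n *\<^sub>R (X n - x) - x)) \<longlonglongrightarrow> 0"
        proof (rule tendsto_sandwich[OF _ _ tendsto_const l])
          have "0 \<le> p (\<theta> n *\<^sub>R (X n - x))" "p (\<theta> n *\<^sub>R (X n - x)) \<le> p (X n - x)" for n
          proof -
            show "0 \<le> p (\<theta> n *\<^sub>R (X n - x))" by (intro nonneg[OF p] scaleR diff XE xE)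
            have "p (\<theta> n *\<^sub>R (X n - x)) \<le> \<bar>\<theta> n\<bar> * p (X n - x)" by (intro scale[OF p] diff XE xE)
            also have "\<dots> \<le> 1 * p (X n - x)"
              using \<theta>(1,2)[of n] nonneg[OF p diff[OF XE[of n] xE]] by (intro mult_right_mono) simp_all
            finally show "p (\<theta> n *\<^sub>R (X n - x)) \<le> p (X n - x)" by simp
          qed
          then show "\<forall>\<^sub>F n in sequentially. 0 \<le> p (x + \<theta> n *\<^sub>R (X n - x) - x)"
            "\<forall>\<^sub>F n in sequentially. p (x + \<theta> n *\<^sub>R (X n - x) - x) \<le> p (X n - x)" by simp_all
        qed
      qed
      then have "(\<lambda>n. D [] (X n - x) (x + \<theta> n *\<^sub>R (X n - x))) \<longlonglongrightarrow> D [] 0 x"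
        by (intro D_cont lists_conv_const lim0 zero diff XE xE xU U_convex XU less_imp_le \<theta>) simp_all
      then have "(\<lambda>n. ?F (X n) - ?F x) \<longlonglongrightarrow> 0" using \<theta>(3) D_lin_scale(1)[OF xU zero zero] by simp
      then show "(\<lambda>n. DD (V n) (X n)) \<longlonglongrightarrow> DD vs x"
        using LIM_zero_cancel by (simp add: DD_def True V LIM_zero_iff)
    qed
  qed
qed

theorem exact_iff_closed:
  "(\<exists>F. lcs_smooth E PS U UNIV {abs} F \<and> (\<forall>x\<in>U. \<forall>h\<in>E. dir_deriv UNIV {abs} F x h = D [] h x)) \<longleftrightarrow>
    (\<forall>x\<in>U. \<forall>h\<in>E. \<forall>k\<in>E. D [k] h x = D [h] k x)"
proof
  assume "\<exists>F. lcs_smooth E PS U UNIV {abs} F \<and> (\<forall>x\<in>U. \<forall>h\<in>E. dir_deriv UNIV {abs} F x h = D [] h x)"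
  then obtain F where "lcs_smooth E PS U UNIV {abs} F" "\<forall>x\<in>U. \<forall>h\<in>E. dir_deriv UNIV {abs} F x h = D [] h x"
    by (elim exE conjE)
  then show "\<forall>x\<in>U. \<forall>h\<in>E. \<forall>k\<in>E. D [k] h x = D [h] k x"
    by (intro ballI exact_imp_closed[of F]) simp_all
next
  assume *: "\<forall>x\<in>U. \<forall>h\<in>E. \<forall>k\<in>E. D [k] h x = D [h] k x"
  show "\<exists>F. lcs_smooth E PS U UNIV {abs} F \<and> (\<forall>x\<in>U. \<forall>h\<in>E. dir_deriv UNIV {abs} F x h = D [] h x)"
  proof (cases "U = {}")
    case True
    then show ?thesis by (intro exI[of _ "\<lambda>_. 0"]) (simp add: lcs_smooth_def)
  next
    case False
    then obtain x0 where x0: "x0 \<in> U" by blast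
    have c: "D [k] h x = D [h] k x" if "x \<in> U" "h \<in> E" "k \<in> E" for x h k using * that by simp
    show ?thesis
      by (intro exI[of _ "potential x0"] conjI ballI potential_smooth[OF c x0] dir_deriv_real_eq potential_deriv[OF c x0])
  qed
qed

end

section \<open>Integration\<close>

context compact_manifold
begin

text \<open>The charts and functions chosen in the definition of the volume integral.\<close>

definition Cs :: "('a, 'n) chart set"
  where "Cs = fst (SOME (C, \<rho>). partition_of_unity A C \<rho>)"

definition \<rho>s :: "('a, 'n) chart \<Rightarrow> 'a \<Rightarrow> real"
  where "\<rho>s = snd (SOME (C, \<rho>). partition_of_unity A C \<rho>)"

lemma partition: "partition_of_unity A Cs \<rho>s"
proof -
  obtain C \<rho> where "partition_of_unity A C \<rho>" using partition_of_unity_exists by (elim exE)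
  then have "case (C, \<rho>) of (C, \<rho>) \<Rightarrow> partition_of_unity A C \<rho>" by simp
  from someI[of "\<lambda>(C, \<rho>). partition_of_unity A C \<rho>", OF this]
  show ?thesis unfolding Cs_def \<rho>s_def by (simp add: case_prod_unfold)
qed

lemma Cs_A: "c \<in> Cs \<Longrightarrow> c \<in> A" and finite_Cs: "finite Cs"
  and \<rho>_smooth: "c \<in> Cs \<Longrightarrow> smooth_fun_on_manifold A (\<rho>s c)"
  and \<rho>_supp: "c \<in> Cs \<Longrightarrow> closure {x. \<rho>s c x \<noteq> 0} \<subseteq> fst c"
  and \<rho>_sum: "(\<Sum>c\<in>Cs. \<rho>s c p) = 1"
  using partition unfolding partition_of_unity_def by (simp_all add: subset_iff)

text \<open>The supports in coordinates. They are compact and cover the manifold, so convergence on all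
  of them is what integrals and the positivity of metrics depend on.\<close>

definition Ks :: "('a, 'n) chart \<Rightarrow> (real ^ 'n) set"
  where "Ks c = snd c ` closure {x. \<rho>s c x \<noteq> 0}"

lemma compact_Ks: "c \<in> Cs \<Longrightarrow> compact (Ks c)"
  and Ks_sub: "c \<in> Cs \<Longrightarrow> Ks c \<subseteq> chart_image c"
proof -
  assume c: "c \<in> Cs"
  have "compact (UNIV \<inter> closure {x. \<rho>s c x \<noteq> 0})" using compact_Int_closed[OF compact_M closed_closure] .
  then show "compact (Ks c)"
    unfolding Ks_def
    by (intro compact_continuous_image continuous_on_subset[OF chart_continuous[OF Cs_A[OF c]] \<rho>_supp[OF c]]) simp
  show "Ks c \<subseteq> chart_image c" unfolding Ks_def chart_image_def by (rule image_mono[OF \<rho>_supp[OF c]])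
qed

lemma \<rho>_zero:
  assumes c: "c \<in> Cs" and x: "x \<in> chart_image c" "x \<notin> Ks c"
  shows "\<rho>s c (chart_inv c x) = 0"
proof (rule ccontr)
  assume "\<rho>s c (chart_inv c x) \<noteq> 0"
  then have "chart_inv c x \<in> closure {x. \<rho>s c x \<noteq> 0}" by (intro subsetD[OF closure_subset]) simp
  then have "snd c (chart_inv c x) \<in> Ks c" unfolding Ks_def by (rule imageI)
  then show False using x chart_inv_right[OF Cs_A[OF c] x(1)] by simp
qed

lemma Ks_cover: "\<exists>c\<in>Cs. p \<in> fst c \<and> snd c p \<in> Ks c"
proof -
  have "(\<Sum>c\<in>Cs. \<rho>s c p) \<noteq> 0" by (simp add: \<rho>_sum)
  then obtain c where c: "c \<in> Cs" "\<rho>s c p \<noteq> 0" by (rule sum.not_neutral_contains_not_neutral)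
  then have "p \<in> closure {x. \<rho>s c x \<noteq> 0}" by (intro subsetD[OF closure_subset]) simp
  then have "p \<in> fst c" "snd c p \<in> Ks c" using \<rho>_supp[OF c(1)] unfolding Ks_def by (rule_tac subsetD, simp_all)
  then show ?thesis using c(1) by (intro bexI[of _ c] conjI)
qed

definition intc :: "('a, 'n) chart \<Rightarrow> (real ^ 'n \<Rightarrow> real) \<Rightarrow> real"
  where "intc c f = (LINT x:chart_image c|lborel. \<rho>s c (chart_inv c x) * f x)"

lemma integral_vol_eq: "integral_vol A g f = (\<Sum>c\<in>Cs. intc c (\<lambda>x. f c x * sqrt (det (g c x))))"
  unfolding integral_vol_def intc_def Cs_def \<rho>s_def by (simp add: case_prod_unfold Let_def mult.assoc)

lemma intc_Ks:
  assumes c: "c \<in> Cs"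
  shows "intc c f = (\<integral>x. indicator (Ks c) x *\<^sub>R (\<rho>s c (chart_inv c x) * f x) \<partial>lborel)"
  unfolding intc_def set_lebesgue_integral_def
proof (rule Bochner_Integration.integral_cong[OF refl])
  fix x
  show "indicator (chart_image c) x *\<^sub>R (\<rho>s c (chart_inv c x) * f x) = indicator (Ks c) x *\<^sub>R (\<rho>s c (chart_inv c x) * f x)"
    using \<rho>_zero[OF c, of x] Ks_sub[OF c] by (auto simp: indicator_def)
qed

lemma \<rho>_continuous: "c \<in> Cs \<Longrightarrow> continuous_on (Ks c) (\<lambda>x. \<rho>s c (chart_inv c x))"
proof -
  assume c: "c \<in> Cs"
  have "smooth_on (chart_image c) (\<rho>s c \<circ> chart_inv c)"
    using \<rho>_smooth[OF c] Cs_A[OF c] unfolding smooth_fun_on_manifold_def by simp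
  from continuous_on_subset[OF smooth_on_continuous[OF this] Ks_sub[OF c]] show ?thesis by (simp add: comp_def)
qed

lemma intc_integrable:
  assumes c: "c \<in> Cs" and f: "continuous_on (Ks c) f"
  shows "integrable lborel (\<lambda>x. indicator (Ks c) x *\<^sub>R (\<rho>s c (chart_inv c x) * f x))"
  by (intro borel_integrable_compact compact_Ks continuous_on_mult \<rho>_continuous c f)

lemma intc_lincomb:
  assumes c: "c \<in> Cs" and f: "continuous_on (Ks c) f" and g: "continuous_on (Ks c) g"
  shows "intc c (\<lambda>x. f x + r * g x) = intc c f + r * intc c g"
proof -
  have "(\<lambda>x. indicator (Ks c) x *\<^sub>R (\<rho>s c (chart_inv c x) * (f x + r * g x))) =
    (\<lambda>x. indicator (Ks c) x *\<^sub>R (\<rho>s c (chart_inv c x) * f x) + r * (indicator (Ks c) x *\<^sub>R (\<rho>s c (chart_inv c x) * g x)))"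
    by (rule ext) (simp add: algebra_simps)
  then show ?thesis
    unfolding intc_Ks[OF c]
    using Bochner_Integration.integral_add[OF intc_integrable[OF c f] integrable_mult_right[OF intc_integrable[OF c g]], of r]
    by simp
qed

lemma intc_cong:
  assumes c: "c \<in> Cs" and "\<And>x. x \<in> Ks c \<Longrightarrow> f x = g x"
  shows "intc c f = intc c g"
  unfolding intc_Ks[OF c] by (rule Bochner_Integration.integral_cong[OF refl]) (simp add: indicator_def assms(2))

lemma intc_bound:
  assumes c: "c \<in> Cs" and f: "continuous_on (Ks c) f" and B: "\<And>x. x \<in> Ks c \<Longrightarrow> \<bar>f x\<bar> \<le> B"
  shows "\<bar>intc c f\<bar> \<le> B * (\<integral>x. indicator (Ks c) x *\<^sub>R \<bar>\<rho>s c (chart_inv c x)\<bar> \<partial>lborel)"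
proof -
  have i: "integrable lborel (\<lambda>x. indicator (Ks c) x *\<^sub>R \<bar>\<rho>s c (chart_inv c x)\<bar>)"
    by (intro borel_integrable_compact compact_Ks continuous_on_rabs \<rho>_continuous c)
  have "\<bar>intc c f\<bar> \<le> (\<integral>x. norm (indicator (Ks c) x *\<^sub>R (\<rho>s c (chart_inv c x) * f x)) \<partial>lborel)"
    unfolding intc_Ks[OF c] real_norm_def[symmetric] by (rule integral_norm_bound)
  also have "\<dots> \<le> (\<integral>x. B * (indicator (Ks c) x *\<^sub>R \<bar>\<rho>s c (chart_inv c x)\<bar>) \<partial>lborel)"
  proof (rule integral_mono[OF integrable_norm[OF intc_integrable[OF c f]] integrable_mult_right[OF i]])
    fix x
    show "norm (indicator (Ks c) x *\<^sub>R (\<rho>s c (chart_inv c x) * f x)) \<le> B * (indicator (Ks c) x *\<^sub>R \<bar>\<rho>s c (chart_inv c x)\<bar>)"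
    proof (cases "x \<in> Ks c")
      case True
      then show ?thesis using mult_right_mono[OF B[OF True] abs_ge_zero[of "\<rho>s c (chart_inv c x)"]]
        by (simp add: abs_mult mult.commute)
    qed simp
  qed
  also have "\<dots> = B * (\<integral>x. indicator (Ks c) x *\<^sub>R \<bar>\<rho>s c (chart_inv c x)\<bar> \<partial>lborel)" by simp
  finally show ?thesis .
qed

lemma intc_tendsto:
  assumes c: "c \<in> Cs" and u: "uniform_limit (Ks c) fs f F" and f: "continuous_on (Ks c) f"
    and fs: "\<forall>\<^sub>F i in F. continuous_on (Ks c) (fs i)"
  shows "((\<lambda>i. intc c (fs i)) \<longlongrightarrow> intc c f) F"
proof (rule tendstoI)
  fix e :: real assume e: "e > 0"
  define M where "M = (\<integral>x. indicator (Ks c) x *\<^sub>R \<bar>\<rho>s c (chart_inv c x)\<bar> \<partial>lborel)"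
  have M: "0 \<le> M" unfolding M_def by (rule Bochner_Integration.integral_nonneg) simp
  define d where "d = e / (M + 1)"
  have d: "0 < d" "d * M < e" using e M by (simp_all add: d_def field_simps)
  show "\<forall>\<^sub>F i in F. dist (intc c (fs i)) (intc c f) < e"
    using uniform_limitD[OF u d(1)] fs
  proof eventually_elim
    case (elim i)
    have cont: "continuous_on (Ks c) (\<lambda>x. fs i x + (-1) * f x)" using elim(2) f by (intro continuous_intros)
    have "intc c (fs i) - intc c f = intc c (\<lambda>x. fs i x + (-1) * f x)"
      by (simp only: intc_lincomb[OF c elim(2) f])
    moreover have "\<bar>intc c (\<lambda>x. fs i x + (-1) * f x)\<bar> \<le> d * M"
      unfolding M_def by (rule intc_bound[OF c cont]) (use elim(1) in \<open>simp add: dist_real_def less_imp_le\<close>)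
    ultimately show ?case using d(2) by (simp add: dist_real_def)
  qed
qed

section \<open>The space of metrics as an open subset\<close>

lemma bounded_bilinear_matrix_vector: "bounded_bilinear ((*v) :: real ^ 'k ^ 'm \<Rightarrow> real ^ 'k \<Rightarrow> real ^ 'm)"
  unfolding bilinear_conv_bounded_bilinear[symmetric] bilinear_def
  by (auto intro!: linearI simp: vec_eq_iff matrix_vector_mult_def sum.distrib sum_distrib_left algebra_simps)

text \<open>By homogeneity it is enough to consider unit vectors; on the compact set of unit vectors
  over \<open>Ks c\<close> the quadratic form of \<open>g\<close> has a positive minimum and
  that of \<open>h\<close> is bounded.\<close>

lemma metrics_open_chart:
  assumes g: "g \<in> \<M>" and h: "h \<in> \<S>" and c: "c \<in> Cs"
  shows "\<exists>\<delta>>0. \<forall>t. \<bar>t\<bar> < \<delta> \<longrightarrow> (\<forall>x\<in>Ks c. pos_def ((g + t *\<^sub>R h) c x))"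
proof (cases "Ks c = {}")
  case True
  then show ?thesis by (intro exI[of _ 1]) simp
next
  case False
  note cA = Cs_A[OF c]
  let ?Z = "Ks c \<times> sphere (0::real ^ 'n) 1"
  have Z: "compact ?Z" by (intro compact_Times compact_Ks c compact_sphere)
  have Zne: "?Z \<noteq> {}" using False by simp
  have cont: "continuous_on ?Z (\<lambda>z. snd z \<bullet> (k c (fst z) *v snd z))" if k: "k \<in> \<S>" for k
  proof -
    have "continuous_on (Ks c) (k c)"
      by (rule continuous_on_subset[OF smooth_on_continuous[OF tensor_smooth[OF k cA]] Ks_sub[OF c]])
    then have "continuous_on ?Z (\<lambda>z. k c (fst z))"
      by (rule continuous_on_compose2[OF _ continuous_on_fst[OF continuous_on_id]]) auto
    then show ?thesis
      by (intro continuous_on_inner bounded_bilinear.continuous_on[OF bounded_bilinear_matrix_vector]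
          continuous_on_snd continuous_on_id)
  qed
  obtain z0 where z0: "z0 \<in> ?Z" "\<forall>z\<in>?Z. snd z0 \<bullet> (g c (fst z0) *v snd z0) \<le> snd z \<bullet> (g c (fst z) *v snd z)"
    using continuous_attains_inf[OF Z Zne cont[OF metric_tensor[OF g]]] by (elim bexE) (rule that)
  define m where "m = snd z0 \<bullet> (g c (fst z0) *v snd z0)"
  have m: "0 < m"
  proof -
    have "fst z0 \<in> chart_image c" "snd z0 \<noteq> 0" using z0(1) Ks_sub[OF c] by (auto simp: mem_Times_iff)
    then show ?thesis using metric_pos_def[OF g cA] by (simp add: m_def pos_def_def)
  qed
  obtain z1 where z1: "z1 \<in> ?Z" "\<forall>z\<in>?Z. \<bar>snd z \<bullet> (h c (fst z) *v snd z)\<bar> \<le> \<bar>snd z1 \<bullet> (h c (fst z1) *v snd z1)\<bar>"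
    using continuous_attains_sup[OF Z Zne continuous_on_rabs[OF cont[OF h]]] by (elim bexE) (rule that)
  define B where "B = \<bar>snd z1 \<bullet> (h c (fst z1) *v snd z1)\<bar>"
  have B: "0 \<le> B" by (simp add: B_def)
  show ?thesis
  proof (intro exI[of _ "m / (B + 1)"] conjI allI impI ballI)
    show "0 < m / (B + 1)" using m B by simp
    fix t x assume t: "\<bar>t\<bar> < m / (B + 1)" and x: "x \<in> Ks c"
    show "pos_def ((g + t *\<^sub>R h) c x)"
      unfolding pos_def_def
    proof (intro allI impI)
      fix v :: "real ^ 'n" assume v: "v \<noteq> 0"
      define w where "w = v /\<^sub>R norm v"
      have w: "(x, w) \<in> ?Z" using x v by (simp add: w_def)
      have vw: "v = norm v *\<^sub>R w" using v by (simp add: w_def)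
      have "m \<le> w \<bullet> (g c x *v w)" using bspec[OF z0(2) w] by (simp add: m_def)
      moreover have "\<bar>w \<bullet> (h c x *v w)\<bar> \<le> B" using bspec[OF z1(2) w] by (simp add: B_def)
      then have "\<bar>t * (w \<bullet> (h c x *v w))\<bar> \<le> \<bar>t\<bar> * B" by (simp add: abs_mult mult_left_mono)
      moreover have "\<bar>t\<bar> * B < m"
      proof -
        have "\<bar>t\<bar> * (B + 1) < m" using t B by (simp add: pos_less_divide_eq)
        moreover have "\<bar>t\<bar> * B \<le> \<bar>t\<bar> * (B + 1)" by (simp add: algebra_simps)
        ultimately show ?thesis by linarith
      qed
      ultimately have pos: "0 < w \<bullet> (g c x *v w) + t * (w \<bullet> (h c x *v w))" by linarith
      have "v \<bullet> ((g + t *\<^sub>R h) c x *v v) = (norm v)\<^sup>2 * (w \<bullet> (g c x *v w) + t * (w \<bullet> (h c x *v w)))"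
        by (subst (1 2) vw) (simp add: add_scaleR_field matrix_vector_mult_add_rdistrib scaleR_matrix_vector_assoc[symmetric]
            matrix_vector_mult_scaleR inner_add_right power2_eq_square algebra_simps del: plus_fun_apply)
      then show "0 < v \<bullet> ((g + t *\<^sub>R h) c x *v v)" using pos v by simp
    qed
  qed
qed

lemma metrics_open:
  assumes g: "g \<in> \<M>" and h: "h \<in> \<S>"
  shows "\<exists>\<delta>>0. \<forall>t. \<bar>t\<bar> < \<delta> \<longrightarrow> g + t *\<^sub>R h \<in> \<M>"
proof -
  have "\<forall>c\<in>Cs. \<exists>\<delta>>0. \<forall>t. \<bar>t\<bar> < \<delta> \<longrightarrow> (\<forall>x\<in>Ks c. pos_def ((g + t *\<^sub>R h) c x))"
    using metrics_open_chart[OF g h] by simp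
  then obtain \<delta> where \<delta>: "\<forall>c\<in>Cs. \<delta> c > 0 \<and> (\<forall>t. \<bar>t\<bar> < \<delta> c \<longrightarrow> (\<forall>x\<in>Ks c. pos_def ((g + t *\<^sub>R h) c x)))"
    by (rule bchoice[THEN exE])
  have ne: "Cs \<noteq> {}" using Ks_cover[of undefined] by auto
  define d where "d = Min (\<delta> ` Cs)"
  have d: "0 < d" unfolding d_def using \<delta> ne finite_Cs by simp
  have d_le: "d \<le> \<delta> c" if "c \<in> Cs" for c unfolding d_def using that finite_Cs by simp
  show ?thesis
  proof (intro exI[of _ d] conjI allI impI d)
    fix t assume t: "\<bar>t\<bar> < d"
    have S: "g + t *\<^sub>R h \<in> \<S>" by (rule tensor_lincomb[OF metric_tensor[OF g] h])
    show "g + t *\<^sub>R h \<in> \<M>"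
      unfolding metric_iff
    proof (intro conjI S ballI)
      fix c x assume c: "c \<in> A" and x: "x \<in> chart_image c"
      \<comment> \<open>Positivity is known over the sets \<open>Ks\<close> only, and is transported from
        there to all other charts.\<close>
      obtain c' where c': "c' \<in> Cs" "chart_inv c x \<in> fst c'" "snd c' (chart_inv c x) \<in> Ks c'"
        using Ks_cover[of "chart_inv c x"] by (elim bexE conjE) (rule that)
      have xo: "x \<in> overlap c c'" using x c'(2) by (simp add: overlap_iff[OF c])
      let ?J = "jac c c' x" and ?y = "transition c c' x"
      have y: "?y \<in> Ks c'" using c'(3) by (simp add: transition_def)
      have p: "pos_def ((g + t *\<^sub>R h) c' ?y)"
        using \<delta> c'(1) y t d_le[OF c'(1)] by (simp del: plus_fun_apply)
      have J: "det ?J \<noteq> 0" by (rule det_jac[OF g c Cs_A[OF c'(1)] xo])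
      show "pos_def ((g + t *\<^sub>R h) c x)"
        unfolding tensor_trans[OF S c Cs_A[OF c'(1)] xo] pos_def_def transpose_inner
      proof (intro allI impI)
        fix v :: "real ^ 'n" assume v: "v \<noteq> 0"
        have "?J *v v \<noteq> 0"
        proof
          assume "?J *v v = 0"
          then have "matrix_inv ?J *v (?J *v v) = 0" by simp
          then show False using v by (simp add: matrix_vector_mul_assoc matrix_inv_left[OF J])
        qed
        then show "0 < (?J *v v) \<bullet> ((g + t *\<^sub>R h) c' ?y *v (?J *v v))" using p unfolding pos_def_def by simp
      qed
    qed
  qed
qed

lemma lcs_domain_metrics: "lcs_domain \<S> (tensor_seminorms A) \<M>"
proof
  show "0 \<in> \<S>" by (rule zero_tensor)
  show "x + t *\<^sub>R y \<in> \<S>" if "x \<in> \<S>" "y \<in> \<S>" for x y t by (rule tensor_lincomb[OF that])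
  show "p (x + y) \<le> p x + p y" if "p \<in> tensor_seminorms A" "x \<in> \<S>" "y \<in> \<S>" for p x y by (rule seminorm_props(1)[OF that])
  show "p (t *\<^sub>R x) \<le> \<bar>t\<bar> * p x" if "p \<in> tensor_seminorms A" "x \<in> \<S>" for p x t by (rule seminorm_props(2)[OF that that(2)])
  show "0 \<le> p x" if "p \<in> tensor_seminorms A" "x \<in> \<S>" for p x by (rule seminorm_props(3)[OF that that(2)])
  show "x = 0" if "x \<in> \<S>" "\<And>p. p \<in> tensor_seminorms A \<Longrightarrow> p x = 0" for x by (rule seminorm_separating[OF that(1)]) (rule that(2))
  show "x \<in> \<S>" if "x \<in> \<M>" for x by (rule metric_tensor[OF that])
  show "\<exists>\<delta>>0. \<forall>t. \<bar>t\<bar> < \<delta> \<longrightarrow> x + t *\<^sub>R v \<in> \<M>" if "x \<in> \<M>" "v \<in> \<S>" for x v by (rule metrics_open[OF that])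
  show "x + t *\<^sub>R (y - x) \<in> \<M>" if "x \<in> \<M>" "y \<in> \<M>" "0 \<le> t" "t \<le> 1" for x y t by (rule metrics_convex[OF that])
qed

end

section \<open>Differential operators on the space of metrics\<close>

lemma norm_matrix_le: "norm (M :: real ^ 'n ^ 'm) \<le> (\<Sum>i\<in>UNIV. \<Sum>j\<in>UNIV. \<bar>M $ i $ j\<bar>)"
proof -
  have "norm M \<le> (\<Sum>i\<in>UNIV. norm (M $ i))" unfolding norm_vec_def by (rule L2_set_le_sum) simp
  also have "\<dots> \<le> (\<Sum>i\<in>UNIV. \<Sum>j\<in>UNIV. \<bar>M $ i $ j\<bar>)" by (intro sum_mono norm_le_l1_cart)
  finally show ?thesis .
qed

lemma uniform_limit_matrix:
  fixes f :: "'i \<Rightarrow> 'x \<Rightarrow> real ^ 'n ^ 'm"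
  assumes "\<And>i j. uniform_limit K (\<lambda>t x. f t x $ i $ j) (\<lambda>x. l x $ i $ j) F"
  shows "uniform_limit K f l F"
proof (rule uniform_limitI)
  fix e :: real assume e: "e > 0"
  define N where "N = real (CARD('m) * CARD('n))"
  have N: "N > 0" by (simp add: N_def)
  have "0 < e / (2 * N)" using e N by simp
  then have "\<forall>\<^sub>F t in F. \<forall>i. \<forall>j. \<forall>x\<in>K. dist (f t x $ i $ j) (l x $ i $ j) < e / (2 * N)"
    by (intro eventually_all_finite uniform_limitD[OF assms])
  then show "\<forall>\<^sub>F t in F. \<forall>x\<in>K. dist (f t x) (l x) < e"
  proof eventually_elim
    case (elim t)
    show ?case
    proof
      fix x assume x: "x \<in> K"
      have "dist (f t x) (l x) \<le> (\<Sum>i\<in>UNIV. \<Sum>j\<in>UNIV. \<bar>(f t x - l x) $ i $ j\<bar>)"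
        unfolding dist_norm by (rule norm_matrix_le)
      also have "\<dots> \<le> (\<Sum>i\<in>(UNIV :: 'm set). \<Sum>j\<in>(UNIV :: 'n set). e / (2 * N))"
        using elim x by (intro sum_mono) (simp add: dist_real_def less_imp_le)
      also have "\<dots> = e / 2" using N by (simp add: N_def)
      also have "\<dots> < e" using e by simp
      finally show "dist (f t x) (l x) < e" .
    qed
  qed
qed

lemma iter_deriv_chi:
  fixes f :: "'n::finite \<Rightarrow> 'n \<Rightarrow> 'e::euclidean_space \<Rightarrow> real"
  assumes S: "open S" and f: "\<And>i j. smooth_on S (f i j)"
  shows "smooth_on S (\<lambda>x. \<chi> i j. f i j x)"
    and "vs \<in> lists Basis \<Longrightarrow> x \<in> S \<Longrightarrow> iter_deriv vs (\<lambda>x. \<chi> i j. f i j x) x $ i $ j = iter_deriv vs (f i j) x"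
proof -
  show s: "smooth_on S (\<lambda>x. \<chi> i j. f i j x)"
    by (rule smooth_on_matrix_entries[OF S]) (simp add: f)
  show "iter_deriv vs (\<lambda>x. \<chi> i j. f i j x) x $ i $ j = iter_deriv vs (f i j) x" if "vs \<in> lists Basis" "x \<in> S"
    using iter_deriv_bounded_linear[OF bounded_linear_entry S s that, of i j] by simp
qed

lemma dx_shift: "dx k (shift e) = shift (dx k e)"
  by (induction e) simp_all

text \<open>An identity of expressions up to the commutation of products, where \<open>Inv\<close> and
  \<open>SqrtDet\<close> need a computation. The nonempty argument list ensures that argument
  \<open>0\<close> is the direction.\<close>

lemma eval_dx_dg: "eval (dx k (dg e)) (v # hs) G x = eval (dg (dx k e)) (v # hs) G x"
proof (induction e)
  case (Inv i j)
  let ?P = "matrix_inv (G x)" and ?D = "iter_deriv (dirs [k]) G x" and ?W = "iter_deriv (dirs [k]) v x"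
  define Q where "Q = - (?P ** ?D ** ?P)"
  define R where "R = - (?P ** v x ** ?P)"
  have Q: "Q $ i $ j = - (\<Sum>a\<in>UNIV. \<Sum>b\<in>UNIV. ?P $ i $ a * (?D $ a $ b * ?P $ b $ j))" for i j
    by (simp add: Q_def triple_product_entry del: dirs_simps)
  have R: "R $ i $ j = - (\<Sum>a\<in>UNIV. \<Sum>b\<in>UNIV. ?P $ i $ a * (v x $ a $ b * ?P $ b $ j))" for i j
    by (simp add: R_def triple_product_entry)
  have "eval (dx k (dg (Inv i j))) (v # hs) G x =
    - (\<Sum>a\<in>UNIV. \<Sum>b\<in>UNIV. ?P $ i $ a * (v x $ a $ b * Q $ b $ j + ?W $ a $ b * ?P $ b $ j) + Q $ i $ a * (v x $ a $ b * ?P $ b $ j))"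
    by (simp add: Q[unfolded dirs_simps])
  also have "\<dots> = - ((?P ** v x ** Q) + (?P ** ?W ** ?P) + (Q ** v x ** ?P)) $ i $ j"
    by (simp add: triple_product_entry sum.distrib distrib_left)
  also have "(?P ** v x ** Q) + (?P ** ?W ** ?P) + (Q ** v x ** ?P) = (?P ** ?D ** R) + (?P ** ?W ** ?P) + (R ** ?D ** ?P)"
    by (simp add: Q_def R_def matrix_mul_assoc bounded_bilinear.minus_left[OF bounded_bilinear_matrix_mult]
        bounded_bilinear.minus_right[OF bounded_bilinear_matrix_mult])
  also have "- (\<dots>) $ i $ j = - (\<Sum>a\<in>UNIV. \<Sum>b\<in>UNIV. ?P $ i $ a * (?D $ a $ b * R $ b $ j + ?W $ a $ b * ?P $ b $ j) + R $ i $ a * (?D $ a $ b * ?P $ b $ j))"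
    by (simp add: triple_product_entry sum.distrib distrib_left)
  also have "\<dots> = eval (dg (dx k (Inv i j))) (v # hs) G x"
    by (simp add: R)
  finally show ?case .
next
  case SqrtDet
  let ?P = "matrix_inv (G x)" and ?D = "iter_deriv (dirs [k]) G x"
  have 1: "(\<Sum>a\<in>UNIV. \<Sum>b\<in>UNIV. (\<Sum>c\<in>UNIV. \<Sum>d\<in>UNIV. ?P $ a $ c * (M $ c $ d * ?P $ d $ b)) * N $ b $ a) = trace (?P ** M ** ?P ** N)" for M N :: "real ^ 'a ^ 'a"
    by (simp add: trace_product triple_product_entry)
  have 2: "trace (?P ** ?D ** ?P ** v x) = trace (?P ** v x ** ?P ** ?D)"
    using trace_mul_sym[of "?P ** ?D" "?P ** v x"] by (simp add: matrix_mul_assoc)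
  show ?case
    using 1[of ?D "v x"] 1[of "v x" ?D] 2 by (simp add: sum.distrib sum_subtractf algebra_simps)
next
  case (Mul e f)
  then show ?case by (simp add: dx_shift algebra_simps)
qed simp_all

lemma eval_foldr_dx_dg:
  assumes r: "regular S (v # hs) G" and x: "x \<in> S"
  shows "eval (foldr dx \<alpha> (dg e)) (v # hs) G x = eval (dg (foldr dx \<alpha> e)) (v # hs) G x"
  using x
proof (induction \<alpha> arbitrary: x)
  case (Cons k \<alpha>)
  have "open S" using r by (simp add: regular_def)
  have "eval (dx k (foldr dx \<alpha> (dg e))) (v # hs) G x = eval (dx k (dg (foldr dx \<alpha> e))) (v # hs) G x"
  proof -
    have "pd k (eval (foldr dx \<alpha> (dg e)) (v # hs) G) x = pd k (eval (dg (foldr dx \<alpha> e)) (v # hs) G) x"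
      by (rule pd_cong[OF \<open>open S\<close> Cons.prems]) (rule Cons.IH)
    then show ?thesis by (simp only: pd_def frechet_derivative_eval[OF r Cons.prems])
  qed
  then show ?case by (simp add: eval_dx_dg)
qed simp

context compact_manifold
begin

abbreviation at_chart :: "('a, 'n) chart \<Rightarrow> ('a, 'n) tensor2_field list \<Rightarrow> 'n mfield list"
  where "at_chart c hs \<equiv> map (\<lambda>h. h c) hs"

lemma eval_uniform_limit:
  assumes g: "g \<in> \<M>" and hs: "set hs \<subseteq> \<S>" and c: "c \<in> A" and K: "compact K" "K \<subseteq> chart_image c"
    and gs: "field_converges gs g F" and len: "\<And>i. length (Hs i) = length hs"
    and Hs: "\<And>m. m < length hs \<Longrightarrow> field_converges (\<lambda>i. Hs i ! m) (hs ! m) F"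
  shows "uniform_limit K (\<lambda>i. eval e (at_chart c (Hs i)) (gs i c)) (eval e (at_chart c hs) (g c)) F"
proof (rule uniform_limit_eval[OF metric_regular[OF g c hs] K field_convergesD[OF gs c K]])
  show "length (at_chart c (Hs i)) = length (at_chart c hs)" for i by (simp add: len)
  fix m \<alpha> assume "m < length (at_chart c hs)"
  then have m: "m < length hs" by simp
  from field_convergesD[OF Hs[OF m] c K, of \<alpha>] m len
  show "uniform_limit K (\<lambda>i. iter_deriv (dirs \<alpha>) (at_chart c (Hs i) ! m)) (iter_deriv (dirs \<alpha>) (at_chart c hs ! m)) F"
    by simp
qed

lemma field_converges_const: "field_converges (\<lambda>i. h) h F"
  unfolding field_converges_def by (simp add: uniform_limit_const)

lemma field_converges_line:
  assumes g: "g \<in> \<S>" and v: "v \<in> \<S>"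
  shows "field_converges (\<lambda>t. g + t *\<^sub>R v) g (at 0)"
proof -
  interpret lcs_domain \<S> "tensor_seminorms A" \<M> by (rule lcs_domain_metrics)
  have "lcs_tendsto (tensor_seminorms A) (\<lambda>t. g + t *\<^sub>R v) (g + 0 *\<^sub>R v) (at 0)"
    by (rule lim_lincomb[OF lim_const lim_const tendsto_ident_at]) (simp_all add: g v)
  then have "lcs_tendsto (tensor_seminorms A) (\<lambda>t. g + t *\<^sub>R v) g (at 0)" by simp
  then show ?thesis
    using lcs_tendsto_field[of "\<lambda>t. g + t *\<^sub>R v" "at 0" g] g tensor_lincomb[OF g v] by simp
qed

text \<open>The mean value theorem, applied at each point, replaces the difference quotient by a
  derivative at a nearby metric; these converge uniformly by
  \<open>eval_uniform_limit\<close>.\<close>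

lemma eval_diff_quotient:
  assumes g: "g \<in> \<M>" and hs: "set hs \<subseteq> \<S>" and v: "v \<in> \<S>" and c: "c \<in> A" and K: "compact K" "K \<subseteq> chart_image c"
  shows "uniform_limit K (\<lambda>t x. (eval e (at_chart c hs) ((g + t *\<^sub>R v) c) x - eval e (at_chart c hs) (g c) x) / t)
    (eval (dg e) (at_chart c (v # hs)) (g c)) (at 0)"
proof -
  obtain \<delta> where \<delta>: "\<delta> > 0" "\<forall>t. \<bar>t\<bar> < \<delta> \<longrightarrow> g + t *\<^sub>R v \<in> \<M>"
    using metrics_open[OF g v] by (elim exE conjE) (rule that)
  have vhs: "set (v # hs) \<subseteq> \<S>" using v hs by simp
  let ?\<phi> = "\<lambda>x t. eval e (at_chart c hs) ((g + t *\<^sub>R v) c) x"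
  let ?\<psi> = "\<lambda>t x. eval (dg e) (at_chart c (v # hs)) ((g + t *\<^sub>R v) c) x"
  have deriv: "(?\<phi> x has_real_derivative ?\<psi> t x) (at t)" if "\<bar>t\<bar> < \<delta>" "x \<in> chart_image c" for t x
  proof -
    have gt: "g + t *\<^sub>R v \<in> \<M>" using \<delta> that by simp
    have "((\<lambda>s. eval e (at_chart c hs) (\<lambda>y. (g + t *\<^sub>R v) c y + s *\<^sub>R v c y) x) has_real_derivative ?\<psi> t x) (at 0)"
      using eval_dg[of "chart_image c" "v c" "at_chart c hs" "(g + t *\<^sub>R v) c" x e]
        metric_regular[OF gt c vhs] that(2) by simp
    moreover have "(\<lambda>y. (g + t *\<^sub>R v) c y + s *\<^sub>R v c y) = (g + (t + s) *\<^sub>R v) c" for s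
      unfolding add_scaleR_field by (simp add: algebra_simps)
    ultimately have "((\<lambda>s. ?\<phi> x (t + s)) has_real_derivative ?\<psi> t x) (at 0)" by simp
    then show ?thesis using DERIV_at_within_shift[of "?\<phi> x" "?\<psi> t x" t 0 UNIV] by simp
  qed
  have U: "uniform_limit K ?\<psi> (eval (dg e) (at_chart c (v # hs)) (g c)) (at 0)"
    by (rule eval_uniform_limit[OF g vhs c K field_converges_line[OF metric_tensor[OF g] v]])
       (simp_all add: field_converges_const)
  show ?thesis
  proof (rule uniform_limitI)
    fix \<epsilon> :: real assume "\<epsilon> > 0"
    from uniform_limitD[OF U this] obtain d where d: "d > 0"
      "\<forall>t. t \<noteq> 0 \<and> dist t 0 < d \<longrightarrow> (\<forall>x\<in>K. dist (?\<psi> t x) (eval (dg e) (at_chart c (v # hs)) (g c) x) < \<epsilon>)"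
      unfolding eventually_at by (elim exE conjE) (rule that, simp_all)
    show "\<forall>\<^sub>F t in at 0. \<forall>x\<in>K. dist ((?\<phi> x t - eval e (at_chart c hs) (g c) x) / t) (eval (dg e) (at_chart c (v # hs)) (g c) x) < \<epsilon>"
    proof (rule eventually_at_0[of "min d \<delta>"])
      show "0 < min d \<delta>" using d \<delta> by simp
      fix t :: real assume t: "t \<noteq> 0" "\<bar>t\<bar> < min d \<delta>"
      show "\<forall>x\<in>K. dist ((?\<phi> x t - eval e (at_chart c hs) (g c) x) / t) (eval (dg e) (at_chart c (v # hs)) (g c) x) < \<epsilon>"
      proof
        fix x assume x: "x \<in> K"
        then have xc: "x \<in> chart_image c" using K by auto
        have "\<exists>s. s \<noteq> 0 \<and> \<bar>s\<bar> < \<bar>t\<bar> \<and> ?\<phi> x t - ?\<phi> x 0 = t * ?\<psi> s x"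
        proof (cases "t > 0")
          case True
          have "\<exists>s>0. s < t \<and> ?\<phi> x t - ?\<phi> x 0 = (t - 0) * ?\<psi> s x"
            by (rule MVT2[OF True]) (rule deriv[OF _ xc], use t in simp)
          then obtain s where "s > 0" "s < t" "?\<phi> x t - ?\<phi> x 0 = (t - 0) * ?\<psi> s x" by (elim exE conjE)
          then show ?thesis by (intro exI[of _ s]) simp
        next
          case False
          then have neg: "t < 0" using t by simp
          have "\<exists>s>t. s < 0 \<and> ?\<phi> x 0 - ?\<phi> x t = (0 - t) * ?\<psi> s x"
            by (rule MVT2[OF neg]) (rule deriv[OF _ xc], use t in simp)
          then obtain s where "s > t" "s < 0" "?\<phi> x 0 - ?\<phi> x t = (0 - t) * ?\<psi> s x" by (elim exE conjE)
          then show ?thesis by (intro exI[of _ s]) simp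
        qed
        then obtain s where s: "s \<noteq> 0" "\<bar>s\<bar> < \<bar>t\<bar>" "?\<phi> x t - ?\<phi> x 0 = t * ?\<psi> s x" by (elim exE conjE)
        have "?\<phi> x 0 = eval e (at_chart c hs) (g c) x" by simp
        with s(3) have "(?\<phi> x t - eval e (at_chart c hs) (g c) x) / t = ?\<psi> s x" using t(1) by simp
        moreover have "dist (?\<psi> s x) (eval (dg e) (at_chart c (v # hs)) (g c) x) < \<epsilon>"
          using d(2)[rule_format, of s x] s t x by (simp add: dist_real_def)
        ultimately show "dist ((?\<phi> x t - eval e (at_chart c hs) (g c) x) / t) (eval (dg e) (at_chart c (v # hs)) (g c) x) < \<epsilon>"
          by (simp only:)
      qed
    qed
  qed
qed

definition operator :: "('n \<Rightarrow> 'n \<Rightarrow> 'n expr) \<Rightarrow> ('a, 'n) tensor2_field list \<Rightarrow> ('a, 'n) tensor2_field \<Rightarrow> ('a, 'n) tensor2_field"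
  where "operator e hs g = (\<lambda>c x. if c \<in> A \<and> x \<in> chart_image c then \<chi> i j. eval (e i j) (at_chart c hs) (g c) x else 0)"

lemma operator_smooth:
  assumes g: "g \<in> \<M>" and hs: "set hs \<subseteq> \<S>" and c: "c \<in> A"
  shows "smooth_on (chart_image c) (operator e hs g c)"
    and "x \<in> chart_image c \<Longrightarrow> iter_deriv (dirs \<alpha>) (operator e hs g c) x $ i $ j = eval (foldr dx \<alpha> (e i j)) (at_chart c hs) (g c) x"
proof -
  note r = metric_regular[OF g c hs]
  have sm: "smooth_on (chart_image c) (eval (e i j) (at_chart c hs) (g c))" for i j by (rule smooth_on_eval[OF r])
  note chi = iter_deriv_chi[where f = "\<lambda>i j. eval (e i j) (at_chart c hs) (g c)", OF open_image[OF c] sm]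
  have eq: "operator e hs g c x = (\<chi> i j. eval (e i j) (at_chart c hs) (g c) x)" if "x \<in> chart_image c" for x
    using that c by (simp add: operator_def)
  show "smooth_on (chart_image c) (operator e hs g c)"
    by (rule smooth_on_cong[OF open_image[OF c] _ chi(1)]) (simp add: eq)
  show "iter_deriv (dirs \<alpha>) (operator e hs g c) x $ i $ j = eval (foldr dx \<alpha> (e i j)) (at_chart c hs) (g c) x"
    if x: "x \<in> chart_image c"
    using iter_deriv_cong[OF open_image[OF c] eq x, where vs = "dirs \<alpha>"] chi(2)[OF dirs_Basis x, of \<alpha> i j] iter_deriv_eval[OF r x, of \<alpha> "e i j"]
    by simp
qed

lemma operator_converges:
  assumes g: "g \<in> \<M>" and hs: "set hs \<subseteq> \<S>"
    and gs: "field_converges gs g F" "\<And>i. gs i \<in> \<M>" and len: "\<And>i. length (Hs i) = length hs" "\<And>i. set (Hs i) \<subseteq> \<S>"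
    and Hs: "\<And>m. m < length hs \<Longrightarrow> field_converges (\<lambda>i. Hs i ! m) (hs ! m) F"
  shows "field_converges (\<lambda>i. operator e (Hs i) (gs i)) (operator e hs g) F"
  unfolding field_converges_def
proof (intro ballI allI impI, elim conjE, rule uniform_limit_matrix)
  fix c K \<alpha> i j assume c: "c \<in> A" and K: "compact K" "K \<subseteq> chart_image c"
  have "uniform_limit K (\<lambda>k. eval (foldr dx \<alpha> (e i j)) (at_chart c (Hs k)) (gs k c)) (eval (foldr dx \<alpha> (e i j)) (at_chart c hs) (g c)) F"
    by (rule eval_uniform_limit[OF g hs c K gs(1) len(1) Hs])
  then show "uniform_limit K (\<lambda>k x. iter_deriv (dirs \<alpha>) (operator e (Hs k) (gs k) c) x $ i $ j)
     (\<lambda>x. iter_deriv (dirs \<alpha>) (operator e hs g c) x $ i $ j) F"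
    by (rule uniform_limit_cong'[THEN iffD1, rotated 2])
       (use K in \<open>simp_all add: subset_iff operator_smooth(2)[OF g hs c] operator_smooth(2)[OF gs(2) len(2) c]\<close>)
qed

text \<open>Symmetry and the transformation law are closed conditions. Thus the derivatives of a map
  with values in tensor fields are tensor fields, without any computation of how they
  transform.\<close>

lemma tensor_limit:
  assumes F: "F \<noteq> bot" and hs: "\<forall>\<^sub>F i in F. hs i \<in> \<S>" and lim: "\<And>c x. c \<in> A \<Longrightarrow> x \<in> chart_image c \<Longrightarrow> ((\<lambda>i. hs i c x) \<longlongrightarrow> h c x) F"
    and zero: "\<And>c x. \<not> (c \<in> A \<and> x \<in> chart_image c) \<Longrightarrow> h c x = 0" and smooth: "\<And>c. c \<in> A \<Longrightarrow> smooth_on (chart_image c) (h c)"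
  shows "h \<in> \<S>"
proof (rule sym_tensorI[OF zero smooth])
  fix c x assume c: "c \<in> A" and x: "x \<in> chart_image c"
  have "((\<lambda>i. transpose (hs i c x)) \<longlongrightarrow> transpose (h c x)) F"
    by (rule bounded_linear.tendsto[OF bounded_linear_transpose lim[OF c x]])
  moreover have "\<forall>\<^sub>F i in F. transpose (hs i c x) = hs i c x"
    using hs by eventually_elim (rule tensor_sym[OF _ c x])
  ultimately have "((\<lambda>i. hs i c x) \<longlongrightarrow> transpose (h c x)) F" by (rule Lim_transform_eventually)
  then show "transpose (h c x) = h c x" by (rule tendsto_unique[OF F _ lim[OF c x]])
next
  fix c d x assume c: "c \<in> A" and d: "d \<in> A" and x: "x \<in> overlap c d"
  have xc: "x \<in> chart_image c" using x by (simp add: overlap_iff[OF c])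
  let ?J = "jac c d x" and ?y = "transition c d x"
  have "((\<lambda>i. transpose ?J ** hs i d ?y ** ?J) \<longlongrightarrow> transpose ?J ** h d ?y ** ?J) F"
    by (rule bounded_bilinear.tendsto[OF bounded_bilinear_matrix_mult bounded_bilinear.tendsto[OF bounded_bilinear_matrix_mult
          tendsto_const lim[OF d transition_in[OF c x]]] tendsto_const])
  moreover have "\<forall>\<^sub>F i in F. transpose ?J ** hs i d ?y ** ?J = hs i c x"
    using hs by eventually_elim (rule tensor_trans[OF _ c d x, symmetric])
  ultimately have "((\<lambda>i. hs i c x) \<longlongrightarrow> transpose ?J ** h d ?y ** ?J) F" by (rule Lim_transform_eventually)
  from tendsto_unique[OF F lim[OF c xc] this] show "h c x = transpose ?J ** h d ?y ** ?J" .
qed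

text \<open>Since \<open>dg\<close> commutes with the coordinate derivatives,
  \<open>eval_diff_quotient\<close> applies to all coordinate derivatives of the components.\<close>

lemma operator_derivative:
  assumes S: "\<And>g. g \<in> \<M> \<Longrightarrow> operator e hs g \<in> \<S>" and g: "g \<in> \<M>" and hs: "set hs \<subseteq> \<S>" and v: "v \<in> \<S>"
  shows "operator (\<lambda>i j. dg (e i j)) (v # hs) g \<in> \<S>"
    and "lcs_tendsto (tensor_seminorms A) (diff_quot (operator e hs) g v) (operator (\<lambda>i j. dg (e i j)) (v # hs) g) (at 0)"
proof -
  let ?l = "operator (\<lambda>i j. dg (e i j)) (v # hs) g"
  have vhs: "set (v # hs) \<subseteq> \<S>" using v hs by simp
  obtain \<delta> where \<delta>: "\<delta> > 0" "\<forall>t. \<bar>t\<bar> < \<delta> \<longrightarrow> g + t *\<^sub>R v \<in> \<M>"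
    using metrics_open[OF g v] by (elim exE conjE) (rule that)
  have dqS: "diff_quot (operator e hs) g v t \<in> \<S>" if "\<bar>t\<bar> < \<delta>" for t
    unfolding diff_quot_def using \<delta>(2) that by (intro tensor_scaleR tensor_diff S g) simp
  have dqS': "\<forall>\<^sub>F t in at 0. diff_quot (operator e hs) g v t \<in> \<S>"
    by (rule eventually_at_0[OF \<delta>(1)]) (rule dqS)
  have conv: "field_converges (diff_quot (operator e hs) g v) ?l (at 0)"
    unfolding field_converges_def
  proof (intro ballI allI impI, elim conjE, rule uniform_limit_matrix)
    fix c K \<alpha> i j assume c: "c \<in> A" and K: "compact K" "K \<subseteq> chart_image c"
    let ?f = "foldr dx \<alpha> (e i j)"
    have u: "uniform_limit K (\<lambda>t x. (eval ?f (at_chart c hs) ((g + t *\<^sub>R v) c) x - eval ?f (at_chart c hs) (g c) x) / t)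
      (eval (dg ?f) (at_chart c (v # hs)) (g c)) (at 0)"
      by (rule eval_diff_quotient[OF g hs v c K])
    have diff_quot: "iter_deriv (dirs \<alpha>) (diff_quot (operator e hs) g v t c) x $ i $ j
        = (eval ?f (at_chart c hs) ((g + t *\<^sub>R v) c) x - eval ?f (at_chart c hs) (g c) x) / t"
      if "\<bar>t\<bar> < \<delta>" "x \<in> K" for t x
    proof -
      have gt: "g + t *\<^sub>R v \<in> \<M>" using \<delta> that by simp
      have xc: "x \<in> chart_image c" using K that by auto
      have "diff_quot (operator e hs) g v t = 0 + inverse t *\<^sub>R (operator e hs (g + t *\<^sub>R v) - operator e hs g)" by (simp add: diff_quot_def)
      then have "iter_deriv (dirs \<alpha>) (diff_quot (operator e hs) g v t c) x =
        iter_deriv (dirs \<alpha>) ((0 :: ('a, 'n) tensor2_field) c) x + inverse t *\<^sub>R iter_deriv (dirs \<alpha>) ((operator e hs (g + t *\<^sub>R v) - operator e hs g) c) x"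
        using iter_deriv_tensor_lincomb[OF zero_tensor tensor_diff[OF S[OF gt] S[OF g]] c xc dirs_Basis] by simp
      also have "iter_deriv (dirs \<alpha>) ((0 :: ('a, 'n) tensor2_field) c) x = 0"
        using iter_deriv_tensor_diff[OF zero_tensor zero_tensor c xc dirs_Basis] by simp
      also have "iter_deriv (dirs \<alpha>) ((operator e hs (g + t *\<^sub>R v) - operator e hs g) c) x
        = iter_deriv (dirs \<alpha>) (operator e hs (g + t *\<^sub>R v) c) x - iter_deriv (dirs \<alpha>) (operator e hs g c) x"
        by (rule iter_deriv_tensor_diff[OF S[OF gt] S[OF g] c xc dirs_Basis])
      finally show ?thesis
        by (simp add: operator_smooth(2)[OF gt hs c xc] operator_smooth(2)[OF g hs c xc] divide_inverse mult.commute del: plus_fun_apply)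
    qed
    show "uniform_limit K (\<lambda>t x. iter_deriv (dirs \<alpha>) (diff_quot (operator e hs) g v t c) x $ i $ j)
       (\<lambda>x. iter_deriv (dirs \<alpha>) (?l c) x $ i $ j) (at 0)"
    proof (rule uniform_limit_cong[THEN iffD1, rotated 2, OF u])
      show "\<forall>\<^sub>F t in at 0. \<forall>x\<in>K. (eval ?f (at_chart c hs) ((g + t *\<^sub>R v) c) x - eval ?f (at_chart c hs) (g c) x) / t
        = iter_deriv (dirs \<alpha>) (diff_quot (operator e hs) g v t c) x $ i $ j"
        by (rule eventually_at_0[OF \<delta>(1)]) (intro ballI diff_quot[symmetric])
      show "eval (dg ?f) (at_chart c (v # hs)) (g c) x = iter_deriv (dirs \<alpha>) (?l c) x $ i $ j" if "x \<in> K" for x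
      proof -
        have xc: "x \<in> chart_image c" using K that by auto
        show ?thesis
          unfolding operator_smooth(2)[OF g vhs c xc] 
          using eval_foldr_dx_dg[of "chart_image c" "v c" "at_chart c hs" "g c" x \<alpha> "e i j"] metric_regular[OF g c vhs] xc
          by (simp only: list.map)
      qed
    qed
  qed
  show S': "?l \<in> \<S>"
  proof (rule tensor_limit[OF at_neq_bot dqS'])
    fix c x assume c: "c \<in> A" and x: "x \<in> chart_image c"
    show "((\<lambda>t. diff_quot (operator e hs) g v t c x) \<longlongrightarrow> ?l c x) (at 0)"
      using tendsto_uniform_limitI[OF field_convergesD[OF conv c, of "{x}" "[]"], of x] x by simp
  next
    show "?l c x = 0" if "\<not> (c \<in> A \<and> x \<in> chart_image c)" for c x using that unfolding operator_def by (rule if_not_P)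
    show "smooth_on (chart_image c) (?l c)" if "c \<in> A" for c by (rule operator_smooth(1)[OF g vhs that])
  qed
  show "lcs_tendsto (tensor_seminorms A) (diff_quot (operator e hs) g v) ?l (at 0)"
    using lcs_tendsto_field[OF dqS' S'] conv by simp
qed

section \<open>The Ricci vector field\<close>

lemma regular_subset: "regular S hs G \<Longrightarrow> open T \<Longrightarrow> T \<subseteq> S \<Longrightarrow> regular T hs G"
  unfolding regular_def by (auto intro: smooth_on_subset)

lemma ricci_eq_operator:
  assumes g: "g \<in> \<M>"
  shows "ricci A g = operator RicE [] g"
proof (rule ext, rule ext)
  fix c x
  show "ricci A g c x = operator RicE [] g c x"
  proof (cases "c \<in> A \<and> x \<in> chart_image c")
    case True
    then have "regular (chart_image c) [] (g c)" using metric_regular[OF g, of c "[]"] by simp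
    with True show ?thesis by (simp add: ricci_def operator_def vec_eq_iff ricci_matrix_eq_eval)
  next
    case False
    then show ?thesis unfolding ricci_def operator_def by (simp only: if_False)
  qed
qed

lemma ricci_tensor:
  assumes g: "g \<in> \<M>"
  shows "ricci A g \<in> \<S>"
proof (rule sym_tensorI)
  show "ricci A g c x = 0" if "\<not> (c \<in> A \<and> x \<in> chart_image c)" for c x
    using that unfolding ricci_def by (rule if_not_P)
  show "smooth_on (chart_image c) (ricci A g c)" if "c \<in> A" for c
    unfolding ricci_eq_operator[OF g] by (rule operator_smooth(1)[OF g _ that]) simp
next
  fix c x assume c: "c \<in> A" and x: "x \<in> chart_image c"
  have r: "regular (chart_image c) [] (g c)" using metric_regular[OF g c, of "[]"] by simp
  have "ricci_matrix (g c) x $ i $ j = ricci_matrix (g c) x $ j $ i" for i j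
    by (rule ricci_matrix_sym[OF r x]) (rule tensor_sym[OF metric_tensor[OF g] c])
  then show "transpose (ricci A g c x) = ricci A g c x"
    using c x by (simp add: ricci_def vec_eq_iff transpose_entry)
next
  fix c d x assume c: "c \<in> A" and d: "d \<in> A" and x: "x \<in> overlap c d"
  have rc: "regular (chart_image c) [] (g c)" and rd: "regular (chart_image d) [] (g d)"
    using metric_regular[OF g c, of "[]"] metric_regular[OF g d, of "[]"] by simp_all
  have "coordinate_change (overlap c d) (chart_image d) (transition c d) (g c) (g d) (jac c d)"
  proof
    show "smooth_on (overlap c d) (transition c d)" by (rule transition_smooth[OF c d])
    show "transition c d x \<in> chart_image d" if "x \<in> overlap c d" for x by (rule transition_in[OF c that])
    show "regular (overlap c d) [] (g c)" by (rule regular_subset[OF rc open_overlap[OF c d] overlap_image])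
    show "regular (chart_image d) [] (g d)" by (rule rd)
    show "transpose (g d y) = g d y" if "y \<in> chart_image d" for y by (rule tensor_sym[OF metric_tensor[OF g] d that])
    show "jac c d x = matrix (frechet_derivative (transition c d) (at x))" for x by (rule jac_def)
    show "g c x = transpose (jac c d x) ** g d (transition c d x) ** jac c d x" if "x \<in> overlap c d" for x
      by (rule tensor_trans[OF metric_tensor[OF g] c d that])
  qed
  from coordinate_change.ricci_matrix_transform[OF this x]
  show "ricci A g c x = transpose (jac c d x) ** ricci A g d (transition c d x) ** jac c d x"
    using c d subsetD[OF overlap_image x] transition_in[OF c x] by (simp add: ricci_def)
qed

definition ricE :: "nat \<Rightarrow> 'n \<Rightarrow> 'n \<Rightarrow> 'n expr"
  where "ricE n = ((\<lambda>e i j. dg (e i j)) ^^ n) RicE"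

text \<open>Iterated derivatives of the Ricci tensor with respect to the metric.\<close>

definition ricD :: "('a, 'n) tensor2_field list \<Rightarrow> ('a, 'n) tensor2_field \<Rightarrow> ('a, 'n) tensor2_field"
  where "ricD vs = operator (ricE (length vs)) vs"

lemma ricE_simps: "ricE 0 = RicE" "ricE (Suc n) = (\<lambda>i j. dg (ricE n i j))"
  by (simp_all add: ricE_def)

lemma ricD_Nil: "g \<in> \<M> \<Longrightarrow> ricD [] g = ricci A g"
  by (simp add: ricD_def ricE_simps ricci_eq_operator)

lemma ricD_Cons: "ricD (v # vs) = operator (\<lambda>i j. dg (ricE (length vs) i j)) (v # vs)"
  by (simp add: ricD_def ricE_simps)

lemma ricD_in: "set vs \<subseteq> \<S> \<Longrightarrow> g \<in> \<M> \<Longrightarrow> ricD vs g \<in> \<S>"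
proof (induction vs arbitrary: g)
  case Nil
  then show ?case by (simp add: ricD_Nil ricci_tensor)
next
  case (Cons v vs)
  then have "set vs \<subseteq> \<S>" "v \<in> \<S>" by simp_all
  then show ?case
    unfolding ricD_Cons using Cons.IH Cons.prems(2) by (intro operator_derivative(1)) (simp_all add: ricD_def)
qed

sublocale lcs_domain \<S> "tensor_seminorms A" \<M> by (rule lcs_domain_metrics)

lemma lists_set: "vs \<in> lists \<S> \<longleftrightarrow> set vs \<subseteq> \<S>"
  by (simp add: lists_eq_set)

lemma conv_field:
  assumes "lcs_tendsto (tensor_seminorms A) X x sequentially" "\<And>n. X n \<in> \<S>" "x \<in> \<S>"
  shows "field_converges X x sequentially"
  using lcs_tendsto_field[of X sequentially x] assms by simp

lemma ricD_family: "smooth_family \<S> (tensor_seminorms A) (\<lambda>vs z. ricD vs)"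
  unfolding smooth_family_def
proof (intro conjI ballI allI impI)
  show "ricD vs x \<in> \<S>" if "vs \<in> lists \<S>" "x \<in> \<M>" for vs x using that by (simp add: ricD_in lists_set)
  show "lcs_tendsto (tensor_seminorms A) (diff_quot (ricD vs) x v) (ricD (v # vs) x) (at 0)"
    if "vs \<in> lists \<S>" "v \<in> \<S>" "x \<in> \<M>" for vs v x
  proof -
    have vs: "set vs \<subseteq> \<S>" using that(1) by (simp only: lists_set)
    show ?thesis
      unfolding ricD_Cons ricD_def[of vs]
      by (rule operator_derivative(2)[OF _ that(3) vs that(2)]) (use ricD_in[OF vs] in \<open>simp add: ricD_def\<close>)
  qed
  fix X V and Z :: "nat \<Rightarrow> ('a, 'n) tensor2_field" and x vs
  assume V: "lists_conv V vs" and X: "\<forall>n. X n \<in> \<M>" "x \<in> \<M>" "lcs_tendsto (tensor_seminorms A) X x sequentially"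
  have len: "length (V n) = length vs" and VS: "set (V n) \<subseteq> \<S>" and vs: "set vs \<subseteq> \<S>" for n
    using V by (simp_all add: lists_conv_def lists_set)
  have S: "X n \<in> \<S>" "x \<in> \<S>" for n using X metric_tensor by simp_all
  have "field_converges (\<lambda>n. operator (ricE (length vs)) (V n) (X n)) (operator (ricE (length vs)) vs x) sequentially"
  proof (rule operator_converges[OF X(2) vs conv_field[OF X(3) S] _ len VS])
    show "X n \<in> \<M>" for n using X by simp
    fix m assume m: "m < length vs"
    show "field_converges (\<lambda>n. V n ! m) (vs ! m) sequentially"
    proof (rule conv_field)
      show "lcs_tendsto (tensor_seminorms A) (\<lambda>n. V n ! m) (vs ! m) sequentially" using V m by (simp add: lists_conv_def)
      show "V n ! m \<in> \<S>" for n using VS[of n] m len[of n] nth_mem[of m "V n"] by auto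
      show "vs ! m \<in> \<S>" using vs m nth_mem[of m vs] by auto
    qed
  qed
  then have "field_converges (\<lambda>n. ricD (V n) (X n)) (ricD vs x) sequentially" by (simp add: ricD_def len)
  moreover have "ricD (V n) (X n) \<in> \<S>" "ricD vs x \<in> \<S>" for n using ricD_in VS vs X by simp_all
  ultimately show "lcs_tendsto (tensor_seminorms A) (\<lambda>n. ricD (V n) (X n)) (ricD vs x) sequentially"
    using lcs_tendsto_field[of "\<lambda>n. ricD (V n) (X n)" sequentially "ricD vs x"] by simp
qed

end

lemma lcs_tendsto_prod:
  assumes "lcs_tendsto PS f a F" "lcs_tendsto QS g b F"
  shows "lcs_tendsto (prod_seminorms PS QS) (\<lambda>i. (f i, g i)) (a, b) F"
  using assms unfolding lcs_tendsto_def prod_seminorms_def by (simp add: ball_Un)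

lemma leibniz_no_parameter:
  "leibniz (\<lambda>as z. T as) R us as bs z x = leibniz (\<lambda>as z. T as) R us as bs z' x"
  by (induction us arbitrary: as bs) simp_all

context compact_manifold
begin

text \<open>\<open>P\<close> is linear in its second slot, so the derivatives of \<open>g \<mapsto>
  P\<^sub>g Ricci\<^sub>g\<close> are obtained by the product rule from those of
  \<open>P\<close> in the first slot and those of the Ricci tensor.\<close>

lemma P_ricci_family:
  assumes P: "admissible_operator A p P"
  obtains W where "smooth_family \<S> (tensor_seminorms A) (\<lambda>vs z. W vs)"
    and "\<And>g. g \<in> \<M> \<Longrightarrow> W [] g = P g (ricci A g)"
proof -
  let ?E = "\<S> \<times> \<S>" and ?PS = "tensor_seminorms A"
  have "depends_smoothly A P" using P unfolding admissible_operator_def by (rule conjunct1)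
  then obtain DP where DP: "(\<forall>x\<in>\<M> \<times> \<S>. DP [] x = (case x of (g, h) \<Rightarrow> P g h)) \<and>
    (\<forall>vs\<in>lists ?E. \<forall>x\<in>\<M> \<times> \<S>. DP vs x \<in> \<S>) \<and>
    (\<forall>vs\<in>lists ?E. \<forall>v\<in>?E. \<forall>x\<in>\<M> \<times> \<S>.
      lcs_tendsto ?PS (\<lambda>t. inverse t *\<^sub>R (DP vs (x + t *\<^sub>R v) - DP vs x)) (DP (v # vs) x) (at (0::real))) \<and>
    (\<forall>X V x. \<forall>vs\<in>lists ?E. (\<forall>n::nat. X n \<in> \<M> \<times> \<S>) \<and> x \<in> \<M> \<times> \<S> \<and>
      (\<forall>n. V n \<in> lists ?E \<and> length (V n) = length vs) \<and>
      lcs_tendsto (prod_seminorms ?PS ?PS) X x sequentially \<and>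
      (\<forall>i<length vs. lcs_tendsto (prod_seminorms ?PS ?PS) (\<lambda>n. V n ! i) (vs ! i) sequentially) \<longrightarrow>
      lcs_tendsto ?PS (\<lambda>n. DP (V n) (X n)) (DP vs x) sequentially)"
    unfolding depends_smoothly_def lcs_smooth_def by (elim exE) (rule that)
  note DP0 = conjunct1[OF DP, rule_format] and DP1 = conjunct1[OF conjunct2[OF DP], rule_format]
    and DP2 = conjunct1[OF conjunct2[OF conjunct2[OF DP]], rule_format]
    and DP3 = conjunct2[OF conjunct2[OF conjunct2[OF DP]], rule_format]
  \<comment> \<open>Derivatives of \<open>P\<close> in its first slot are those in directions with second
    component \<open>0\<close>.\<close>
  define pr :: "('a, 'n) tensor2_field list \<Rightarrow> (('a, 'n) tensor2_field \<times> ('a, 'n) tensor2_field) list"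
    where "pr = map (\<lambda>a. (a, 0))"
  have pr: "pr as \<in> lists ?E" if "as \<in> lists \<S>" for as
    using that zero by (auto simp: pr_def lists_set in_lists_conv_set)
  define T where "T as g u = DP (pr as) (g, u)" for as g u
  have TP: "T [] g u = P g u" if "g \<in> \<M>" "u \<in> \<S>" for g u
    using DP0[of "(g, u)"] that by (simp add: T_def pr_def)
  have Plin: "linear_on_tensors A (P g)" if "g \<in> \<M>" for g
    using P that unfolding admissible_operator_def pseudo_differential_def by simp
  interpret L: linear_family \<S> ?PS \<M> \<S> ?PS "\<lambda>as z. T as" ricD
  proof
    show "T as x u \<in> \<S>" if "as \<in> lists \<S>" "x \<in> \<M>" "u \<in> \<S>" for as x u
      unfolding T_def by (rule DP1[OF pr[OF that(1)]]) (use that in simp)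
    show "T [] x (u + t *\<^sub>R u') = T [] x u + t *\<^sub>R T [] x u'" if "x \<in> \<M>" "u \<in> \<S>" "u' \<in> \<S>" for x u u' t
    proof -
      have "P x (u + t *\<^sub>R u') = P x u + P x (t *\<^sub>R u')" "P x (t *\<^sub>R u') = t *\<^sub>R P x u'"
        using Plin[OF that(1)] that scaleR[OF that(3)] unfolding linear_on_tensors_def by simp_all
      then show ?thesis by (simp only: TP[OF that(1)] that lincomb)
    qed
    show "lcs_tendsto ?PS (diff_quot (\<lambda>x. T as x u) x v) (T (v # as) x u) (at 0)"
      if "as \<in> lists \<S>" "x \<in> \<M>" "u \<in> \<S>" "v \<in> \<S>" for as x u v
    proof -
      have "lcs_tendsto ?PS (\<lambda>t. inverse t *\<^sub>R (DP (pr as) ((x, u) + t *\<^sub>R (v, 0)) - DP (pr as) (x, u))) (DP ((v, 0) # pr as) (x, u)) (at 0)"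
        by (rule DP2[OF pr[OF that(1)]]) (use that zero in simp_all)
      then show ?thesis by (simp add: diff_quot_def[abs_def] T_def pr_def)
    qed
    show "lcs_tendsto ?PS (\<lambda>n. T (V n) (X n) (Y n)) (T vs x u) sequentially"
      if V: "lists_conv V vs" and X: "\<And>n. X n \<in> \<M>" "x \<in> \<M>" and Y: "\<And>n. Y n \<in> \<S>" "u \<in> \<S>"
        and lim: "lcs_tendsto ?PS X x sequentially" "lcs_tendsto ?PS Y u sequentially" for V vs X x Y u
      unfolding T_def
    proof (rule DP3)
      have l: "vs \<in> lists \<S>" "\<And>n. V n \<in> lists \<S>" "\<And>n. length (V n) = length vs" using V by (simp_all add: lists_conv_def)
      show "pr vs \<in> lists ?E" by (rule pr[OF l(1)])
      have "lcs_tendsto (prod_seminorms ?PS ?PS) (\<lambda>n. pr (V n) ! i) (pr vs ! i) sequentially" if i: "i < length vs" for i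
      proof -
        have "lcs_tendsto ?PS (\<lambda>n. V n ! i) (vs ! i) sequentially" using V i by (simp add: lists_conv_def)
        from lcs_tendsto_prod[OF this lim_const[of 0]] show ?thesis using i l(3) by (simp add: pr_def)
      qed
      then show "(\<forall>n. (X n, Y n) \<in> \<M> \<times> \<S>) \<and> (x, u) \<in> \<M> \<times> \<S> \<and> (\<forall>n. pr (V n) \<in> lists ?E \<and> length (pr (V n)) = length (pr vs)) \<and>
        lcs_tendsto (prod_seminorms ?PS ?PS) (\<lambda>n. (X n, Y n)) (x, u) sequentially \<and>
        (\<forall>i<length (pr vs). lcs_tendsto (prod_seminorms ?PS ?PS) (\<lambda>n. pr (V n) ! i) (pr vs ! i) sequentially)"
        using X Y pr[OF l(2)] l(3) lcs_tendsto_prod[OF lim] by (simp add: pr_def)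
    qed
    show "smooth_family \<S> ?PS (\<lambda>vs z. ricD vs)" by (rule ricD_family)
  qed
  define W where "W vs g = leibniz (\<lambda>as z. T as) ricD (rev vs) [] [] 0 g" for vs g
  have "(\<lambda>vs. leibniz (\<lambda>as z. T as) ricD (rev vs) [] []) = (\<lambda>vs z. W vs)"
    unfolding W_def by (intro ext leibniz_no_parameter)
  then have 1: "smooth_family \<S> ?PS (\<lambda>vs z. W vs)" using L.leibniz_family by simp
  have 2: "W [] g = P g (ricci A g)" if "g \<in> \<M>" for g
    using that by (simp add: W_def ricD_Nil TP ricci_tensor)
  show ?thesis by (rule that[OF 1 2])
qed

end

section \<open>The one-form of the Ricci vector field\<close>

text \<open>The integrand \<open>Tr(g\<inverse> w g\<inverse> h) sqrt(det g)\<close>, with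
  \<open>h\<close> as argument \<open>0\<close> and \<open>w\<close> as argument
  \<open>1\<close>.\<close>

definition formE :: "'n expr"
  where "formE = Mul (Sum (\<lambda>i. Sum (\<lambda>j. Mul (Sum (\<lambda>a. Sum (\<lambda>b. Mul (Inv i a) (Mul (Arg 1 [] a b) (Inv b j))))) (Arg 0 [] j i)))) SqrtDet"

lemma eval_formE:
  "eval formE [h, w] G x = trace (matrix_inv (G x) ** w x ** matrix_inv (G x) ** h x) * sqrt (det (G x))"
  by (simp add: formE_def trace_product triple_product_entry)

lemma eval_dg_formE:
  "eval (dg formE) [v, h, w] G x =
    (1/2 * trace (matrix_inv (G x) ** v x) * trace (matrix_inv (G x) ** w x ** matrix_inv (G x) ** h x)
     - trace (matrix_inv (G x) ** w x ** matrix_inv (G x) ** v x ** matrix_inv (G x) ** h x)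
     - trace (matrix_inv (G x) ** v x ** matrix_inv (G x) ** w x ** matrix_inv (G x) ** h x)) * sqrt (det (G x))"
proof -
  let ?P = "matrix_inv (G x)" and ?s = "sqrt (det (G x))"
  define R where "R = - (?P ** v x ** ?P)"
  have R: "R $ i $ j = - (\<Sum>a\<in>UNIV. \<Sum>b\<in>UNIV. ?P $ i $ a * (v x $ a $ b * ?P $ b $ j))" for i j
    by (simp add: R_def triple_product_entry)
  have "eval (dg formE) [v, h, w] G x =
     (\<Sum>i\<in>UNIV. \<Sum>j\<in>UNIV. (?P ** w x ** ?P) $ i $ j * h x $ j $ i) * (1/2 * trace (?P ** v x) * ?s)
     + (\<Sum>i\<in>UNIV. \<Sum>j\<in>UNIV. (\<Sum>a\<in>UNIV. \<Sum>b\<in>UNIV. ?P $ i $ a * (w x $ a $ b * R $ b $ j) + R $ i $ a * (w x $ a $ b * ?P $ b $ j)) * h x $ j $ i) * ?s"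
    by (simp add: formE_def R triple_product_entry trace_product)
  also have "(\<Sum>i\<in>UNIV. \<Sum>j\<in>UNIV. (?P ** w x ** ?P) $ i $ j * h x $ j $ i) = trace (?P ** w x ** ?P ** h x)"
    by (simp add: trace_product)
  also have "(\<Sum>i\<in>UNIV. \<Sum>j\<in>UNIV. (\<Sum>a\<in>UNIV. \<Sum>b\<in>UNIV. ?P $ i $ a * (w x $ a $ b * R $ b $ j) + R $ i $ a * (w x $ a $ b * ?P $ b $ j)) * h x $ j $ i)
    = trace ((?P ** w x ** R + R ** w x ** ?P) ** h x)"
    by (simp add: trace_product triple_product_entry sum.distrib)
  also have "?P ** w x ** R + R ** w x ** ?P = - (?P ** w x ** ?P ** v x ** ?P) - (?P ** v x ** ?P ** w x ** ?P)"
    by (simp add: R_def matrix_mul_assoc bounded_bilinear.minus_left[OF bounded_bilinear_matrix_mult]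
        bounded_bilinear.minus_right[OF bounded_bilinear_matrix_mult])
  also have "trace (\<dots> ** h x) = - trace (?P ** w x ** ?P ** v x ** ?P ** h x) - trace (?P ** v x ** ?P ** w x ** ?P ** h x)"
    by (simp add: bounded_bilinear.diff_left[OF bounded_bilinear_matrix_mult] bounded_bilinear.minus_left[OF bounded_bilinear_matrix_mult]
        trace_sub linear_neg[OF bounded_linear.linear[OF bounded_linear_trace]])
  finally show ?thesis by (simp add: algebra_simps)
qed

text \<open>The two terms from the variation of the inverse metric are interchanged, up to the cyclic
  invariance of the trace and the order of the factors, when \<open>v\<close> and
  \<open>h\<close> are; only the variation of the volume survives.\<close>

lemma eval_dg_formE_antisym:
  "eval (dg formE) [v, h, w] G x - eval (dg formE) [h, v, w] G x =
    1/2 * (trace (matrix_inv (G x) ** v x) * trace (matrix_inv (G x) ** w x ** matrix_inv (G x) ** h x)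
     - trace (matrix_inv (G x) ** h x) * trace (matrix_inv (G x) ** w x ** matrix_inv (G x) ** v x)) * sqrt (det (G x))"
proof -
  let ?P = "matrix_inv (G x)"
  have 1: "trace (?P ** w x ** ?P ** v x ** ?P ** h x) = trace (?P ** h x ** ?P ** w x ** ?P ** v x)"
    using trace_mul_sym[of "?P ** w x ** ?P ** v x" "?P ** h x"] by (simp add: matrix_mul_assoc)
  have 2: "trace (?P ** v x ** ?P ** w x ** ?P ** h x) = trace (?P ** w x ** ?P ** h x ** ?P ** v x)"
    using trace_mul_sym[of "?P ** v x" "?P ** w x ** ?P ** h x"] by (simp add: matrix_mul_assoc)
  show ?thesis unfolding eval_dg_formE 1 2 by (simp add: algebra_simps)
qed

lemma matrix_inv_congruence:
  fixes J H M :: "real ^ 'n ^ 'n"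
  assumes J: "det J \<noteq> 0" and H: "det H \<noteq> 0"
  shows "matrix_inv (transpose J ** H ** J) ** (transpose J ** M ** J) = matrix_inv J ** (matrix_inv H ** M) ** J"
proof -
  let ?G = "transpose J ** H ** J" and ?X = "matrix_inv J ** (matrix_inv H ** M) ** J"
  have "det ?G \<noteq> 0" using J H by (simp add: det_mul)
  have "?G ** ?X = transpose J ** (H ** ((J ** matrix_inv J) ** (matrix_inv H ** M))) ** J"
    by (simp add: matrix_mul_assoc)
  also have "\<dots> = transpose J ** ((H ** matrix_inv H) ** M) ** J"
    by (simp add: matrix_inv_right[OF J] matrix_mul_assoc)
  also have "\<dots> = transpose J ** M ** J" by (simp add: matrix_inv_right[OF H])
  finally have "matrix_inv ?G ** (transpose J ** M ** J) = matrix_inv ?G ** (?G ** ?X)" by simp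
  also have "\<dots> = ?X" using matrix_inv_left[OF \<open>det ?G \<noteq> 0\<close>] by (simp add: matrix_mul_assoc)
  finally show ?thesis .
qed

lemma trace_conjugate: "det (J :: real ^ 'n ^ 'n) \<noteq> 0 \<Longrightarrow> trace (matrix_inv J ** X ** J) = trace X"
  using trace_mul_sym[of "matrix_inv J ** X" J] by (simp add: matrix_mul_assoc matrix_inv_right)

context compact_manifold
begin

text \<open>Iterated derivatives, in directions \<open>as\<close>, of the
  \<open>L\<^sup>2\<close>-product of \<open>u\<close> and \<open>z\<close> as a function of
  the metric alone.\<close>

definition pairing :: "('a, 'n) tensor2_field list \<Rightarrow> ('a, 'n) tensor2_field \<Rightarrow> ('a, 'n) tensor2_field \<Rightarrow> ('a, 'n) tensor2_field \<Rightarrow> real"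
  where "pairing as z g u = (\<Sum>c\<in>Cs. intc c (eval ((dg ^^ length as) formE) (at_chart c (as @ [z, u])) (g c)))"

lemma pairing_Nil: "pairing [] h g w = g02_L2 A g w h"
  by (simp add: pairing_def g02_L2_def integral_vol_eq g02_def eval_formE[abs_def])

lemma eval_continuous:
  assumes "g \<in> \<M>" "set hs \<subseteq> \<S>" "c \<in> Cs"
  shows "continuous_on (Ks c) (eval e (at_chart c hs) (g c))"
  by (rule regular_continuous_on(2)[OF metric_regular[OF assms(1) Cs_A[OF assms(3)] assms(2)] Ks_sub[OF assms(3)]])

lemma pairing_lin:
  assumes g: "g \<in> \<M>" and S: "z \<in> \<S>" "z' \<in> \<S>" "u \<in> \<S>" "u' \<in> \<S>"
  shows "pairing [] z g (u + t *\<^sub>R u') = pairing [] z g u + t * pairing [] z g u'"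
    and "pairing [] (z + t *\<^sub>R z') g u = pairing [] z g u + t * pairing [] z' g u"
proof -
  note cont = eval_continuous[OF g, of "[a, b]" for a b]
  note tr = linear_add[OF bounded_linear.linear[OF bounded_linear_trace]] linear_cmul[OF bounded_linear.linear[OF bounded_linear_trace]]
  have 1: "eval formE [z c, (u + t *\<^sub>R u') c] (g c) x = eval formE [z c, u c] (g c) x + t * eval formE [z c, u' c] (g c) x" for c x
    unfolding eval_formE add_scaleR_field matrix_mult_linear tr by (simp add: algebra_simps)
  have 2: "eval formE [(z + t *\<^sub>R z') c, u c] (g c) x = eval formE [z c, u c] (g c) x + t * eval formE [z' c, u c] (g c) x" for c x
    unfolding eval_formE add_scaleR_field matrix_mult_linear tr by (simp add: algebra_simps)
  have "intc c (eval formE [z c, (u + t *\<^sub>R u') c] (g c)) = intc c (eval formE [z c, u c] (g c)) + t * intc c (eval formE [z c, u' c] (g c))"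
    if "c \<in> Cs" for c
    unfolding 1[abs_def] using intc_lincomb[OF that cont[OF _ that] cont[OF _ that]] S by simp
  then show "pairing [] z g (u + t *\<^sub>R u') = pairing [] z g u + t * pairing [] z g u'"
    by (simp add: pairing_def sum.distrib sum_distrib_left del: plus_fun_apply)
  have "intc c (eval formE [(z + t *\<^sub>R z') c, u c] (g c)) = intc c (eval formE [z c, u c] (g c)) + t * intc c (eval formE [z' c, u c] (g c))"
    if "c \<in> Cs" for c
    unfolding 2[abs_def] using intc_lincomb[OF that cont[OF _ that] cont[OF _ that]] S by simp
  then show "pairing [] (z + t *\<^sub>R z') g u = pairing [] z g u + t * pairing [] z' g u"
    by (simp add: pairing_def sum.distrib sum_distrib_left del: plus_fun_apply)
qed

lemma pairing_deriv:
  assumes as: "set as \<subseteq> \<S>" and S: "z \<in> \<S>" "u \<in> \<S>" "v \<in> \<S>" and g: "g \<in> \<M>"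
  shows "(diff_quot (\<lambda>g. pairing as z g u) g v \<longlongrightarrow> pairing (v # as) z g u) (at 0)"
proof -
  let ?e = "(dg ^^ length as) formE" and ?hs = "as @ [z, u]"
  have hs: "set ?hs \<subseteq> \<S>" "set (v # ?hs) \<subseteq> \<S>" using as S by simp_all
  obtain \<delta> where \<delta>: "\<delta> > 0" "\<forall>t. \<bar>t\<bar> < \<delta> \<longrightarrow> g + t *\<^sub>R v \<in> \<M>"
    using metrics_open[OF g S(3)] by (elim exE conjE) (rule that)
  let ?q = "\<lambda>c t x. (eval ?e (at_chart c ?hs) ((g + t *\<^sub>R v) c) x - eval ?e (at_chart c ?hs) (g c) x) / t"
  have q: "?q c t = (\<lambda>x. inverse t * eval ?e (at_chart c ?hs) ((g + t *\<^sub>R v) c) x + (- inverse t) * eval ?e (at_chart c ?hs) (g c) x)" for c t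
    by (rule ext) (simp add: divide_inverse algebra_simps del: plus_fun_apply)
  have cont: "continuous_on (Ks c) (?q c t)" if "c \<in> Cs" "\<bar>t\<bar> < \<delta>" for c t
  proof -
    have gt: "g + t *\<^sub>R v \<in> \<M>" using \<delta>(2) that by simp
    show ?thesis
      unfolding q by (intro continuous_on_add continuous_on_mult continuous_on_const eval_continuous[OF gt hs(1) that(1)]
        eval_continuous[OF g hs(1) that(1)])
  qed
  have lim: "((\<lambda>t. intc c (?q c t)) \<longlongrightarrow> intc c (eval (dg ?e) (at_chart c (v # ?hs)) (g c))) (at 0)" if c: "c \<in> Cs" for c
  proof (rule intc_tendsto[OF c eval_diff_quotient[OF g hs(1) S(3) Cs_A[OF c] compact_Ks[OF c] Ks_sub[OF c]] eval_continuous[OF g hs(2) c]])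
    show "\<forall>\<^sub>F t in at 0. continuous_on (Ks c) (?q c t)"
      by (rule eventually_at_0[OF \<delta>(1)]) (rule cont[OF c])
  qed
  have "((\<lambda>t. \<Sum>c\<in>Cs. intc c (?q c t)) \<longlongrightarrow> (\<Sum>c\<in>Cs. intc c (eval (dg ?e) (at_chart c (v # ?hs)) (g c)))) (at 0)"
    by (rule tendsto_sum[OF lim])
  then have "((\<lambda>t. \<Sum>c\<in>Cs. intc c (?q c t)) \<longlongrightarrow> pairing (v # as) z g u) (at 0)"
    by (simp add: pairing_def del: plus_fun_apply)
  moreover have "\<forall>\<^sub>F t in at 0. (\<Sum>c\<in>Cs. intc c (?q c t)) = diff_quot (\<lambda>g. pairing as z g u) g v t"
  proof (rule eventually_at_0[OF \<delta>(1)])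
    fix t :: real assume t: "\<bar>t\<bar> < \<delta>"
    then have gt: "g + t *\<^sub>R v \<in> \<M>" using \<delta> by simp
    have "intc c (?q c t) = inverse t * (intc c (eval ?e (at_chart c ?hs) ((g + t *\<^sub>R v) c)) - intc c (eval ?e (at_chart c ?hs) (g c)))"
      if c: "c \<in> Cs" for c
    proof -
      note k = eval_continuous[OF gt hs(1) c, of ?e] eval_continuous[OF g hs(1) c, of ?e]
      have z: "continuous_on (Ks c) (\<lambda>x. 0::real)" by (rule continuous_on_const)
      have "intc c (?q c t) = intc c (\<lambda>x. (0 + inverse t * eval ?e (at_chart c ?hs) ((g + t *\<^sub>R v) c) x) + (- inverse t) * eval ?e (at_chart c ?hs) (g c) x)"
        unfolding q by simp
      also have "\<dots> = intc c (\<lambda>x. 0 + inverse t * eval ?e (at_chart c ?hs) ((g + t *\<^sub>R v) c) x) + (- inverse t) * intc c (eval ?e (at_chart c ?hs) (g c))"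
        by (rule intc_lincomb[OF c _ k(2)]) (intro continuous_intros k)
      also have "intc c (\<lambda>x. 0 + inverse t * eval ?e (at_chart c ?hs) ((g + t *\<^sub>R v) c) x)
          = intc c (\<lambda>x. 0) + inverse t * intc c (eval ?e (at_chart c ?hs) ((g + t *\<^sub>R v) c))"
        by (rule intc_lincomb[OF c z k(1)])
      also have "intc c (\<lambda>x. 0) = 0" by (simp add: intc_def set_lebesgue_integral_def)
      finally show ?thesis by (simp add: algebra_simps del: plus_fun_apply)
    qed
    then show "(\<Sum>c\<in>Cs. intc c (?q c t)) = diff_quot (\<lambda>g. pairing as z g u) g v t"
      by (simp add: diff_quot_def pairing_def sum_distrib_left sum_subtractf[symmetric] del: plus_fun_apply)
  qed
  ultimately show ?thesis by (rule Lim_transform_eventually)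
qed

lemma pairing_cont:
  assumes V: "lists_conv V vs" and X: "\<And>n. X n \<in> \<M>" "x \<in> \<M>" and Z: "\<And>n. Z n \<in> \<S>" "z \<in> \<S>" and Y: "\<And>n. Y n \<in> \<S>" "u \<in> \<S>"
    and lim: "lcs_tendsto (tensor_seminorms A) X x sequentially" "lcs_tendsto (tensor_seminorms A) Z z sequentially"
      "lcs_tendsto (tensor_seminorms A) Y u sequentially"
  shows "(\<lambda>n. pairing (V n) (Z n) (X n) (Y n)) \<longlonglongrightarrow> pairing vs z x u"
proof -
  let ?e = "(dg ^^ length vs) formE"
  define hs where "hs = vs @ [z, u]"
  define Hs where "Hs n = V n @ [Z n, Y n]" for n
  have "lists_conv (\<lambda>n. [Z n, Y n]) [z, u]"
    by (intro lists_conv_Cons Z Y lim lists_conv_const) simp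
  then have H: "lists_conv Hs hs" unfolding Hs_def hs_def by (rule lists_conv_append[OF V])
  have len: "length (Hs n) = length hs" and HS: "set (Hs n) \<subseteq> \<S>" and hs: "set hs \<subseteq> \<S>" for n
    using H by (simp_all add: lists_conv_def lists_set)
  have lenV: "length (V n) = length vs" for n using V by (simp add: lists_conv_def)
  have "(\<lambda>n. intc c (eval ?e (at_chart c (Hs n)) (X n c))) \<longlonglongrightarrow> intc c (eval ?e (at_chart c hs) (x c))" if c: "c \<in> Cs" for c
  proof (rule intc_tendsto[OF c _ eval_continuous[OF X(2) hs c]])
    show "uniform_limit (Ks c) (\<lambda>n. eval ?e (at_chart c (Hs n)) (X n c)) (eval ?e (at_chart c hs) (x c)) sequentially"
    proof (rule eval_uniform_limit[OF X(2) hs Cs_A[OF c] compact_Ks[OF c] Ks_sub[OF c] conv_field[OF lim(1)] len])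
      show "X n \<in> \<S>" "x \<in> \<S>" for n using X metric_tensor by simp_all
      fix m assume m: "m < length hs"
      show "field_converges (\<lambda>n. Hs n ! m) (hs ! m) sequentially"
      proof (rule conv_field)
        show "lcs_tendsto (tensor_seminorms A) (\<lambda>n. Hs n ! m) (hs ! m) sequentially" using H m by (simp add: lists_conv_def)
        show "Hs n ! m \<in> \<S>" for n using subsetD[OF HS[of n] nth_mem, of m] m len[of n] by simp
        show "hs ! m \<in> \<S>" by (rule subsetD[OF hs nth_mem[OF m]])
      qed
    qed
    show "\<forall>\<^sub>F n in sequentially. continuous_on (Ks c) (eval ?e (at_chart c (Hs n)) (X n c))"
      by (intro always_eventually allI eval_continuous X HS c)
  qed
  then show ?thesis unfolding pairing_def lenV Hs_def hs_def by (intro tendsto_sum)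
qed

text \<open>As \<open>P\<^sub>g\<close> is onto, \<open>T = P\<^sub>g h\<close> for some
  \<open>h\<close>; testing with \<open>h\<close> and positivity of \<open>P\<^sub>g\<close>
  give \<open>h = 0\<close>.\<close>

lemma L2_nondegenerate:
  assumes P: "admissible_operator A p P" and g: "g \<in> \<M>" and T: "T \<in> \<S>"
    and z: "\<And>k. k \<in> \<S> \<Longrightarrow> g02_L2 A g T k = 0"
  shows "T = 0"
proof -
  have Pg: "pseudo_differential A (2 * p) (P g)" "positive_symmetric A g (P g)" "bij_betw (P g) \<S> \<S>"
    using P g unfolding admissible_operator_def by simp_all
  have "T \<in> P g ` \<S>" using Pg(3) T by (simp add: bij_betw_def)
  then obtain h where h: "h \<in> \<S>" "T = P g h" by (elim imageE)
  have "h = 0"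
  proof (rule ccontr)
    assume "h \<noteq> 0"
    then have "0 < g02_L2 A g (P g h) h" using Pg(2) h(1) unfolding positive_symmetric_def by simp
    then show False using z[OF h(1)] h(2) by simp
  qed
  moreover have "linear_on_tensors A (P g)" using Pg(1) unfolding pseudo_differential_def by (rule conjunct1)
  then have "P g (0 *\<^sub>R 0) = 0 *\<^sub>R P g 0"
    unfolding linear_on_tensors_def using zero by (metis (no_types, lifting))
  ultimately show ?thesis using h(2) by simp
qed

lemma L2_sym: "g02_L2 A g h k = g02_L2 A g k h"
proof -
  have "g02 g h k = g02 g k h"
  proof (intro ext)
    fix c x
    show "g02 g h k c x = g02 g k h c x"
      unfolding g02_def using trace_mul_sym[of "matrix_inv (g c x) ** h c x" "matrix_inv (g c x) ** k c x"]
      by (simp add: matrix_mul_assoc)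
  qed
  then show ?thesis by (simp add: g02_L2_def)
qed

lemma field_mult_tensor:
  assumes w: "w \<in> \<S>" and smooth: "\<And>c. c \<in> A \<Longrightarrow> smooth_on (chart_image c) (f c)"
    and inv: "\<And>c d x. c \<in> A \<Longrightarrow> d \<in> A \<Longrightarrow> x \<in> overlap c d \<Longrightarrow> f c x = f d (transition c d x)"
  shows "field_mult f w \<in> \<S>"
proof (rule sym_tensorI)
  show "field_mult f w c x = 0" if "\<not> (c \<in> A \<and> x \<in> chart_image c)" for c x
    using tensor_zero[OF w that] by (simp add: field_mult_def)
  show "smooth_on (chart_image c) (field_mult f w c)" if c: "c \<in> A" for c
  proof (rule smooth_on_matrix_entries[OF open_image[OF c]])
    show "smooth_on (chart_image c) (\<lambda>x. field_mult f w c x $ i $ j)" for i j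
      using smooth_on_mult[OF open_image[OF c] smooth[OF c]
          smooth_on_compose_bounded_linear[OF bounded_linear_entry open_image[OF c] tensor_smooth[OF w c]], of i j]
      by (simp add: field_mult_def)
  qed
  show "transpose (field_mult f w c x) = field_mult f w c x" if "c \<in> A" "x \<in> chart_image c" for c x
    using tensor_sym[OF w that]
    by (simp add: field_mult_def linear_cmul[OF bounded_linear.linear[OF bounded_linear_transpose]])
  show "field_mult f w c x = transpose (jac c d x) ** field_mult f w d (transition c d x) ** jac c d x"
    if "c \<in> A" "d \<in> A" "x \<in> overlap c d" for c d x
    using inv[OF that] tensor_trans[OF w that] by (simp add: field_mult_def matrix_mult_linear)
qed

lemma trace_field_scalar:
  assumes g: "g \<in> \<M>" and h: "h \<in> \<S>"
  shows "c \<in> A \<Longrightarrow> smooth_on (chart_image c) (trace_field g h c)"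
    and "c \<in> A \<Longrightarrow> d \<in> A \<Longrightarrow> x \<in> overlap c d \<Longrightarrow> trace_field g h c x = trace_field g h d (transition c d x)"
proof -
  have e: "trace_field g h c = eval (Sum (\<lambda>a. Sum (\<lambda>b. Mul (Inv a b) (Arg 0 [] b a)))) (at_chart c [h]) (g c)" for c
    by (rule ext) (simp add: trace_field_def trace_product)
  show "smooth_on (chart_image c) (trace_field g h c)" if "c \<in> A"
    unfolding e by (rule smooth_on_eval[OF metric_regular[OF g that]]) (simp add: h)
  assume cdx: "c \<in> A" "d \<in> A" "x \<in> overlap c d"
  have J: "det (jac c d x) \<noteq> 0" by (rule det_jac[OF g cdx])
  have H: "det (g d (transition c d x)) \<noteq> 0" by (rule metric_det[OF g cdx(2) transition_in[OF cdx(1,3)]])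
  show "trace_field g h c x = trace_field g h d (transition c d x)"
    unfolding trace_field_def tensor_trans[OF metric_tensor[OF g] cdx] tensor_trans[OF h cdx] matrix_inv_congruence[OF J H]
    by (rule trace_conjugate[OF J])
qed

lemma g02_scalar:
  assumes g: "g \<in> \<M>" and w: "w \<in> \<S>" and h: "h \<in> \<S>"
  shows "c \<in> A \<Longrightarrow> smooth_on (chart_image c) (g02 g w h c)"
    and "c \<in> A \<Longrightarrow> d \<in> A \<Longrightarrow> x \<in> overlap c d \<Longrightarrow> g02 g w h c x = g02 g w h d (transition c d x)"
proof -
  have e: "g02 g w h c = eval (Sum (\<lambda>i. Sum (\<lambda>j. Mul (Sum (\<lambda>a. Sum (\<lambda>b. Mul (Inv i a) (Mul (Arg 1 [] a b) (Inv b j))))) (Arg 0 [] j i))))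
      (at_chart c [h, w]) (g c)" for c
    by (rule ext) (simp add: g02_def trace_product triple_product_entry)
  show "smooth_on (chart_image c) (g02 g w h c)" if "c \<in> A"
    unfolding e by (rule smooth_on_eval[OF metric_regular[OF g that]]) (simp add: h w)
  assume cdx: "c \<in> A" "d \<in> A" "x \<in> overlap c d"
  let ?J = "jac c d x" and ?y = "transition c d x"
  have J: "det ?J \<noteq> 0" by (rule det_jac[OF g cdx])
  have H: "det (g d ?y) \<noteq> 0" by (rule metric_det[OF g cdx(2) transition_in[OF cdx(1,3)]])
  have a: "matrix_inv (g c x) ** k c x = matrix_inv ?J ** (matrix_inv (g d ?y) ** k d ?y) ** ?J" if "k \<in> \<S>" for k
    unfolding tensor_trans[OF metric_tensor[OF g] cdx] tensor_trans[OF that cdx] by (rule matrix_inv_congruence[OF J H])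
  have "g02 g w h c x = trace ((matrix_inv (g c x) ** w c x) ** (matrix_inv (g c x) ** h c x))"
    by (simp add: g02_def matrix_mul_assoc)
  also have "\<dots> = trace (matrix_inv ?J ** ((matrix_inv (g d ?y) ** w d ?y) ** ((?J ** matrix_inv ?J) ** (matrix_inv (g d ?y) ** h d ?y))) ** ?J)"
    unfolding a[OF w] a[OF h] by (simp add: matrix_mul_assoc)
  also have "\<dots> = g02 g w h d ?y"
    unfolding trace_conjugate[OF J] by (simp add: matrix_inv_right[OF J] g02_def matrix_mul_assoc)
  finally show "g02 g w h c x = g02 g w h d ?y" .
qed

text \<open>The product rule is applied with the \<open>L\<^sup>2\<close>-product in the role of the
  linear map and \<open>g \<mapsto> P\<^sub>g Ricci\<^sub>g\<close> in the role of its
  argument. This turns the \<open>G\<^sup>P\<close>-dual of the Ricci field into a one-form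
  with known derivative, to which \<open>exact_iff_closed\<close> and nondegeneracy apply.\<close>

lemma gradient_criterion:
  assumes P: "admissible_operator A p P"
    and Q_def: "\<And>g h. Q g h = D_tensor A (\<lambda>g'. P g' (ricci A g')) g h"
    and Q_adj: "\<And>g. g \<in> \<M> \<Longrightarrow> is_adjoint A g (Q g) (Q_adj g)"
  shows "gradient_field A P (ricci A) \<longleftrightarrow>
    (\<forall>g\<in>\<M>. \<forall>h\<in>\<S>. 2 *\<^sub>R (Q g h - Q_adj g h) + field_mult (trace_field g h) (P g (ricci A g))
      - field_mult (g02 g (P g (ricci A g)) h) g = 0)"
proof -
  obtain W where W: "smooth_family \<S> (tensor_seminorms A) (\<lambda>vs z. W vs)"
    and W_Nil: "\<And>g. g \<in> \<M> \<Longrightarrow> W [] g = P g (ricci A g)"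
    by (rule P_ricci_family[OF P]) (rule that)
  have W_in: "W vs g \<in> \<S>" if "vs \<in> lists \<S>" "g \<in> \<M>" for vs g
    by (rule smooth_familyD(1)[OF W that(1) zero that(2)])
  have nil: "[] \<in> lists \<S>" by simp
  have Q_eq: "Q g k = W [k] g" if g: "g \<in> \<M>" and k: "k \<in> \<S>" for g k
  proof -
    let ?F = "\<lambda>g'. P g' (ricci A g')"
    have kl: "[k] \<in> lists \<S>" using k by simp
    have ev: "\<forall>\<^sub>F t in at 0. diff_quot (W []) g k t = diff_quot ?F g k t"
      using eventually_U[OF g k] by eventually_elim (simp only: diff_quot_def W_Nil g)
    have lim: "lcs_tendsto (tensor_seminorms A) (diff_quot ?F g k) (W [k] g) (at 0)"
      by (rule lcs_tendsto_cong[OF ev smooth_familyD(2)[OF W nil zero k g]])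
    have in_S: "\<forall>\<^sub>F t in at 0. diff_quot ?F g k t \<in> \<S>"
      using ev eventually_U[OF g k]
    proof eventually_elim
      case (elim t)
      have "diff_quot (W []) g k t \<in> \<S>" unfolding diff_quot_def by (intro scaleR diff W_in nil g elim)
      then show ?case using elim(1) by simp
    qed
    have l: "lcs_tendsto (tensor_seminorms A) (\<lambda>t. inverse t *\<^sub>R (?F (g + t *\<^sub>R k) - ?F g)) d (at 0) \<longleftrightarrow>
        lcs_tendsto (tensor_seminorms A) (diff_quot ?F g k) d (at 0)" for d
      by (simp only: diff_quot_def[abs_def])
    have "dir_deriv \<S> (tensor_seminorms A) ?F g k = W [k] g"
      unfolding dir_deriv_def l
    proof (rule the_equality)
      show "W [k] g \<in> \<S> \<and> lcs_tendsto (tensor_seminorms A) (diff_quot ?F g k) (W [k] g) (at 0)"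
        using W_in[OF kl g] lim by simp
      fix d assume "d \<in> \<S> \<and> lcs_tendsto (tensor_seminorms A) (diff_quot ?F g k) d (at 0)"
      then show "d = W [k] g" using limit_unique[OF at_neq_bot _ lim in_S _ W_in[OF kl g], of d] by simp
    qed
    then show ?thesis by (simp add: Q_def D_tensor_def)
  qed
  interpret R: seminormed "UNIV :: real set" "{abs}" by (rule seminormed_real)
  interpret L: linear_family \<S> "tensor_seminorms A" \<M> "UNIV :: real set" "{abs}" pairing W
  proof
    show "pairing as z x u \<in> UNIV" for as z x u by simp
    show "pairing [] z x (u + t *\<^sub>R u') = pairing [] z x u + t *\<^sub>R pairing [] z x u'"
      if "z \<in> \<S>" "x \<in> \<M>" "u \<in> \<S>" "u' \<in> \<S>" for z x u u' t
      using pairing_lin(1)[OF that(2,1,1,3,4)] by simp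
    show "lcs_tendsto {abs} (diff_quot (\<lambda>x. pairing as z x u) x v) (pairing (v # as) z x u) (at 0)"
      if "as \<in> lists \<S>" "z \<in> \<S>" "x \<in> \<M>" "u \<in> \<S>" "v \<in> \<S>" for as z x u v
      unfolding lcs_tendsto_real by (rule pairing_deriv[OF _ that(2,4,5,3)]) (use that(1) in \<open>simp add: lists_set\<close>)
    show "lcs_tendsto {abs} (\<lambda>n. pairing (V n) (Z n) (X n) (Y n)) (pairing vs z x u) sequentially"
      if "lists_conv V vs" "\<And>n. X n \<in> \<M>" "x \<in> \<M>" "\<And>n. Z n \<in> \<S>" "z \<in> \<S>" "\<And>n. Y n \<in> \<S>" "u \<in> \<S>"
        "lcs_tendsto (tensor_seminorms A) X x sequentially" "lcs_tendsto (tensor_seminorms A) Z z sequentially"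
        "lcs_tendsto (tensor_seminorms A) Y u sequentially" for V vs X x Z z Y u
      unfolding lcs_tendsto_real by (rule pairing_cont[OF that])
    show "smooth_family \<S> (tensor_seminorms A) (\<lambda>vs z. W vs)" by (rule W)
  qed
  \<comment> \<open>\<open>\<omega> [] h g\<close> is the value of the one-form at \<open>g\<close> on
    \<open>h\<close>, and \<open>\<omega> [k] h g\<close> its derivative in direction
    \<open>k\<close>.\<close>
  define \<omega> where "\<omega> = (\<lambda>vs. leibniz pairing W (rev vs) [] [])"
  have \<omega>0: "\<omega> [] h g = pairing [] h g (W [] g)" for h g by (simp add: \<omega>_def)
  have \<omega>1: "\<omega> [k] h g = pairing [k] h g (W [] g) + pairing [] h g (W [k] g)" for k h g by (simp add: \<omega>_def)
  interpret one_form \<S> "tensor_seminorms A" \<M> \<omega>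
  proof
    show "smooth_family UNIV {abs} \<omega>" unfolding \<omega>_def by (rule L.leibniz_family)
    show "\<omega> [] (z + t *\<^sub>R z') x = \<omega> [] z x + t * \<omega> [] z' x" if "x \<in> \<M>" "z \<in> \<S>" "z' \<in> \<S>" for x z z' t
      unfolding \<omega>0 by (rule pairing_lin(2)[OF that W_in[OF nil that(1)] W_in[OF nil that(1)]])
  qed
  have "GP A P g (ricci A g) h = \<omega> [] h g" if "g \<in> \<M>" for g h
    by (simp add: \<omega>0 pairing_Nil GP_def g02_L2_def W_Nil[OF that])
  then have "gradient_field A P (ricci A) \<longleftrightarrow>
    (\<exists>F. lcs_smooth \<S> (tensor_seminorms A) \<M> UNIV {abs} F \<and> (\<forall>g\<in>\<M>. \<forall>h\<in>\<S>. dir_deriv UNIV {abs} F g h = \<omega> [] h g))"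
    unfolding gradient_field_def smooth_real_on_metrics_def D_real_def by simp
  also have "\<dots> \<longleftrightarrow> (\<forall>g\<in>\<M>. \<forall>h\<in>\<S>. \<forall>k\<in>\<S>. \<omega> [k] h g = \<omega> [h] k g)"
    by (rule exact_iff_closed)
  also have "\<dots> \<longleftrightarrow> (\<forall>g\<in>\<M>. \<forall>h\<in>\<S>. 2 *\<^sub>R (Q g h - Q_adj g h) + field_mult (trace_field g h) (P g (ricci A g))
      - field_mult (g02 g (P g (ricci A g)) h) g = 0)"
  proof (intro ball_cong refl)
    fix g h assume g: "g \<in> \<M>" and h: "h \<in> \<S>"
    let ?w = "P g (ricci A g)"
    let ?Z = "2 *\<^sub>R (Q g h - Q_adj g h) + field_mult (trace_field g h) ?w - field_mult (g02 g ?w h) g"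
    have gS: "g \<in> \<S>" by (rule metric_tensor[OF g])
    have w: "?w \<in> \<S>" using W_in[OF nil g] by (simp add: W_Nil[OF g])
    have QS: "Q g k \<in> \<S>" if "k \<in> \<S>" for k unfolding Q_eq[OF g that] by (rule W_in[OF _ g]) (use that in simp)
    have adj: "Q_adj g h \<in> \<S>" "\<And>k. k \<in> \<S> \<Longrightarrow> g02_L2 A g (Q g k) h = g02_L2 A g k (Q_adj g h)"
      using Q_adj[OF g] h unfolding is_adjoint_def by simp_all
    have trace_term_in: "field_mult (trace_field g h) ?w \<in> \<S>"
      by (rule field_mult_tensor[OF w]) (fact trace_field_scalar[OF g h])+
    have g02_term_in: "field_mult (g02 g ?w h) g \<in> \<S>"
      by (rule field_mult_tensor[OF gS]) (fact g02_scalar[OF g w h])+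
    note field_mult_in = trace_term_in g02_term_in
    have ZS: "?Z \<in> \<S>" by (intro diff add scaleR QS adj field_mult_in h)
    have key: "g02_L2 A g ?Z k = 2 * (\<omega> [h] k g - \<omega> [k] h g)" if k: "k \<in> \<S>" for k
    proof -
      note lin = pairing_lin(1)[OF g k k, unfolded pairing_Nil]
      let ?U = "field_mult (trace_field g h) ?w + 2 *\<^sub>R Q g h"
      have Zeq: "?Z = (?U + (-2) *\<^sub>R Q_adj g h) + (-1) *\<^sub>R field_mult (g02 g ?w h) g"
        by (simp add: scaleR_diff_right)
      have U: "?U \<in> \<S>" by (rule lincomb[OF field_mult_in(1) QS[OF h]])
      have UQ: "?U + (-2) *\<^sub>R Q_adj g h \<in> \<S>" by (rule lincomb[OF U adj(1)])
      have 1: "g02_L2 A g ?Z k = (g02_L2 A g (field_mult (trace_field g h) ?w) k - g02_L2 A g (field_mult (g02 g ?w h) g) k)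
        + 2 * (g02_L2 A g (Q g h) k - g02_L2 A g (Q g k) h)"
        unfolding Zeq lin[OF UQ field_mult_in(2)] lin[OF U adj(1)] lin[OF field_mult_in(1) QS[OF h]]
          adj(2)[OF k] L2_sym[of g "Q_adj g h" k] by (simp only: algebra_simps)
      have "g02_L2 A g (field_mult (trace_field g h) ?w) k - g02_L2 A g (field_mult (g02 g ?w h) g) k
        = 2 * (pairing [h] k g ?w - pairing [k] h g ?w)"
      proof -
        have e: "g02 g (field_mult (trace_field g h) ?w) k c x * sqrt (det (g c x)) + (-1) * (g02 g (field_mult (g02 g ?w h) g) k c x * sqrt (det (g c x)))
          = (2 * eval (dg formE) [h c, k c, ?w c] (g c) x) + (-2) * eval (dg formE) [k c, h c, ?w c] (g c) x"
          if c: "c \<in> Cs" and x: "x \<in> Ks c" for c x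
        proof -
          have xc: "x \<in> chart_image c" using x Ks_sub[OF c] by (rule subsetD[rotated])
          let ?I = "matrix_inv (g c x)"
          have "det (g c x) \<noteq> 0" by (rule metric_det[OF g Cs_A[OF c] xc])
          then have "?I ** g c x ** ?I ** k c x = ?I ** k c x" by (simp add: matrix_inv_left)
          then have b: "g02 g (field_mult (g02 g ?w h) g) k c x = g02 g ?w h c x * trace (?I ** k c x)"
            by (simp add: g02_def field_mult_def matrix_mult_linear linear_cmul[OF bounded_linear.linear[OF bounded_linear_trace]])
          \<comment> \<open>Pairing \<open>g\<close> itself with \<open>k\<close> produces the trace of
            \<open>k\<close>; this is where the last term of the equation comes from.\<close>
          have a: "g02 g (field_mult (trace_field g h) ?w) k c x = trace_field g h c x * g02 g ?w k c x"
            by (simp add: g02_def field_mult_def matrix_mult_linear linear_cmul[OF bounded_linear.linear[OF bounded_linear_trace]])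
          have "2 * eval (dg formE) [h c, k c, ?w c] (g c) x + (-2) * eval (dg formE) [k c, h c, ?w c] (g c) x
            = 2 * (eval (dg formE) [h c, k c, ?w c] (g c) x - eval (dg formE) [k c, h c, ?w c] (g c) x)" by simp
          also have "\<dots> = (trace_field g h c x * g02 g ?w k c x - g02 g ?w h c x * trace (?I ** k c x)) * sqrt (det (g c x))"
            unfolding eval_dg_formE_antisym by (simp add: trace_field_def g02_def algebra_simps)
          finally show ?thesis unfolding a b by (simp add: algebra_simps)
        qed
        have t: "intc c (\<lambda>x. g02 g (field_mult (trace_field g h) ?w) k c x * sqrt (det (g c x)))
            - intc c (\<lambda>x. g02 g (field_mult (g02 g ?w h) g) k c x * sqrt (det (g c x)))
          = 2 * (intc c (eval (dg formE) [h c, k c, ?w c] (g c)) - intc c (eval (dg formE) [k c, h c, ?w c] (g c)))"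
          if c: "c \<in> Cs" for c
        proof -
          have cf: "continuous_on (Ks c) (\<lambda>x. g02 g u k c x * sqrt (det (g c x)))" if "u \<in> \<S>" for u
            using eval_continuous[OF g _ c, of "[k, u]" formE] that k by (simp add: eval_formE[abs_def] g02_def)
          have ce: "continuous_on (Ks c) (eval (dg formE) [a c, b c, ?w c] (g c))" if "a \<in> \<S>" "b \<in> \<S>" for a b
            using eval_continuous[OF g _ c, of "[a, b, ?w]" "dg formE"] that w by simp
          have z: "continuous_on (Ks c) (\<lambda>x. 0::real)" by (rule continuous_on_const)
          have "intc c (\<lambda>x. g02 g (field_mult (trace_field g h) ?w) k c x * sqrt (det (g c x)))
              + (-1) * intc c (\<lambda>x. g02 g (field_mult (g02 g ?w h) g) k c x * sqrt (det (g c x)))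
            = intc c (\<lambda>x. g02 g (field_mult (trace_field g h) ?w) k c x * sqrt (det (g c x)) + (-1) * (g02 g (field_mult (g02 g ?w h) g) k c x * sqrt (det (g c x))))"
            by (rule intc_lincomb[OF c cf[OF field_mult_in(1)] cf[OF field_mult_in(2)], symmetric])
          also have "\<dots> = intc c (\<lambda>x. (0 + 2 * eval (dg formE) [h c, k c, ?w c] (g c) x) + (-2) * eval (dg formE) [k c, h c, ?w c] (g c) x)"
            by (rule intc_cong[OF c]) (simp only: e[OF c] add_0)
          also have "\<dots> = intc c (\<lambda>x. 0 + 2 * eval (dg formE) [h c, k c, ?w c] (g c) x) + (-2) * intc c (eval (dg formE) [k c, h c, ?w c] (g c))"
            by (rule intc_lincomb[OF c _ ce[OF k h]]) (intro continuous_on_add continuous_on_mult continuous_on_const ce h k)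
          also have "intc c (\<lambda>x. 0 + 2 * eval (dg formE) [h c, k c, ?w c] (g c) x) = intc c (\<lambda>x. 0) + 2 * intc c (eval (dg formE) [h c, k c, ?w c] (g c))"
            by (rule intc_lincomb[OF c z ce[OF h k]])
          also have "intc c (\<lambda>x. 0) = 0" by (simp add: intc_def set_lebesgue_integral_def)
          finally show ?thesis by simp
        qed
        have "g02_L2 A g (field_mult (trace_field g h) ?w) k - g02_L2 A g (field_mult (g02 g ?w h) g) k
          = (\<Sum>c\<in>Cs. 2 * (intc c (eval (dg formE) [h c, k c, ?w c] (g c)) - intc c (eval (dg formE) [k c, h c, ?w c] (g c))))"
          unfolding g02_L2_def integral_vol_eq sum_subtractf[symmetric] by (rule sum.cong[OF refl t])
        then show ?thesis by (simp add: pairing_def sum_distrib_left[symmetric] sum_subtractf)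
      qed
      with 1 show ?thesis
        unfolding \<omega>1 W_Nil[OF g] pairing_Nil Q_eq[OF g h, symmetric] Q_eq[OF g k, symmetric] by (simp add: algebra_simps)
    qed
    show "(\<forall>k\<in>\<S>. \<omega> [k] h g = \<omega> [h] k g) \<longleftrightarrow> ?Z = 0"
    proof
      assume c: "\<forall>k\<in>\<S>. \<omega> [k] h g = \<omega> [h] k g"
      show "?Z = 0"
        by (rule L2_nondegenerate[OF P g ZS]) (use c in \<open>simp only: key, simp\<close>)
    next
      assume Z: "?Z = 0"
      show "\<forall>k\<in>\<S>. \<omega> [k] h g = \<omega> [h] k g"
      proof
        fix k assume k: "k \<in> \<S>"
        have "g02_L2 A g (0 :: ('a, 'n) tensor2_field) k = 0"
          using pairing_lin(1)[OF g k k zero zero, of 1] by (simp add: pairing_Nil)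
        then show "\<omega> [k] h g = \<omega> [h] k g" using key[OF k] Z by simp
      qed
    qed
  qed
  finally show ?thesis .
qed

end

theorem mainTheorem5:
  fixes A :: "('a::t2_space, 'n::finite) chart set"
    and p :: real
    and P :: "('a, 'n) tensor2_field \<Rightarrow> ('a, 'n) tensor2_field \<Rightarrow> ('a, 'n) tensor2_field"
    and Q Q_adj :: "('a, 'n) tensor2_field \<Rightarrow> ('a, 'n) tensor2_field \<Rightarrow> ('a, 'n) tensor2_field"
  assumes "compact (UNIV :: 'a set)"
    and "smooth_structure A"
    and "p \<ge> 0"
    and "admissible_operator A p P"
    and Q_def: "\<And>g h. Q g h = D_tensor A (\<lambda>g'. P g' (ricci A g')) g h"
    and Q_adj: "\<And>g. g \<in> metrics A \<Longrightarrow> is_adjoint A g (Q g) (Q_adj g)"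
  shows "gradient_field A P (ricci A) \<longleftrightarrow>
    (\<forall>g\<in>metrics A. \<forall>h\<in>sym_tensor_fields A.
      2 *\<^sub>R (Q g h - Q_adj g h)
      + field_mult (trace_field g h) (P g (ricci A g))
      - field_mult (g02 g (P g (ricci A g)) h) g = 0)"
proof -
  interpret compact_manifold A by standard (rule assms(1), rule assms(2))
  show ?thesis by (rule gradient_criterion[OF assms(4) Q_def Q_adj])
qed

end
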